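(* Let $K$ be a real compact nc convex set, and let $X=\bigsqcup_nX_n\subseteq K$, $X_n\subseteq K_n$, be a nc closed subset of $K$, in the sense that every $X_n$ is closed in $K_n$ and, whenever $x_i\in X_{n_i}$ is a net and $\{\alpha_i\in M_{n,n_i}(\mathbb R)\}$ is a net of contractions such that $\lim\alpha_i\alpha_i^*=I_n$ and $\lim\alpha_ix_i\alpha_i^*=x$ exists, then $x\in X_n$. Suppose that $X$ is also closed under compressions, i.e. $\alpha^*X_n\alpha\subseteq X_m$ for every isometry $\alpha\in M_{n,m}(\mathbb R)$. If the closed nc convex hull of $X$ is $K$, then all real nc extreme points of $K$ are contained in $X$.
   Context: $M_{m,n}(\mathbb R)$ denotes the bounded operators $\ell^2_n\to\ell^2_m$ (real Hilbert spaces, possibly infinite cardinals); for a real operator space $E$, $M_n(E)$ is the space of $n\times n$ matrices over $E$ whose finitely supported submatrices are uniformly bounded. Fix a large enough infinite cardinal $\kappa$ (e.g. at least the cardinality of $E$); all cardinals are nonzero and $\le\kappa$, and $\mathcal M(E)=\bigsqcup_{n\le\kappa}M_n(E)$. A real nc convex set over a real dual operator space $E$ is a subset $K=\bigsqcup_nK_n\subseteq\mathcal M(E)$, $K_n\subseteq M_n(E)$, closed under direct sums ($\sum_i\alpha_ix_i\alpha_i^{\mathsf T}\in K_n$ for bounded families $x_i\in K_{n_i}$ and isometries $\alpha_i\in M_{n,n_i}(\mathbb R)$ with $\sum_i\alpha_i\alpha_i^{\mathsf T}=1_n$) and compressions ($\beta^{\mathsf T}x\beta\in K_m$ for $x\in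 K_n$ and isometries $\beta\in M_{n,m}(\mathbb R)$). It is closed (resp. compact) if each $K_n$ is weak* closed (resp. weak* compact). All closures and limits (in $K_n$, $M_n(E)$ and $M_n(\mathbb R)$) are in the weak* topology. The closed nc convex hull of $X$ is the smallest closed nc convex set containing $X$. A point $x\in K_n$ is (real) nc extreme if whenever $x=\sum_i\alpha_i^{\mathsf T}x_i\alpha_i$ is a finite nc convex combination with $x_i\in K_{n_i}$, nonzero $\alpha_i\in M_{n_i,n}(\mathbb R)$ and $\sum_i\alpha_i^{\mathsf T}\alpha_i=1_n$, then for each $i$ one has $\alpha_i=c_i\beta_i$ with $c_i>0$ and $\beta_i$ an isometry, $\beta_i^{\mathsf T}x_i\beta_i=x$, and $x_i$ commutes with $\beta_i\beta_i^{\mathsf T}$. *)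

theory Defs
  imports "HOL-Analysis.Analysis"
begin

unbundle cardinal_syntax

section \<open>Operators between real \<open>\<ell>\<^sup>2\<close> spaces, given by their matrices\<close>

definition l2 :: "'i set \<Rightarrow> ('i \<Rightarrow> real) set" where
  "l2 N = {v. (\<forall>i. i \<notin> N \<longrightarrow> v i = 0) \<and> (\<lambda>i. (v i)\<^sup>2) summable_on N}"

definition l2norm :: "'i set \<Rightarrow> ('i \<Rightarrow> real) \<Rightarrow> real" where
  "l2norm N v = sqrt (\<Sum>\<^sub>\<infinity>i\<in>N. (v i)\<^sup>2)"

definition mvec :: "'j set \<Rightarrow> ('i \<Rightarrow> 'j \<Rightarrow> real) \<Rightarrow> ('j \<Rightarrow> real) \<Rightarrow> 'i \<Rightarrow> real" where
  "mvec M a v = (\<lambda>i. \<Sum>\<^sub>\<infinity>j\<in>M. a i j * v j)"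

text \<open>\<open>bounded_mats N M\<close> is \<open>M\<^sub>n\<^sub>,\<^sub>m(\<real>)\<close>, the bounded operators from \<open>\<ell>\<^sup>2(M)\<close> to \<open>\<ell>\<^sup>2(N)\<close>
  (rows indexed by \<open>N\<close>, columns by \<open>M\<close>).  Entries outside \<open>N \<times> M\<close> are set to zero so that
  operators and matrices correspond one-to-one.\<close>

definition bounded_mats :: "'i set \<Rightarrow> 'j set \<Rightarrow> ('i \<Rightarrow> 'j \<Rightarrow> real) set" where
  "bounded_mats N M = {a. (\<forall>i j. i \<notin> N \<or> j \<notin> M \<longrightarrow> a i j = 0) \<and>
     (\<exists>C. \<forall>v\<in>l2 M. mvec M a v \<in> l2 N \<and> l2norm N (mvec M a v) \<le> C * l2norm M v)}"

definition opnorm :: "'i set \<Rightarrow> 'j set \<Rightarrow> ('i \<Rightarrow> 'j \<Rightarrow> real) \<Rightarrow> real" where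
  "opnorm N M a = (SUP v \<in> {v \<in> l2 M. l2norm M v \<le> 1}. l2norm N (mvec M a v))"

definition contractions :: "'i set \<Rightarrow> 'j set \<Rightarrow> ('i \<Rightarrow> 'j \<Rightarrow> real) set" where
  "contractions N M = {a \<in> bounded_mats N M. opnorm N M a \<le> 1}"

definition isometries :: "'i set \<Rightarrow> 'j set \<Rightarrow> ('i \<Rightarrow> 'j \<Rightarrow> real) set" where
  "isometries N M = {a \<in> bounded_mats N M. \<forall>v\<in>l2 M. l2norm N (mvec M a v) = l2norm M v}"

definition mtrans :: "('i \<Rightarrow> 'j \<Rightarrow> 'a) \<Rightarrow> 'j \<Rightarrow> 'i \<Rightarrow> 'a" where
  "mtrans a = (\<lambda>j i. a i j)"

definition idmat :: "'i set \<Rightarrow> 'i \<Rightarrow> 'i \<Rightarrow> real" where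
  "idmat N = (\<lambda>p q. if p = q \<and> p \<in> N then 1 else 0)"

text \<open>Products of scalar matrices with matrices over a Banach space (in particular over
  \<open>\<real>\<close>); the index set is the one summed over.  For bounded \<open>a\<close>, \<open>b\<close> and
  \<open>x \<in> M\<^sub>n(E)\<close> all these sums converge unconditionally in norm.  In \<open>sandwich\<close> they have
  to be iterated: the corresponding double family need not be summable.\<close>

definition lmul :: "'j set \<Rightarrow> ('i \<Rightarrow> 'j \<Rightarrow> real) \<Rightarrow> ('j \<Rightarrow> 'l \<Rightarrow> 'a::real_normed_vector) \<Rightarrow> 'i \<Rightarrow> 'l \<Rightarrow> 'a" where
  "lmul N a x = (\<lambda>p q. \<Sum>\<^sub>\<infinity>i\<in>N. a p i *\<^sub>R x i q)"

definition rmul :: "'j set \<Rightarrow> ('i \<Rightarrow> 'j \<Rightarrow> 'a::real_normed_vector) \<Rightarrow> ('j \<Rightarrow> 'l \<Rightarrow> real) \<Rightarrow> 'i \<Rightarrow> 'l \<Rightarrow> 'a" where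
  "rmul N x b = (\<lambda>p q. \<Sum>\<^sub>\<infinity>j\<in>N. b j q *\<^sub>R x p j)"

definition sandwich :: "'j set \<Rightarrow> ('i \<Rightarrow> 'j \<Rightarrow> real) \<Rightarrow> ('j \<Rightarrow> 'j \<Rightarrow> 'a::real_normed_vector) \<Rightarrow> ('j \<Rightarrow> 'l \<Rightarrow> real) \<Rightarrow> 'i \<Rightarrow> 'l \<Rightarrow> 'a" where
  "sandwich N a x b = lmul N a (rmul N x b)"


section \<open>Real operator spaces and real dual operator spaces\<close>

text \<open>\<open>mn m x\<close> is the norm in \<open>M\<^sub>m(E)\<close> of the matrix \<open>(x i j)\<close>, \<open>i, j < m\<close>.\<close>

type_synonym 'a mat_norms = "nat \<Rightarrow> (nat \<Rightarrow> nat \<Rightarrow> 'a) \<Rightarrow> real"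

definition dsum :: "nat \<Rightarrow> (nat \<Rightarrow> nat \<Rightarrow> 'a::zero) \<Rightarrow> (nat \<Rightarrow> nat \<Rightarrow> 'a) \<Rightarrow> nat \<Rightarrow> nat \<Rightarrow> 'a" where
  "dsum m x y = (\<lambda>i j. if i < m \<and> j < m then x i j
                       else if m \<le> i \<and> m \<le> j then y (i - m) (j - m) else 0)"

text \<open>Ruan's axioms: the matrix norms are norms, extend the norm of the space, and satisfy
  \<open>\<parallel>\<alpha> x \<beta>\<parallel> \<le> \<parallel>\<alpha>\<parallel> \<parallel>x\<parallel> \<parallel>\<beta>\<parallel>\<close> and \<open>\<parallel>x \<oplus> y\<parallel> = max \<parallel>x\<parallel> \<parallel>y\<parallel>\<close>.\<close>

definition real_operator_space :: "'a::real_normed_vector mat_norms \<Rightarrow> bool" where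
  "real_operator_space mn \<longleftrightarrow>
     (\<forall>m x y. (\<forall>i<m. \<forall>j<m. x i j = y i j) \<longrightarrow> mn m x = mn m y) \<and>
     (\<forall>m x. 0 \<le> mn m x) \<and>
     (\<forall>m x. mn m x = 0 \<longrightarrow> (\<forall>i<m. \<forall>j<m. x i j = 0)) \<and>
     (\<forall>m x y. mn m (\<lambda>i j. x i j + y i j) \<le> mn m x + mn m y) \<and>
     (\<forall>m c x. mn m (\<lambda>i j. c *\<^sub>R x i j) = \<bar>c\<bar> * mn m x) \<and>
     (\<forall>x. mn 1 x = norm (x 0 0)) \<and>
     (\<forall>l m a x b. mn l (sandwich {..<m} a x b) \<le> opnorm {..<l} {..<m} a * mn m x * opnorm {..<m} {..<l} b) \<and>
     (\<forall>m l x y. mn (m + l) (dsum m x y) = max (mn m x) (mn l y))"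

text \<open>\<open>E\<close> (with matrix norms \<open>mnE\<close>) is the operator space dual of the complete operator space
  \<open>F\<close> (with matrix norms \<open>mnF\<close>) via the pairing \<open>pr\<close>: this identifies \<open>E\<close> with
  \<open>F\<^sup>*\<close>, and \<open>M\<^sub>m(E)\<close> isometrically with \<open>CB(F, M\<^sub>m(\<real>))\<close>.  The supremum is the completely
  bounded norm of \<open>f \<mapsto> (\<langle>x i j, f\<rangle>)\<close>.\<close>

definition real_dual_operator_space ::
  "'e::banach mat_norms \<Rightarrow> 'f::banach mat_norms \<Rightarrow> ('e \<Rightarrow> 'f \<Rightarrow> real) \<Rightarrow> bool" where
  "real_dual_operator_space mnE mnF pr \<longleftrightarrow>
     real_operator_space mnE \<and> real_operator_space mnF \<and> bounded_bilinear pr \<and>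
     (\<forall>\<phi>. bounded_linear \<phi> \<longrightarrow> (\<exists>!e. \<forall>f. pr e f = \<phi> f)) \<and>
     (\<forall>m x. mnE m x =
        Sup {opnorm ({..<m} \<times> {..<r}) ({..<m} \<times> {..<r}) (\<lambda>(i, k) (j, l). pr (x i j) (f k l)) |r f. mnF r f \<le> 1})"

text \<open>The matrix norms of \<open>\<real>\<close>; together with multiplication as the pairing they make \<open>\<real>\<close> the
  dual of itself.\<close>

definition real_mn :: "real mat_norms" where
  "real_mn m a = opnorm {..<m} {..<m} a"


section \<open>Infinite matrices and their weak* topology\<close>

text \<open>Norms of the finite submatrices of \<open>x\<close> with indices in \<open>N\<close>.\<close>

definition submat_norms :: "'a mat_norms \<Rightarrow> 'k set \<Rightarrow> ('k \<Rightarrow> 'k \<Rightarrow> 'a) \<Rightarrow> real set" where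
  "submat_norms mn N x = {mn m (\<lambda>i j. x (\<sigma> i) (\<sigma> j)) |m \<sigma>. inj_on \<sigma> {..<m} \<and> \<sigma> ` {..<m} \<subseteq> N}"

definition Mn :: "'a::zero mat_norms \<Rightarrow> 'k set \<Rightarrow> ('k \<Rightarrow> 'k \<Rightarrow> 'a) set" where
  "Mn mn N = {x. (\<forall>p q. p \<notin> N \<or> q \<notin> N \<longrightarrow> x p q = 0) \<and> bdd_above (submat_norms mn N x)}"

definition Mn_norm :: "'a mat_norms \<Rightarrow> 'k set \<Rightarrow> ('k \<Rightarrow> 'k \<Rightarrow> 'a) \<Rightarrow> real" where
  "Mn_norm mn N x = Sup (submat_norms mn N x)"

text \<open>The predual of \<open>M\<^sub>n(E) = CB(F, M\<^sub>n(\<real>))\<close> is the operator space projective tensor product of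
  \<open>F\<close> with the trace class on \<open>\<ell>\<^sup>2\<^sub>n\<close>.  Inside the Banach space dual of \<open>M\<^sub>n(E)\<close> it is the norm
  closure of the span of the functionals \<open>x \<mapsto> \<langle>x p q, f\<rangle>\<close>.  Linearity of \<open>\<phi>\<close> on \<open>M\<^sub>n(E)\<close>
  follows from the approximation.\<close>

definition predual_functional ::
  "'e::zero mat_norms \<Rightarrow> ('e \<Rightarrow> 'f \<Rightarrow> real) \<Rightarrow> 'k set \<Rightarrow> (('k \<Rightarrow> 'k \<Rightarrow> 'e) \<Rightarrow> real) \<Rightarrow> bool" where
  "predual_functional mn pr N \<phi> \<longleftrightarrow>
     (\<forall>\<epsilon>>0. \<exists>S f. finite S \<and> S \<subseteq> N \<times> N \<and>
        (\<forall>x\<in>Mn mn N. \<bar>\<phi> x - (\<Sum>(p, q)\<in>S. pr (x p q) (f p q))\<bar> \<le> \<epsilon> * Mn_norm mn N x))"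

definition wstar :: "'e::zero mat_norms \<Rightarrow> ('e \<Rightarrow> 'f \<Rightarrow> real) \<Rightarrow> 'k set \<Rightarrow> ('k \<Rightarrow> 'k \<Rightarrow> 'e) topology" where
  "wstar mn pr N = topology_generated_by
     {{x \<in> Mn mn N. \<phi> x \<in> U} |\<phi> U. predual_functional mn pr N \<phi> \<and> open U}"

abbreviation wstar_real :: "'k set \<Rightarrow> ('k \<Rightarrow> 'k \<Rightarrow> real) topology" where
  "wstar_real N \<equiv> wstar real_mn (*) N"


section \<open>Nc convex sets\<close>

text \<open>With \<open>\<kappa>\<close> the cardinality of the type \<open>'k\<close>, the nonzero cardinals \<open>n \<le> \<kappa>\<close> are, as usual,
  the nonempty initial ordinals: those initial segments of the well-order \<open>|UNIV :: 'k set|\<close> all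
  of whose proper initial segments have smaller cardinality.  Each cardinal is thus represented
  by exactly one index set.\<close>

definition cardinals :: "'k set set" where
  "cardinals = {N. N \<noteq> {} \<and> ofilter |UNIV :: 'k set| N \<and>
                   (\<forall>a\<in>N. |underS |UNIV :: 'k set| a| <o |N| )}"

text \<open>A graded set \<open>K = \<Squnion>\<^sub>n K\<^sub>n\<close> is a set of pairs \<open>(n, x)\<close>; its level \<open>K\<^sub>n\<close> is \<open>K `` {n}\<close>.\<close>

type_synonym ('k, 'e) graded = "('k set \<times> ('k \<Rightarrow> 'k \<Rightarrow> 'e)) set"

definition nc_matrices :: "'e::zero mat_norms \<Rightarrow> ('k, 'e) graded" where
  "nc_matrices mn = (SIGMA n : cardinals. Mn mn n)"

text \<open>Infinite sums are weak* limits of the finite partial sums.  It suffices to index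
  families by subsets of \<open>'k\<close>, because isometries \<open>\<alpha>\<^sub>i\<close> with \<open>\<Sum>\<^sub>i \<alpha>\<^sub>i \<alpha>\<^sub>i\<^sup>T = 1\<^sub>n\<close> have orthogonal
  nonzero ranges in \<open>\<ell>\<^sup>2\<^sub>n\<close>, so that there are at most \<open>n \<le> \<kappa>\<close> of them.\<close>

definition closed_under_direct_sums ::
  "'e::banach mat_norms \<Rightarrow> ('e \<Rightarrow> 'f \<Rightarrow> real) \<Rightarrow> ('k, 'e) graded \<Rightarrow> bool" where
  "closed_under_direct_sums mn pr K \<longleftrightarrow>
     (\<forall>n\<in>cardinals. \<forall>(I :: 'k set) d x \<alpha> y.
        (\<forall>i\<in>I. (d i, x i) \<in> K \<and> \<alpha> i \<in> isometries n (d i)) \<and>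
        (\<exists>C. \<forall>i\<in>I. Mn_norm mn (d i) (x i) \<le> C) \<and>
        limitin (wstar_real n) (\<lambda>J p q. \<Sum>i\<in>J. lmul (d i) (\<alpha> i) (mtrans (\<alpha> i)) p q)
          (idmat n) (finite_subsets_at_top I) \<and>
        limitin (wstar mn pr n) (\<lambda>J p q. \<Sum>i\<in>J. sandwich (d i) (\<alpha> i) (x i) (mtrans (\<alpha> i)) p q)
          y (finite_subsets_at_top I)
        \<longrightarrow> (n, y) \<in> K)"

definition closed_under_compressions :: "('k, 'e::banach) graded \<Rightarrow> bool" where
  "closed_under_compressions K \<longleftrightarrow>
     (\<forall>n\<in>cardinals. \<forall>m\<in>cardinals. \<forall>x \<beta>. (n, x) \<in> K \<and> \<beta> \<in> isometries n m
        \<longrightarrow> (m, sandwich n (mtrans \<beta>) x \<beta>) \<in> K)"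

definition nc_convex :: "'e::banach mat_norms \<Rightarrow> ('e \<Rightarrow> 'f \<Rightarrow> real) \<Rightarrow> ('k, 'e) graded \<Rightarrow> bool" where
  "nc_convex mn pr K \<longleftrightarrow>
     K \<subseteq> nc_matrices mn \<and> closed_under_direct_sums mn pr K \<and> closed_under_compressions K"

definition closed_nc_convex :: "'e::banach mat_norms \<Rightarrow> ('e \<Rightarrow> 'f \<Rightarrow> real) \<Rightarrow> ('k, 'e) graded \<Rightarrow> bool" where
  "closed_nc_convex mn pr K \<longleftrightarrow>
     nc_convex mn pr K \<and> (\<forall>n\<in>cardinals. closedin (wstar mn pr n) (K `` {n}))"

definition compact_nc_convex :: "'e::banach mat_norms \<Rightarrow> ('e \<Rightarrow> 'f \<Rightarrow> real) \<Rightarrow> ('k, 'e) graded \<Rightarrow> bool" where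
  "compact_nc_convex mn pr K \<longleftrightarrow>
     nc_convex mn pr K \<and> (\<forall>n\<in>cardinals. compactin (wstar mn pr n) (K `` {n}))"

definition closed_nc_hull ::
  "'e::banach mat_norms \<Rightarrow> ('e \<Rightarrow> 'f \<Rightarrow> real) \<Rightarrow> ('k, 'e) graded \<Rightarrow> ('k, 'e) graded" where
  "closed_nc_hull mn pr X = \<Inter>{L. closed_nc_convex mn pr L \<and> X \<subseteq> L}"

text \<open>Nets of triples \<open>(n\<^sub>i, x\<^sub>i, \<alpha>\<^sub>i)\<close> are rendered by proper filters on the set of triples;
  every net has its filter of tails, and every proper filter arises this way, so nets over
  arbitrary directed sets are covered.\<close>

definition nc_closed_in ::
  "'e::banach mat_norms \<Rightarrow> ('e \<Rightarrow> 'f \<Rightarrow> real) \<Rightarrow> ('k, 'e) graded \<Rightarrow> ('k, 'e) graded \<Rightarrow> bool" where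
  "nc_closed_in mn pr K X \<longleftrightarrow>
     X \<subseteq> K \<and>
     (\<forall>n\<in>cardinals. closedin (subtopology (wstar mn pr n) (K `` {n})) (X `` {n})) \<and>
     (\<forall>n\<in>cardinals. \<forall>(F :: ('k set \<times> ('k \<Rightarrow> 'k \<Rightarrow> 'e) \<times> ('k \<Rightarrow> 'k \<Rightarrow> real)) filter) y.
        F \<noteq> bot \<and>
        (\<forall>\<^sub>F (d, x, \<alpha>) in F. (d, x) \<in> X \<and> \<alpha> \<in> contractions n d) \<and>
        limitin (wstar_real n) (\<lambda>(d, x, \<alpha>). lmul d \<alpha> (mtrans \<alpha>)) (idmat n) F \<and>
        limitin (wstar mn pr n) (\<lambda>(d, x, \<alpha>). sandwich d \<alpha> x (mtrans \<alpha>)) y F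
        \<longrightarrow> (n, y) \<in> X)"

definition nc_extreme :: "('k, 'e::banach) graded \<Rightarrow> 'k set \<Rightarrow> ('k \<Rightarrow> 'k \<Rightarrow> 'e) \<Rightarrow> bool" where
  "nc_extreme K n x \<longleftrightarrow>
     (n, x) \<in> K \<and>
     (\<forall>(r::nat) d y \<alpha>.
        (\<forall>i<r. (d i, y i) \<in> K \<and> \<alpha> i \<in> bounded_mats (d i) n \<and> \<alpha> i \<noteq> (\<lambda>p q. 0)) \<and>
        (\<lambda>p q. \<Sum>i<r. lmul (d i) (mtrans (\<alpha> i)) (\<alpha> i) p q) = idmat n \<and>
        (\<lambda>p q. \<Sum>i<r. sandwich (d i) (mtrans (\<alpha> i)) (y i) (\<alpha> i) p q) = x
        \<longrightarrow> (\<forall>i<r. \<exists>c \<beta>. c > 0 \<and> \<beta> \<in> isometries (d i) n \<and> \<alpha> i = (\<lambda>p q. c * \<beta> p q) \<and>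
              sandwich (d i) (mtrans \<beta>) (y i) \<beta> = x \<and>
              rmul (d i) (y i) (lmul n \<beta> (mtrans \<beta>)) = lmul (d i) (lmul n \<beta> (mtrans \<beta>)) (y i)))"

end

theory Submission
  imports Defs
begin

text \<open>The proof adapts Milman's partial converse of the Krein--Milman theorem.  An operator
  \<open>\<alpha>\<close> and a point \<open>y \<in> X\<^sub>d\<close> give the pair \<open>(\<alpha>\<^sup>T\<alpha>, \<alpha>\<^sup>Ty\<alpha>)\<close>.  The points \<open>z\<close> of \<open>K\<close> for which
  \<open>(1, z)\<close> is a weak* limit of finite sums of such pairs form a closed nc convex set containing
  \<open>X\<close>, hence all of \<open>K\<close>.  Let \<open>x\<close> be nc extreme and let finite sums converge to \<open>(1, x)\<close>.  Fix
  finitely many matrix entries and predual elements, and colour the summands by the box of side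
  \<open>\<eta>\<close> containing their normalized values.  The number of colours is bounded, so the partial sum
  of the heaviest colour keeps a fixed share of the mass, and along a subnet it converges to some
  \<open>D\<^sub>1\<close>, the remainder to \<open>D\<^sub>2\<close>, with \<open>D\<^sub>1 + D\<^sub>2 = (1, x)\<close>.  Extremality forces \<open>D\<^sub>1\<close> to be a
  multiple of \<open>(1, x)\<close>.  As all summands of that colour have nearly proportional values, a single
  one of them, rescaled, approximates \<open>(1, x)\<close>.  Letting the finite data grow gives contractions
  \<open>\<alpha>\<^sub>i\<^sup>T\<close> and points \<open>y\<^sub>i \<in> X\<close> as in the definition of an nc closed set.\<close>

section \<open>The Hilbert space of square-summable families\<close>

text \<open>Extremality speaks of points of \<open>K\<close>, whereas the limits D1 and D2 of
  partial sums come from no points, and their first components need not be invertible. Mixing each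
  of them with a large share of \<open>(1, x)\<close> cures this: the first component moves close to
  1 and has an invertible square root, and a point is recovered as a limit of compressions of finite
  direct sums. Nearly orthonormal vectors must there be replaced by orthonormal ones and completed
  to an isometry on the whole level \<open>n\<close>; the direct sums are therefore formed on the
  top level \<kappa>, where \<kappa> many spare dimensions remain. Limits stay under control because
  the second component of a pair is dominated by the first, with one constant for all levels of
  \<open>K\<close>, which weak* compactness supplies. As \<open>n\<close> may be infinite, the
  identity may have no finite trace: the mass of a pair is its trace over the chosen finite set of
  basis vectors. The share kept by the heaviest colour depends on the number of colours but not on
  the sum, so it survives the limit and the multiple of \<open>(1, x)\<close> is not zero.\<close>

typedef 'k ell2 = "l2 (UNIV :: 'k set)" morphisms coord Abs_ell2
  by (rule exI[of _ "\<lambda>_. 0"]) (simp add: l2_def)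

lemma coord_square_summable: "(\<lambda>i. (coord v i)\<^sup>2) summable_on A"
  using coord[of v] summable_on_subset_banach[of "\<lambda>i. (coord v i)\<^sup>2" UNIV A] by (auto simp: l2_def)

lemma square_summableI:
  fixes v :: "'i \<Rightarrow> real"
  assumes "\<And>J. finite J \<Longrightarrow> J \<subseteq> A \<Longrightarrow> (\<Sum>i\<in>J. (v i)\<^sup>2) \<le> C"
  shows "(\<lambda>i. (v i)\<^sup>2) summable_on A"
  by (rule nonneg_bdd_above_summable_on) (use assms in \<open>auto intro!: bdd_aboveI\<close>)

lemma coord_Abs_ell2:
  assumes "(\<lambda>i. (v i)\<^sup>2) summable_on UNIV"
  shows "coord (Abs_ell2 v) = v"
  using assms by (intro Abs_ell2_inverse) (simp add: l2_def)

lemma product_summable: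
  fixes v w :: "'i \<Rightarrow> real"
  assumes "(\<lambda>i. (v i)\<^sup>2) summable_on A" "(\<lambda>i. (w i)\<^sup>2) summable_on A"
  shows "(\<lambda>i. v i * w i) summable_on A"
proof -
  have "(\<lambda>i. (v i)\<^sup>2 + (w i)\<^sup>2) summable_on A"
    using assms by (rule summable_on_add)
  then have "(\<lambda>i. norm ((v i)\<^sup>2 + (w i)\<^sup>2)) summable_on A"
    by simp
  then have "(\<lambda>i. norm (v i * w i)) summable_on A"
  proof (rule Infinite_Sum.abs_summable_on_comparison_test)
    fix i
    have "2 * (\<bar>v i\<bar> * \<bar>w i\<bar>) \<le> (v i)\<^sup>2 + (w i)\<^sup>2"
      using sum_squares_bound[of "\<bar>v i\<bar>" "\<bar>w i\<bar>"] by simp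
    moreover have "0 \<le> \<bar>v i\<bar> * \<bar>w i\<bar>" by simp
    ultimately have "\<bar>v i\<bar> * \<bar>w i\<bar> \<le> (v i)\<^sup>2 + (w i)\<^sup>2" by linarith
    then show "norm (v i * w i) \<le> norm ((v i)\<^sup>2 + (w i)\<^sup>2)"
      by (simp add: abs_mult)
  qed
  then show ?thesis
    by (rule abs_summable_summable)
qed

lemma square_summable_add:
  fixes v w :: "'i \<Rightarrow> real"
  assumes "(\<lambda>i. (v i)\<^sup>2) summable_on A" "(\<lambda>i. (w i)\<^sup>2) summable_on A"
  shows "(\<lambda>i. (v i + w i)\<^sup>2) summable_on A"
proof -
  have "(\<lambda>i. (v i)\<^sup>2 + (w i)\<^sup>2 + 2 * (v i * w i)) summable_on A"
    by (intro summable_on_add assms summable_on_cmult_right product_summable)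
  then show ?thesis
    by (simp add: power2_sum algebra_simps)
qed

lemma square_summable_scale:
  fixes v :: "'i \<Rightarrow> real"
  assumes "(\<lambda>i. (v i)\<^sup>2) summable_on A"
  shows "(\<lambda>i. (c * v i)\<^sup>2) summable_on A"
  unfolding power_mult_distrib by (intro summable_on_cmult_right assms)

instantiation ell2 :: (type) real_vector
begin

definition "0 = Abs_ell2 (\<lambda>_. 0)"
definition "v + w = Abs_ell2 (\<lambda>i. coord v i + coord w i)"
definition "- v = Abs_ell2 (\<lambda>i. - coord v i)"
definition "v - w = Abs_ell2 (\<lambda>i. coord v i - coord w i)"
definition "c *\<^sub>R v = Abs_ell2 (\<lambda>i. c * coord v i)"

lemma coord_zero [simp]: "coord 0 = (\<lambda>_. 0)"
  unfolding zero_ell2_def by (rule coord_Abs_ell2) simp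

lemma coord_add [simp]: "coord (v + w) = (\<lambda>i. coord v i + coord w i)"
  unfolding plus_ell2_def by (intro coord_Abs_ell2 square_summable_add coord_square_summable)

lemma coord_scaleR [simp]: "coord (c *\<^sub>R v) = (\<lambda>i. c * coord v i)"
  unfolding scaleR_ell2_def by (intro coord_Abs_ell2 square_summable_scale coord_square_summable)

lemma coord_minus [simp]: "coord (- v) = (\<lambda>i. - coord v i)"
  unfolding uminus_ell2_def by (intro coord_Abs_ell2) (simp add: coord_square_summable)

lemma coord_diff [simp]: "coord (v - w) = (\<lambda>i. coord v i - coord w i)"
proof -
  have "(\<lambda>i. (coord v i + (- 1) * coord w i)\<^sup>2) summable_on UNIV"
    by (intro square_summable_add square_summable_scale coord_square_summable)
  then show ?thesis
    unfolding minus_ell2_def by (intro coord_Abs_ell2) simp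
qed

instance
proof
  fix u v w :: "'a ell2" and a b :: real
  show "u + v + w = u + (v + w)" "u + v = v + u" "0 + u = u" "- u + u = 0" "u - v = u + - v"
    "a *\<^sub>R (u + v) = a *\<^sub>R u + a *\<^sub>R v" "(a + b) *\<^sub>R u = a *\<^sub>R u + b *\<^sub>R u"
    "a *\<^sub>R b *\<^sub>R u = (a * b) *\<^sub>R u" "1 *\<^sub>R u = u"
    by (simp_all add: coord_inject[symmetric] algebra_simps)
qed

end

instantiation ell2 :: (type) real_inner
begin

definition "inner v w = (\<Sum>\<^sub>\<infinity>i. coord v i * coord w i)"
definition "norm v = sqrt (\<Sum>\<^sub>\<infinity>i. (coord v i)\<^sup>2)"
definition "sgn (v :: 'a ell2) = v /\<^sub>R norm v"
definition "dist v w = norm (v - w :: 'a ell2)"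
definition [code del]:
  "(uniformity :: ('a ell2 \<times> 'a ell2) filter) = (INF e\<in>{0<..}. principal {(x, y). dist x y < e})"
definition [code del]:
  "open (U :: 'a ell2 set) \<longleftrightarrow> (\<forall>x\<in>U. eventually (\<lambda>(x', y). x' = x \<longrightarrow> y \<in> U) uniformity)"

instance
proof
  fix u v w :: "'a ell2" and a b :: real
  show "dist u v = norm (u - v)" by (rule dist_ell2_def)
  show "sgn u = u /\<^sub>R norm u" by (rule sgn_ell2_def)
  show "(uniformity :: ('a ell2 \<times> 'a ell2) filter) = (INF e\<in>{0<..}. principal {(x, y). dist x y < e})"
    by (rule uniformity_ell2_def)
  show "open (U :: 'a ell2 set) \<longleftrightarrow> (\<forall>x\<in>U. eventually (\<lambda>(x', y). x' = x \<longrightarrow> y \<in> U) uniformity)" for U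
    by (rule open_ell2_def)
  show "inner u v = inner v u" by (simp add: inner_ell2_def mult.commute)
  show "inner (u + v) w = inner u w + inner v w"
    unfolding inner_ell2_def coord_add distrib_right
    by (intro infsum_add product_summable coord_square_summable)
  show "inner (a *\<^sub>R u) v = a * inner u v"
    unfolding inner_ell2_def by (simp add: mult.assoc infsum_cmult_right')
  show "0 \<le> inner u u"
    unfolding inner_ell2_def by (intro infsum_nonneg) simp
  show "inner u u = 0 \<longleftrightarrow> u = 0"
  proof
    assume "inner u u = 0"
    then have "(coord u i)\<^sup>2 = 0" for i
      using nonneg_infsum_le_0D[of "\<lambda>i. (coord u i)\<^sup>2" UNIV i] coord_square_summable[of u UNIV]
      by (simp add: inner_ell2_def power2_eq_square)
    then show "u = 0"
      by (simp add: coord_inject[symmetric] fun_eq_iff)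
  qed (simp add: inner_ell2_def)
  show "norm u = sqrt (inner u u)"
    by (simp add: norm_ell2_def inner_ell2_def power2_eq_square)
qed

end

lemma ell2_eqI: "(\<And>p. coord v p = coord w p) \<Longrightarrow> v = w"
  by (simp add: coord_inject[symmetric] fun_eq_iff)

lemma coord_sum: "coord (\<Sum>i\<in>I. v i) p = (\<Sum>i\<in>I. coord (v i) p)"
  by (induction I rule: infinite_finite_induct) auto

lemma norm_ell2_square: "(norm v)\<^sup>2 = (\<Sum>\<^sub>\<infinity>i. (coord v i)\<^sup>2)"
  unfolding norm_ell2_def by (simp add: infsum_nonneg)

lemma sum_coord_square_le: "finite J \<Longrightarrow> (\<Sum>i\<in>J. (coord v i)\<^sup>2) \<le> (norm v)\<^sup>2"
  unfolding norm_ell2_square by (intro finite_sum_le_infsum coord_square_summable) auto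

lemma norm_ell2_leI:
  assumes "0 \<le> C" "\<And>J. finite J \<Longrightarrow> (\<Sum>i\<in>J. (coord v i)\<^sup>2) \<le> C\<^sup>2"
  shows "norm v \<le> C"
proof (rule power2_le_imp_le)
  show "(norm v)\<^sup>2 \<le> C\<^sup>2"
    unfolding norm_ell2_square using assms by (intro infsum_le_finite_sums coord_square_summable) auto
qed fact

lemma abs_coord_le_norm: "\<bar>coord v p\<bar> \<le> norm v"
  using sum_coord_square_le[of "{p}" v] by (simp add: abs_le_square_iff[symmetric])

text \<open>Coordinates of a Cauchy sequence converge. Bounds on finite sums of squares pass to the
  coordinatewise limit; this gives both its square-summability and convergence in norm.\<close>

instance ell2 :: (type) banach
proof
  fix X :: "nat \<Rightarrow> 'a ell2"
  assume X: "Cauchy X"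
  have "Cauchy (\<lambda>n. coord (X n) p)" for p
  proof (rule metric_CauchyI)
    fix e :: real assume "e > 0"
    then obtain M where M: "\<And>m n. m \<ge> M \<Longrightarrow> n \<ge> M \<Longrightarrow> dist (X m) (X n) < e"
      using X unfolding Cauchy_def by blast
    have "dist (coord (X m) p) (coord (X n) p) \<le> dist (X m) (X n)" for m n
      using abs_coord_le_norm[of "X m - X n" p] by (simp add: dist_norm)
    with M show "\<exists>M. \<forall>m\<ge>M. \<forall>n\<ge>M. dist (coord (X m) p) (coord (X n) p) < e"
      by (meson le_less_trans)
  qed
  then have "\<exists>l. (\<lambda>n. coord (X n) p) \<longlonglongrightarrow> l" for p
    by (simp add: real_Cauchy_convergent convergent_def[symmetric])
  then obtain l where l: "\<And>p. (\<lambda>n. coord (X n) p) \<longlonglongrightarrow> l p"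
    by metis
  obtain M where M: "\<And>n. norm (X n) \<le> M"
    using Cauchy_Bseq[OF X] by (auto simp: Bseq_def)
  have sums: "(\<Sum>p\<in>J. (l p)\<^sup>2) \<le> M\<^sup>2" if "finite J" for J
  proof (rule LIMSEQ_le_const2)
    show "(\<lambda>n. \<Sum>p\<in>J. (coord (X n) p)\<^sup>2) \<longlonglongrightarrow> (\<Sum>p\<in>J. (l p)\<^sup>2)"
      by (intro tendsto_intros l)
    have "(\<Sum>p\<in>J. (coord (X n) p)\<^sup>2) \<le> M\<^sup>2" for n
      using sum_coord_square_le[OF that, of "X n"] power_mono[OF M[of n], of 2] by simp
    then show "\<exists>N. \<forall>n\<ge>N. (\<Sum>p\<in>J. (coord (X n) p)\<^sup>2) \<le> M\<^sup>2" by blast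
  qed
  define L where "L = Abs_ell2 l"
  have coord_L: "coord L = l"
    unfolding L_def using sums by (intro coord_Abs_ell2 square_summableI)
  have "X \<longlonglongrightarrow> L"
  proof (rule metric_LIMSEQ_I)
    fix e :: real assume e: "e > 0"
    then obtain N where N: "\<And>m n. m \<ge> N \<Longrightarrow> n \<ge> N \<Longrightarrow> dist (X m) (X n) < e / 2"
      using X unfolding Cauchy_def by (meson half_gt_zero)
    have "dist (X m) L < e" if m: "m \<ge> N" for m
    proof -
      have "norm (X m - L) \<le> e / 2"
      proof (rule norm_ell2_leI)
        fix J :: "'a set" assume J: "finite J"
        show "(\<Sum>i\<in>J. (coord (X m - L) i)\<^sup>2) \<le> (e / 2)\<^sup>2"
        proof (rule LIMSEQ_le_const2)
          show "(\<lambda>n. \<Sum>i\<in>J. (coord (X m - X n) i)\<^sup>2) \<longlonglongrightarrow> (\<Sum>i\<in>J. (coord (X m - L) i)\<^sup>2)"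
            unfolding coord_diff coord_L by (intro tendsto_intros l)
          have "(\<Sum>i\<in>J. (coord (X m - X n) i)\<^sup>2) \<le> (e / 2)\<^sup>2" if "n \<ge> N" for n
          proof -
            have "(\<Sum>i\<in>J. (coord (X m - X n) i)\<^sup>2) \<le> (norm (X m - X n))\<^sup>2"
              by (rule sum_coord_square_le[OF J])
            also have "\<dots> \<le> (e / 2)\<^sup>2"
              using N[OF m that] by (intro power_mono) (auto simp: dist_norm)
            finally show ?thesis .
          qed
          then show "\<exists>N. \<forall>n\<ge>N. (\<Sum>i\<in>J. (coord (X m - X n) i)\<^sup>2) \<le> (e / 2)\<^sup>2" by blast
        qed
      qed (use e in simp)
      then show ?thesis using e by (simp add: dist_norm)
    qed
    then show "\<exists>no. \<forall>n\<ge>no. dist (X n) L < e" by blast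
  qed
  then show "convergent X" by (auto simp: convergent_def)
qed

section \<open>The standard orthonormal basis and maps determined by it\<close>

definition basis :: "'k \<Rightarrow> 'k ell2" where
  "basis p = Abs_ell2 (\<lambda>i. if i = p then 1 else 0)"

lemma coord_basis [simp]: "coord (basis p) = (\<lambda>i. if i = p then 1 else 0)"
  unfolding basis_def
proof (intro coord_Abs_ell2 square_summableI)
  fix J :: "'a set" assume "finite J"
  have "(\<Sum>i\<in>J. (if i = p then 1 else 0 :: real)\<^sup>2) = (\<Sum>i\<in>J. if i = p then 1 else 0)"
    by (intro sum.cong) auto
  also have "\<dots> \<le> 1" using \<open>finite J\<close> by simp
  finally show "(\<Sum>i\<in>J. (if i = p then 1 else 0 :: real)\<^sup>2) \<le> 1" .
qed

lemma inner_basis [simp]: "inner v (basis p) = coord v p" "inner (basis p) v = coord v p"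
proof -
  have "inner v (basis p) = (\<Sum>\<^sub>\<infinity>i\<in>{p}. coord v i * coord (basis p) i)"
    unfolding inner_ell2_def by (intro infsum_cong_neutral) auto
  then show "inner v (basis p) = coord v p" by simp
  then show "inner (basis p) v = coord v p" by (simp add: inner_commute)
qed

lemma norm_basis [simp]: "norm (basis p) = 1"
  by (simp add: norm_eq_sqrt_inner)

lemma norm_fin_comb:
  assumes "finite J"
  shows "(norm (\<Sum>p\<in>J. c p *\<^sub>R basis p))\<^sup>2 = (\<Sum>p\<in>J. (c p)\<^sup>2)"
proof -
  have "(norm (\<Sum>p\<in>J. c p *\<^sub>R basis p))\<^sup>2 = (\<Sum>p\<in>J. c p * coord (\<Sum>q\<in>J. c q *\<^sub>R basis q) p)"
    by (simp add: power2_norm_eq_inner inner_sum_left)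
  also have "\<dots> = (\<Sum>p\<in>J. (c p)\<^sup>2)"
    using assms by (intro sum.cong) (simp_all add: coord_sum power2_eq_square if_distrib cong: if_cong)
  finally show ?thesis .
qed

text \<open>By Pythagoras the squared error of a finite partial sum is the squared norm minus the
  finite sum of squares.\<close>

lemma basis_has_sum: "((\<lambda>p. coord v p *\<^sub>R basis p) has_sum v) UNIV"
proof -
  have eq: "(norm (v - (\<Sum>p\<in>J. coord v p *\<^sub>R basis p)))\<^sup>2 = (norm v)\<^sup>2 - (\<Sum>p\<in>J. (coord v p)\<^sup>2)"
    if "finite J" for J
  proof -
    have "inner v (\<Sum>p\<in>J. coord v p *\<^sub>R basis p) = (\<Sum>p\<in>J. (coord v p)\<^sup>2)"
      by (simp add: inner_sum_right power2_eq_square)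
    with norm_fin_comb[OF that, of "coord v"] show ?thesis
      by (simp add: power2_norm_eq_inner inner_diff inner_commute)
  qed
  have "((\<lambda>i. (coord v i)\<^sup>2) has_sum (norm v)\<^sup>2) UNIV"
    unfolding norm_ell2_square by (intro has_sum_infsum coord_square_summable)
  then have "((\<lambda>J. (norm v)\<^sup>2 - (\<Sum>p\<in>J. (coord v p)\<^sup>2)) \<longlongrightarrow> (norm v)\<^sup>2 - (norm v)\<^sup>2) (finite_subsets_at_top UNIV)"
    unfolding has_sum_def by (intro tendsto_intros)
  then have "((\<lambda>J. (norm (v - (\<Sum>p\<in>J. coord v p *\<^sub>R basis p)))\<^sup>2) \<longlongrightarrow> 0) (finite_subsets_at_top UNIV)"
    by (subst tendsto_cong[where g="\<lambda>J. (norm v)\<^sup>2 - (\<Sum>p\<in>J. (coord v p)\<^sup>2)"])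
      (auto simp: eq intro!: eventually_finite_subsets_at_top_weakI)
  then have "((\<lambda>J. sqrt ((norm (v - (\<Sum>p\<in>J. coord v p *\<^sub>R basis p)))\<^sup>2)) \<longlongrightarrow> sqrt 0) (finite_subsets_at_top UNIV)"
    by (rule tendsto_real_sqrt)
  then show ?thesis
    unfolding has_sum_def by (simp add: tendsto_dist_iff[of _ v] dist_norm norm_minus_commute)
qed

text \<open>Most operator identities below are proved through this reduction, or through its
  bilinear version, instead of by manipulating infinite sums.\<close>

lemma bounded_linear_eq_on_basis:
  fixes f g :: "'k ell2 \<Rightarrow> 'b::real_normed_vector"
  assumes "bounded_linear f" "bounded_linear g" "\<And>p. f (basis p) = g (basis p)"
  shows "f v = g v"
proof -
  have "((\<lambda>p. f (coord v p *\<^sub>R basis p)) has_sum f v) UNIV"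
    using has_sum_bounded_linear[OF assms(1) basis_has_sum] by (simp add: o_def)
  moreover have "((\<lambda>p. g (coord v p *\<^sub>R basis p)) has_sum g v) UNIV"
    using has_sum_bounded_linear[OF assms(2) basis_has_sum] by (simp add: o_def)
  moreover have "f (coord v p *\<^sub>R basis p) = g (coord v p *\<^sub>R basis p)" for p
    by (simp add: assms linear_cmul bounded_linear.linear)
  ultimately show ?thesis
    by (simp add: has_sum_unique)
qed

lemma bounded_linear_has_sum_basis:
  assumes "bounded_linear f"
  shows "((\<lambda>p. coord v p *\<^sub>R f (basis p)) has_sum f v) UNIV"
  using has_sum_bounded_linear[OF assms basis_has_sum, of v]
  by (simp add: o_def linear_cmul bounded_linear.linear[OF assms])

text \<open>The hypothesis bounds, on finite combinations, the linear map that sends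
  \<open>basis p\<close> to \<open>g p\<close>. Applied to tails it makes the partial sums Cauchy,
  so the map extends to the whole space with the same bound. The values may lie in any Banach
  space.\<close>

lemma ell2_extension:
  fixes g :: "'k \<Rightarrow> 'b::banach"
  assumes C: "\<And>J c. finite J \<Longrightarrow> norm (\<Sum>p\<in>J. c p *\<^sub>R g p) \<le> C * sqrt (\<Sum>p\<in>J. (c p)\<^sup>2)"
  shows "(\<lambda>p. coord v p *\<^sub>R g p) summable_on UNIV"
    and "bounded_linear (\<lambda>v. \<Sum>\<^sub>\<infinity>p. coord v p *\<^sub>R g p)"
    and "norm (\<Sum>\<^sub>\<infinity>p. coord v p *\<^sub>R g p) \<le> C * norm v"
proof -
  have C0: "0 \<le> C"
    using C[of "{undefined}" "\<lambda>_. 1"] order_trans[OF norm_ge_zero[of "g undefined"]] by simp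
  show summable: "(\<lambda>p. coord v p *\<^sub>R g p) summable_on UNIV" for v
  proof -
    let ?S = "\<lambda>J. \<Sum>p\<in>J. coord v p *\<^sub>R g p"
    have "\<exists>P. eventually P (finite_subsets_at_top UNIV) \<and> (\<forall>I J. P I \<and> P J \<longrightarrow> dist (?S I) (?S J) < e)"
      if e: "e > 0" for e
    proof -
      \<comment> \<open>Makes \<open>C * \<eta>\<close> smaller than \<open>e / 2\<close>; the
        \<open>+ 1\<close> covers \<open>C = 0\<close>.\<close>
      define \<eta> where "\<eta> = e / (3 * (C + 1))"
      have \<eta>: "\<eta> > 0" using e C0 by (simp add: \<eta>_def)
      have "((\<lambda>i. (coord v i)\<^sup>2) has_sum (norm v)\<^sup>2) UNIV"
        unfolding norm_ell2_square by (intro has_sum_infsum coord_square_summable)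
      then obtain I0 where I0: "finite I0"
        "\<And>I. finite I \<Longrightarrow> I0 \<subseteq> I \<Longrightarrow> dist (\<Sum>i\<in>I. (coord v i)\<^sup>2) ((norm v)\<^sup>2) < \<eta>\<^sup>2"
        using \<eta> unfolding has_sum_def tendsto_iff eventually_finite_subsets_at_top
        by (metis subset_UNIV zero_less_power)
      have near: "dist (?S I) (?S I0) \<le> C * \<eta>" if I: "finite I" "I0 \<subseteq> I" for I
      proof -
        have "(\<Sum>i\<in>I - I0. (coord v i)\<^sup>2) = (\<Sum>i\<in>I. (coord v i)\<^sup>2) - (\<Sum>i\<in>I0. (coord v i)\<^sup>2)"
          using I by (simp add: sum_diff)
        also have "\<dots> \<le> \<eta>\<^sup>2"
          using I0(2)[OF I0(1) order_refl] sum_coord_square_le[OF I(1), of v] by (auto simp: dist_real_def)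
        finally have "sqrt (\<Sum>i\<in>I - I0. (coord v i)\<^sup>2) \<le> \<eta>"
          using \<eta> by (intro real_le_lsqrt) auto
        then have "C * sqrt (\<Sum>i\<in>I - I0. (coord v i)\<^sup>2) \<le> C * \<eta>"
          by (intro mult_left_mono C0)
        moreover have "dist (?S I) (?S I0) = norm (?S (I - I0))"
          using I I0(1) by (simp add: dist_norm sum_diff)
        ultimately show ?thesis
          using C[of "I - I0" "coord v"] I by simp
      qed
      have small: "C * \<eta> < e / 2"
        using e C0 by (simp add: \<eta>_def field_simps add_nonneg_pos)
      have "dist (?S I) (?S J) < e" if "finite I \<and> I0 \<subseteq> I" "finite J \<and> I0 \<subseteq> J" for I J
        using near[of I] near[of J] that small dist_triangle2[of "?S I" "?S J" "?S I0"] by simp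
      moreover have "eventually (\<lambda>I. finite I \<and> I0 \<subseteq> I) (finite_subsets_at_top UNIV)"
        using I0(1) by (auto simp: eventually_finite_subsets_at_top)
      ultimately show ?thesis by blast
    qed
    then have "cauchy_filter (filtermap ?S (finite_subsets_at_top UNIV))"
      by (simp add: cauchy_filter_metric_filtermap)
    moreover have "complete (UNIV :: 'b set)"
      by (meson Cauchy_convergent UNIV_I complete_def convergent_def)
    ultimately obtain L where "(?S \<longlongrightarrow> L) (finite_subsets_at_top UNIV)"
      using complete_uniform[where S="UNIV :: 'b set"] by (force simp add: filterlim_def)
    then show ?thesis
      using summable_on_def has_sum_def by blast
  qed
  show bound: "norm (\<Sum>\<^sub>\<infinity>p. coord v p *\<^sub>R g p) \<le> C * norm v" for v
  proof (rule tendsto_upperbound)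
    show "((\<lambda>J. norm (\<Sum>p\<in>J. coord v p *\<^sub>R g p)) \<longlongrightarrow> norm (\<Sum>\<^sub>\<infinity>p. coord v p *\<^sub>R g p)) (finite_subsets_at_top UNIV)"
      by (intro tendsto_norm infsum_tendsto summable)
    have "norm (\<Sum>p\<in>J. coord v p *\<^sub>R g p) \<le> C * norm v" if "finite J" for J
    proof -
      have "sqrt (\<Sum>p\<in>J. (coord v p)\<^sup>2) \<le> norm v"
        using sum_coord_square_le[OF that, of v] by (intro real_le_lsqrt) auto
      with C[OF that, of "coord v"] mult_left_mono[OF this C0] show ?thesis by linarith
    qed
    then show "eventually (\<lambda>J. norm (\<Sum>p\<in>J. coord v p *\<^sub>R g p) \<le> C * norm v) (finite_subsets_at_top UNIV)"
      by (auto intro: eventually_finite_subsets_at_top_weakI)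
  qed simp
  show "bounded_linear (\<lambda>v. \<Sum>\<^sub>\<infinity>p. coord v p *\<^sub>R g p)"
  proof (rule bounded_linear_intro)
    fix v w :: "'k ell2" and c :: real
    show "(\<Sum>\<^sub>\<infinity>p. coord (v + w) p *\<^sub>R g p) = (\<Sum>\<^sub>\<infinity>p. coord v p *\<^sub>R g p) + (\<Sum>\<^sub>\<infinity>p. coord w p *\<^sub>R g p)"
      by (simp add: scaleR_add_left infsum_add summable)
    show "(\<Sum>\<^sub>\<infinity>p. coord (c *\<^sub>R v) p *\<^sub>R g p) = c *\<^sub>R (\<Sum>\<^sub>\<infinity>p. coord v p *\<^sub>R g p)"
      by (simp add: infsum_scaleR_right flip: scaleR_scaleR)
    show "norm (\<Sum>\<^sub>\<infinity>p. coord v p *\<^sub>R g p) \<le> norm v * C"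
      using bound by (simp add: mult.commute)
  qed
qed

text \<open>The representing vector has the coordinates \<open>\<phi> (basis p)\<close>. Testing
  \<phi> on the finite combination with these very coefficients bounds their sum of squares by the
  square of the norm bound.\<close>

lemma ell2_riesz:
  fixes \<phi> :: "'k ell2 \<Rightarrow> real"
  assumes "bounded_linear \<phi>"
  shows "\<exists>w. \<forall>v. \<phi> v = inner w v"
proof -
  interpret bounded_linear \<phi> by fact
  obtain K where K: "K \<ge> 0" "\<And>v. \<bar>\<phi> v\<bar> \<le> K * norm v"
    using nonneg_bounded by (auto simp: mult.commute)
  have "(\<Sum>p\<in>J. (\<phi> (basis p))\<^sup>2) \<le> K\<^sup>2" if J: "finite J" for J
  proof -
    let ?s = "\<Sum>p\<in>J. (\<phi> (basis p))\<^sup>2" and ?v = "\<Sum>p\<in>J. \<phi> (basis p) *\<^sub>R basis p"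
    have s0: "?s \<ge> 0" by (intro sum_nonneg) auto
    have nv: "norm ?v = sqrt ?s"
      using norm_fin_comb[OF J, of "\<lambda>p. \<phi> (basis p)"] by (metis norm_ge_zero real_sqrt_unique)
    have "\<phi> ?v = ?s" by (simp add: sum scaleR power2_eq_square)
    with K(2)[of ?v] have "?s \<le> K * sqrt ?s" unfolding nv by simp
    then have "sqrt ?s * sqrt ?s \<le> K * sqrt ?s" using s0 by simp
    moreover have "sqrt ?s \<ge> 0" using s0 by simp
    ultimately have "sqrt ?s \<le> K"
      using K(1) by (cases "sqrt ?s = 0") (linarith, metis less_eq_real_def mult_right_le_imp_le)
    then show ?thesis using s0 by (metis real_sqrt_ge_zero real_sqrt_pow2 power_mono)
  qed
  then have c: "coord (Abs_ell2 (\<lambda>p. \<phi> (basis p))) = (\<lambda>p. \<phi> (basis p))"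
    by (intro coord_Abs_ell2 square_summableI)
  have "\<phi> v = inner (Abs_ell2 (\<lambda>p. \<phi> (basis p))) v" for v
    by (rule bounded_linear_eq_on_basis)
      (auto simp: c inner_commute intro: assms bounded_linear_inner_right)
  then show ?thesis by blast
qed

section \<open>Adjoint operators\<close>

definition adj :: "('k ell2 \<Rightarrow> 'k ell2) \<Rightarrow> 'k ell2 \<Rightarrow> 'k ell2" where
  "adj T w = (SOME u. \<forall>v. inner (T v) w = inner u v)"

lemma adj:
  assumes "bounded_linear T"
  shows "inner (T v) w = inner v (adj T w)"
proof -
  have "\<exists>u. \<forall>v. inner (T v) w = inner u v"
    by (intro ell2_riesz bounded_linear_compose[OF bounded_linear_inner_left assms])
  then have "\<forall>v. inner (T v) w = inner (adj T w) v"
    unfolding adj_def by (rule someI_ex)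
  then show ?thesis by (simp add: inner_commute)
qed

lemma adj_norm_le:
  assumes T: "bounded_linear T" and K: "\<And>v. norm (T v) \<le> K * norm v"
  shows "norm (adj T w) \<le> K * norm w"
proof (cases "adj T w = 0")
  case True
  have "0 \<le> K" using order_trans[OF norm_ge_zero K[of "basis undefined"]] by simp
  with True show ?thesis by simp
next
  case False
  have "norm (adj T w) * norm (adj T w) = inner (T (adj T w)) w"
    by (simp add: adj[OF T] norm_eq_sqrt_inner)
  also have "\<dots> \<le> norm (T (adj T w)) * norm w"
    by (rule norm_cauchy_schwarz)
  also have "\<dots> \<le> K * norm (adj T w) * norm w"
    by (intro mult_right_mono K) simp
  finally show ?thesis using False by (simp add: mult_ac)
qed

lemma bounded_linear_adj:
  assumes "bounded_linear T"
  shows "bounded_linear (adj T)"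
proof -
  obtain K where K: "\<And>v. norm (T v) \<le> norm v * K"
    using bounded_linear.bounded[OF assms] by blast
  have eqI: "u = u'" if "\<And>v. inner v u = inner v u'" for u u' :: "'a ell2"
    using that vector_eq_ldot by blast
  show ?thesis
  proof (rule bounded_linear_intro)
    show "norm (adj T w) \<le> norm w * K" for w
      using adj_norm_le[OF assms, of K] K by (simp add: mult.commute)
    show "adj T (u + w) = adj T u + adj T w" for u w
      by (rule eqI) (simp add: adj[OF assms, symmetric] inner_add_right)
    show "adj T (r *\<^sub>R w) = r *\<^sub>R adj T w" for r w
      by (rule eqI) (simp add: adj[OF assms, symmetric])
  qed
qed

lemma coord_adj: "bounded_linear T \<Longrightarrow> coord (adj T (basis q)) p = coord (T (basis p)) q"
  using adj[of T "basis p" "basis q"] by simp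

text \<open>Every level is treated as a coordinate subspace of the single Hilbert space
  \<open>'k ell2\<close>. An operator between two levels is then an endomorphism of that space, cut
  down by \<open>supp_in\<close> on the target and by \<open>proj\<close> on the source.\<close>

definition supp_in :: "'k set \<Rightarrow> 'k ell2 \<Rightarrow> bool" where
  "supp_in N v \<longleftrightarrow> (\<forall>p. p \<notin> N \<longrightarrow> coord v p = 0)"

definition proj :: "'k set \<Rightarrow> 'k ell2 \<Rightarrow> 'k ell2" where
  "proj N v = Abs_ell2 (\<lambda>p. if p \<in> N then coord v p else 0)"

lemma coord_proj [simp]: "coord (proj N v) = (\<lambda>p. if p \<in> N then coord v p else 0)"
  unfolding proj_def
proof (intro coord_Abs_ell2 square_summableI)
  fix J :: "'a set" assume "finite J"
  have "(\<Sum>p\<in>J. (if p \<in> N then coord v p else 0)\<^sup>2) \<le> (\<Sum>p\<in>J. (coord v p)\<^sup>2)"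
    by (intro sum_mono) auto
  then show "(\<Sum>p\<in>J. (if p \<in> N then coord v p else 0)\<^sup>2) \<le> (norm v)\<^sup>2"
    using sum_coord_square_le[OF \<open>finite J\<close>, of v] by linarith
qed

lemma supp_in_proj [simp]: "supp_in N (proj N v)"
  by (simp add: supp_in_def)

lemma proj_id: "supp_in N v \<Longrightarrow> proj N v = v"
  by (intro ell2_eqI) (auto simp: supp_in_def)

lemma proj_basis: "proj N (basis p) = (if p \<in> N then basis p else 0)"
  by (intro ell2_eqI) auto

lemma norm_proj_le: "norm (proj N v) \<le> norm v"
proof (rule norm_ell2_leI)
  fix J :: "'a set" assume "finite J"
  have "(\<Sum>p\<in>J. (coord (proj N v) p)\<^sup>2) \<le> (\<Sum>p\<in>J. (coord v p)\<^sup>2)"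
    by (intro sum_mono) auto
  then show "(\<Sum>p\<in>J. (coord (proj N v) p)\<^sup>2) \<le> (norm v)\<^sup>2"
    using sum_coord_square_le[OF \<open>finite J\<close>, of v] by linarith
qed simp

lemma bounded_linear_proj: "bounded_linear (proj N)"
  by (rule bounded_linear_intro[where K=1]) (auto intro!: ell2_eqI simp: norm_proj_le)

lemma inner_proj: "inner (proj N v) w = inner v (proj N w)"
  unfolding inner_ell2_def by (intro infsum_cong) auto

lemma proj_proj [simp]: "proj N (proj N v) = proj N v"
  by (simp add: proj_id)

lemma supp_in_add: "supp_in N v \<Longrightarrow> supp_in N w \<Longrightarrow> supp_in N (v + w)"
  and supp_in_diff: "supp_in N v \<Longrightarrow> supp_in N w \<Longrightarrow> supp_in N (v - w)"
  and supp_in_scaleR: "supp_in N v \<Longrightarrow> supp_in N (c *\<^sub>R v)"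
  and supp_in_zero: "supp_in N 0"
  by (auto simp: supp_in_def)

section \<open>Matrices as operators\<close>

lemma l2_coord: "supp_in N u \<Longrightarrow> coord u \<in> l2 N"
  by (auto simp: l2_def supp_in_def coord_square_summable)

lemma l2_obtain:
  assumes "v \<in> l2 N"
  obtains u where "supp_in N u" "v = coord u"
proof
  have "(\<lambda>i. (v i)\<^sup>2) summable_on UNIV \<longleftrightarrow> (\<lambda>i. (v i)\<^sup>2) summable_on N"
    using assms by (intro summable_on_cong_neutral) (auto simp: l2_def)
  then have "coord (Abs_ell2 v) = v"
    using assms by (intro coord_Abs_ell2) (simp add: l2_def)
  then show "supp_in N (Abs_ell2 v)" "v = coord (Abs_ell2 v)"
    using assms by (auto simp: l2_def supp_in_def)
qed

lemma l2norm_coord: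
  assumes "supp_in N u"
  shows "l2norm N (coord u) = norm u"
  unfolding l2norm_def norm_ell2_def using assms
  by (intro arg_cong[where f=sqrt] infsum_cong_neutral) (auto simp: supp_in_def)

text \<open>Columns outside \<open>M\<close> are zero by the convention of
  \<open>bounded_mats\<close>. For operators that factor through \<open>proj M\<close> nothing is
  cut off.\<close>

definition mat :: "'k set \<Rightarrow> ('k ell2 \<Rightarrow> 'k ell2) \<Rightarrow> 'k \<Rightarrow> 'k \<Rightarrow> real" where
  "mat M T = (\<lambda>p q. if q \<in> M then coord (T (basis q)) p else 0)"

lemma bounded_linear_coord:
  assumes "bounded_linear T"
  shows "bounded_linear (\<lambda>v. coord (T v) p)"
  using bounded_linear_compose[OF bounded_linear_inner_left assms, of "basis p"] by simp

lemma mvec_mat: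
  assumes "bounded_linear T"
  shows "mvec M (mat M T) (coord v) = coord (T (proj M v))"
proof
  fix p
  have "((\<lambda>q. coord v q *\<^sub>R coord (T (proj M (basis q))) p) has_sum coord (T (proj M v)) p) UNIV"
    by (rule bounded_linear_has_sum_basis[OF bounded_linear_coord[OF
            bounded_linear_compose[OF assms bounded_linear_proj]]])
  moreover have "((\<lambda>q. coord v q *\<^sub>R coord (T (proj M (basis q))) p) has_sum coord (T (proj M v)) p) UNIV
      \<longleftrightarrow> ((\<lambda>q. mat M T p q * coord v q) has_sum coord (T (proj M v)) p) M"
    by (intro has_sum_cong_neutral)
      (auto simp: proj_basis mat_def linear_0[OF bounded_linear.linear[OF assms]] mult.commute)
  ultimately show "mvec M (mat M T) (coord v) p = coord (T (proj M v)) p"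
    unfolding mvec_def by (intro infsumI) blast
qed

lemma mat_bounded_mats:
  assumes "bounded_linear T" "\<And>v. supp_in N (T v)"
  shows "mat M T \<in> bounded_mats N M"
proof -
  obtain C where C: "\<And>v. norm (T v) \<le> norm v * C"
    using bounded_linear.bounded[OF assms(1)] by blast
  have "mvec M (mat M T) v \<in> l2 N \<and> l2norm N (mvec M (mat M T) v) \<le> C * l2norm M v"
    if v: "v \<in> l2 M" for v
  proof -
    obtain u where u: "supp_in M u" "v = coord u" by (rule l2_obtain[OF v])
    show ?thesis
      using C[of u] assms(2) u(1)
      by (simp add: u(2) mvec_mat assms(1) proj_id l2_coord l2norm_coord mult.commute)
  qed
  moreover have "mat M T i j = 0" if "i \<notin> N \<or> j \<notin> M" for i j
    using that assms(2) by (auto simp: mat_def supp_in_def)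
  ultimately show ?thesis unfolding bounded_mats_def by blast
qed

lemma opnorm_mat_le:
  assumes "bounded_linear T" "\<And>v. supp_in N (T v)" "\<And>v. norm (T v) \<le> C * norm v" "0 \<le> C"
  shows "opnorm N M (mat M T) \<le> C"
  unfolding opnorm_def
proof (rule cSUP_least)
  have "coord 0 \<in> l2 M" "l2norm M (coord 0) \<le> 1"
    by (simp_all add: l2_coord supp_in_zero l2norm_coord del: coord_zero)
  then show "{v \<in> l2 M. l2norm M v \<le> 1} \<noteq> {}" by blast
next
  fix v assume "v \<in> {v \<in> l2 M. l2norm M v \<le> 1}"
  then have v: "v \<in> l2 M" "l2norm M v \<le> 1" by auto
  obtain u where u: "supp_in M u" "v = coord u" by (rule l2_obtain[OF v(1)])
  have "norm (T u) \<le> C * norm u" by fact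
  also have "\<dots> \<le> C * 1"
    using v(2) u assms(4) by (intro mult_left_mono) (auto simp: l2norm_coord)
  finally show "l2norm N (mvec M (mat M T) v) \<le> C"
    by (simp add: u mvec_mat assms proj_id l2norm_coord)
qed

text \<open>The columns of \<open>a\<close> are the images of unit vectors, hence square-summable,
  and boundedness of \<open>a\<close> on finite combinations of them is what
  \<open>ell2_extension\<close> asks for. The operator is normalized to vanish on the complement of
  \<open>M\<close>.\<close>

lemma bounded_mats_operator:
  assumes a: "a \<in> bounded_mats N M"
  obtains T where "bounded_linear T" "\<And>v. supp_in N (T v)" "\<And>v. T (proj M v) = T v" "a = mat M T"
proof -
  have a0: "a i j = 0" if "i \<notin> N \<or> j \<notin> M" for i j
    using a that by (auto simp: bounded_mats_def)
  obtain C where C: "\<And>v. v \<in> l2 M \<Longrightarrow> mvec M a v \<in> l2 N \<and> l2norm N (mvec M a v) \<le> C * l2norm M v"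
    using a unfolding bounded_mats_def by blast
  define g where "g q = Abs_ell2 (\<lambda>p. a p q)" for q
  have mvec_fin: "mvec M a (coord (\<Sum>q\<in>J. c q *\<^sub>R basis q)) = (\<lambda>p. \<Sum>q\<in>J. c q * a p q)"
    if "finite J" "J \<subseteq> M" for J c
  proof
    fix p
    have "mvec M a (coord (\<Sum>q\<in>J. c q *\<^sub>R basis q)) p
        = (\<Sum>\<^sub>\<infinity>j\<in>J. a p j * coord (\<Sum>q\<in>J. c q *\<^sub>R basis q) j)"
      unfolding mvec_def using that by (intro infsum_cong_neutral)
          (auto simp: coord_sum if_distrib cong: if_cong)
    also have "\<dots> = (\<Sum>q\<in>J. c q * a p q)"
      using that by (simp add: coord_sum if_distrib mult.commute cong: if_cong)
    finally show "mvec M a (coord (\<Sum>q\<in>J. c q *\<^sub>R basis q)) p = (\<Sum>q\<in>J. c q * a p q)" .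
  qed
  have fin_supp: "supp_in M (\<Sum>q\<in>J. c q *\<^sub>R basis q)" if "J \<subseteq> M" for J c
    using that by (auto simp: supp_in_def coord_sum intro!: sum.neutral)
  have coord_g: "coord (g q) = (\<lambda>p. a p q)" for q
  proof (cases "q \<in> M")
    case True
    have "mvec M a (coord (\<Sum>q\<in>{q}. 1 *\<^sub>R basis q)) \<in> l2 N"
      using C[OF l2_coord[OF fin_supp[of "{q}" "\<lambda>_. 1"]]] True by simp
    moreover have "mvec M a (coord (\<Sum>q\<in>{q}. 1 *\<^sub>R basis q)) = (\<lambda>p. a p q)"
      using mvec_fin[of "{q}" "\<lambda>_. 1"] True by simp
    ultimately have "(\<lambda>p. a p q) \<in> l2 N" by simp
    then obtain u where "(\<lambda>p. a p q) = coord u" by (rule l2_obtain)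
    then show ?thesis by (simp add: g_def coord_inverse)
  next
    case False
    then show ?thesis unfolding g_def by (intro coord_Abs_ell2) (simp add: a0)
  qed
  have g0: "g q = 0" if "q \<notin> M" for q
    using that a0 by (intro ell2_eqI) (simp add: coord_g)
  have bound: "norm (\<Sum>p\<in>J. c p *\<^sub>R g p) \<le> \<bar>C\<bar> * sqrt (\<Sum>p\<in>J. (c p)\<^sup>2)" if J: "finite J" for J c
  proof -
    let ?u = "\<Sum>q\<in>J \<inter> M. c q *\<^sub>R basis q"
    have u: "supp_in M ?u" by (intro fin_supp) auto
    have eq: "(\<Sum>p\<in>J. c p *\<^sub>R g p) = (\<Sum>p\<in>J \<inter> M. c p *\<^sub>R g p)"
      using J by (intro sum.mono_neutral_right) (auto simp: g0)
    have "mvec M a (coord ?u) = coord (\<Sum>p\<in>J \<inter> M. c p *\<^sub>R g p)"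
      using J by (subst mvec_fin) (auto simp: coord_sum coord_g)
    moreover have "supp_in N (\<Sum>p\<in>J \<inter> M. c p *\<^sub>R g p)"
      by (auto simp: supp_in_def coord_sum coord_g a0)
    moreover have "norm ?u = sqrt (\<Sum>q\<in>J \<inter> M. (c q)\<^sup>2)"
      using J by (intro real_sqrt_unique[OF norm_fin_comb norm_ge_zero, symmetric]) simp
    ultimately have "norm (\<Sum>p\<in>J. c p *\<^sub>R g p) \<le> C * sqrt (\<Sum>q\<in>J \<inter> M. (c q)\<^sup>2)"
      using C[OF l2_coord[OF u]] by (simp only: l2norm_coord u eq)
    also have "\<dots> \<le> \<bar>C\<bar> * sqrt (\<Sum>q\<in>J. (c q)\<^sup>2)"
      using J by (intro mult_mono real_sqrt_le_mono sum_mono2) (auto intro!: sum_nonneg)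
    finally show ?thesis .
  qed
  define T where "T v = (\<Sum>\<^sub>\<infinity>q. coord v q *\<^sub>R g q)" for v
  have lin: "bounded_linear T"
    unfolding T_def by (rule ell2_extension(2)[OF bound])
  have T_basis: "T (basis q) = g q" for q
  proof -
    have "T (basis q) = (\<Sum>\<^sub>\<infinity>i\<in>{q}. coord (basis q) i *\<^sub>R g i)"
      unfolding T_def by (intro infsum_cong_neutral) auto
    then show ?thesis by simp
  qed
  have supp: "supp_in N (T v)" for v
  proof -
    have "coord (T v) p = 0" if "p \<notin> N" for p
      using bounded_linear_eq_on_basis[OF bounded_linear_coord[OF lin] bounded_linear_zero, of p v] that
      by (simp add: T_basis coord_g a0)
    then show ?thesis by (simp add: supp_in_def)
  qed
  have "T (proj M v) = T v" for v
    using bounded_linear_eq_on_basis[OF bounded_linear_compose[OF lin bounded_linear_proj] lin, of M v]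
    by (auto simp: proj_basis T_basis g0 linear_0[OF bounded_linear.linear[OF lin]])
  moreover have "a = mat M T"
    by (auto simp: mat_def T_basis coord_g a0 fun_eq_iff)
  ultimately show thesis using lin supp that by blast
qed

text \<open>Polarization turns preservation of norms into preservation of inner products, which is
  how the condition that the Gram matrix is the identity gets used.\<close>

lemma isometry_operator:
  assumes a: "a \<in> isometries N M"
  obtains T where "bounded_linear T" "\<And>v. supp_in N (T v)" "\<And>v. T (proj M v) = T v" "a = mat M T"
    "\<And>v. norm (T v) = norm (proj M v)" "\<And>v w. inner (T v) (T w) = inner (proj M v) (proj M w)"
proof -
  obtain T where T: "bounded_linear T" "\<And>v. supp_in N (T v)" "\<And>v. T (proj M v) = T v" "a = mat M T"
    using a by (auto simp: isometries_def elim: bounded_mats_operator)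
  have nT: "norm (T v) = norm (proj M v)" for v
  proof -
    have "l2norm N (mvec M a (coord (proj M v))) = l2norm M (coord (proj M v))"
      using a by (simp add: isometries_def l2_coord del: coord_proj)
    then have "l2norm N (coord (T v)) = norm (proj M v)"
      unfolding T(4) mvec_mat[OF T(1)] proj_proj T(3) by (simp add: l2norm_coord del: coord_proj)
    then show ?thesis by (simp add: l2norm_coord T(2))
  qed
  have "inner (T v) (T w) = inner (proj M v) (proj M w)" for v w
  proof -
    have "T (v + w) = T v + T w" "proj M (v + w) = proj M v + proj M w"
      using T(1) bounded_linear_proj[of M] by (simp_all add: linear_add bounded_linear.linear)
    with nT[of "v + w"] nT[of v] nT[of w] show ?thesis
      by (simp add: dot_norm)
  qed
  with T nT show thesis using that by blast
qed

lemma mat_isometry: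
  assumes "bounded_linear T" "\<And>v. supp_in N (T v)" "\<And>v. supp_in M v \<Longrightarrow> norm (T v) = norm v"
  shows "mat M T \<in> isometries N M"
proof -
  have "l2norm N (mvec M (mat M T) v) = l2norm M v" if v: "v \<in> l2 M" for v
  proof -
    obtain u where u: "supp_in M u" "v = coord u" by (rule l2_obtain[OF v])
    then show ?thesis by (simp add: mvec_mat assms proj_id l2norm_coord)
  qed
  with mat_bounded_mats[OF assms(1,2)] show ?thesis by (simp add: isometries_def)
qed

section \<open>Operator norms of finite matrices\<close>

lemma finite_l2norm: "finite I \<Longrightarrow> l2norm I v = sqrt (\<Sum>i\<in>I. (v i)\<^sup>2)"
  by (simp add: l2norm_def)

lemma finite_mvec: "finite J \<Longrightarrow> mvec J a v = (\<lambda>i. \<Sum>j\<in>J. a i j * v j)"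
  by (simp add: mvec_def)

text \<open>With \<xi> the image of \<open>v\<close> the bilinear form becomes the squared norm of
  that image, and one factor cancels.\<close>

lemma opnorm_finite_leI:
  assumes fin: "finite I" "finite J" and C: "0 \<le> C"
    and le: "\<And>\<xi> \<eta>. (\<Sum>i\<in>I. \<Sum>j\<in>J. \<xi> i * a i j * \<eta> j) \<le> C * sqrt (\<Sum>i\<in>I. (\<xi> i)\<^sup>2) * sqrt (\<Sum>j\<in>J. (\<eta> j)\<^sup>2)"
  shows "opnorm I J a \<le> C"
  unfolding opnorm_def
proof (rule cSUP_least)
  have "(\<lambda>_. 0) \<in> l2 J" "l2norm J (\<lambda>_. 0) \<le> 1"
    by (auto simp: l2_def l2norm_def)
  then show "{v \<in> l2 J. l2norm J v \<le> 1} \<noteq> {}" by blast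
next
  fix v :: "_ \<Rightarrow> real" assume "v \<in> {v \<in> l2 J. l2norm J v \<le> 1}"
  then have v: "sqrt (\<Sum>j\<in>J. (v j)\<^sup>2) \<le> 1" using fin by (simp add: finite_l2norm)
  define \<xi> where "\<xi> i = (\<Sum>j\<in>J. a i j * v j)" for i
  let ?s = "\<Sum>i\<in>I. (\<xi> i)\<^sup>2"
  have s0: "?s \<ge> 0" by (intro sum_nonneg) auto
  have "?s = (\<Sum>i\<in>I. \<Sum>j\<in>J. \<xi> i * a i j * v j)"
    by (simp add: power2_eq_square \<xi>_def sum_distrib_left mult.assoc)
  also have "\<dots> \<le> C * sqrt ?s * sqrt (\<Sum>j\<in>J. (v j)\<^sup>2)" by (rule le)
  also have "\<dots> \<le> C * sqrt ?s * 1"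
    using C v s0 by (intro mult_left_mono) auto
  finally have "sqrt ?s * sqrt ?s \<le> C * sqrt ?s" using s0 by simp
  moreover have "sqrt ?s \<ge> 0" using s0 by simp
  ultimately have "sqrt ?s \<le> C"
    using C by (cases "sqrt ?s = 0") (linarith, metis less_eq_real_def mult_right_le_imp_le)
  then show "l2norm I (mvec J a v) \<le> C"
    using fin by (simp add: finite_l2norm finite_mvec \<xi>_def)
qed

text \<open>A real supremum carries information only over a bounded set; the crude bound by the sum
  of all absolute entries is enough for this.\<close>

lemma opnorm_bdd_above:
  assumes fin: "finite I" "finite J"
  shows "bdd_above ((\<lambda>v. l2norm I (mvec J a v)) ` {v \<in> l2 J. l2norm J v \<le> 1})"
proof (rule bdd_aboveI2)
  fix v :: "_ \<Rightarrow> real" assume "v \<in> {v \<in> l2 J. l2norm J v \<le> 1}"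
  then have v: "(\<Sum>j\<in>J. (v j)\<^sup>2) \<le> 1" using fin by (simp add: finite_l2norm)
  have vj: "\<bar>v j\<bar> \<le> 1" if "j \<in> J" for j
  proof -
    have "(v j)\<^sup>2 \<le> (\<Sum>j\<in>J. (v j)\<^sup>2)" using fin that by (intro member_le_sum) auto
    then show ?thesis using v abs_le_square_iff[of "v j" 1] by simp
  qed
  have "l2norm I (mvec J a v) = L2_set (\<lambda>i. \<Sum>j\<in>J. a i j * v j) I"
    using fin by (simp add: finite_l2norm finite_mvec L2_set_def)
  also have "\<dots> \<le> (\<Sum>i\<in>I. \<bar>\<Sum>j\<in>J. a i j * v j\<bar>)" by (rule L2_set_le_sum_abs)
  also have "\<dots> \<le> (\<Sum>i\<in>I. \<Sum>j\<in>J. \<bar>a i j\<bar>)"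
    using vj by (intro sum_mono order_trans[OF sum_abs]) (simp add: abs_mult mult_left_le)
  finally show "l2norm I (mvec J a v) \<le> (\<Sum>i\<in>I. \<Sum>j\<in>J. \<bar>a i j\<bar>)" .
qed

lemma opnorm_nonneg:
  assumes "finite I" "finite J"
  shows "0 \<le> opnorm I J a"
proof -
  have "(\<lambda>_. 0) \<in> {v \<in> l2 J. l2norm J v \<le> 1}"
    by (auto simp: l2_def l2norm_def)
  then have "l2norm I (mvec J a (\<lambda>_. 0)) \<le> opnorm I J a"
    unfolding opnorm_def by (rule cSUP_upper[OF _ opnorm_bdd_above[OF assms]])
  then show ?thesis by (simp add: l2norm_def mvec_def)
qed

lemma norm_mvec_le_opnorm:
  assumes fin: "finite I" "finite J"
  shows "sqrt (\<Sum>i\<in>I. (\<Sum>j\<in>J. a i j * \<eta> j)\<^sup>2) \<le> opnorm I J a * sqrt (\<Sum>j\<in>J. (\<eta> j)\<^sup>2)"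
proof -
  define s where "s = sqrt (\<Sum>j\<in>J. (\<eta> j)\<^sup>2)"
  show ?thesis
  proof (cases "s = 0")
    case True
    then have "(\<Sum>j\<in>J. (\<eta> j)\<^sup>2) = 0" by (simp add: s_def)
    then have "\<And>j. j \<in> J \<Longrightarrow> \<eta> j = 0" using fin by (simp add: sum_nonneg_eq_0_iff)
    then show ?thesis by simp
  next
    case False
    then have s: "s > 0" by (simp add: s_def less_le sum_nonneg)
    define v where "v j = (if j \<in> J then \<eta> j / s else 0)" for j
    have "(\<Sum>j\<in>J. (v j)\<^sup>2) = (\<Sum>j\<in>J. (\<eta> j)\<^sup>2) / s\<^sup>2"
      by (simp add: v_def power_divide sum_divide_distrib)
    also have "\<dots> = 1" using s by (simp add: s_def sum_nonneg)
    finally have "v \<in> {v \<in> l2 J. l2norm J v \<le> 1}"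
      using fin by (simp add: l2_def finite_l2norm v_def)
    then have "l2norm I (mvec J a v) \<le> opnorm I J a"
      unfolding opnorm_def by (rule cSUP_upper[OF _ opnorm_bdd_above[OF fin]])
    moreover have "l2norm I (mvec J a v) = sqrt (\<Sum>i\<in>I. (\<Sum>j\<in>J. a i j * \<eta> j)\<^sup>2) / s"
    proof -
      have "(\<Sum>j\<in>J. a i j * v j) = (\<Sum>j\<in>J. a i j * \<eta> j) / s" for i
        by (simp add: v_def sum_divide_distrib)
      then have "l2norm I (mvec J a v) = sqrt (\<Sum>i\<in>I. (\<Sum>j\<in>J. a i j * \<eta> j)\<^sup>2 / s\<^sup>2)"
        using fin by (simp add: finite_l2norm finite_mvec power_divide)
      also have "\<dots> = sqrt (\<Sum>i\<in>I. (\<Sum>j\<in>J. a i j * \<eta> j)\<^sup>2) / s"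
        using s by (simp only: sum_divide_distrib[symmetric] real_sqrt_divide real_sqrt_abs)
      finally show ?thesis .
    qed
    ultimately have "sqrt (\<Sum>i\<in>I. (\<Sum>j\<in>J. a i j * \<eta> j)\<^sup>2) \<le> opnorm I J a * s"
      using s by (simp add: pos_divide_le_eq)
    then show ?thesis by (simp only: s_def)
  qed
qed

lemma abs_bilinear_le_opnorm:
  assumes fin: "finite I" "finite J"
  shows "\<bar>\<Sum>i\<in>I. \<Sum>j\<in>J. \<xi> i * a i j * \<eta> j\<bar>
    \<le> opnorm I J a * sqrt (\<Sum>i\<in>I. (\<xi> i)\<^sup>2) * sqrt (\<Sum>j\<in>J. (\<eta> j)\<^sup>2)"
proof -
  have "\<bar>\<Sum>i\<in>I. \<Sum>j\<in>J. \<xi> i * a i j * \<eta> j\<bar> = \<bar>\<Sum>i\<in>I. \<xi> i * (\<Sum>j\<in>J. a i j * \<eta> j)\<bar>"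
    by (simp add: sum_distrib_left mult.assoc)
  also have "\<dots> \<le> (\<Sum>i\<in>I. \<bar>\<xi> i\<bar> * \<bar>\<Sum>j\<in>J. a i j * \<eta> j\<bar>)"
    by (rule order_trans[OF sum_abs]) (simp add: abs_mult)
  also have "\<dots> \<le> sqrt (\<Sum>i\<in>I. (\<xi> i)\<^sup>2) * sqrt (\<Sum>i\<in>I. (\<Sum>j\<in>J. a i j * \<eta> j)\<^sup>2)"
    using L2_set_mult_ineq[of \<xi> "\<lambda>i. \<Sum>j\<in>J. a i j * \<eta> j" I] by (simp add: L2_set_def)
  also have "\<dots> \<le> sqrt (\<Sum>i\<in>I. (\<xi> i)\<^sup>2) * (opnorm I J a * sqrt (\<Sum>j\<in>J. (\<eta> j)\<^sup>2))"
    by (intro mult_left_mono norm_mvec_le_opnorm fin) (simp add: sum_nonneg)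
  finally show ?thesis by (simp add: mult_ac)
qed

section \<open>The bilinear form of an infinite matrix\<close>

text \<open>The vector-valued form \<open>v\<^sup>T x w\<close>, summed in the same iterated order
  as \<open>sandwich\<close>, since the double family need not be summable.\<close>

definition form :: "('k \<Rightarrow> 'k \<Rightarrow> 'b::banach) \<Rightarrow> 'k ell2 \<Rightarrow> 'k ell2 \<Rightarrow> 'b" where
  "form x v w = (\<Sum>\<^sub>\<infinity>i. coord v i *\<^sub>R (\<Sum>\<^sub>\<infinity>j. coord w j *\<^sub>R x i j))"

text \<open>Only finite sums occur, so the condition presupposes no convergence; it in turn makes
  all iterated sums in \<open>form\<close> converge. It bounds \<open>x\<close> as a bilinear form,
  which is weaker than a completely bounded estimate.\<close>

definition bounded_form :: "real \<Rightarrow> ('k \<Rightarrow> 'k \<Rightarrow> 'b::banach) \<Rightarrow> bool" where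
  "bounded_form C x \<longleftrightarrow> 0 \<le> C \<and> (\<forall>I J v w. finite I \<longrightarrow> finite J \<longrightarrow>
     norm (\<Sum>i\<in>I. v i *\<^sub>R (\<Sum>j\<in>J. w j *\<^sub>R x i j)) \<le> C * sqrt (\<Sum>i\<in>I. (v i)\<^sup>2) * sqrt (\<Sum>j\<in>J. (w j)\<^sup>2))"

lemma bounded_formD:
  assumes "bounded_form C x" "finite I" "finite J"
  shows "norm (\<Sum>i\<in>I. v i *\<^sub>R (\<Sum>j\<in>J. w j *\<^sub>R x i j)) \<le> C * sqrt (\<Sum>i\<in>I. (v i)\<^sup>2) * sqrt (\<Sum>j\<in>J. (w j)\<^sup>2)"
  using assms unfolding bounded_form_def by blast

lemma bounded_bilinear_eq_on_basis:
  fixes B B' :: "'k ell2 \<Rightarrow> 'k ell2 \<Rightarrow> 'b::real_normed_vector"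
  assumes "bounded_bilinear B" "bounded_bilinear B'" "\<And>p q. B (basis p) (basis q) = B' (basis p) (basis q)"
  shows "B v w = B' v w"
proof -
  have "B (basis p) w = B' (basis p) w" for p
    by (rule bounded_linear_eq_on_basis[OF bounded_bilinear.bounded_linear_right[OF assms(1)]
          bounded_bilinear.bounded_linear_right[OF assms(2)] assms(3)])
  then show ?thesis
    by (rule bounded_linear_eq_on_basis[OF bounded_bilinear.bounded_linear_left[OF assms(1)]
          bounded_bilinear.bounded_linear_left[OF assms(2)]])
qed

lemma infsum_basis:
  fixes g :: "'k \<Rightarrow> 'b::{banach}"
  shows "(\<Sum>\<^sub>\<infinity>i. coord (basis p) i *\<^sub>R g i) = g p"
proof -
  have "(\<Sum>\<^sub>\<infinity>i. coord (basis p) i *\<^sub>R g i) = (\<Sum>\<^sub>\<infinity>i\<in>{p}. coord (basis p) i *\<^sub>R g i)"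
    by (intro infsum_cong_neutral) auto
  then show ?thesis by simp
qed

lemma form_basis [simp]: "form x (basis p) (basis q) = x p q"
  by (simp only: form_def infsum_basis)

text \<open>\<open>ell2_extension\<close> is applied twice. For a fixed row the inner sum is bounded
  and linear in \<open>w\<close>; a finite combination of rows is of the same kind, and its bound is
  the hypothesis needed for the outer sum.\<close>

lemma
  fixes x :: "'k \<Rightarrow> 'k \<Rightarrow> 'b::banach"
  assumes x: "bounded_form C x"
  shows norm_form_le: "norm (form x v w) \<le> C * norm v * norm w"
    and bounded_bilinear_form: "bounded_bilinear (form x)"
proof -
  define row where "row i w = (\<Sum>\<^sub>\<infinity>j. coord w j *\<^sub>R x i j)" for i w
  have row_bound: "norm (\<Sum>j\<in>J. c j *\<^sub>R x i j) \<le> C * sqrt (\<Sum>j\<in>J. (c j)\<^sup>2)" if "finite J" for i J c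
    using bounded_formD[OF x, of "{i}" J "\<lambda>_. 1" c] that by simp
  have row_lin: "bounded_linear (row i)" for i
    unfolding row_def by (rule ell2_extension(2)[OF row_bound])
  have row_basis: "row i (basis q) = x i q" for i q
    unfolding row_def by (rule infsum_basis)
  have rows: "norm (\<Sum>i\<in>I. v i *\<^sub>R row i w) \<le> C * norm w * sqrt (\<Sum>i\<in>I. (v i)\<^sup>2)"
    if I: "finite I" for I v w
  proof -
    let ?g = "\<lambda>j. \<Sum>i\<in>I. v i *\<^sub>R x i j"
    have g: "norm (\<Sum>j\<in>J. c j *\<^sub>R ?g j) \<le> C * sqrt (\<Sum>i\<in>I. (v i)\<^sup>2) * sqrt (\<Sum>j\<in>J. (c j)\<^sup>2)"
      if "finite J" for J c
    proof -
      have "(\<Sum>j\<in>J. c j *\<^sub>R ?g j) = (\<Sum>j\<in>J. \<Sum>i\<in>I. v i *\<^sub>R c j *\<^sub>R x i j)"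
        by (simp add: scaleR_sum_right mult.commute)
      also have "\<dots> = (\<Sum>i\<in>I. v i *\<^sub>R (\<Sum>j\<in>J. c j *\<^sub>R x i j))"
        by (subst sum.swap) (simp only: scaleR_sum_right)
      finally show ?thesis using bounded_formD[OF x I that] by simp
    qed
    have "(\<Sum>i\<in>I. v i *\<^sub>R row i w) = (\<Sum>\<^sub>\<infinity>j. coord w j *\<^sub>R ?g j)"
      by (rule bounded_linear_eq_on_basis[OF bounded_linear_sum ell2_extension(2)[OF g]])
        (simp_all only: infsum_basis row_basis bounded_linear_compose[OF bounded_linear_scaleR_right row_lin])
    with ell2_extension(3)[OF g, of w] show ?thesis by (simp add: mult_ac)
  qed
  have form_row: "form x v w = (\<Sum>\<^sub>\<infinity>i. coord v i *\<^sub>R row i w)" for v w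
    by (simp only: form_def row_def)
  show bound: "norm (form x v w) \<le> C * norm v * norm w" for v w
    using ell2_extension(3)[OF rows[where w=w], of v] by (simp add: form_row mult_ac)
  have left: "bounded_linear (\<lambda>v. form x v w)" for w
    unfolding form_row by (rule ell2_extension(2)[OF rows])
  have summ: "(\<lambda>i. coord v i *\<^sub>R row i w) summable_on UNIV" for v w
    by (rule ell2_extension(1)[OF rows])
  have add_right: "form x v (w + w') = form x v w + form x v w'" for v w w'
    using row_lin by (simp add: form_row linear_add bounded_linear.linear scaleR_add_right infsum_add summ)
  have scale_right: "form x v (c *\<^sub>R w) = c *\<^sub>R form x v w" for v w c
  proof -
    have "form x v (c *\<^sub>R w) = (\<Sum>\<^sub>\<infinity>i. c *\<^sub>R (coord v i *\<^sub>R row i w))"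
      using row_lin by (simp add: form_row linear_cmul bounded_linear.linear mult.commute)
    then show ?thesis by (simp only: infsum_scaleR_right form_row)
  qed
  show "bounded_bilinear (form x)"
  proof (rule bounded_bilinear.intro)
    show "\<exists>K. \<forall>a b. norm (form x a b) \<le> norm a * norm b * K"
      using bound by (intro exI[of _ C]) (simp add: mult_ac)
    fix v v' w :: "'k ell2" and r :: real
    show "form x (v + v') w = form x v w + form x v' w"
      by (rule linear_add[OF bounded_linear.linear[OF left]])
    show "form x (r *\<^sub>R v) w = r *\<^sub>R form x v w"
      by (rule linear_cmul[OF bounded_linear.linear[OF left]])
  qed (rule add_right, rule scale_right)
qed

text \<open>With \<open>bounded_bilinear_form\<close> this identifies matrices satisfying
  \<open>bounded_form\<close> with bounded bilinear maps. Compressions and finite sums of matrices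
  can then be computed in the vector arguments, without touching entries.\<close>

lemma bounded_form_of_bilinear:
  fixes B :: "'k ell2 \<Rightarrow> 'k ell2 \<Rightarrow> 'b::banach"
  assumes B: "bounded_bilinear B" and C: "\<And>v w. norm (B v w) \<le> C * norm v * norm w" "0 \<le> C"
  shows "bounded_form C (\<lambda>p q. B (basis p) (basis q))"
    and "form (\<lambda>p q. B (basis p) (basis q)) v w = B v w"
proof -
  interpret bounded_bilinear B by fact
  show *: "bounded_form C (\<lambda>p q. B (basis p) (basis q))"
    unfolding bounded_form_def
  proof (intro conjI allI impI C(2))
    fix I J :: "'k set" and v w :: "'k \<Rightarrow> real"
    assume fin: "finite I" "finite J"
    have nrm: "norm (\<Sum>i\<in>I. v i *\<^sub>R basis i) = sqrt (\<Sum>i\<in>I. (v i)\<^sup>2)" if "finite I" for I :: "'k set" and v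
      using that by (intro real_sqrt_unique[OF norm_fin_comb norm_ge_zero, symmetric])
    have "(\<Sum>i\<in>I. v i *\<^sub>R (\<Sum>j\<in>J. w j *\<^sub>R B (basis i) (basis j)))
        = B (\<Sum>i\<in>I. v i *\<^sub>R basis i) (\<Sum>j\<in>J. w j *\<^sub>R basis j)"
      by (simp add: sum_left sum_right scaleR_left scaleR_right scaleR_sum_right)
        (simp add: sum.swap[of _ I J] mult.commute)
    then show "norm (\<Sum>i\<in>I. v i *\<^sub>R (\<Sum>j\<in>J. w j *\<^sub>R B (basis i) (basis j)))
        \<le> C * sqrt (\<Sum>i\<in>I. (v i)\<^sup>2) * sqrt (\<Sum>j\<in>J. (w j)\<^sup>2)"
      using C(1) fin by (simp flip: nrm)
  qed
  show "form (\<lambda>p q. B (basis p) (basis q)) v w = B v w"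
    by (rule bounded_bilinear_eq_on_basis[OF bounded_bilinear_form[OF *] B]) simp
qed

lemma form_compose:
  assumes x: "bounded_form C x" and A: "bounded_linear A" "\<And>v. norm (A v) \<le> norm v"
  shows "bounded_form C (\<lambda>p q. form x (A (basis p)) (A (basis q)))"
    and "form (\<lambda>p q. form x (A (basis p)) (A (basis q))) v w = form x (A v) (A w)"
proof -
  have C0: "0 \<le> C" using x by (simp add: bounded_form_def)
  have B: "bounded_bilinear (\<lambda>v w. form x (A v) (A w))"
    by (rule bounded_bilinear.comp[OF bounded_bilinear_form[OF x] A(1) A(1)])
  have le: "norm (form x (A v) (A w)) \<le> C * norm v * norm w" for v w
    by (rule order_trans[OF norm_form_le[OF x]]) (intro mult_mono A C0 mult_nonneg_nonneg; simp)
  show "bounded_form C (\<lambda>p q. form x (A (basis p)) (A (basis q)))"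
    "form (\<lambda>p q. form x (A (basis p)) (A (basis q))) v w = form x (A v) (A w)"
    using bounded_form_of_bilinear[OF B le C0] by simp_all
qed

text \<open>The outer factors are given by their columns regarded as vectors. As \<open>x\<close>
  vanishes outside \<open>N\<close>, sums over \<open>N\<close> and over the whole index type
  agree.\<close>

lemma sandwich_form:
  assumes "\<And>p q. p \<notin> N \<or> q \<notin> N \<Longrightarrow> x p q = 0"
  shows "sandwich N (\<lambda>p i. coord (f p) i) x (\<lambda>j q. coord (g q) j) p q = form x (f p) (g q)"
proof -
  have "(\<Sum>\<^sub>\<infinity>j\<in>N. coord (g q) j *\<^sub>R x i j) = (\<Sum>\<^sub>\<infinity>j. coord (g q) j *\<^sub>R x i j)" for i
    using assms by (intro infsum_cong_neutral) auto
  then show ?thesis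
    unfolding sandwich_def lmul_def rmul_def form_def
    using assms by (intro infsum_cong_neutral) auto
qed

lemma lmul_inner: "lmul N (\<lambda>p i. coord (f p) i) (\<lambda>i q. coord (g q) i) p q = inner (proj N (f p)) (g q)"
  unfolding lmul_def inner_ell2_def by (intro infsum_cong_neutral) auto

lemma mat_columns:
  assumes "\<And>v. T (proj M v) = T v" "bounded_linear T"
  shows "mat M T = (\<lambda>p q. coord (T (basis q)) p)"
proof -
  have "T (basis q) = 0" if "q \<notin> M" for q
    using assms(1)[of "basis q"] that by (simp add: proj_basis linear_0[OF bounded_linear.linear[OF assms(2)]])
  then show ?thesis by (auto simp: mat_def fun_eq_iff)
qed

lemma proj_tendsto: "((\<lambda>J. proj J v) \<longlongrightarrow> v) (finite_subsets_at_top UNIV)"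
proof -
  have "(\<Sum>p\<in>J. coord v p *\<^sub>R basis p) = proj J v" if "finite J" for J
    using that by (intro ell2_eqI) (simp add: coord_sum if_distrib cong: if_cong)
  then have "eventually (\<lambda>J. (\<Sum>p\<in>J. coord v p *\<^sub>R basis p) = proj J v) (finite_subsets_at_top UNIV)"
    by (intro eventually_finite_subsets_at_top_weakI)
  then show ?thesis
    by (rule Lim_transform_eventually[OF basis_has_sum[of v, unfolded has_sum_def]])
qed

section \<open>Matrix norms and weak* topologies\<close>

text \<open>The consequence of Ruan's axioms that governs convergence: the effect of multiplying by
  a row and a column. It is isolated so that scalar matrices and matrices over an operator space
  share the lemmas on forms and on weak* limits.\<close>

definition ruan_bound :: "'b::real_normed_vector mat_norms \<Rightarrow> bool" where
  "ruan_bound mn \<longleftrightarrow> (\<forall>m x. 0 \<le> mn m x) \<and> (\<forall>m x a b. norm (\<Sum>i<m. a i *\<^sub>R (\<Sum>j<m. b j *\<^sub>R x i j))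
      \<le> mn m x * sqrt (\<Sum>i<m. (a i)\<^sup>2) * sqrt (\<Sum>j<m. (b j)\<^sup>2))"

lemma ruan_boundD:
  assumes "ruan_bound mn"
  shows "0 \<le> mn m x"
    and "norm (\<Sum>i<m. a i *\<^sub>R (\<Sum>j<m. b j *\<^sub>R x i j))
      \<le> mn m x * sqrt (\<Sum>i<m. (a i)\<^sup>2) * sqrt (\<Sum>j<m. (b j)\<^sup>2)"
  using assms by (auto simp: ruan_bound_def)

lemma ruan_bound_real_mn: "ruan_bound real_mn"
  unfolding ruan_bound_def real_mn_def
proof (intro conjI allI)
  fix m and x :: "nat \<Rightarrow> nat \<Rightarrow> real" and a b :: "nat \<Rightarrow> real"
  show "norm (\<Sum>i<m. a i *\<^sub>R (\<Sum>j<m. b j *\<^sub>R x i j))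
      \<le> opnorm {..<m} {..<m} x * sqrt (\<Sum>i<m. (a i)\<^sup>2) * sqrt (\<Sum>j<m. (b j)\<^sup>2)"
    using abs_bilinear_le_opnorm[of "{..<m}" "{..<m}" a x b] by (simp add: sum_distrib_left mult_ac)
qed (simp add: opnorm_nonneg)

text \<open>Multiplication by the row \<open>a\<close> and the column \<open>b\<close> compresses
  \<open>x\<close> to a 1 by 1 matrix, whose norm is that of its entry; by Cauchy-Schwarz the row
  and the column have operator norm at most their Euclidean norms.\<close>

lemma real_operator_space_ruan_bound:
  fixes mn :: "'b::real_normed_vector mat_norms"
  assumes mn: "real_operator_space mn"
  shows "ruan_bound mn"
  unfolding ruan_bound_def
proof (intro conjI allI)
  show nonneg: "0 \<le> mn m x" for m x using mn by (simp add: real_operator_space_def)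
  fix m and x :: "nat \<Rightarrow> nat \<Rightarrow> 'b" and a b :: "nat \<Rightarrow> real"
  let ?s = "sandwich {..<m} (\<lambda>(p::nat) i. a i) x (\<lambda>j (q::nat). b j)"
  have a: "opnorm {..<1} {..<m} (\<lambda>(p::nat) i. a i) \<le> sqrt (\<Sum>i<m. (a i)\<^sup>2)" for a :: "nat \<Rightarrow> real"
  proof (rule opnorm_finite_leI)
    fix \<xi> \<eta> :: "nat \<Rightarrow> real"
    have "(\<Sum>i<1. \<Sum>j<m. \<xi> i * a j * \<eta> j) = \<xi> 0 * (\<Sum>j<m. a j * \<eta> j)"
      by (simp add: sum_distrib_left mult.assoc)
    also have "\<dots> \<le> \<bar>\<xi> 0\<bar> * (\<Sum>j<m. \<bar>a j\<bar> * \<bar>\<eta> j\<bar>)"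
      by (rule order_trans[OF abs_ge_self]) (auto simp: abs_mult intro!: mult_left_mono order_trans[OF sum_abs])
    also have "\<dots> \<le> \<bar>\<xi> 0\<bar> * (sqrt (\<Sum>i<m. (a i)\<^sup>2) * sqrt (\<Sum>i<m. (\<eta> i)\<^sup>2))"
      using L2_set_mult_ineq[of a \<eta> "{..<m}"] by (intro mult_left_mono) (auto simp: L2_set_def)
    finally show "(\<Sum>i<1. \<Sum>j<m. \<xi> i * a j * \<eta> j)
        \<le> sqrt (\<Sum>i<m. (a i)\<^sup>2) * sqrt (\<Sum>i<1. (\<xi> i)\<^sup>2) * sqrt (\<Sum>j<m. (\<eta> j)\<^sup>2)"
      by (simp add: mult_ac)
  qed (auto simp: sum_nonneg)
  have b: "opnorm {..<m} {..<1} (\<lambda>j (q::nat). b j) \<le> sqrt (\<Sum>j<m. (b j)\<^sup>2)"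
  proof (rule opnorm_finite_leI)
    fix \<xi> \<eta> :: "nat \<Rightarrow> real"
    have "(\<Sum>i<m. \<Sum>j<1. \<xi> i * b i * \<eta> j) = \<eta> 0 * (\<Sum>j<m. b j * \<xi> j)"
      by (simp add: sum_distrib_left mult_ac)
    also have "\<dots> \<le> \<bar>\<eta> 0\<bar> * (\<Sum>j<m. \<bar>b j\<bar> * \<bar>\<xi> j\<bar>)"
      by (rule order_trans[OF abs_ge_self]) (auto simp: abs_mult intro!: mult_left_mono order_trans[OF sum_abs])
    also have "\<dots> \<le> \<bar>\<eta> 0\<bar> * (sqrt (\<Sum>i<m. (b i)\<^sup>2) * sqrt (\<Sum>i<m. (\<xi> i)\<^sup>2))"
      using L2_set_mult_ineq[of b \<xi> "{..<m}"] by (intro mult_left_mono) (auto simp: L2_set_def)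
    finally show "(\<Sum>i<m. \<Sum>j<1. \<xi> i * b i * \<eta> j)
        \<le> sqrt (\<Sum>i<m. (b i)\<^sup>2) * sqrt (\<Sum>i<m. (\<xi> i)\<^sup>2) * sqrt (\<Sum>j<1. (\<eta> j)\<^sup>2)"
      by (simp add: mult_ac)
  qed (auto simp: sum_nonneg)
  have "norm (\<Sum>i<m. a i *\<^sub>R (\<Sum>j<m. b j *\<^sub>R x i j)) = mn 1 ?s"
  proof -
    have "mn 1 y = norm (y 0 0)" for y using mn by (simp add: real_operator_space_def)
    then show ?thesis by (simp add: sandwich_def lmul_def rmul_def)
  qed
  also have "\<dots> \<le> opnorm {..<1} {..<m} (\<lambda>(p::nat) i. a i) * mn m x * opnorm {..<m} {..<1} (\<lambda>j (q::nat). b j)"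
    using mn unfolding real_operator_space_def by blast
  also have "\<dots> \<le> sqrt (\<Sum>i<m. (a i)\<^sup>2) * mn m x * sqrt (\<Sum>j<m. (b j)\<^sup>2)"
    by (intro mult_mono a b nonneg opnorm_nonneg mult_nonneg_nonneg) (auto simp: sum_nonneg)
  finally show "norm (\<Sum>i<m. a i *\<^sub>R (\<Sum>j<m. b j *\<^sub>R x i j))
      \<le> mn m x * sqrt (\<Sum>i<m. (a i)\<^sup>2) * sqrt (\<Sum>j<m. (b j)\<^sup>2)" by (simp add: mult_ac)
qed

section \<open>Infinite matrices over an operator space as bounded forms\<close>

lemma Mn_zero: "x \<in> Mn mn N \<Longrightarrow> p \<notin> N \<or> q \<notin> N \<Longrightarrow> x p q = 0"
  by (auto simp: Mn_def)

lemma submat_norm_le: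
  assumes "x \<in> Mn mn N" "inj_on \<sigma> {..<m}" "\<sigma> ` {..<m} \<subseteq> N"
  shows "mn m (\<lambda>i j. x (\<sigma> i) (\<sigma> j)) \<le> Mn_norm mn N x"
  unfolding Mn_norm_def using assms by (intro cSup_upper) (auto simp: Mn_def submat_norms_def)

lemma finite_enumeration:
  assumes "finite S"
  obtains \<sigma> :: "nat \<Rightarrow> 'k" and m where "inj_on \<sigma> {..<m}" "\<sigma> ` {..<m} = S"
  using ex_bij_betw_nat_finite[OF assms] by (auto simp: bij_betw_def atLeast0LessThan)

lemma Mn_norm_nonneg:
  assumes "ruan_bound mn" "x \<in> Mn mn N"
  shows "0 \<le> Mn_norm mn N x"
proof -
  have "0 \<le> mn 0 (\<lambda>i j. x undefined undefined)" using assms(1) by (simp add: ruan_bound_def)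
  also have "\<dots> \<le> Mn_norm mn N x"
    using submat_norm_le[OF assms(2), of "\<lambda>_. undefined" 0] by simp
  finally show ?thesis .
qed

text \<open>Matrix norms are given for square blocks only, so the finitely many rows and columns are
  put into one block indexed by \<open>(I \<union> J) \<inter> N\<close>, with the coefficient
  vectors extended by zero.\<close>

lemma Mn_bounded_form:
  fixes mn :: "'b::banach mat_norms"
  assumes mn: "ruan_bound mn" and x: "x \<in> Mn mn N"
  shows "bounded_form (Mn_norm mn N x) x"
  unfolding bounded_form_def
proof (intro conjI allI impI Mn_norm_nonneg[OF mn x])
  fix I J :: "'a set" and v w :: "'a \<Rightarrow> real"
  assume fin: "finite I" "finite J"
  define S where "S = (I \<union> J) \<inter> N"
  have "finite S" using fin by (simp add: S_def)
  then obtain \<sigma> :: "nat \<Rightarrow> 'a" and m where \<sigma>: "inj_on \<sigma> {..<m}" "\<sigma> ` {..<m} = S"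
    by (rule finite_enumeration)
  define a where "a p = (if p \<in> I then v p else 0)" for p
  define b where "b p = (if p \<in> J then w p else 0)" for p
  have re: "(\<Sum>p\<in>S. h p) = (\<Sum>i<m. h (\<sigma> i))" for h :: "'a \<Rightarrow> 'c::comm_monoid_add"
    using sum.reindex[OF \<sigma>(1)] by (simp flip: \<sigma>(2))
  have inner_eq: "(\<Sum>j\<in>J. w j *\<^sub>R x i j) = (\<Sum>j\<in>S. b j *\<^sub>R x i j)" for i
    using fin by (intro sum.mono_neutral_cong) (auto simp: S_def b_def Mn_zero[OF x])
  have "(\<Sum>i\<in>I. v i *\<^sub>R (\<Sum>j\<in>J. w j *\<^sub>R x i j)) = (\<Sum>i\<in>S. a i *\<^sub>R (\<Sum>j\<in>S. b j *\<^sub>R x i j))"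
    unfolding inner_eq using fin
    by (intro sum.mono_neutral_cong) (auto simp: S_def a_def Mn_zero[OF x] intro!: sum.neutral)
  also have "\<dots> = (\<Sum>i<m. a (\<sigma> i) *\<^sub>R (\<Sum>j<m. b (\<sigma> j) *\<^sub>R x (\<sigma> i) (\<sigma> j)))"
    by (simp add: re)
  finally have eq: "(\<Sum>i\<in>I. v i *\<^sub>R (\<Sum>j\<in>J. w j *\<^sub>R x i j)) = \<dots>" .
  have "norm (\<Sum>i\<in>I. v i *\<^sub>R (\<Sum>j\<in>J. w j *\<^sub>R x i j))
      \<le> mn m (\<lambda>i j. x (\<sigma> i) (\<sigma> j)) * sqrt (\<Sum>i<m. (a (\<sigma> i))\<^sup>2) * sqrt (\<Sum>j<m. (b (\<sigma> j))\<^sup>2)"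
    unfolding eq by (rule ruan_boundD(2)[OF mn, where a = "\<lambda>i. a (\<sigma> i)" and b = "\<lambda>j. b (\<sigma> j)"])
  also have "\<dots> = mn m (\<lambda>i j. x (\<sigma> i) (\<sigma> j)) * sqrt (\<Sum>p\<in>S. (a p)\<^sup>2) * sqrt (\<Sum>p\<in>S. (b p)\<^sup>2)"
    by (simp add: re)
  also have "\<dots> \<le> Mn_norm mn N x * sqrt (\<Sum>i\<in>I. (v i)\<^sup>2) * sqrt (\<Sum>j\<in>J. (w j)\<^sup>2)"
  proof (intro mult_mono real_sqrt_le_mono submat_norm_le[OF x] \<sigma>)
    have "(\<Sum>p\<in>S. (a p)\<^sup>2) = (\<Sum>p\<in>S \<inter> I. (v p)\<^sup>2)"
      using fin by (intro sum.mono_neutral_cong) (auto simp: S_def a_def)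
    also have "\<dots> \<le> (\<Sum>i\<in>I. (v i)\<^sup>2)" using fin by (intro sum_mono2) auto
    finally show "(\<Sum>p\<in>S. (a p)\<^sup>2) \<le> (\<Sum>i\<in>I. (v i)\<^sup>2)" .
    have "(\<Sum>p\<in>S. (b p)\<^sup>2) = (\<Sum>p\<in>S \<inter> J. (w p)\<^sup>2)"
      using fin by (intro sum.mono_neutral_cong) (auto simp: S_def b_def)
    also have "\<dots> \<le> (\<Sum>i\<in>J. (w i)\<^sup>2)" using fin by (intro sum_mono2) auto
    finally show "(\<Sum>p\<in>S. (b p)\<^sup>2) \<le> (\<Sum>i\<in>J. (w i)\<^sup>2)" .
    show "\<sigma> ` {..<m} \<subseteq> N" by (auto simp: \<sigma> S_def)
  qed (auto simp: Mn_norm_nonneg[OF mn x] sum_nonneg intro!: mult_nonneg_nonneg)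
  finally show "norm (\<Sum>i\<in>I. v i *\<^sub>R (\<Sum>j\<in>J. w j *\<^sub>R x i j))
      \<le> Mn_norm mn N x * sqrt (\<Sum>i\<in>I. (v i)\<^sup>2) * sqrt (\<Sum>j\<in>J. (w j)\<^sup>2)" .
qed

text \<open>Truncating both vectors to a finite set \<open>J\<close> leaves finitely many entries.
  The error is the norm of \<open>x\<close> times a quantity that depends on \<open>v\<close>,
  \<open>w\<close> and \<open>J\<close> but not on \<open>x\<close>, which is the uniformity that
  the predual requires.\<close>

lemma predual_functional_form:
  fixes mn :: "'b::banach mat_norms" and pr :: "'b \<Rightarrow> 'f::real_normed_vector \<Rightarrow> real"
  assumes mn: "ruan_bound mn" and pr: "bounded_bilinear pr"
  shows "predual_functional mn pr N (\<lambda>x. pr (form x v w) f)"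
  unfolding predual_functional_def
proof (intro allI impI)
  fix \<epsilon> :: real assume \<epsilon>: "\<epsilon> > 0"
  interpret pr: bounded_bilinear pr by fact
  obtain K where K: "K > 0" "\<And>e f. norm (pr e f) \<le> norm e * norm f * K"
    using pr.pos_bounded by blast
  define \<tau> where "\<tau> J = norm (v - proj J v) * norm w + norm (proj J v) * norm (w - proj J w)" for J
  have "((\<lambda>J. \<tau> J * norm f * K) \<longlongrightarrow> (norm (v - v) * norm w + norm v * norm (w - w)) * norm f * K)
      (finite_subsets_at_top UNIV)"
    unfolding \<tau>_def by (intro tendsto_intros proj_tendsto)
  then have "((\<lambda>J. \<tau> J * norm f * K) \<longlongrightarrow> 0) (finite_subsets_at_top UNIV)" by simp
  then have "eventually (\<lambda>J. \<tau> J * norm f * K < \<epsilon>) (finite_subsets_at_top UNIV)"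
    using \<epsilon> by (rule order_tendstoD)
  then obtain J where J: "finite J" "\<tau> J * norm f * K < \<epsilon>"
    by (auto simp: eventually_finite_subsets_at_top)
  define S where "S = (J \<times> J) \<inter> (N \<times> N)"
  define h where "h p q = (coord v p * coord w q) *\<^sub>R f" for p q
  have "\<bar>pr (form x v w) f - (\<Sum>(p, q)\<in>S. pr (x p q) (h p q))\<bar> \<le> \<epsilon> * Mn_norm mn N x"
    if x: "x \<in> Mn mn N" for x
  proof -
    have bf: "bounded_form (Mn_norm mn N x) x" by (rule Mn_bounded_form[OF mn x])
    interpret bx: bounded_bilinear "form x" by (rule bounded_bilinear_form[OF bf])
    have projJ: "proj J u = (\<Sum>p\<in>J. coord u p *\<^sub>R basis p)" for u
      using J(1) by (intro ell2_eqI) (simp add: coord_sum if_distrib cong: if_cong)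
    have "(\<Sum>(p, q)\<in>S. pr (x p q) (h p q)) = (\<Sum>(p, q)\<in>J \<times> J. pr (x p q) (h p q))"
    proof (intro sum.mono_neutral_left ballI)
      fix z assume "z \<in> J \<times> J - S"
      then obtain p q where "z = (p, q)" "p \<notin> N \<or> q \<notin> N" by (auto simp: S_def)
      then show "(case z of (p, q) \<Rightarrow> pr (x p q) (h p q)) = 0"
        using Mn_zero[OF x] by (simp add: pr.zero_left)
    qed (use J(1) in \<open>auto simp: S_def\<close>)
    also have "\<dots> = (\<Sum>p\<in>J. \<Sum>q\<in>J. pr (x p q) (h p q))"
      by (simp add: sum.cartesian_product)
    also have "\<dots> = pr (form x (proj J v) (proj J w)) f"
    proof -
      have "form x (proj J v) (proj J w) = (\<Sum>p\<in>J. form x (coord v p *\<^sub>R basis p) (proj J w))"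
        by (simp only: projJ[of v] bx.sum_left)
      also have "\<dots> = (\<Sum>p\<in>J. \<Sum>q\<in>J. form x (coord v p *\<^sub>R basis p) (coord w q *\<^sub>R basis q))"
        by (simp only: projJ[of w] bx.sum_right)
      finally show ?thesis
        by (simp add: pr.sum_left h_def bx.scaleR_left bx.scaleR_right pr.scaleR_left pr.scaleR_right mult_ac)
    qed
    finally have S: "(\<Sum>(p, q)\<in>S. pr (x p q) (h p q)) = pr (form x (proj J v) (proj J w)) f" .
    have "form x v w - form x (proj J v) (proj J w) = form x (v - proj J v) w + form x (proj J v) (w - proj J w)"
      by (simp add: bx.diff_left bx.diff_right)
    then have "norm (form x v w - form x (proj J v) (proj J w))
        \<le> norm (form x (v - proj J v) w) + norm (form x (proj J v) (w - proj J w))"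
      by (metis norm_triangle_ineq)
    also have "\<dots> \<le> Mn_norm mn N x * \<tau> J"
      using norm_form_le[OF bf, of "v - proj J v" w] norm_form_le[OF bf, of "proj J v" "w - proj J w"]
      by (simp add: \<tau>_def algebra_simps)
    finally have le: "norm (form x v w - form x (proj J v) (proj J w)) \<le> Mn_norm mn N x * \<tau> J" .
    have "\<bar>pr (form x v w) f - (\<Sum>(p, q)\<in>S. pr (x p q) (h p q))\<bar>
        = norm (pr (form x v w - form x (proj J v) (proj J w)) f)"
      by (simp add: S pr.diff_left)
    also have "\<dots> \<le> norm (form x v w - form x (proj J v) (proj J w)) * norm f * K"
      by (rule K)
    also have "\<dots> \<le> (Mn_norm mn N x * \<tau> J) * norm f * K"
      using K(1) by (intro mult_right_mono le) auto
    also have "\<dots> = Mn_norm mn N x * (\<tau> J * norm f * K)" by simp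
    also have "\<dots> \<le> Mn_norm mn N x * \<epsilon>"
      using J(2) by (intro mult_left_mono Mn_norm_nonneg[OF mn x]) simp
    finally show ?thesis by (simp add: mult.commute)
  qed
  moreover have "finite S" "S \<subseteq> N \<times> N" using J(1) by (auto simp: S_def)
  ultimately show "\<exists>S h. finite S \<and> S \<subseteq> N \<times> N \<and>
      (\<forall>x\<in>Mn mn N. \<bar>pr (form x v w) f - (\<Sum>(p, q)\<in>S. pr (x p q) (h p q))\<bar> \<le> \<epsilon> * Mn_norm mn N x)"
    by blast
qed

section \<open>Continuity and limits in the weak* topology\<close>

lemma topspace_wstar:
  assumes "ruan_bound mn"
  shows "topspace (wstar mn pr N) = Mn mn N"
proof -
  have "predual_functional mn pr N (\<lambda>_. 0)"
    unfolding predual_functional_def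
    by (intro allI impI exI[of _ "{}"]) (auto intro!: mult_nonneg_nonneg Mn_norm_nonneg[OF assms])
  then show ?thesis
    unfolding wstar_def topology_generated_by_topspace by blast
qed

lemma continuous_map_wstar:
  assumes "ruan_bound mn" "predual_functional mn pr N \<phi>"
  shows "continuous_map (wstar mn pr N) euclideanreal \<phi>"
  unfolding continuous_map_def
proof (intro conjI allI impI)
  fix U :: "real set" assume "openin euclideanreal U"
  then have "{x \<in> Mn mn N. \<phi> x \<in> U} \<in> {{x \<in> Mn mn N. \<phi> x \<in> U} |\<phi> U. predual_functional mn pr N \<phi> \<and> open U}"
    using assms(2) by auto
  then show "openin (wstar mn pr N) {x \<in> topspace (wstar mn pr N). \<phi> x \<in> U}"
    unfolding topspace_wstar[OF assms(1)] unfolding wstar_def by (rule topology_generated_by_Basis)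
qed simp

lemma wstar_limitD:
  assumes "ruan_bound mn" "predual_functional mn pr N \<phi>" "limitin (wstar mn pr N) h l F"
  shows "((\<lambda>i. \<phi> (h i)) \<longlongrightarrow> \<phi> l) F"
  using continuous_map_limit[OF continuous_map_wstar[OF assms(1,2)] assms(3)] by (simp add: o_def)

text \<open>On a norm bounded set each predual functional is a uniform limit of finite combinations
  of entries, so for a bounded net weak* convergence can be tested entry by entry.\<close>

lemma wstar_limitI:
  fixes pr :: "'b::real_normed_vector \<Rightarrow> 'f \<Rightarrow> real"
  assumes mn: "ruan_bound mn" and l: "l \<in> Mn mn N"
    and h: "eventually (\<lambda>i. h i \<in> Mn mn N \<and> Mn_norm mn N (h i) \<le> C) F"
    and lim: "\<And>p q f. p \<in> N \<Longrightarrow> q \<in> N \<Longrightarrow> ((\<lambda>i. pr (h i p q) f) \<longlongrightarrow> pr (l p q) f) F"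
  shows "limitin (wstar mn pr N) h l F"
proof -
  have \<phi>: "((\<lambda>i. \<phi> (h i)) \<longlongrightarrow> \<phi> l) F" if pf: "predual_functional mn pr N \<phi>" for \<phi>
  proof (rule tendstoI)
    fix e :: real assume e: "e > 0"
    define D where "D = \<bar>C\<bar> + Mn_norm mn N l + 1"
    have D: "D > 0" "C \<le> D" "Mn_norm mn N l \<le> D"
      using Mn_norm_nonneg[OF mn l] by (auto simp: D_def)
    define \<epsilon> where "\<epsilon> = e / (3 * D)"
    have \<epsilon>: "\<epsilon> > 0" "\<epsilon> * D = e / 3" using e D by (auto simp: \<epsilon>_def)
    obtain S f where S: "finite S" "S \<subseteq> N \<times> N"
      "\<And>x. x \<in> Mn mn N \<Longrightarrow> \<bar>\<phi> x - (\<Sum>(p, q)\<in>S. pr (x p q) (f p q))\<bar> \<le> \<epsilon> * Mn_norm mn N x"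
      using pf[unfolded predual_functional_def, rule_format, OF \<epsilon>(1)] by (elim exE conjE) (rule that, auto)
    let ?s = "\<lambda>x. \<Sum>z\<in>S. pr (x (fst z) (snd z)) (f (fst z) (snd z))"
    have "((\<lambda>i. ?s (h i)) \<longlongrightarrow> ?s l) F"
      using S(2) by (intro tendsto_sum lim) auto
    then have "eventually (\<lambda>i. dist (?s (h i)) (?s l) < e / 3) F"
      using e by (intro tendstoD) auto
    with h show "eventually (\<lambda>i. dist (\<phi> (h i)) (\<phi> l) < e) F"
    proof eventually_elim
      case (elim i)
      have "\<bar>\<phi> (h i) - ?s (h i)\<bar> \<le> e / 3"
        using S(3)[of "h i"] elim(1) D(2) mult_left_mono[of "Mn_norm mn N (h i)" D \<epsilon>] \<epsilon>
        by (simp add: case_prod_unfold)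
      moreover have "\<bar>\<phi> l - ?s l\<bar> \<le> e / 3"
        using S(3)[OF l] D(3) mult_left_mono[of "Mn_norm mn N l" D \<epsilon>] \<epsilon>
        by (simp add: case_prod_unfold)
      ultimately show ?case using elim(2) by (simp add: dist_real_def abs_if split: if_splits)
    qed
  qed
  \<comment> \<open>Induction over the generated topology; the convergence of predual functionals
    handles the subbasic sets.\<close>
  have ev: "l \<in> U \<longrightarrow> eventually (\<lambda>i. h i \<in> U) F"
    if "generate_topology_on {{x \<in> Mn mn N. \<phi> x \<in> U} |\<phi> U. predual_functional mn pr N \<phi> \<and> open U} U" for U
    using that
  proof (induction rule: generate_topology_on.induct)
    case (Int a b)
    then show ?case by (auto intro: eventually_conj)
  next
    case (UN K)
    show ?case
    proof
      assume "l \<in> \<Union>K"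
      then obtain k where "k \<in> K" "l \<in> k" by blast
      with UN have "eventually (\<lambda>i. h i \<in> k) F" by blast
      then show "eventually (\<lambda>i. h i \<in> \<Union>K) F"
        by eventually_elim (use \<open>k \<in> K\<close> in blast)
    qed
  next
    case (Basis s)
    then obtain \<phi> U where s: "s = {x \<in> Mn mn N. \<phi> x \<in> U}" "predual_functional mn pr N \<phi>" "open U" by blast
    show ?case
    proof
      assume "l \<in> s"
      then have "eventually (\<lambda>i. \<phi> (h i) \<in> U) F"
        using \<phi>[OF s(2)] s by (auto intro: topological_tendstoD)
      with h show "eventually (\<lambda>i. h i \<in> s) F"
        by eventually_elim (simp add: s)
    qed
  qed simp
  show ?thesis
    unfolding limitin_def topspace_wstar[OF mn]
    using l ev by (simp add: wstar_def openin_topology_generated_by_iff)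
qed

section \<open>Dual pairs and completely bounded norms\<close>

lemma norm_fin_comb_inj:
  assumes "finite I" "inj_on \<sigma> I"
  shows "(norm (\<Sum>i\<in>I. c i *\<^sub>R basis (\<sigma> i)))\<^sup>2 = (\<Sum>i\<in>I. (c i)\<^sup>2)"
proof -
  define d where "d = c \<circ> the_inv_into I \<sigma>"
  have d: "d (\<sigma> i) = c i" if "i \<in> I" for i
    using that assms(2) by (simp add: d_def the_inv_into_f_f)
  have "(\<Sum>i\<in>I. c i *\<^sub>R basis (\<sigma> i)) = (\<Sum>p\<in>\<sigma> ` I. d p *\<^sub>R basis p)"
    using assms(2) by (simp add: sum.reindex d)
  moreover have "(\<Sum>p\<in>\<sigma> ` I. (d p)\<^sup>2) = (\<Sum>i\<in>I. (c i)\<^sup>2)"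
    using assms(2) by (simp add: sum.reindex d)
  ultimately show ?thesis using norm_fin_comb[of "\<sigma> ` I" d] assms(1) by simp
qed

locale dual_pair =
  fixes mnE :: "'e::banach mat_norms" and mnF :: "'f::banach mat_norms" and pr :: "'e \<Rightarrow> 'f \<Rightarrow> real"
  assumes dual: "real_dual_operator_space mnE mnF pr"
begin

lemma ruan_E: "ruan_bound mnE" and ruan_F: "ruan_bound mnF"
  using dual by (simp_all add: real_dual_operator_space_def real_operator_space_ruan_bound)

sublocale pr: bounded_bilinear pr
  using dual by (simp add: real_dual_operator_space_def)

text \<open>Both elements represent the same functional on the predual, and representing elements
  are unique.\<close>

lemma pr_eqI:
  assumes "\<And>f. pr e f = pr e' f"
  shows "e = e'"
proof -
  have "\<exists>!u. \<forall>f. pr u f = pr e f"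
    using dual pr.bounded_linear_right[of e] unfolding real_dual_operator_space_def by blast
  with assms show ?thesis by metis
qed

text \<open>The value at the matrix \<open>f\<close> of the amplified map that \<open>y\<close>
  induces on the predual.\<close>

definition cb_mat :: "(nat \<Rightarrow> nat \<Rightarrow> 'e) \<Rightarrow> (nat \<Rightarrow> nat \<Rightarrow> 'f) \<Rightarrow> nat \<times> nat \<Rightarrow> nat \<times> nat \<Rightarrow> real" where
  "cb_mat y f = (\<lambda>(i, k) (j, l). pr (y i j) (f k l))"

lemma mnE_eq_Sup:
  "mnE m y = Sup {opnorm ({..<m} \<times> {..<r}) ({..<m} \<times> {..<r}) (cb_mat y f) |r f. mnF r f \<le> 1}"
  using dual unfolding real_dual_operator_space_def cb_mat_def by blast

lemma cb_mat_sum: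
  "(\<Sum>a\<in>{..<m} \<times> {..<r}. \<Sum>b\<in>{..<m} \<times> {..<r}. \<xi> a * cb_mat y f a b * \<eta> b)
    = (\<Sum>i<m. \<Sum>j<m. pr (y i j) (\<Sum>k<r. \<xi> (i, k) *\<^sub>R (\<Sum>l<r. \<eta> (j, l) *\<^sub>R f k l)))"
proof -
  have "(\<Sum>a\<in>{..<m} \<times> {..<r}. \<Sum>b\<in>{..<m} \<times> {..<r}. \<xi> a * cb_mat y f a b * \<eta> b)
      = (\<Sum>i<m. \<Sum>k<r. \<Sum>j<m. \<Sum>l<r. \<xi> (i, k) * pr (y i j) (f k l) * \<eta> (j, l))"
  proof -
    have "(\<Sum>a\<in>{..<m} \<times> {..<r}. g a) = (\<Sum>i<m. \<Sum>k<r. g (i, k))" for g :: "nat \<times> nat \<Rightarrow> real"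
      by (simp add: sum.cartesian_product)
    then show ?thesis by (simp add: cb_mat_def)
  qed
  also have "\<dots> = (\<Sum>i<m. \<Sum>j<m. \<Sum>k<r. \<Sum>l<r. \<xi> (i, k) * pr (y i j) (f k l) * \<eta> (j, l))"
    by (rule sum.cong[OF refl], rule sum.swap)
  also have "\<dots> = (\<Sum>i<m. \<Sum>j<m. pr (y i j) (\<Sum>k<r. \<xi> (i, k) *\<^sub>R (\<Sum>l<r. \<eta> (j, l) *\<^sub>R f k l)))"
    by (simp add: pr.sum_right pr.scaleR_right sum_distrib_left mult_ac)
  finally show ?thesis .
qed

text \<open>Compressing \<open>f\<close> by the slices of \<xi> and \<eta> at \<open>i\<close> and
  \<open>j\<close> gives, by the Ruan bound on the predual, an element of norm at most the product
  of the norms of \<xi> and \<eta>. Adding the \<open>m * m\<close> entries gives a bound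
  independent of \<open>r\<close> and \<open>f\<close>.\<close>

lemma cb_bdd_above:
  "bdd_above {opnorm ({..<m} \<times> {..<r}) ({..<m} \<times> {..<r}) (cb_mat y f) |r f. mnF r f \<le> 1}"
proof -
  obtain K where K: "K > 0" "\<And>e f. norm (pr e f) \<le> norm e * norm f * K"
    using pr.pos_bounded by blast
  have "opnorm ({..<m} \<times> {..<r}) ({..<m} \<times> {..<r}) (cb_mat y f) \<le> (\<Sum>i<m. \<Sum>j<m. norm (y i j) * K)"
    if f: "mnF r f \<le> 1" for r f
  proof (rule opnorm_finite_leI)
    show "0 \<le> (\<Sum>i<m. \<Sum>j<m. norm (y i j) * K)"
      using K(1) by (intro sum_nonneg) simp
    fix \<xi> \<eta> :: "nat \<times> nat \<Rightarrow> real"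
    let ?x = "sqrt (\<Sum>a\<in>{..<m} \<times> {..<r}. (\<xi> a)\<^sup>2)" and ?e = "sqrt (\<Sum>a\<in>{..<m} \<times> {..<r}. (\<eta> a)\<^sup>2)"
    have part: "sqrt (\<Sum>k<r. (\<zeta> (i, k))\<^sup>2) \<le> sqrt (\<Sum>a\<in>{..<m} \<times> {..<r}. (\<zeta> a)\<^sup>2)"
      if "i < m" for i and \<zeta> :: "nat \<times> nat \<Rightarrow> real"
    proof -
      have "(\<Sum>k<r. (\<zeta> (i, k))\<^sup>2) = (\<Sum>a\<in>Pair i ` {..<r}. (\<zeta> a)\<^sup>2)"
        by (simp add: sum.reindex inj_on_def)
      also have "\<dots> \<le> (\<Sum>a\<in>{..<m} \<times> {..<r}. (\<zeta> a)\<^sup>2)"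
        using that by (intro sum_mono2) auto
      finally show ?thesis by simp
    qed
    have "pr (y i j) (\<Sum>k<r. \<xi> (i, k) *\<^sub>R (\<Sum>l<r. \<eta> (j, l) *\<^sub>R f k l)) \<le> norm (y i j) * K * (?x * ?e)"
      if ij: "i < m" "j < m" for i j
    proof -
      have "norm (\<Sum>k<r. \<xi> (i, k) *\<^sub>R (\<Sum>l<r. \<eta> (j, l) *\<^sub>R f k l))
          \<le> mnF r f * sqrt (\<Sum>k<r. (\<xi> (i, k))\<^sup>2) * sqrt (\<Sum>l<r. (\<eta> (j, l))\<^sup>2)"
        by (rule ruan_boundD(2)[OF ruan_F, where a = "\<lambda>k. \<xi> (i, k)" and b = "\<lambda>l. \<eta> (j, l)"])
      also have "\<dots> \<le> 1 * ?x * ?e"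
        using ruan_boundD(1)[OF ruan_F] ij
        by (intro mult_mono f part mult_nonneg_nonneg) (auto simp: sum_nonneg)
      finally have le: "norm (\<Sum>k<r. \<xi> (i, k) *\<^sub>R (\<Sum>l<r. \<eta> (j, l) *\<^sub>R f k l)) \<le> ?x * ?e" by simp
      have "pr (y i j) (\<Sum>k<r. \<xi> (i, k) *\<^sub>R (\<Sum>l<r. \<eta> (j, l) *\<^sub>R f k l))
          \<le> norm (y i j) * norm (\<Sum>k<r. \<xi> (i, k) *\<^sub>R (\<Sum>l<r. \<eta> (j, l) *\<^sub>R f k l)) * K"
        using K(2) abs_le_D1 by (simp add: abs_le_iff)
      also have "\<dots> \<le> norm (y i j) * (?x * ?e) * K"
        using K(1) by (intro mult_right_mono mult_left_mono le) auto
      finally show ?thesis by (simp add: mult_ac)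
    qed
    then have "(\<Sum>i<m. \<Sum>j<m. pr (y i j) (\<Sum>k<r. \<xi> (i, k) *\<^sub>R (\<Sum>l<r. \<eta> (j, l) *\<^sub>R f k l)))
        \<le> (\<Sum>i<m. \<Sum>j<m. norm (y i j) * K * (?x * ?e))"
      by (intro sum_mono) auto
    then show "(\<Sum>a\<in>{..<m} \<times> {..<r}. \<Sum>b\<in>{..<m} \<times> {..<r}. \<xi> a * cb_mat y f a b * \<eta> b)
        \<le> (\<Sum>i<m. \<Sum>j<m. norm (y i j) * K) * ?x * ?e"
      unfolding cb_mat_sum by (simp only: sum_distrib_right[symmetric] mult.assoc)
  qed auto
  then show ?thesis by (auto intro!: bdd_aboveI)
qed

lemma opnorm_le_mnE:
  "mnF r f \<le> 1 \<Longrightarrow> opnorm ({..<m} \<times> {..<r}) ({..<m} \<times> {..<r}) (cb_mat y f) \<le> mnE m y"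
  unfolding mnE_eq_Sup by (rule cSup_upper[OF _ cb_bdd_above]) blast

lemma mnE_leI:
  assumes "\<And>r f. mnF r f \<le> 1 \<Longrightarrow> opnorm ({..<m} \<times> {..<r}) ({..<m} \<times> {..<r}) (cb_mat y f) \<le> C"
  shows "mnE m y \<le> C"
  unfolding mnE_eq_Sup
proof (rule cSup_least)
  have "real_operator_space mnF" using dual by (simp add: real_dual_operator_space_def)
  then have "mnF m (\<lambda>i j. c *\<^sub>R x i j) = \<bar>c\<bar> * mnF m x" for m c x
    by (simp add: real_operator_space_def)
  \<comment> \<open>The empty matrix has norm zero, so the supremum is taken over a nonempty
    set.\<close>
  from this[of 0 0 "\<lambda>_ _. 0"] have "mnF 0 (\<lambda>_ _. 0) \<le> 1" by simp
  then show "{opnorm ({..<m} \<times> {..<r}) ({..<m} \<times> {..<r}) (cb_mat y f) |r f. mnF r f \<le> 1} \<noteq> {}" by blast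
qed (use assms in blast)

text \<open>The completely bounded norm tested on families of vectors instead of finite submatrices.
  \<open>Mn_cb_bound\<close> and \<open>Mn_cbI\<close> show that this gives the norm of the level;
  in this form the estimate passes easily to compressions and to block sums.\<close>

definition cb_bound :: "real \<Rightarrow> ('k \<Rightarrow> 'k \<Rightarrow> 'e) \<Rightarrow> bool" where
  "cb_bound C x \<longleftrightarrow> 0 \<le> C \<and> (\<forall>r f v w. mnF r f \<le> 1 \<longrightarrow>
     \<bar>\<Sum>k<r. \<Sum>l<r. pr (form x (v k) (w l)) (f k l)\<bar>
       \<le> C * sqrt (\<Sum>k<r. (norm (v k))\<^sup>2) * sqrt (\<Sum>l<r. (norm (w l))\<^sup>2))"

lemma cb_boundD:
  assumes "cb_bound C x" "mnF r f \<le> 1"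
  shows "\<bar>\<Sum>k<r. \<Sum>l<r. pr (form x (v k) (w l)) (f k l)\<bar>
       \<le> C * sqrt (\<Sum>k<r. (norm (v k))\<^sup>2) * sqrt (\<Sum>l<r. (norm (w l))\<^sup>2)"
  using assms unfolding cb_bound_def by blast

lemma bounded_form_E: "x \<in> Mn mnE N \<Longrightarrow> bounded_form (Mn_norm mnE N x) x"
  by (rule Mn_bounded_form[OF ruan_E])

lemma bilinear_form_E: "x \<in> Mn mnE N \<Longrightarrow> bounded_bilinear (form x)"
  using bounded_form_E bounded_bilinear_form by blast

text \<open>For vectors truncated to a finite set this is the completely bounded estimate for one
  finite submatrix. The bound does not depend on the truncation, so it survives the limit.\<close>

lemma Mn_cb_bound:
  fixes x :: "'k \<Rightarrow> 'k \<Rightarrow> 'e"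
  assumes x: "x \<in> Mn mnE N"
  shows "cb_bound (Mn_norm mnE N x) x"
  unfolding cb_bound_def
proof (intro conjI allI impI Mn_norm_nonneg[OF ruan_E x])
  fix r f and v w :: "nat \<Rightarrow> 'k ell2"
  assume f: "mnF r f \<le> 1"
  interpret bx: bounded_bilinear "form x" by (rule bilinear_form_E[OF x])
  let ?R = "Mn_norm mnE N x * sqrt (\<Sum>k<r. (norm (v k))\<^sup>2) * sqrt (\<Sum>l<r. (norm (w l))\<^sup>2)"
  have le: "\<bar>\<Sum>k<r. \<Sum>l<r. pr (form x (proj J (v k)) (proj J (w l))) (f k l)\<bar> \<le> ?R" if J: "finite J" for J
  proof -
    have "finite (J \<inter> N)" using J by simp
    then obtain \<sigma> :: "nat \<Rightarrow> 'k" and m where \<sigma>: "inj_on \<sigma> {..<m}" "\<sigma> ` {..<m} = J \<inter> N"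
      by (rule finite_enumeration)
    have re: "(\<Sum>p\<in>J \<inter> N. h p) = (\<Sum>i<m. h (\<sigma> i))" for h :: "'k \<Rightarrow> 'z::comm_monoid_add"
      using sum.reindex[OF \<sigma>(1)] by (simp flip: \<sigma>(2))
    have form_proj: "form x (proj J u) (proj J u')
        = (\<Sum>i<m. \<Sum>j<m. (coord u (\<sigma> i) * coord u' (\<sigma> j)) *\<^sub>R x (\<sigma> i) (\<sigma> j))" for u u'
    proof -
      have projJ: "proj J u = (\<Sum>p\<in>J. coord u p *\<^sub>R basis p)" for u :: "'k ell2"
        using J by (intro ell2_eqI) (simp add: coord_sum if_distrib cong: if_cong)
      have "form x (proj J u) (proj J u') = (\<Sum>p\<in>J. form x (coord u p *\<^sub>R basis p) (proj J u'))"
        by (simp only: projJ[of u] bx.sum_left)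
      also have "\<dots> = (\<Sum>p\<in>J. \<Sum>q\<in>J. form x (coord u p *\<^sub>R basis p) (coord u' q *\<^sub>R basis q))"
        by (simp only: projJ[of u'] bx.sum_right)
      also have "\<dots> = (\<Sum>p\<in>J. \<Sum>q\<in>J. (coord u p * coord u' q) *\<^sub>R x p q)"
        by (simp add: bx.scaleR_left bx.scaleR_right mult.commute)
      also have "\<dots> = (\<Sum>p\<in>J. \<Sum>q\<in>J \<inter> N. (coord u p * coord u' q) *\<^sub>R x p q)"
        using J by (intro sum.cong[OF refl] sum.mono_neutral_right) (auto simp: Mn_zero[OF x])
      also have "\<dots> = (\<Sum>p\<in>J \<inter> N. \<Sum>q\<in>J \<inter> N. (coord u p * coord u' q) *\<^sub>R x p q)"
        using J by (intro sum.mono_neutral_right) (auto simp: Mn_zero[OF x])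
      finally show ?thesis by (simp only: re)
    qed
    let ?y = "\<lambda>i j. x (\<sigma> i) (\<sigma> j)"
    let ?\<xi> = "\<lambda>(i, k). coord (v k) (\<sigma> i)" and ?\<eta> = "\<lambda>(j, l). coord (w l) (\<sigma> j)"
    have "(\<Sum>k<r. \<Sum>l<r. pr (form x (proj J (v k)) (proj J (w l))) (f k l))
        = (\<Sum>k<r. \<Sum>l<r. \<Sum>i<m. \<Sum>j<m. coord (v k) (\<sigma> i) * (coord (w l) (\<sigma> j) * pr (?y i j) (f k l)))"
      by (simp add: form_proj pr.sum_left pr.scaleR_left mult.assoc)
    also have "\<dots> = (\<Sum>k<r. \<Sum>i<m. \<Sum>l<r. \<Sum>j<m. coord (v k) (\<sigma> i) * (coord (w l) (\<sigma> j) * pr (?y i j) (f k l)))"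
      by (rule sum.cong[OF refl], rule sum.swap)
    also have "\<dots> = (\<Sum>i<m. \<Sum>k<r. \<Sum>l<r. \<Sum>j<m. coord (v k) (\<sigma> i) * (coord (w l) (\<sigma> j) * pr (?y i j) (f k l)))"
      by (rule sum.swap)
    also have "\<dots> = (\<Sum>i<m. \<Sum>k<r. \<Sum>j<m. \<Sum>l<r. coord (v k) (\<sigma> i) * (coord (w l) (\<sigma> j) * pr (?y i j) (f k l)))"
      by (intro sum.cong[OF refl], rule sum.swap)
    also have "\<dots> = (\<Sum>i<m. \<Sum>j<m. \<Sum>k<r. \<Sum>l<r. coord (v k) (\<sigma> i) * (coord (w l) (\<sigma> j) * pr (?y i j) (f k l)))"
      by (rule sum.cong[OF refl], rule sum.swap)
    also have "\<dots> = (\<Sum>i<m. \<Sum>j<m. pr (?y i j) (\<Sum>k<r. ?\<xi> (i, k) *\<^sub>R (\<Sum>l<r. ?\<eta> (j, l) *\<^sub>R f k l)))"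
      by (simp add: pr.sum_right pr.scaleR_right sum_distrib_left)
    finally have eq: "(\<Sum>k<r. \<Sum>l<r. pr (form x (proj J (v k)) (proj J (w l))) (f k l))
        = (\<Sum>a\<in>{..<m} \<times> {..<r}. \<Sum>b\<in>{..<m} \<times> {..<r}. ?\<xi> a * cb_mat ?y f a b * ?\<eta> b)"
      by (simp only: cb_mat_sum)
    have "\<bar>\<Sum>a\<in>{..<m} \<times> {..<r}. \<Sum>b\<in>{..<m} \<times> {..<r}. ?\<xi> a * cb_mat ?y f a b * ?\<eta> b\<bar>
      \<le> opnorm ({..<m} \<times> {..<r}) ({..<m} \<times> {..<r}) (cb_mat ?y f)
        * sqrt (\<Sum>a\<in>{..<m} \<times> {..<r}. (?\<xi> a)\<^sup>2) * sqrt (\<Sum>b\<in>{..<m} \<times> {..<r}. (?\<eta> b)\<^sup>2)"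
      by (rule abs_bilinear_le_opnorm) auto
    also have "\<dots> \<le> ?R"
    proof (intro mult_mono real_sqrt_le_mono)
      show "opnorm ({..<m} \<times> {..<r}) ({..<m} \<times> {..<r}) (cb_mat ?y f) \<le> Mn_norm mnE N x"
        using opnorm_le_mnE[OF f, of m ?y] submat_norm_le[OF x \<sigma>(1)] \<sigma>(2) by (auto intro: order_trans)
      have part: "(\<Sum>a\<in>{..<m} \<times> {..<r}. ((\<lambda>(i, k). coord (v k) (\<sigma> i)) a)\<^sup>2) \<le> (\<Sum>k<r. (norm (v k))\<^sup>2)"
        for v :: "nat \<Rightarrow> 'k ell2"
      proof -
        have "(\<Sum>a\<in>{..<m} \<times> {..<r}. ((\<lambda>(i, k). coord (v k) (\<sigma> i)) a)\<^sup>2) = (\<Sum>i<m. \<Sum>k<r. (coord (v k) (\<sigma> i))\<^sup>2)"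
          by (simp add: sum.cartesian_product case_prod_unfold)
        also have "\<dots> = (\<Sum>k<r. \<Sum>i<m. (coord (v k) (\<sigma> i))\<^sup>2)" by (rule sum.swap)
        also have "\<dots> = (\<Sum>k<r. \<Sum>p\<in>J \<inter> N. (coord (v k) p)\<^sup>2)" by (simp only: re)
        also have "\<dots> \<le> (\<Sum>k<r. (norm (v k))\<^sup>2)"
          using J by (intro sum_mono sum_coord_square_le) simp
        finally show ?thesis .
      qed
      show "(\<Sum>a\<in>{..<m} \<times> {..<r}. (?\<xi> a)\<^sup>2) \<le> (\<Sum>k<r. (norm (v k))\<^sup>2)"
        "(\<Sum>a\<in>{..<m} \<times> {..<r}. (?\<eta> a)\<^sup>2) \<le> (\<Sum>k<r. (norm (w k))\<^sup>2)"
        by (rule part)+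
    qed (auto simp: Mn_norm_nonneg[OF ruan_E x] sum_nonneg intro!: mult_nonneg_nonneg)
    finally show ?thesis by (simp only: eq)
  qed
  show "\<bar>\<Sum>k<r. \<Sum>l<r. pr (form x (v k) (w l)) (f k l)\<bar> \<le> ?R"
  proof (rule tendsto_upperbound)
    show "((\<lambda>J. \<bar>\<Sum>k<r. \<Sum>l<r. pr (form x (proj J (v k)) (proj J (w l))) (f k l)\<bar>) \<longlongrightarrow>
        \<bar>\<Sum>k<r. \<Sum>l<r. pr (form x (v k) (w l)) (f k l)\<bar>) (finite_subsets_at_top UNIV)"
      by (intro tendsto_intros pr.tendsto bx.tendsto proj_tendsto)
    show "eventually (\<lambda>J. \<bar>\<Sum>k<r. \<Sum>l<r. pr (form x (proj J (v k)) (proj J (w l))) (f k l)\<bar> \<le> ?R)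
        (finite_subsets_at_top UNIV)"
      using le by (rule eventually_finite_subsets_at_top_weakI)
  qed simp
qed

text \<open>Applied to vectors spanned by the basis vectors at \<open>\<sigma> i\<close>, the
  estimate becomes the one for the amplification of the submatrix along \<sigma>. The bound
  \<open>C'\<close> serves to make \<open>form x\<close> bilinear.\<close>

lemma Mn_cbI:
  assumes x0: "\<And>p q. p \<notin> N \<or> q \<notin> N \<Longrightarrow> x p q = 0"
    and bf: "bounded_form C' x" and cb: "cb_bound C x"
  shows "x \<in> Mn mnE N" "Mn_norm mnE N x \<le> C"
proof -
  interpret bx: bounded_bilinear "form x" by (rule bounded_bilinear_form[OF bf])
  have C0: "0 \<le> C" using cb by (simp add: cb_bound_def)
  have le: "mnE m (\<lambda>i j. x (\<sigma> i) (\<sigma> j)) \<le> C" if \<sigma>: "inj_on \<sigma> {..<m}" for m \<sigma>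
  proof (rule mnE_leI, rule opnorm_finite_leI)
    fix r f and \<xi> \<eta> :: "nat \<times> nat \<Rightarrow> real"
    assume f: "mnF r f \<le> 1"
    define v where "v \<zeta> k = (\<Sum>i<m. \<zeta> (i, k) *\<^sub>R basis (\<sigma> i))" for \<zeta> :: "nat \<times> nat \<Rightarrow> real" and k
    have nv: "(\<Sum>k<r. (norm (v \<zeta> k))\<^sup>2) = (\<Sum>a\<in>{..<m} \<times> {..<r}. (\<zeta> a)\<^sup>2)" for \<zeta>
    proof -
      have "(\<Sum>k<r. (norm (v \<zeta> k))\<^sup>2) = (\<Sum>k<r. \<Sum>i<m. (\<zeta> (i, k))\<^sup>2)"
        using \<sigma> by (simp add: v_def norm_fin_comb_inj)
      also have "\<dots> = (\<Sum>i<m. \<Sum>k<r. (\<zeta> (i, k))\<^sup>2)" by (rule sum.swap)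
      finally show ?thesis by (simp add: sum.cartesian_product)
    qed
    let ?t = "\<lambda>k l i j. \<xi> (i, k) * (\<eta> (j, l) * pr (x (\<sigma> i) (\<sigma> j)) (f k l))"
    have "(\<Sum>k<r. \<Sum>l<r. pr (form x (v \<xi> k) (v \<eta> l)) (f k l)) = (\<Sum>k<r. \<Sum>l<r. \<Sum>i<m. \<Sum>j<m. ?t k l i j)"
    proof (intro sum.cong[OF refl])
      fix k l
      have "form x (v \<xi> k) (v \<eta> l) = (\<Sum>i<m. form x (\<xi> (i, k) *\<^sub>R basis (\<sigma> i)) (v \<eta> l))"
        by (simp only: v_def[of \<xi>] bx.sum_left)
      also have "\<dots> = (\<Sum>i<m. \<Sum>j<m. form x (\<xi> (i, k) *\<^sub>R basis (\<sigma> i)) (\<eta> (j, l) *\<^sub>R basis (\<sigma> j)))"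
        by (simp only: v_def[of \<eta>] bx.sum_right)
      finally show "pr (form x (v \<xi> k) (v \<eta> l)) (f k l) = (\<Sum>i<m. \<Sum>j<m. ?t k l i j)"
        by (simp add: bx.scaleR_left bx.scaleR_right pr.sum_left pr.scaleR_left mult_ac)
    qed
    also have "\<dots> = (\<Sum>k<r. \<Sum>i<m. \<Sum>l<r. \<Sum>j<m. ?t k l i j)"
      by (rule sum.cong[OF refl], rule sum.swap)
    also have "\<dots> = (\<Sum>i<m. \<Sum>k<r. \<Sum>l<r. \<Sum>j<m. ?t k l i j)"
      by (rule sum.swap)
    also have "\<dots> = (\<Sum>i<m. \<Sum>k<r. \<Sum>j<m. \<Sum>l<r. ?t k l i j)"
      by (intro sum.cong[OF refl], rule sum.swap)
    also have "\<dots> = (\<Sum>i<m. \<Sum>j<m. \<Sum>k<r. \<Sum>l<r. ?t k l i j)"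
      by (rule sum.cong[OF refl], rule sum.swap)
    also have "\<dots> = (\<Sum>a\<in>{..<m} \<times> {..<r}. \<Sum>b\<in>{..<m} \<times> {..<r}. \<xi> a * cb_mat (\<lambda>i j. x (\<sigma> i) (\<sigma> j)) f a b * \<eta> b)"
      unfolding cb_mat_sum by (simp add: pr.sum_right pr.scaleR_right sum_distrib_left)
    finally show "(\<Sum>a\<in>{..<m} \<times> {..<r}. \<Sum>b\<in>{..<m} \<times> {..<r}. \<xi> a * cb_mat (\<lambda>i j. x (\<sigma> i) (\<sigma> j)) f a b * \<eta> b)
        \<le> C * sqrt (\<Sum>a\<in>{..<m} \<times> {..<r}. (\<xi> a)\<^sup>2) * sqrt (\<Sum>a\<in>{..<m} \<times> {..<r}. (\<eta> a)\<^sup>2)"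
      using cb_boundD[OF cb f, of "v \<xi>" "v \<eta>"] by (simp add: nv)
  qed (use C0 in auto)
  have ne: "submat_norms mnE N x \<noteq> {}"
  proof -
    have "mnE 0 (\<lambda>i j. x undefined undefined) \<in> submat_norms mnE N x"
      unfolding submat_norms_def by (rule CollectI, intro exI[of _ 0] exI[of _ "\<lambda>_. undefined"]) simp
    then show ?thesis by blast
  qed
  have all: "\<And>s. s \<in> submat_norms mnE N x \<Longrightarrow> s \<le> C"
    using le by (auto simp: submat_norms_def)
  then show "x \<in> Mn mnE N"
    using x0 by (auto simp: Mn_def intro!: bdd_aboveI)
  show "Mn_norm mnE N x \<le> C"
    unfolding Mn_norm_def using ne all by (rule cSup_least)
qed

lemma predual_form: "predual_functional mnE pr N (\<lambda>x. pr (form x v w) f)"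
  by (rule predual_functional_form[OF ruan_E pr.bounded_bilinear_axioms])

end

section \<open>Direct sums at the top level\<close>

lemma bounded_bilinear_zero: "bounded_bilinear (\<lambda>_ _. 0)"
  by (rule bounded_bilinear.intro) (auto intro: exI[of _ 0])

lemma bounded_bilinear_add:
  assumes "bounded_bilinear A" "bounded_bilinear B"
  shows "bounded_bilinear (\<lambda>v w. A v w + B v w)"
proof -
  interpret A: bounded_bilinear A by fact
  interpret B: bounded_bilinear B by fact
  obtain K where K: "\<And>a b. norm (A a b) \<le> norm a * norm b * K" using A.bounded by blast
  obtain L where L: "\<And>a b. norm (B a b) \<le> norm a * norm b * L" using B.bounded by blast
  show ?thesis
  proof (rule bounded_bilinear.intro)
    have "norm (A a b + B a b) \<le> norm a * norm b * (K + L)" for a b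
      using norm_triangle_mono[OF K L] by (simp add: distrib_left)
    then show "\<exists>K. \<forall>a b. norm (A a b + B a b) \<le> norm a * norm b * K" by blast
  qed (simp_all add: A.add_left A.add_right A.scaleR_left A.scaleR_right
      B.add_left B.add_right B.scaleR_left B.scaleR_right scaleR_add_right)
qed

lemma bounded_bilinear_sum:
  assumes "\<And>i. i \<in> I \<Longrightarrow> bounded_bilinear (B i)"
  shows "bounded_bilinear (\<lambda>v w. \<Sum>i\<in>I. B i v w)"
  using assms
  by (induction I rule: infinite_finite_induct) (simp_all add: bounded_bilinear_zero bounded_bilinear_add)

lemma bounded_form_reindex:
  assumes "bounded_form C x" "inj_on \<sigma> I" "finite I"
  shows "norm (\<Sum>i\<in>I. \<xi> i *\<^sub>R (\<Sum>j\<in>I. \<eta> j *\<^sub>R x (\<sigma> i) (\<sigma> j)))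
    \<le> C * sqrt (\<Sum>i\<in>I. (\<xi> i)\<^sup>2) * sqrt (\<Sum>j\<in>I. (\<eta> j)\<^sup>2)"
proof -
  have d: "\<zeta> (the_inv_into I \<sigma> (\<sigma> i)) = \<zeta> i" if "i \<in> I" for \<zeta> :: "_ \<Rightarrow> real" and i
    using that assms(2) by (simp add: the_inv_into_f_f)
  show ?thesis
    using bounded_formD[OF assms(1), of "\<sigma> ` I" "\<sigma> ` I" "\<xi> \<circ> the_inv_into I \<sigma>" "\<eta> \<circ> the_inv_into I \<sigma>"] assms(2,3)
    by (simp add: sum.reindex d)
qed

lemma
  assumes a0: "\<And>p q. p \<notin> N \<or> q \<notin> N \<Longrightarrow> a p q = 0" and a: "bounded_form C a"
  shows Mn_realI: "a \<in> Mn real_mn N" and Mn_norm_real_le: "Mn_norm real_mn N a \<le> C"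
proof -
  have le: "real_mn m (\<lambda>i j. a (\<sigma> i) (\<sigma> j)) \<le> C" if "inj_on \<sigma> {..<m}" for m \<sigma>
    unfolding real_mn_def
  proof (rule opnorm_finite_leI)
    fix \<xi> \<eta> :: "nat \<Rightarrow> real"
    show "(\<Sum>i<m. \<Sum>j<m. \<xi> i * a (\<sigma> i) (\<sigma> j) * \<eta> j)
        \<le> C * sqrt (\<Sum>i<m. (\<xi> i)\<^sup>2) * sqrt (\<Sum>j<m. (\<eta> j)\<^sup>2)"
      using bounded_form_reindex[OF a that, of \<xi> \<eta>] by (simp add: abs_le_iff sum_distrib_left mult_ac)
  qed (use a in \<open>auto simp: bounded_form_def\<close>)
  have ne: "submat_norms real_mn N a \<noteq> {}"
  proof -
    have "real_mn 0 (\<lambda>i j. a undefined undefined) \<in> submat_norms real_mn N a"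
      unfolding submat_norms_def by (rule CollectI, intro exI[of _ 0] exI[of _ "\<lambda>_. undefined"]) simp
    then show ?thesis by blast
  qed
  have all: "\<And>s. s \<in> submat_norms real_mn N a \<Longrightarrow> s \<le> C"
    using le by (auto simp: submat_norms_def)
  then show "a \<in> Mn real_mn N"
    using a0 by (auto simp: Mn_def intro!: bdd_aboveI)
  show "Mn_norm real_mn N a \<le> C"
    unfolding Mn_norm_def using ne all by (rule cSup_least)
qed

text \<open>For injective \<tau> on \<open>D\<close>, a partial isometry that permutes coordinates.
  It serves in both directions: as the embedding of a block and as the adjoint of that
  embedding.\<close>

definition reindex :: "'k set \<Rightarrow> ('k \<Rightarrow> 'k) \<Rightarrow> 'k ell2 \<Rightarrow> 'k ell2" where
  "reindex D \<tau> v = Abs_ell2 (\<lambda>q. if q \<in> D then coord v (\<tau> q) else 0)"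

lemma
  assumes "inj_on \<tau> D"
  shows coord_reindex: "coord (reindex D \<tau> v) = (\<lambda>q. if q \<in> D then coord v (\<tau> q) else 0)"
    and norm_reindex_le: "norm (reindex D \<tau> v) \<le> norm v"
    and bounded_linear_reindex: "bounded_linear (reindex D \<tau>)"
proof -
  have le: "(\<Sum>q\<in>J. (if q \<in> D then coord v (\<tau> q) else 0)\<^sup>2) \<le> (norm v)\<^sup>2" if J: "finite J" for J v
  proof -
    have "(\<Sum>q\<in>J. (if q \<in> D then coord v (\<tau> q) else 0)\<^sup>2) = (\<Sum>q\<in>J \<inter> D. (coord v (\<tau> q))\<^sup>2)"
      using J by (intro sum.mono_neutral_cong_right) auto
    also have "\<dots> = (\<Sum>p\<in>\<tau> ` (J \<inter> D). (coord v p)\<^sup>2)"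
      using assms by (subst sum.reindex) (auto intro: inj_on_subset)
    also have "\<dots> \<le> (norm v)\<^sup>2"
      using J by (intro sum_coord_square_le) auto
    finally show ?thesis .
  qed
  then show c: "coord (reindex D \<tau> v) = (\<lambda>q. if q \<in> D then coord v (\<tau> q) else 0)" for v
    unfolding reindex_def by (intro coord_Abs_ell2 square_summableI)
  show n: "norm (reindex D \<tau> v) \<le> norm v" for v
    by (rule norm_ell2_leI) (simp_all only: c le norm_ge_zero)
  show "bounded_linear (reindex D \<tau>)"
    by (rule bounded_linear_intro[where K=1]) (auto intro!: ell2_eqI simp: c n)
qed

text \<open>\<kappa> many nonempty sets of size at most \<kappa> have a disjoint union of size
  \<kappa>, because the square of an infinite cardinal is itself. Hence a direct sum of \<kappa>
  blocks fits on level \<kappa>.\<close>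

lemma Sigma_UNIV_bij:
  assumes "infinite (UNIV :: 'k set)" "\<And>i. d i \<noteq> ({} :: 'k set)"
  obtains b :: "'k \<times> 'k \<Rightarrow> 'k" where "bij_betw b (SIGMA i:UNIV. d i) UNIV"
proof -
  let ?S = "SIGMA i:(UNIV :: 'k set). d i"
  have "|?S| \<le>o |(UNIV :: 'k set) \<times> (UNIV :: 'k set)|"
    by (rule card_of_mono1) auto
  also have "|(UNIV :: 'k set) \<times> (UNIV :: 'k set)| =o |UNIV :: 'k set|"
    by (rule card_of_Times_same_infinite[OF assms(1)])
  finally have le: "|?S| \<le>o |UNIV :: 'k set|" .
  have "inj (\<lambda>i. (i, SOME p. p \<in> d i))" by (auto intro: injI)
  moreover have "range (\<lambda>i. (i, SOME p. p \<in> d i)) \<subseteq> ?S"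
    using assms(2) by (auto intro: some_in_eq[THEN iffD2])
  ultimately have "|UNIV :: 'k set| \<le>o |?S|"
    using card_of_ordLeq by blast
  with le have "|?S| =o |UNIV :: 'k set|" by (simp add: ordIso_iff_ordLeq)
  then show thesis using that card_of_ordIso by blast
qed

context dual_pair
begin

text \<open>The axiom for direct sums takes the isometries and the existence of the limits as
  premises. A bijection from the disjoint union of the levels onto \<open>UNIV\<close> supplies
  isometries with orthogonal ranges; the limits exist because the finite stages are uniformly
  bounded and each entry is eventually constant.\<close>

lemma direct_sum:
  fixes K :: "('k, 'e) graded"
  assumes K: "closed_under_direct_sums mnE pr K" "K \<subseteq> nc_matrices mnE"
    and inf: "infinite (UNIV :: 'k set)" and U: "(UNIV :: 'k set) \<in> cardinals"
    and dx: "\<And>i :: 'k. (d i, x i) \<in> K" "\<And>i. Mn_norm mnE (d i) (x i) \<le> C"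
  obtains y T where "(UNIV, y) \<in> K" "Mn_norm mnE UNIV y \<le> C" "\<And>i. bounded_linear (T i)"
    "\<And>i j v w. inner (T i v) (T j w) = (if i = j then inner (proj (d i) v) (proj (d i) w) else 0)"
    "\<And>i j v w. form y (T i v) (T j w) = (if i = j then form (x i) v w else 0)"
    "\<And>i p. p \<in> d i \<Longrightarrow> \<exists>q. T i (basis p) = basis q"
proof -
  have card: "d i \<in> cardinals" and xM: "x i \<in> Mn mnE (d i)" for i
    using dx(1)[of i] K(2) by (auto simp: nc_matrices_def)
  have C0: "0 \<le> C" using Mn_norm_nonneg[OF ruan_E xM] dx(2) order_trans by blast
  obtain b :: "'k \<times> 'k \<Rightarrow> 'k" where b: "bij_betw b (SIGMA i:UNIV. d i) UNIV"
    using Sigma_UNIV_bij[OF inf, of d] card by (auto simp: cardinals_def)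
  define c where "c = inv_into (SIGMA i:UNIV. d i) b"
  have c: "c q \<in> (SIGMA i:UNIV. d i)" "b (c q) = q" for q
    using b unfolding c_def by (auto simp: bij_betw_def inv_into_into f_inv_into_f)
  have cb: "c (b (i, p)) = (i, p)" if "p \<in> d i" for i p
    using b that unfolding c_def bij_betw_def by (auto intro: inv_into_f_f)
  have b_eq: "b (i, p) = b (j, q) \<longleftrightarrow> i = j \<and> p = q" if "p \<in> d i" "q \<in> d j" for i j p q
    using cb[OF that(1)] cb[OF that(2)] by (metis prod.inject)
  have c_iff: "fst (c q) = i \<and> snd (c q) = p \<longleftrightarrow> p \<in> d i \<and> q = b (i, p)" for i p q
  proof
    assume "fst (c q) = i \<and> snd (c q) = p"
    then have "c q = (i, p)" by (simp add: prod_eq_iff)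
    with c[of q] show "p \<in> d i \<and> q = b (i, p)" by simp
  qed (simp add: cb)
  \<comment> \<open>\<open>S i\<close> reads off block \<open>i\<close>; it is the adjoint of the
    embedding \<open>T i\<close> defined next.\<close>
  define S where "S i = reindex (d i) (\<lambda>p. b (i, p))" for i
  have injS: "inj_on (\<lambda>p. b (i, p)) (d i)" for i by (auto intro!: inj_onI simp: b_eq)
  note S_coord = coord_reindex[OF injS, folded S_def]
    and S_norm = norm_reindex_le[OF injS, folded S_def]
    and S_lin = bounded_linear_reindex[OF injS, folded S_def]
  define T where "T i = reindex {q. fst (c q) = i} (snd \<circ> c)" for i
  have injT: "inj_on (snd \<circ> c) {q. fst (c q) = i}" for i
    by (rule inj_onI) (metis c(2) comp_apply mem_Collect_eq prod.expand)
  note T_coord = coord_reindex[OF injT, folded T_def]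
    and T_norm = norm_reindex_le[OF injT, folded T_def]
    and T_lin = bounded_linear_reindex[OF injT, folded T_def]
  have T_basis: "T i (basis p) = (if p \<in> d i then basis (b (i, p)) else 0)" for i p
  proof (rule ell2_eqI)
    fix q
    have "coord (T i (basis p)) q = (if fst (c q) = i \<and> snd (c q) = p then 1 else 0)"
      by (simp add: T_coord)
    also have "\<dots> = coord (if p \<in> d i then basis (b (i, p)) else 0) q"
      unfolding c_iff by simp
    finally show "coord (T i (basis p)) q = coord (if p \<in> d i then basis (b (i, p)) else 0) q" .
  qed
  have S_basis: "S i (basis q) = (if fst (c q) = i then basis (snd (c q)) else 0)" for i q
  proof (rule ell2_eqI)
    fix p
    have "coord (if fst (c q) = i then basis (snd (c q)) else 0) p
        = (if fst (c q) = i \<and> snd (c q) = p then 1 else 0)"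
      by simp
    also have "\<dots> = coord (S i (basis q)) p"
      unfolding c_iff by (auto simp: S_coord)
    finally show "coord (S i (basis q)) p = coord (if fst (c q) = i then basis (snd (c q)) else 0) p" ..
  qed
  have S_supp: "supp_in (d i) (S i v)" for i v by (auto simp: supp_in_def S_coord)
  \<comment> \<open>Bessel's inequality for the orthogonal ranges of the embeddings.\<close>
  have sumS: "(\<Sum>i\<in>J. (norm (S i v))\<^sup>2) \<le> (norm v)\<^sup>2" if J: "finite J" for J v
  proof -
    have ST: "inner v (T i w) = inner (S i v) w" for i w
      using bounded_linear_eq_on_basis[OF bounded_linear_compose[OF bounded_linear_inner_right T_lin]
            bounded_linear_inner_right, of v i "S i v" w] by (simp add: T_basis S_coord)
    have TT: "inner (T i v) (T j w) = (if i = j then inner (proj (d i) v) w else 0)" for i j v w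
    proof (rule bounded_bilinear_eq_on_basis[where B = "\<lambda>v w. inner (T i v) (T j w)"
          and B' = "\<lambda>v w. if i = j then inner (proj (d i) v) w else 0"])
      show "bounded_bilinear (\<lambda>v w. inner (T i v) (T j w))"
        by (rule bounded_bilinear.comp[OF bounded_bilinear_inner T_lin T_lin])
      show "bounded_bilinear (\<lambda>v w. if i = j then inner (proj (d i) v) w else 0)"
        using bounded_bilinear.comp[OF bounded_bilinear_inner bounded_linear_proj[of "d i"] bounded_linear_ident]
        by (cases "i = j") (simp_all add: bounded_bilinear_zero)
    qed (auto simp: T_basis proj_basis b_eq)
    have "inner v (\<Sum>i\<in>J. T i (S i v)) = (\<Sum>i\<in>J. (norm (S i v))\<^sup>2)"
      by (simp add: inner_sum_right ST power2_norm_eq_inner)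
    moreover have "inner (\<Sum>i\<in>J. T i (S i v)) (\<Sum>i\<in>J. T i (S i v)) = (\<Sum>i\<in>J. (norm (S i v))\<^sup>2)"
      using J by (simp add: inner_sum_left inner_sum_right TT proj_id S_supp power2_norm_eq_inner)
    moreover have "0 \<le> inner (v - (\<Sum>i\<in>J. T i (S i v))) (v - (\<Sum>i\<in>J. T i (S i v)))"
      by (rule inner_ge_zero)
    ultimately show ?thesis
      by (simp add: inner_diff_left inner_diff_right inner_commute power2_norm_eq_inner)
  qed
  define B where "B J v w = (\<Sum>i\<in>J. form (x i) (S i v) (S i w))" for J v w
  have B_bil: "bounded_bilinear (B J)" for J
    unfolding B_def
    by (intro bounded_bilinear_sum bounded_bilinear.comp[OF bilinear_form_E[OF xM] S_lin S_lin])
  \<comment> \<open>Cauchy-Schwarz over the blocks. It is the reason why a block diagonal matrix,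
    and each of its amplifications, is bounded by a common bound of the blocks.\<close>
  have cs: "(\<Sum>i\<in>J. sqrt (\<Sum>k<r. (norm (S i (v k)))\<^sup>2) * sqrt (\<Sum>k<r. (norm (S i (w k)))\<^sup>2))
      \<le> sqrt (\<Sum>k<r. (norm (v k))\<^sup>2) * sqrt (\<Sum>k<r. (norm (w k))\<^sup>2)"
    if J: "finite J" for J and v w :: "nat \<Rightarrow> 'k ell2" and r :: nat
  proof -
    have part: "sqrt (\<Sum>i\<in>J. (sqrt (\<Sum>k<r. (norm (S i (v k)))\<^sup>2))\<^sup>2) \<le> sqrt (\<Sum>k<r. (norm (v k))\<^sup>2)"
      for v :: "nat \<Rightarrow> 'k ell2"
    proof -
      have "(\<Sum>i\<in>J. (sqrt (\<Sum>k<r. (norm (S i (v k)))\<^sup>2))\<^sup>2) = (\<Sum>i\<in>J. \<Sum>k<r. (norm (S i (v k)))\<^sup>2)"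
        by (simp add: sum_nonneg)
      also have "\<dots> = (\<Sum>k<r. \<Sum>i\<in>J. (norm (S i (v k)))\<^sup>2)" by (rule sum.swap)
      also have "\<dots> \<le> (\<Sum>k<r. (norm (v k))\<^sup>2)" by (intro sum_mono sumS J)
      finally show ?thesis by simp
    qed
    have "(\<Sum>i\<in>J. sqrt (\<Sum>k<r. (norm (S i (v k)))\<^sup>2) * sqrt (\<Sum>k<r. (norm (S i (w k)))\<^sup>2))
       \<le> sqrt (\<Sum>i\<in>J. (sqrt (\<Sum>k<r. (norm (S i (v k)))\<^sup>2))\<^sup>2) * sqrt (\<Sum>i\<in>J. (sqrt (\<Sum>k<r. (norm (S i (w k)))\<^sup>2))\<^sup>2)"
      using L2_set_mult_ineq[of "\<lambda>i. sqrt (\<Sum>k<r. (norm (S i (v k)))\<^sup>2)" "\<lambda>i. sqrt (\<Sum>k<r. (norm (S i (w k)))\<^sup>2)" J]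
      by (simp add: L2_set_def sum_nonneg)
    also have "\<dots> \<le> sqrt (\<Sum>k<r. (norm (v k))\<^sup>2) * sqrt (\<Sum>k<r. (norm (w k))\<^sup>2)"
      by (intro mult_mono part) (auto simp: sum_nonneg)
    finally show ?thesis .
  qed
  have B_norm: "norm (B J v w) \<le> C * norm v * norm w" if J: "finite J" for J v w
  proof -
    have "norm (B J v w) \<le> (\<Sum>i\<in>J. C * (norm (S i v) * norm (S i w)))"
      unfolding B_def
    proof (rule sum_norm_le)
      fix i
      have "norm (form (x i) (S i v) (S i w)) \<le> Mn_norm mnE (d i) (x i) * norm (S i v) * norm (S i w)"
        by (rule norm_form_le[OF bounded_form_E[OF xM]])
      also have "\<dots> \<le> C * norm (S i v) * norm (S i w)"
        by (intro mult_right_mono dx) auto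
      finally show "norm (form (x i) (S i v) (S i w)) \<le> C * (norm (S i v) * norm (S i w))" by simp
    qed
    also have "\<dots> \<le> C * (norm v * norm w)"
      using mult_left_mono[OF cs[OF J, of "\<lambda>_. v" 1 "\<lambda>_. w"] C0]
      by (simp add: sum_distrib_left)
    finally show ?thesis by simp
  qed
  define yJ where "yJ J p q = B J (basis p) (basis q)" for J p q
  have yJ_bf: "bounded_form C (yJ J)" and yJ_form: "form (yJ J) v w = B J v w" if "finite J" for J v w
    using bounded_form_of_bilinear[OF B_bil B_norm[OF that] C0] by (simp_all add: yJ_def[abs_def])
  have yJ_cb: "cb_bound C (yJ J)" if J: "finite J" for J
    unfolding cb_bound_def
  proof (intro conjI allI impI C0)
    fix r f and v w :: "nat \<Rightarrow> 'k ell2"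
    assume f: "mnF r f \<le> 1"
    have "(\<Sum>k<r. \<Sum>l<r. pr (form (yJ J) (v k) (w l)) (f k l))
        = (\<Sum>i\<in>J. \<Sum>k<r. \<Sum>l<r. pr (form (x i) (S i (v k)) (S i (w l))) (f k l))"
      by (simp add: yJ_form[OF J] B_def pr.sum_left sum.swap[of _ J])
    then have "\<bar>\<Sum>k<r. \<Sum>l<r. pr (form (yJ J) (v k) (w l)) (f k l)\<bar>
        \<le> (\<Sum>i\<in>J. \<bar>\<Sum>k<r. \<Sum>l<r. pr (form (x i) (S i (v k)) (S i (w l))) (f k l)\<bar>)"
      by simp
    also have "\<dots> \<le> (\<Sum>i\<in>J. C * (sqrt (\<Sum>k<r. (norm (S i (v k)))\<^sup>2) * sqrt (\<Sum>k<r. (norm (S i (w k)))\<^sup>2)))"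
    proof (rule sum_mono)
      fix i
      have "\<bar>\<Sum>k<r. \<Sum>l<r. pr (form (x i) (S i (v k)) (S i (w l))) (f k l)\<bar> \<le> Mn_norm mnE (d i) (x i)
          * sqrt (\<Sum>k<r. (norm (S i (v k)))\<^sup>2) * sqrt (\<Sum>k<r. (norm (S i (w k)))\<^sup>2)"
        by (rule cb_boundD[OF Mn_cb_bound[OF xM] f])
      also have "\<dots> \<le> C * sqrt (\<Sum>k<r. (norm (S i (v k)))\<^sup>2) * sqrt (\<Sum>k<r. (norm (S i (w k)))\<^sup>2)"
        by (intro mult_right_mono dx) (auto simp: sum_nonneg)
      finally show "\<bar>\<Sum>k<r. \<Sum>l<r. pr (form (x i) (S i (v k)) (S i (w l))) (f k l)\<bar>
          \<le> C * (sqrt (\<Sum>k<r. (norm (S i (v k)))\<^sup>2) * sqrt (\<Sum>k<r. (norm (S i (w k)))\<^sup>2))"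
        by simp
    qed
    also have "\<dots> \<le> C * (sqrt (\<Sum>k<r. (norm (v k))\<^sup>2) * sqrt (\<Sum>k<r. (norm (w k))\<^sup>2))"
      unfolding sum_distrib_left[symmetric] by (rule mult_left_mono[OF cs[OF J] C0])
    finally show "\<bar>\<Sum>k<r. \<Sum>l<r. pr (form (yJ J) (v k) (w l)) (f k l)\<bar>
        \<le> C * sqrt (\<Sum>k<r. (norm (v k))\<^sup>2) * sqrt (\<Sum>k<r. (norm (w k))\<^sup>2)" by simp
  qed
  have yJ_M: "yJ J \<in> Mn mnE UNIV" "Mn_norm mnE UNIV (yJ J) \<le> C" if "finite J" for J
    using Mn_cbI[OF _ yJ_bf[OF that] yJ_cb[OF that]] by auto
  define y where "y p q = (if fst (c p) = fst (c q) then x (fst (c p)) (snd (c p)) (snd (c q)) else 0)" for p q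
  \<comment> \<open>A row is final as soon as its block has entered \<open>J\<close>.\<close>
  have yJ_y: "yJ J p q = y p q" if "finite J" "fst (c p) \<in> J" for J p q
  proof -
    have z: "form (x i) 0 w = 0" "form (x i) v 0 = 0" for i v w
      using bilinear_form_E[OF xM] by (simp_all add: bounded_bilinear.zero_left bounded_bilinear.zero_right)
    have "yJ J p q = (\<Sum>i\<in>J. if i = fst (c p) then y p q else 0)"
      unfolding yJ_def B_def by (intro sum.cong) (auto simp: S_basis z y_def)
    then show ?thesis using that by simp
  qed
  \<comment> \<open>A finite submatrix meets finitely many blocks, so it already occurs in a finite
    stage.\<close>
  have y_le: "mnE m (\<lambda>i j. y (\<sigma> i) (\<sigma> j)) \<le> C" if "inj_on \<sigma> {..<m}" for m \<sigma>
  proof -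
    define J where "J = (fst \<circ> c \<circ> \<sigma>) ` {..<m}"
    have J: "finite J" by (simp add: J_def)
    have "real_operator_space mnE" using dual by (simp add: real_dual_operator_space_def)
    then have "(\<forall>i<m. \<forall>j<m. u i j = v i j) \<Longrightarrow> mnE m u = mnE m v" for u v
      by (simp add: real_operator_space_def)
    then have "mnE m (\<lambda>i j. y (\<sigma> i) (\<sigma> j)) = mnE m (\<lambda>i j. yJ J (\<sigma> i) (\<sigma> j))"
      using yJ_y[OF J] by (simp add: J_def)
    also have "\<dots> \<le> C"
      using submat_norm_le[OF yJ_M(1)[OF J] that] yJ_M(2)[OF J] by simp
    finally show ?thesis .
  qed
  have y_M: "y \<in> Mn mnE UNIV" "Mn_norm mnE UNIV y \<le> C"
  proof -
    have ne: "submat_norms mnE UNIV y \<noteq> {}"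
    proof -
      have "mnE 0 (\<lambda>i j. y undefined undefined) \<in> submat_norms mnE UNIV y"
        unfolding submat_norms_def by (rule CollectI, intro exI[of _ 0] exI[of _ "\<lambda>_. undefined"]) simp
      then show ?thesis by blast
    qed
    have all: "\<And>s. s \<in> submat_norms mnE UNIV y \<Longrightarrow> s \<le> C"
      using y_le by (auto simp: submat_norms_def)
    then show "y \<in> Mn mnE UNIV" by (auto simp: Mn_def intro!: bdd_aboveI)
    show "Mn_norm mnE UNIV y \<le> C"
      unfolding Mn_norm_def using ne all by (rule cSup_least)
  qed
  have adjS: "coord (T i (basis p)) q = coord (S i (basis q)) p" for i p q
  proof -
    have "coord (T i (basis p)) q = (if p \<in> d i \<and> q = b (i, p) then 1 else 0)"
      by (simp add: T_basis)
    also have "\<dots> = coord (S i (basis q)) p"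
      unfolding c_iff[symmetric] by (simp add: S_basis)
    finally show ?thesis .
  qed
  define \<alpha> where "\<alpha> i = (\<lambda>p j. coord (S i (basis p)) j)" for i
  have \<alpha>_mat: "\<alpha> i = mat (d i) (T i)" for i
    using c by (auto simp: \<alpha>_def mat_def adjS fun_eq_iff S_coord)
  have \<alpha>_tr: "mtrans (\<alpha> i) = (\<lambda>j p. coord (S i (basis p)) j)" for i
    by (simp add: \<alpha>_def mtrans_def)
  have T_iso: "norm (T i v) = norm v" if "supp_in (d i) v" for i v
  proof (rule antisym[OF T_norm])
    have "S i (T i v) = v"
      using that by (intro ell2_eqI) (auto simp: S_coord T_coord cb supp_in_def)
    then show "norm v \<le> norm (T i v)" using S_norm[of i "T i v"] by simp
  qed
  have \<alpha>_iso: "\<alpha> i \<in> isometries UNIV (d i)" for i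
    unfolding \<alpha>_mat by (rule mat_isometry[OF T_lin _ T_iso]) (simp add: supp_in_def)
  have lim1: "limitin (wstar_real UNIV) (\<lambda>J p q. \<Sum>i\<in>J. lmul (d i) (\<alpha> i) (mtrans (\<alpha> i)) p q)
      (idmat UNIV) (finite_subsets_at_top UNIV)"
  proof (rule wstar_limitI[OF ruan_bound_real_mn, where C=1])
    let ?a = "\<lambda>J p q. \<Sum>i\<in>J. lmul (d i) (\<alpha> i) (mtrans (\<alpha> i)) p q"
    have a: "?a J p q = (\<Sum>i\<in>J. inner (S i (basis p)) (S i (basis q)))" for J p q
      unfolding \<alpha>_tr unfolding \<alpha>_def by (simp add: lmul_inner proj_id S_supp)
    have a_bf: "bounded_form 1 (?a J)" if J: "finite J" for J
    proof -
      have bil: "bounded_bilinear (\<lambda>v w. \<Sum>i\<in>J. inner (S i v) (S i w))"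
        by (intro bounded_bilinear_sum bounded_bilinear.comp[OF bounded_bilinear_inner S_lin S_lin])
      have "norm (\<Sum>i\<in>J. inner (S i v) (S i w)) \<le> 1 * norm v * norm w" for v w
      proof -
        have "norm (\<Sum>i\<in>J. inner (S i v) (S i w)) \<le> (\<Sum>i\<in>J. norm (S i v) * norm (S i w))"
          by (rule sum_norm_le) (simp add: Cauchy_Schwarz_ineq2)
        also have "\<dots> \<le> norm v * norm w"
          using cs[OF J, of "\<lambda>_. v" 1 "\<lambda>_. w"] by simp
        finally show ?thesis by simp
      qed
      from bounded_form_of_bilinear(1)[OF bil this] show ?thesis by (simp add: a)
    qed
    show "eventually (\<lambda>J. ?a J \<in> Mn real_mn UNIV \<and> Mn_norm real_mn UNIV (?a J) \<le> 1) (finite_subsets_at_top UNIV)"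
      by (intro eventually_finite_subsets_at_top_weakI conjI Mn_realI[OF _ a_bf] Mn_norm_real_le[OF _ a_bf]) auto
    have id_bf: "bounded_form 1 (idmat (UNIV :: 'k set))"
    proof -
      have "bounded_form 1 (\<lambda>p q. inner (basis p) (basis q :: 'k ell2))"
        by (rule bounded_form_of_bilinear(1)[OF bounded_bilinear_inner]) (auto simp: Cauchy_Schwarz_ineq2)
      moreover have "(\<lambda>p q. inner (basis p) (basis q :: 'k ell2)) = idmat UNIV"
        by (auto simp: idmat_def fun_eq_iff)
      ultimately show ?thesis by simp
    qed
    show "idmat UNIV \<in> Mn real_mn (UNIV :: 'k set)" by (rule Mn_realI[OF _ id_bf]) auto
    fix p q :: 'k and f :: real
    have "?a J p q = idmat UNIV p q" if "finite J" "fst (c p) \<in> J" for J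
    proof -
      have "?a J p q = (\<Sum>i\<in>J. if i = fst (c p) then idmat UNIV p q else 0)"
        unfolding a
      proof (intro sum.cong refl)
        fix i
        show "inner (S i (basis p)) (S i (basis q)) = (if i = fst (c p) then idmat UNIV p q else 0)"
          using c(2)[of p] c(2)[of q] by (cases "c p"; cases "c q") (auto simp: S_basis idmat_def)
      qed
      then show ?thesis using that by simp
    qed
    then have "eventually (\<lambda>J. ?a J p q * f = idmat UNIV p q * f) (finite_subsets_at_top UNIV)"
      unfolding eventually_finite_subsets_at_top by (intro exI[of _ "{fst (c p)}"]) auto
    then show "((\<lambda>J. ?a J p q * f) \<longlongrightarrow> idmat UNIV p q * f) (finite_subsets_at_top UNIV)"
      by (rule tendsto_eventually)
  qed
  have lim2: "limitin (wstar mnE pr UNIV) (\<lambda>J p q. \<Sum>i\<in>J. sandwich (d i) (\<alpha> i) (x i) (mtrans (\<alpha> i)) p q)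
      y (finite_subsets_at_top UNIV)"
  proof -
    have eq: "(\<lambda>J p q. \<Sum>i\<in>J. sandwich (d i) (\<alpha> i) (x i) (mtrans (\<alpha> i)) p q) = yJ"
      unfolding \<alpha>_tr unfolding \<alpha>_def yJ_def B_def
      by (intro ext sum.cong refl sandwich_form) (rule Mn_zero[OF xM])
    show ?thesis
      unfolding eq
    proof (rule wstar_limitI[OF ruan_E y_M(1)])
      show "eventually (\<lambda>J. yJ J \<in> Mn mnE UNIV \<and> Mn_norm mnE UNIV (yJ J) \<le> C) (finite_subsets_at_top UNIV)"
        using yJ_M by (intro eventually_finite_subsets_at_top_weakI) auto
      fix p q :: 'k and f
      have "eventually (\<lambda>J. pr (yJ J p q) f = pr (y p q) f) (finite_subsets_at_top UNIV)"
        unfolding eventually_finite_subsets_at_top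
        by (intro exI[of _ "{fst (c p)}"]) (auto simp: yJ_y)
      then show "((\<lambda>J. pr (yJ J p q) f) \<longlongrightarrow> pr (y p q) f) (finite_subsets_at_top UNIV)"
        by (rule tendsto_eventually)
    qed
  qed
  have "(UNIV, y) \<in> K"
    using K(1)[unfolded closed_under_direct_sums_def, rule_format, OF U, of UNIV d x \<alpha> y] dx \<alpha>_iso lim1 lim2
    by blast
  moreover have "inner (T i v) (T j w) = (if i = j then inner (proj (d i) v) (proj (d i) w) else 0)" for i j v w
  proof (rule bounded_bilinear_eq_on_basis[where B = "\<lambda>v w. inner (T i v) (T j w)"
        and B' = "\<lambda>v w. if i = j then inner (proj (d i) v) (proj (d i) w) else 0"])
    show "bounded_bilinear (\<lambda>v w. inner (T i v) (T j w))"
      by (rule bounded_bilinear.comp[OF bounded_bilinear_inner T_lin T_lin])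
    show "bounded_bilinear (\<lambda>v w. if i = j then inner (proj (d i) v) (proj (d i) w) else 0)"
      using bounded_bilinear.comp[OF bounded_bilinear_inner bounded_linear_proj[of "d i"] bounded_linear_proj[of "d i"]]
      by (cases "i = j") (simp_all add: bounded_bilinear_zero)
  qed (auto simp: T_basis proj_basis b_eq)
  moreover have "form y (T i v) (T j w) = (if i = j then form (x i) v w else 0)" for i j v w
  proof (rule bounded_bilinear_eq_on_basis[where B = "\<lambda>v w. form y (T i v) (T j w)"
        and B' = "\<lambda>v w. if i = j then form (x i) v w else 0"])
    interpret by': bounded_bilinear "form y" by (rule bilinear_form_E[OF y_M(1)])
    show "bounded_bilinear (\<lambda>v w. form y (T i v) (T j w))"
      by (rule bounded_bilinear.comp[OF bilinear_form_E[OF y_M(1)] T_lin T_lin])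
    show "bounded_bilinear (\<lambda>v w. if i = j then form (x i) v w else 0)"
      using bilinear_form_E[OF xM[of i]] by (cases "i = j") (simp_all add: bounded_bilinear_zero)
    show "form y (T i (basis p)) (T j (basis q)) = (if i = j then form (x i) (basis p) (basis q) else 0)" for p q
      by (auto simp: T_basis by'.zero_left by'.zero_right y_def cb Mn_zero[OF xM])
  qed
  ultimately show thesis
    using y_M T_lin T_basis by (intro that[of y T]) auto
qed

end

section \<open>Compactness and uniform boundedness\<close>

text \<open>Basic neighbourhoods in the product topology restrict finitely many coordinates, and the
  minimum of finitely many radii serves as \<epsilon>.\<close>

lemma closure_fun_iff:
  fixes D :: "'z \<Rightarrow> real"
  shows "D \<in> closure S \<longleftrightarrow> (\<forall>Q \<epsilon>. finite Q \<longrightarrow> \<epsilon> > 0 \<longrightarrow> (\<exists>s\<in>S. \<forall>q\<in>Q. \<bar>s q - D q\<bar> < \<epsilon>))"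
proof (intro iffI allI impI)
  fix Q :: "'z set" and \<epsilon> :: real
  assume D: "D \<in> closure S" and Q: "finite Q" "\<epsilon> > 0"
  have "open {g :: 'z \<Rightarrow> real. \<bar>g q - D q\<bar> < \<epsilon>}" for q
    by (intro open_Collect_less continuous_intros continuous_on_product_coordinates)
  then have "open (\<Inter>q\<in>Q. {g :: 'z \<Rightarrow> real. \<bar>g q - D q\<bar> < \<epsilon>})"
    using Q(1) by (intro open_INT) auto
  moreover have "D \<in> (\<Inter>q\<in>Q. {g. \<bar>g q - D q\<bar> < \<epsilon>})" using Q(2) by auto
  ultimately have "S \<inter> (\<Inter>q\<in>Q. {g. \<bar>g q - D q\<bar> < \<epsilon>}) \<noteq> {}"
    using D unfolding closure_iff_nhds_not_empty by blast
  then show "\<exists>s\<in>S. \<forall>q\<in>Q. \<bar>s q - D q\<bar> < \<epsilon>" by blast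
next
  assume *: "\<forall>Q \<epsilon>. finite Q \<longrightarrow> \<epsilon> > 0 \<longrightarrow> (\<exists>s\<in>S. \<forall>q\<in>Q. \<bar>s q - D q\<bar> < \<epsilon>)"
  show "D \<in> closure S"
    unfolding closure_iff_nhds_not_empty
  proof (intro allI impI)
    fix A U :: "('z \<Rightarrow> real) set" assume AU: "U \<subseteq> A" "open U" "D \<in> U"
    then have "openin (product_topology (\<lambda>_. euclidean) UNIV) U" by (simp add: open_fun_def)
    then obtain X where X: "D \<in> (\<Pi>\<^sub>E i\<in>UNIV. X i)" "\<And>i. openin euclidean (X i)"
      "finite {i. X i \<noteq> topspace euclidean}" "(\<Pi>\<^sub>E i\<in>UNIV. X i) \<subseteq> U"
      using product_topology_open_contains_basis[OF _ AU(3)] by blast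
    define Q where "Q = {i. X i \<noteq> UNIV}"
    have Q: "finite Q" using X(3) by (simp add: Q_def)
    have "\<exists>e>0. \<forall>t. \<bar>t - D i\<bar> < e \<longrightarrow> t \<in> X i" for i
    proof -
      have "open (X i)" "D i \<in> X i" using X(1,2) by (auto simp: PiE_iff)
      then obtain e where "e > 0" "ball (D i) e \<subseteq> X i" by (meson openE)
      then show ?thesis by (intro exI[of _ e]) (auto simp: dist_real_def subset_iff abs_minus_commute)
    qed
    then obtain e where e: "\<And>i. e i > 0" "\<And>i t. \<bar>t - D i\<bar> < e i \<Longrightarrow> t \<in> X i" by metis
    define \<epsilon> where "\<epsilon> = Min (insert 1 (e ` Q))"
    have "\<epsilon> > 0" using Q e(1) by (simp add: \<epsilon>_def)
    moreover have "\<epsilon> \<le> e q" if "q \<in> Q" for q using that Q by (simp add: \<epsilon>_def)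
    ultimately obtain s where s: "s \<in> S" "\<And>q. q \<in> Q \<Longrightarrow> \<bar>s q - D q\<bar> < e q"
      using * Q by (metis order_less_le_trans)
    have "s i \<in> X i" for i
      using s(2)[of i] e(2)[of "s i" i] by (cases "i \<in> Q") (auto simp: Q_def)
    then have "s \<in> U" using X(4) by (auto simp: PiE_iff)
    then show "S \<inter> A \<noteq> {}" using s(1) AU by blast
  qed
qed

lemma Hausdorff_space_fun: "Hausdorff_space (euclidean :: ('z \<Rightarrow> real) topology)"
  by (simp add: euclidean_product_topology[symmetric] Hausdorff_space_product_topology)

context dual_pair
begin

section \<open>The linear space of predual functionals and its use on compact sets\<close>

lemma predual_zero: "predual_functional mnE pr N (\<lambda>_. 0)"
  unfolding predual_functional_def
  by (intro allI impI exI[of _ "{}"]) (auto intro!: mult_nonneg_nonneg Mn_norm_nonneg[OF ruan_E])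

lemma predual_add:
  assumes "predual_functional mnE pr N \<phi>" "predual_functional mnE pr N \<psi>"
  shows "predual_functional mnE pr N (\<lambda>x. \<phi> x + \<psi> x)"
  unfolding predual_functional_def
proof (intro allI impI)
  fix \<epsilon> :: real assume "\<epsilon> > 0"
  then have e2: "\<epsilon> / 2 > 0" by simp
  obtain S f where S: "finite S" "S \<subseteq> N \<times> N"
    "\<And>x. x \<in> Mn mnE N \<Longrightarrow> \<bar>\<phi> x - (\<Sum>(p, q)\<in>S. pr (x p q) (f p q))\<bar> \<le> \<epsilon> / 2 * Mn_norm mnE N x"
    using assms(1)[unfolded predual_functional_def, rule_format, OF e2] by (elim exE conjE) (rule that, auto)
  obtain S' f' where S': "finite S'" "S' \<subseteq> N \<times> N"
    "\<And>x. x \<in> Mn mnE N \<Longrightarrow> \<bar>\<psi> x - (\<Sum>(p, q)\<in>S'. pr (x p q) (f' p q))\<bar> \<le> \<epsilon> / 2 * Mn_norm mnE N x"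
    using assms(2)[unfolded predual_functional_def, rule_format, OF e2] by (elim exE conjE) (rule that, auto)
  define h where "h p q = (if (p, q) \<in> S then f p q else 0) + (if (p, q) \<in> S' then f' p q else 0)" for p q
  have eq: "(\<Sum>(p, q)\<in>S \<union> S'. pr (x p q) (h p q))
      = (\<Sum>(p, q)\<in>S. pr (x p q) (f p q)) + (\<Sum>(p, q)\<in>S'. pr (x p q) (f' p q))" for x
  proof -
    have "(\<Sum>(p, q)\<in>S \<union> S'. pr (x p q) (h p q))
        = (\<Sum>(p, q)\<in>S \<union> S'. pr (x p q) (if (p, q) \<in> S then f p q else 0))
        + (\<Sum>(p, q)\<in>S \<union> S'. pr (x p q) (if (p, q) \<in> S' then f' p q else 0))"
      by (simp add: h_def pr.add_right case_prod_unfold sum.distrib)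
    also have "(\<Sum>(p, q)\<in>S \<union> S'. pr (x p q) (if (p, q) \<in> S then f p q else 0)) = (\<Sum>(p, q)\<in>S. pr (x p q) (f p q))"
      using S(1) S'(1) by (intro sum.mono_neutral_cong_right) (auto simp: pr.zero_right)
    also have "(\<Sum>(p, q)\<in>S \<union> S'. pr (x p q) (if (p, q) \<in> S' then f' p q else 0)) = (\<Sum>(p, q)\<in>S'. pr (x p q) (f' p q))"
      using S(1) S'(1) by (intro sum.mono_neutral_cong_right) (auto simp: pr.zero_right)
    finally show ?thesis .
  qed
  have "\<bar>\<phi> x + \<psi> x - (\<Sum>(p, q)\<in>S \<union> S'. pr (x p q) (h p q))\<bar> \<le> \<epsilon> * Mn_norm mnE N x"
    if "x \<in> Mn mnE N" for x
  proof -
    have "\<epsilon> * Mn_norm mnE N x = \<epsilon> / 2 * Mn_norm mnE N x + \<epsilon> / 2 * Mn_norm mnE N x" by simp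
    then show ?thesis unfolding eq using S(3)[OF that] S'(3)[OF that] by linarith
  qed
  then show "\<exists>S f. finite S \<and> S \<subseteq> N \<times> N \<and>
      (\<forall>x\<in>Mn mnE N. \<bar>\<phi> x + \<psi> x - (\<Sum>(p, q)\<in>S. pr (x p q) (f p q))\<bar> \<le> \<epsilon> * Mn_norm mnE N x)"
    using S(1,2) S'(1,2) by (intro exI[of _ "S \<union> S'"] exI[of _ h]) auto
qed

lemma predual_scale:
  assumes "predual_functional mnE pr N \<phi>"
  shows "predual_functional mnE pr N (\<lambda>x. c * \<phi> x)"
  unfolding predual_functional_def
proof (intro allI impI)
  fix \<epsilon> :: real assume "\<epsilon> > 0"
  then have e2: "\<epsilon> / (\<bar>c\<bar> + 1) > 0" by simp
  obtain S f where S: "finite S" "S \<subseteq> N \<times> N"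
    "\<And>x. x \<in> Mn mnE N \<Longrightarrow> \<bar>\<phi> x - (\<Sum>(p, q)\<in>S. pr (x p q) (f p q))\<bar> \<le> \<epsilon> / (\<bar>c\<bar> + 1) * Mn_norm mnE N x"
    using assms(1)[unfolded predual_functional_def, rule_format, OF e2] by (elim exE conjE) (rule that, auto)
  have "\<bar>c * \<phi> x - (\<Sum>(p, q)\<in>S. pr (x p q) (c *\<^sub>R f p q))\<bar> \<le> \<epsilon> * Mn_norm mnE N x"
    if x: "x \<in> Mn mnE N" for x
  proof -
    have "\<bar>c * \<phi> x - (\<Sum>(p, q)\<in>S. pr (x p q) (c *\<^sub>R f p q))\<bar>
        = \<bar>c\<bar> * \<bar>\<phi> x - (\<Sum>(p, q)\<in>S. pr (x p q) (f p q))\<bar>"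
      by (simp add: pr.scaleR_right case_prod_unfold abs_mult[symmetric] right_diff_distrib sum_distrib_left)
    also have "\<dots> \<le> \<bar>c\<bar> * (\<epsilon> / (\<bar>c\<bar> + 1) * Mn_norm mnE N x)"
      by (intro mult_left_mono S(3) x) simp
    also have "\<dots> = \<bar>c\<bar> / (\<bar>c\<bar> + 1) * (\<epsilon> * Mn_norm mnE N x)" by simp
    also have "\<dots> \<le> 1 * (\<epsilon> * Mn_norm mnE N x)"
      using \<open>\<epsilon> > 0\<close> by (intro mult_right_mono mult_nonneg_nonneg Mn_norm_nonneg[OF ruan_E x]) auto
    finally show ?thesis by simp
  qed
  then show "\<exists>S f. finite S \<and> S \<subseteq> N \<times> N \<and>
      (\<forall>x\<in>Mn mnE N. \<bar>c * \<phi> x - (\<Sum>(p, q)\<in>S. pr (x p q) (f p q))\<bar> \<le> \<epsilon> * Mn_norm mnE N x)"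
    using S(1,2) by (intro exI[of _ S] exI[of _ "\<lambda>p q. c *\<^sub>R f p q"]) auto
qed

lemma predual_sum:
  assumes "\<And>i. i \<in> I \<Longrightarrow> predual_functional mnE pr N (\<phi> i)"
  shows "predual_functional mnE pr N (\<lambda>x. \<Sum>i\<in>I. \<phi> i x)"
  using assms
  by (induction I rule: infinite_finite_induct) (simp_all add: predual_zero predual_add)

lemma continuous_map_predual: "predual_functional mnE pr N \<phi> \<Longrightarrow> continuous_map (wstar mnE pr N) euclideanreal \<phi>"
  by (rule continuous_map_wstar[OF ruan_E])

lemma compactin_predual_bounded:
  assumes "compactin (wstar mnE pr N) A" "predual_functional mnE pr N \<phi>"
  obtains M where "\<And>x. x \<in> A \<Longrightarrow> \<bar>\<phi> x\<bar> \<le> M"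
proof -
  have "compact (\<phi> ` A)"
    using image_compactin[OF assms(1) continuous_map_predual[OF assms(2)]] by simp
  then show thesis
    using that compact_imp_bounded[of "\<phi> ` A"] by (auto simp: bounded_iff)
qed

text \<open>The functionals in \<open>cb_bound\<close>, divided by the norms of their vectors, lie
  in the predual and determine the norm. If all of them stayed below 3/4 of the norm of
  \<open>x\<close>, that number would be a completely bounded estimate, and \<open>Mn_cbI\<close>
  would put the norm below it.\<close>

lemma norming_functional:
  fixes x :: "'k \<Rightarrow> 'k \<Rightarrow> 'e"
  assumes x: "x \<in> Mn mnE N"
  obtains \<phi> where "predual_functional mnE pr N \<phi>" "\<And>y. y \<in> Mn mnE N \<Longrightarrow> \<bar>\<phi> y\<bar> \<le> Mn_norm mnE N y"
    "3 / 4 * Mn_norm mnE N x \<le> \<phi> x"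
proof (rule ccontr)
  assume no: "\<not> thesis"
  let ?M = "Mn_norm mnE N x"
  have M: "?M > 0"
  proof (rule ccontr)
    assume "\<not> ?M > 0"
    then have "?M = 0" using Mn_norm_nonneg[OF ruan_E x] by simp
    then have thesis
      by (intro that[of "\<lambda>_. 0"]) (auto simp: predual_zero Mn_norm_nonneg[OF ruan_E])
    with no show False by blast
  qed
  have "cb_bound (3 / 4 * ?M) x"
    unfolding cb_bound_def
  proof (intro conjI allI impI)
    fix r f and v w :: "nat \<Rightarrow> 'k ell2"
    assume f: "mnF r f \<le> 1"
    define s where "s = sqrt (\<Sum>k<r. (norm (v k))\<^sup>2) * sqrt (\<Sum>l<r. (norm (w l))\<^sup>2)"
    define \<psi> where "\<psi> y = (\<Sum>k<r. \<Sum>l<r. pr (form y (v k) (w l)) (f k l))" for y :: "'k \<Rightarrow> 'k \<Rightarrow> 'e"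
    have s0: "s \<ge> 0" by (simp add: s_def sum_nonneg)
    have \<psi>: "\<bar>\<psi> y\<bar> \<le> Mn_norm mnE N y * s" if "y \<in> Mn mnE N" for y
      using cb_boundD[OF Mn_cb_bound[OF that] f, of v w] by (simp add: \<psi>_def s_def mult.assoc)
    have "\<bar>\<psi> x\<bar> \<le> 3 / 4 * ?M * s"
    proof (cases "s = 0")
      case True
      with \<psi>[OF x] show ?thesis by simp
    next
      case False
      then have s: "s > 0" using s0 by simp
      define c where "c = sgn (\<psi> x) / s"
      have cabs: "\<bar>c\<bar> \<le> 1 / s" using s by (simp add: c_def abs_divide sgn_if)
      have "\<not> 3 / 4 * ?M \<le> c * \<psi> x"
      proof
        assume *: "3 / 4 * ?M \<le> c * \<psi> x"
        have "predual_functional mnE pr N (\<lambda>y. c * \<psi> y)"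
          unfolding \<psi>_def by (intro predual_scale predual_sum predual_form)
        moreover have "\<bar>c * \<psi> y\<bar> \<le> Mn_norm mnE N y" if "y \<in> Mn mnE N" for y
        proof -
          have "\<bar>c * \<psi> y\<bar> \<le> 1 / s * (Mn_norm mnE N y * s)"
            unfolding abs_mult using s by (intro mult_mono cabs \<psi> that) auto
          then show ?thesis using s by simp
        qed
        ultimately show False using no that * by blast
      qed
      moreover have "c * \<psi> x = \<bar>\<psi> x\<bar> / s" by (simp add: c_def abs_sgn mult.commute)
      ultimately show ?thesis using s by (simp add: pos_divide_le_eq not_le pos_divide_less_eq less_imp_le)
    qed
    then show "\<bar>\<Sum>k<r. \<Sum>l<r. pr (form x (v k) (w l)) (f k l)\<bar>
        \<le> 3 / 4 * ?M * sqrt (\<Sum>k<r. (norm (v k))\<^sup>2) * sqrt (\<Sum>l<r. (norm (w l))\<^sup>2)"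
      by (simp add: \<psi>_def s_def mult.assoc)
  qed (use M in simp)
  then have "?M \<le> 3 / 4 * ?M"
    by (rule Mn_cbI(2)[OF _ bounded_form_E[OF x], rotated]) (rule Mn_zero[OF x])
  with M show False by simp
qed

text \<open>A gliding hump argument: if \<open>A\<close> were unbounded, then \<open>\<Sum>\<^sub>n 3\<^sup>-\<^sup>n \<phi>\<^sub>n\<close>, for suitable norming
  functionals \<open>\<phi>\<^sub>n\<close>, would be a predual functional that is unbounded on \<open>A\<close>.\<close>

lemma compactin_norm_bounded:
  assumes A: "compactin (wstar mnE pr N) A"
  obtains C where "\<And>x. x \<in> A \<Longrightarrow> Mn_norm mnE N x \<le> C"
proof (rule ccontr)
  assume no: "\<not> thesis"
  have unb: "\<exists>x\<in>A. C < Mn_norm mnE N x" for C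
    using no that by (meson not_le)
  have AM: "A \<subseteq> Mn mnE N"
    using compactin_subset_topspace[OF A] topspace_wstar[OF ruan_E] by blast
  let ?n = "Mn_norm mnE N"
  define \<Phi> where "\<Phi> = {\<phi>. predual_functional mnE pr N \<phi> \<and> (\<forall>y\<in>Mn mnE N. \<bar>\<phi> y\<bar> \<le> ?n y)}"
  \<comment> \<open>\<open>B\<close> bounds the weighted sum of the earlier functionals on
    \<open>A\<close>. At \<open>x\<close> the current term is at least 3/4 of
    \<open>(1/3)^n * ?n x\<close> and the later terms together are at most 1/2 of it; the remaining
    quarter is required to be at least \<open>n + B\<close>.\<close>
  define P where "P n s = (case s of (x, \<phi>, B) \<Rightarrow> x \<in> A \<and> \<phi> \<in> \<Phi> \<and> 3 / 4 * ?n x \<le> \<phi> x \<and> 0 \<le> B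
    \<and> real n + B \<le> (1/3)^n / 4 * ?n x)" for n :: nat and s :: "('a \<Rightarrow> 'a \<Rightarrow> 'e) \<times> (('a \<Rightarrow> 'a \<Rightarrow> 'e) \<Rightarrow> real) \<times> real"
  define Q where "Q n s s' = (case s of (x, \<phi>, B) \<Rightarrow> case s' of (x', \<phi>', B') \<Rightarrow>
    \<forall>y\<in>A. (1/3)^n * \<bar>\<phi> y\<bar> + B \<le> B')" for n :: nat and s s' :: "('a \<Rightarrow> 'a \<Rightarrow> 'e) \<times> (('a \<Rightarrow> 'a \<Rightarrow> 'e) \<Rightarrow> real) \<times> real"
  have ex: "\<exists>x \<phi>. P n (x, \<phi>, B)" if "0 \<le> B" for n B
  proof -
    obtain x where x: "x \<in> A" "(real n + B) * 4 * 3 ^ n < ?n x" using unb by blast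
    have "x \<in> Mn mnE N" using x(1) AM by blast
    then obtain \<phi> where "predual_functional mnE pr N \<phi>" "\<And>y. y \<in> Mn mnE N \<Longrightarrow> \<bar>\<phi> y\<bar> \<le> ?n y" "3 / 4 * ?n x \<le> \<phi> x"
      by (rule norming_functional) blast
    moreover have "real n + B \<le> (1/3)^n / 4 * ?n x"
      using x(2) by (simp add: power_one_over field_simps)
    ultimately have "P n (x, \<phi>, B)" using x that by (auto simp: P_def \<Phi>_def)
    then show ?thesis by blast
  qed
  \<comment> \<open>A single functional is bounded on the compact set \<open>A\<close>, so the next
    \<open>B\<close> is finite; unboundedness of \<open>A\<close> then supplies the next
    point.\<close>
  obtain g where g: "\<And>n. P n (g n)" "\<And>n. Q n (g n) (g (Suc n))"
  proof -
    have "\<exists>s. P 0 s" using ex[of 0 0] by auto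
    moreover have "\<exists>s'. P (Suc n) s' \<and> Q n s s'" if "P n s" for n s
    proof -
      obtain x \<phi> B where s: "s = (x, \<phi>, B)" by (cases s)
      have \<phi>: "predual_functional mnE pr N \<phi>" and B: "0 \<le> B" using that by (auto simp: s P_def \<Phi>_def)
      obtain M where M: "\<And>y. y \<in> A \<Longrightarrow> \<bar>\<phi> y\<bar> \<le> M"
        by (rule compactin_predual_bounded[OF A \<phi>]) blast
      obtain x0 where "x0 \<in> A" using unb by blast
      then have M0: "0 \<le> M" using M[of x0] by linarith
      define B' where "B' = (1/3)^n * M + B"
      have "0 \<le> B'" using M0 B by (simp add: B'_def)
      then obtain x' \<phi>' where "P (Suc n) (x', \<phi>', B')" using ex by blast
      moreover have "Q n s (x', \<phi>', B')"
        using M by (auto simp: Q_def s B'_def intro!: mult_left_mono)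
      ultimately show ?thesis by blast
    qed
    ultimately show ?thesis using that dependent_nat_choice[of P Q] by metis
  qed
  define x where "x n = fst (g n)" for n
  define \<phi> where "\<phi> n = fst (snd (g n))" for n
  define B where "B n = snd (snd (g n))" for n
  have g_eq: "g n = (x n, \<phi> n, B n)" for n by (simp add: x_def \<phi>_def B_def)
  have xA: "x n \<in> A" and \<phi>p: "predual_functional mnE pr N (\<phi> n)"
    and \<phi>n: "\<And>y. y \<in> Mn mnE N \<Longrightarrow> \<bar>\<phi> n y\<bar> \<le> ?n y" and \<phi>x: "3 / 4 * ?n (x n) \<le> \<phi> n (x n)"
    and B0: "0 \<le> B n" and xn: "real n + B n \<le> (1/3)^n / 4 * ?n (x n)" for n
    using g(1)[of n] by (auto simp: g_eq P_def \<Phi>_def)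
  have Bstep: "(1/3)^n * \<bar>\<phi> n y\<bar> + B n \<le> B (Suc n)" if "y \<in> A" for n y
    using g(2)[of n] that by (auto simp: g_eq Q_def)
  have Bsum: "(\<Sum>i<n. (1/3)^i * \<bar>\<phi> i y\<bar>) \<le> B n" if "y \<in> A" for n y
  proof (induction n)
    case (Suc n)
    then show ?case using Bstep[OF that, of n] by simp
  qed (simp add: B0)
  define \<Psi> where "\<Psi> y = (\<Sum>i. (1/3)^i * \<phi> i y)" for y
  have tail: "\<bar>\<Psi> y - (\<Sum>i<n. (1/3)^i * \<phi> i y)\<bar> \<le> (1/3)^n * (3/2) * ?n y" if y: "y \<in> Mn mnE N" for y n
  proof -
    have geo: "(\<lambda>i. (1/3 :: real)^i) sums (3/2)" using geometric_sums[of "1/3 :: real"] by simp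
    have le: "norm ((1/3)^i * \<phi> i y) \<le> (1/3)^i * ?n y" for i
      using \<phi>n[OF y, of i] by (simp add: abs_mult mult_left_mono)
    have s1: "summable (\<lambda>i. (1/3)^i * ?n y)" using geo by (intro summable_mult2) (simp add: sums_iff)
    have s2: "summable (\<lambda>i. (1/3)^i * \<phi> i y)"
      by (rule summable_comparison_test'[OF s1]) (rule le)
    have "\<Psi> y - (\<Sum>i<n. (1/3)^i * \<phi> i y) = (\<Sum>i. (1/3)^(i + n) * \<phi> (i + n) y)"
      unfolding \<Psi>_def using suminf_split_initial_segment[OF s2, of n] by simp
    also have "\<bar>\<dots>\<bar> \<le> (\<Sum>i. (1/3)^(i + n) * ?n y)"
    proof -
      have "summable (\<lambda>i. (1/3)^(i + n) * ?n y)" using s1 by (rule summable_ignore_initial_segment)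
      then show ?thesis
        using summable_norm_comparison_test[of "\<lambda>i. (1/3)^(i + n) * \<phi> (i + n) y"]
        by (intro norm_suminf_le[where 'a=real, simplified real_norm_def] le[simplified real_norm_def])
    qed
    also have "\<dots> = (1/3)^n * (3/2) * ?n y"
    proof -
      have "(\<lambda>i. (1/3)^i * ((1/3)^n * ?n y)) sums (3/2 * ((1/3)^n * ?n y))"
        using geo by (rule sums_mult2)
      then have "(\<Sum>i. (1/3)^i * ((1/3)^n * ?n y)) = 3/2 * ((1/3)^n * ?n y)" by (simp add: sums_iff)
      then show ?thesis by (simp add: power_add mult_ac)
    qed
    finally show ?thesis .
  qed
  \<comment> \<open>The tail estimate makes the series converge uniformly on balls, and the predual
    is closed under such limits.\<close>
  have "predual_functional mnE pr N \<Psi>"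
    unfolding predual_functional_def
  proof (intro allI impI)
    fix \<epsilon> :: real assume e: "\<epsilon> > 0"
    then have e2: "\<epsilon> / 2 > 0" by simp
    obtain n where n: "(1/3 :: real)^n < \<epsilon> / 3"
      using real_arch_pow_inv[of "\<epsilon> / 3" "1/3"] e by auto
    have part: "predual_functional mnE pr N (\<lambda>y. \<Sum>i<n. (1/3)^i * \<phi> i y)"
      by (intro predual_sum predual_scale \<phi>p)
    obtain S f where S: "finite S" "S \<subseteq> N \<times> N" "\<And>y. y \<in> Mn mnE N \<Longrightarrow>
        \<bar>(\<Sum>i<n. (1/3)^i * \<phi> i y) - (\<Sum>(p, q)\<in>S. pr (y p q) (f p q))\<bar> \<le> \<epsilon> / 2 * Mn_norm mnE N y"
      using part[unfolded predual_functional_def, rule_format, OF e2] by (elim exE conjE) (rule that, auto)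
    have "\<bar>\<Psi> y - (\<Sum>(p, q)\<in>S. pr (y p q) (f p q))\<bar> \<le> \<epsilon> * Mn_norm mnE N y" if y: "y \<in> Mn mnE N" for y
    proof -
      have "(1/3)^n * (3/2) * ?n y \<le> \<epsilon> / 2 * ?n y"
        using n by (intro mult_right_mono Mn_norm_nonneg[OF ruan_E y]) simp
      moreover have "\<epsilon> * ?n y = \<epsilon> / 2 * ?n y + \<epsilon> / 2 * ?n y" by simp
      ultimately show ?thesis using tail[OF y, of n] S(3)[OF y] by linarith
    qed
    then show "\<exists>S f. finite S \<and> S \<subseteq> N \<times> N \<and>
        (\<forall>x\<in>Mn mnE N. \<bar>\<Psi> x - (\<Sum>(p, q)\<in>S. pr (x p q) (f p q))\<bar> \<le> \<epsilon> * Mn_norm mnE N x)"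
      using S(1,2) by (intro exI[of _ S] exI[of _ f]) auto
  qed
  then obtain M where M: "\<And>y. y \<in> A \<Longrightarrow> \<bar>\<Psi> y\<bar> \<le> M"
    by (rule compactin_predual_bounded[OF A]) blast
  have "real n \<le> M" for n
  proof -
    have "\<bar>\<Psi> (x n) - (\<Sum>i<Suc n. (1/3)^i * \<phi> i (x n))\<bar> \<le> (1/3)^Suc n * (3/2) * ?n (x n)"
      using AM xA by (intro tail) blast
    also have "\<dots> = (1/3)^n / 2 * ?n (x n)" by simp
    finally have 1: "\<bar>\<Psi> (x n) - (\<Sum>i<Suc n. (1/3)^i * \<phi> i (x n))\<bar> \<le> (1/3)^n / 2 * ?n (x n)" .
    have "\<bar>\<Sum>i<n. (1/3)^i * \<phi> i (x n)\<bar> \<le> (\<Sum>i<n. (1/3)^i * \<bar>\<phi> i (x n)\<bar>)"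
      by (rule order_trans[OF sum_abs]) (simp add: abs_mult)
    also have "\<dots> \<le> B n" by (rule Bsum[OF xA])
    finally have 2: "\<bar>\<Sum>i<n. (1/3)^i * \<phi> i (x n)\<bar> \<le> B n" .
    have "(1/3)^n * (3 / 4 * ?n (x n)) \<le> (1/3)^n * \<phi> n (x n)"
      by (intro mult_left_mono \<phi>x) simp
    then have 3: "(1/3)^n / 2 * ?n (x n) + (1/3)^n / 4 * ?n (x n) \<le> (1/3)^n * \<phi> n (x n)"
      by (simp add: algebra_simps)
    have "(\<Sum>i<Suc n. (1/3)^i * \<phi> i (x n)) = (\<Sum>i<n. (1/3)^i * \<phi> i (x n)) + (1/3)^n * \<phi> n (x n)" by simp
    with 1 2 3 xn[of n] M[OF xA, of n] show ?thesis by linarith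
  qed
  then show False using reals_Archimedean2[of M] by (meson not_le)
qed

section \<open>Comparison of the weak* topology with pointwise convergence\<close>

lemma continuous_map_coordinates:
  assumes "\<And>z. continuous_map (wstar mnE pr N) euclideanreal (\<lambda>x. G x z)"
  shows "continuous_map (wstar mnE pr N) euclidean (G :: _ \<Rightarrow> 'z \<Rightarrow> real)"
proof -
  have "continuous_map (wstar mnE pr N) (product_topology (\<lambda>_. euclideanreal) UNIV) G"
    unfolding continuous_map_componentwise_UNIV using assms by blast
  then show ?thesis by (simp add: euclidean_product_topology)
qed

text \<open>An injective weak* continuous map into a product of real lines. It makes the weak*
  topology Hausdorff and carries weak* compact sets to closed sets, where membership is tested on
  finitely many coordinates.\<close>

definition entries :: "('k \<Rightarrow> 'k \<Rightarrow> 'e) \<Rightarrow> 'k \<times> 'k \<times> 'f \<Rightarrow> real" where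
  "entries x = (\<lambda>(p, q, f). pr (x p q) f)"

lemma continuous_map_entries: "continuous_map (wstar mnE pr N) euclidean entries"
proof (rule continuous_map_coordinates)
  fix z show "continuous_map (wstar mnE pr N) euclideanreal (\<lambda>x. entries x z)"
    using continuous_map_predual[OF predual_form[of N "basis (fst z)" "basis (fst (snd z))" "snd (snd z)"]]
    by (simp add: entries_def case_prod_unfold)
qed

lemma inj_entries: "inj entries"
proof (rule injI)
  fix x y :: "'k \<Rightarrow> 'k \<Rightarrow> 'e" assume "entries x = entries y"
  then have "pr (x p q) f = pr (y p q) f" for p q f
    by (metis (mono_tags, lifting) case_prod_conv entries_def)
  then show "x = y" by (intro ext pr_eqI)
qed

lemma compactin_closed_entries:
  assumes "compactin (wstar mnE pr N) A"
  shows "closed (entries ` A)"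
  using compactin_imp_closedin[OF Hausdorff_space_fun image_compactin[OF assms continuous_map_entries]]
  by simp

lemma Hausdorff_wstar: "Hausdorff_space (wstar mnE pr N)"
  by (rule Hausdorff_space_injective_preimage[OF _ continuous_map_entries])
    (auto intro: inj_on_subset[OF inj_entries] simp: Hausdorff_space_fun)

lemma closedin_compact_preimage:
  assumes A: "compactin (wstar mnE pr N) A" and C: "closed C"
    and G: "\<And>z. continuous_map (wstar mnE pr N) euclideanreal (\<lambda>x. G x z)"
  shows "closedin (wstar mnE pr N) {x \<in> A. (G x :: 'z \<Rightarrow> real) \<in> C}"
proof -
  have "closedin (wstar mnE pr N) {x \<in> topspace (wstar mnE pr N). G x \<in> C}"
    using continuous_map_coordinates[of N G] G C by (intro closedin_continuous_map_preimage) auto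
  moreover have "closedin (wstar mnE pr N) A"
    by (rule compactin_imp_closedin[OF Hausdorff_wstar A])
  ultimately have "closedin (wstar mnE pr N) ({x \<in> topspace (wstar mnE pr N). G x \<in> C} \<inter> A)"
    by (rule closedin_Int)
  moreover have "{x \<in> topspace (wstar mnE pr N). G x \<in> C} \<inter> A = {x \<in> A. G x \<in> C}"
    using compactin_subset_topspace[OF A] by blast
  ultimately show ?thesis by simp
qed

end

section \<open>One norm bound for all levels\<close>

lemma UNIV_in_cardinals: "(UNIV :: 'k set) \<in> cardinals"
proof -
  have "ofilter |UNIV :: 'k set| UNIV"
    by (auto simp: ofilter_def Field_card_of)
  moreover have "|underS |UNIV :: 'k set| a| <o |UNIV :: 'k set|" for a
    by (rule card_of_underS[OF card_of_Card_order]) (simp add: Field_card_of)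
  ultimately show ?thesis by (simp add: cardinals_def)
qed

context dual_pair
begin

text \<open>Compactness bounds each level separately. To get one constant, \<open>x\<close> is moved
  to the top level as a direct sum of \<kappa> copies of itself; being a compression of that sum, it
  has no larger norm.\<close>

lemma compact_nc_convex_bounded:
  fixes K :: "('k, 'e) graded"
  assumes K: "compact_nc_convex mnE pr K" and inf: "infinite (UNIV :: 'k set)"
  obtains C where "0 \<le> C" "\<And>d x. (d, x) \<in> K \<Longrightarrow> Mn_norm mnE d x \<le> C"
proof -
  have K': "closed_under_direct_sums mnE pr K" "K \<subseteq> nc_matrices mnE"
    and comp: "compactin (wstar mnE pr UNIV) (K `` {UNIV})"
    using K UNIV_in_cardinals by (auto simp: compact_nc_convex_def nc_convex_def)
  obtain C where C: "\<And>x. x \<in> K `` {UNIV} \<Longrightarrow> Mn_norm mnE UNIV x \<le> C"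
    by (rule compactin_norm_bounded[OF comp]) blast
  have "Mn_norm mnE d x \<le> \<bar>C\<bar>" if dx: "(d, x) \<in> K" for d x
  proof -
    have xM: "x \<in> Mn mnE d" using dx K'(2) by (auto simp: nc_matrices_def)
    obtain y T where yT: "(UNIV, y) \<in> K" "\<And>i :: 'k. bounded_linear (T i)"
      "\<And>i j v w. inner (T i v) (T j w) = (if i = j then inner (proj d v) (proj d w) else 0)"
      "\<And>i j v w. form y (T i v) (T j w) = (if i = j then form x v w else 0)"
      by (rule direct_sum[OF K' inf UNIV_in_cardinals dx order_refl]) blast
    have yC: "Mn_norm mnE UNIV y \<le> \<bar>C\<bar>" using C[of y] yT(1) by auto
    have yM: "y \<in> Mn mnE UNIV" using yT(1) K'(2) by (auto simp: nc_matrices_def)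
    let ?T = "T undefined"
    have "norm (?T v) \<le> norm v" for v
      using yT(3)[of undefined v undefined v] norm_proj_le[of d v] by (simp add: norm_eq_sqrt_inner)
    then have le: "sqrt (\<Sum>k<r. (norm (?T (v k)))\<^sup>2) \<le> sqrt (\<Sum>k<r. (norm (v k))\<^sup>2)" for v :: "nat \<Rightarrow> 'k ell2" and r :: nat
      by (intro real_sqrt_le_mono sum_mono power_mono) auto
    have "cb_bound \<bar>C\<bar> x"
      unfolding cb_bound_def
    proof (intro conjI allI impI)
      fix r f and v w :: "nat \<Rightarrow> 'k ell2" assume f: "mnF r f \<le> 1"
      have "\<bar>\<Sum>k<r. \<Sum>l<r. pr (form x (v k) (w l)) (f k l)\<bar>
          = \<bar>\<Sum>k<r. \<Sum>l<r. pr (form y (?T (v k)) (?T (w l))) (f k l)\<bar>" by (simp add: yT(4))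
      also have "\<dots> \<le> Mn_norm mnE UNIV y * sqrt (\<Sum>k<r. (norm (?T (v k)))\<^sup>2) * sqrt (\<Sum>k<r. (norm (?T (w k)))\<^sup>2)"
        by (rule cb_boundD[OF Mn_cb_bound[OF yM] f])
      also have "\<dots> \<le> \<bar>C\<bar> * sqrt (\<Sum>k<r. (norm (v k))\<^sup>2) * sqrt (\<Sum>k<r. (norm (w k))\<^sup>2)"
        by (intro mult_mono yC le mult_nonneg_nonneg) (auto simp: sum_nonneg)
      finally show "\<bar>\<Sum>k<r. \<Sum>l<r. pr (form x (v k) (w l)) (f k l)\<bar>
          \<le> \<bar>C\<bar> * sqrt (\<Sum>k<r. (norm (v k))\<^sup>2) * sqrt (\<Sum>k<r. (norm (w k))\<^sup>2)" .
    qed simp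
    then show ?thesis
      by (rule Mn_cbI(2)[OF _ bounded_form_E[OF xM], rotated]) (rule Mn_zero[OF xM])
  qed
  then show thesis by (intro that[of "\<bar>C\<bar>"]) auto
qed

end

section \<open>The cone of a graded set\<close>

lemma closure_fun_add:
  fixes D D' :: "'z \<Rightarrow> real"
  assumes "D \<in> closure S" "D' \<in> closure S'" and R: "\<And>s s'. s \<in> S \<Longrightarrow> s' \<in> S' \<Longrightarrow> (\<lambda>z. s z + s' z) \<in> R"
  shows "(\<lambda>z. D z + D' z) \<in> closure R"
  unfolding closure_fun_iff
proof (intro allI impI)
  fix Q :: "'z set" and \<epsilon> :: real assume Q: "finite Q" and "\<epsilon> > 0"
  then have e: "\<epsilon> / 2 > 0" by simp
  obtain s where s: "s \<in> S" "\<forall>q\<in>Q. \<bar>s q - D q\<bar> < \<epsilon> / 2"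
    using assms(1) Q e unfolding closure_fun_iff by blast
  obtain s' where s': "s' \<in> S'" "\<forall>q\<in>Q. \<bar>s' q - D' q\<bar> < \<epsilon> / 2"
    using assms(2) Q e unfolding closure_fun_iff by blast
  have "\<bar>s q + s' q - (D q + D' q)\<bar> < \<epsilon>" if "q \<in> Q" for q
  proof -
    have "\<bar>s q - D q\<bar> < \<epsilon> / 2" "\<bar>s' q - D' q\<bar> < \<epsilon> / 2" using s(2) s'(2) that by auto
    then show ?thesis by linarith
  qed
  then show "\<exists>s\<in>R. \<forall>q\<in>Q. \<bar>s q - (D q + D' q)\<bar> < \<epsilon>"
    using R[OF s(1) s'(1)] by (intro bexI[of _ "\<lambda>z. s z + s' z"]) auto
qed

lemma closure_fun_scale:
  fixes D :: "'z \<Rightarrow> real"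
  assumes "D \<in> closure S" and R: "\<And>s. s \<in> S \<Longrightarrow> (\<lambda>z. c * s z) \<in> R"
  shows "(\<lambda>z. c * D z) \<in> closure R"
  unfolding closure_fun_iff
proof (intro allI impI)
  fix Q :: "'z set" and \<epsilon> :: real assume Q: "finite Q" and "\<epsilon> > 0"
  then have e: "\<epsilon> / (\<bar>c\<bar> + 1) > 0" by simp
  obtain s where s: "s \<in> S" "\<forall>q\<in>Q. \<bar>s q - D q\<bar> < \<epsilon> / (\<bar>c\<bar> + 1)"
    using assms(1) Q e unfolding closure_fun_iff by blast
  have "\<bar>c * s q - c * D q\<bar> < \<epsilon>" if "q \<in> Q" for q
  proof -
    have "\<bar>c * s q - c * D q\<bar> = \<bar>c\<bar> * \<bar>s q - D q\<bar>" by (simp add: abs_mult[symmetric] right_diff_distrib)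
    also have "\<dots> \<le> (\<bar>c\<bar> + 1) * \<bar>s q - D q\<bar>" by (intro mult_right_mono) auto
    also have "\<dots> < (\<bar>c\<bar> + 1) * (\<epsilon> / (\<bar>c\<bar> + 1))" using s(2) that by (intro mult_strict_left_mono) auto
    also have "\<dots> = \<epsilon>" by simp
    finally show ?thesis .
  qed
  then show "\<exists>s\<in>R. \<forall>q\<in>Q. \<bar>s q - c * D q\<bar> < \<epsilon>"
    using R[OF s(1)] by (intro bexI[of _ "\<lambda>z. c * s z"]) auto
qed

lemma closure_fun_comp:
  fixes D :: "'z \<Rightarrow> real" and h :: "'y \<Rightarrow> 'z"
  assumes "D \<in> closure S" and R: "\<And>s. s \<in> S \<Longrightarrow> (\<lambda>z. s (h z)) \<in> R"
  shows "(\<lambda>z. D (h z)) \<in> closure R"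
  unfolding closure_fun_iff
proof (intro allI impI)
  fix Q :: "'y set" and \<epsilon> :: real assume "finite Q" and e: "\<epsilon> > 0"
  then have "finite (h ` Q)" by simp
  then obtain s where s: "s \<in> S" "\<forall>q\<in>h ` Q. \<bar>s q - D q\<bar> < \<epsilon>"
    using assms(1) e unfolding closure_fun_iff by blast
  then show "\<exists>s\<in>R. \<forall>q\<in>Q. \<bar>s q - D (h q)\<bar> < \<epsilon>"
    using R[OF s(1)] by (intro bexI[of _ "\<lambda>z. s (h z)"]) auto
qed

lemma closure_fun_limit:
  fixes L :: "'z \<Rightarrow> real"
  assumes "F \<noteq> bot" "eventually (\<lambda>i. D i \<in> closure S) F" "\<And>z. ((\<lambda>i. D i z) \<longlongrightarrow> L z) F"
  shows "L \<in> closure S"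
  unfolding closure_fun_iff
proof (intro allI impI)
  fix Q :: "'z set" and \<epsilon> :: real assume Q: "finite Q" and "\<epsilon> > 0"
  then have e: "\<epsilon> / 2 > 0" by simp
  have "eventually (\<lambda>i. \<forall>q\<in>Q. dist (D i q) (L q) < \<epsilon> / 2) F"
    using Q by (intro eventually_ball_finite ballI tendstoD assms(3) e) 
  with assms(2) have "eventually (\<lambda>i. D i \<in> closure S \<and> (\<forall>q\<in>Q. dist (D i q) (L q) < \<epsilon> / 2)) F"
    by eventually_elim auto
  then obtain i where i: "D i \<in> closure S" "\<forall>q\<in>Q. dist (D i q) (L q) < \<epsilon> / 2"
    using assms(1) eventually_happens by blast
  then obtain s where s: "s \<in> S" "\<forall>q\<in>Q. \<bar>s q - D i q\<bar> < \<epsilon> / 2"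
    using Q e unfolding closure_fun_iff by blast
  have "\<bar>s q - L q\<bar> < \<epsilon>" if "q \<in> Q" for q
  proof -
    have "\<bar>s q - D i q\<bar> < \<epsilon> / 2" "\<bar>D i q - L q\<bar> < \<epsilon> / 2"
      using s(2) i(2) that by (auto simp: dist_real_def)
    then show ?thesis by linarith
  qed
  then show "\<exists>s\<in>S. \<forall>q\<in>Q. \<bar>s q - L q\<bar> < \<epsilon>" using s(1) by blast
qed

lemma form_of_bilinear:
  fixes B :: "'k ell2 \<Rightarrow> 'k ell2 \<Rightarrow> 'b::banach"
  assumes B: "bounded_bilinear B"
  shows "form (\<lambda>p q. B (basis p) (basis q)) v w = B v w"
proof -
  obtain K where K: "0 \<le> K" "\<And>v w. norm (B v w) \<le> norm v * norm w * K"
    using bounded_bilinear.nonneg_bounded[OF B] by blast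
  have "norm (B v w) \<le> K * norm v * norm w" for v w using K(2)[of v w] by (simp add: mult_ac)
  then show ?thesis by (rule bounded_form_of_bilinear(2)[OF B _ K(1)])
qed

text \<open>Substituting \<open>B\<close> into both vector slots is the passage from a pair
  \<open>(a, b)\<close> of forms to \<open>(B\<^sup>T a B, B\<^sup>T b B)\<close>.\<close>

definition pull :: "('a \<Rightarrow> 'b) \<Rightarrow> 'a \<times> 'a \<times> 'g \<Rightarrow> 'b \<times> 'b \<times> 'g" where
  "pull B = (\<lambda>(v, w, g). (B v, B w, g))"

section \<open>Pairs attached to points, and the cone that they generate\<close>

context dual_pair
begin

text \<open>The pair \<open>(u\<^sup>Tu, u\<^sup>Txu)\<close> as a real function: the index \<open>None\<close> records \<open>u\<^sup>Tu\<close>, and \<open>Some f\<close> the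
  pairing of \<open>u\<^sup>Txu\<close> with the predual element \<open>f\<close>.  On such functions the topology of pointwise
  convergence replaces the weak* topology.\<close>

definition datum :: "('k ell2 \<Rightarrow> 'k ell2) \<Rightarrow> ('k \<Rightarrow> 'k \<Rightarrow> 'e) \<Rightarrow> 'k ell2 \<times> 'k ell2 \<times> 'f option \<Rightarrow> real" where
  "datum u x = (\<lambda>(v, w, g). case g of None \<Rightarrow> inner (u v) (u w) | Some f \<Rightarrow> pr (form x (u v) (u w)) f)"

lemma datum_simps [simp]:
  "datum u x (v, w, None) = inner (u v) (u w)"
  "datum u x (v, w, Some f) = pr (form x (u v) (u w)) f"
  by (simp_all add: datum_def)

text \<open>The operator \<open>u\<close> maps into the level of the point and is otherwise
  arbitrary: neither an isometry nor a contraction, and not tied to a particular source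
  level.\<close>

definition datums :: "('k, 'e) graded \<Rightarrow> ('k ell2 \<times> 'k ell2 \<times> 'f option \<Rightarrow> real) set" where
  "datums S = {datum u x |u d x. (d, x) \<in> S \<and> bounded_linear u \<and> (\<forall>v. supp_in d (u v))}"

definition datum_cone :: "('k, 'e) graded \<Rightarrow> ('k ell2 \<times> 'k ell2 \<times> 'f option \<Rightarrow> real) set" where
  "datum_cone S = {\<lambda>z. \<Sum>i<r. D i z |(r :: nat) D. \<forall>i<r. D i \<in> datums S}"

lemma datumsI: "(d, x) \<in> S \<Longrightarrow> bounded_linear u \<Longrightarrow> (\<And>v. supp_in d (u v)) \<Longrightarrow> datum u x \<in> datums S"
  unfolding datums_def by blast

lemma datumsE:
  assumes "D \<in> datums S"
  obtains u d x where "D = datum u x" "(d, x) \<in> S" "bounded_linear u" "\<And>v. supp_in d (u v)"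
  using assms unfolding datums_def by blast

lemma coneI: "(\<And>i. i < r \<Longrightarrow> D i \<in> datums S) \<Longrightarrow> (\<lambda>z. \<Sum>i<r. D i z) \<in> datum_cone S" for r :: nat
  unfolding datum_cone_def by blast

lemma coneE:
  assumes "D \<in> datum_cone S"
  obtains r :: nat and Ds where "D = (\<lambda>z. \<Sum>i<r. Ds i z)" "\<And>i. i < r \<Longrightarrow> Ds i \<in> datums S"
  using assms unfolding datum_cone_def by blast

lemma cone_finite_sum:
  fixes I :: "'i set"
  assumes "finite I" "\<And>i. i \<in> I \<Longrightarrow> D i \<in> datums S"
  shows "(\<lambda>z. \<Sum>i\<in>I. D i z) \<in> datum_cone S"
proof -
  obtain \<sigma> :: "nat \<Rightarrow> 'i" and m where \<sigma>: "inj_on \<sigma> {..<m}" "\<sigma> ` {..<m} = I"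
    by (rule finite_enumeration[OF assms(1)])
  have "(\<lambda>z. \<Sum>i<m. D (\<sigma> i) z) \<in> datum_cone S"
    using \<sigma>(2) by (intro coneI assms(2)) auto
  moreover have "(\<Sum>i<m. D (\<sigma> i) z) = (\<Sum>i\<in>I. D i z)" for z
    using sum.reindex[OF \<sigma>(1), of "\<lambda>i. D i z"] by (simp add: \<sigma>(2))
  ultimately show ?thesis by simp
qed

lemma datums_cone: "D \<in> datums S \<Longrightarrow> D \<in> datum_cone S"
  using coneI[of 1 "\<lambda>_. D" S] by simp

lemma cone_zero: "(\<lambda>_. 0) \<in> datum_cone S"
  using coneI[of 0 _ S] by simp

lemma cone_add:
  assumes "D \<in> datum_cone S" "D' \<in> datum_cone S"
  shows "(\<lambda>z. D z + D' z) \<in> datum_cone S"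
proof -
  obtain r :: nat and Ds where D: "D = (\<lambda>z. \<Sum>i<r. Ds i z)" "\<And>i. i < r \<Longrightarrow> Ds i \<in> datums S"
    using assms(1) by (rule coneE) (rule that)
  obtain r' :: nat and Ds' where D': "D' = (\<lambda>z. \<Sum>i<r'. Ds' i z)" "\<And>i. i < r' \<Longrightarrow> Ds' i \<in> datums S"
    using assms(2) by (rule coneE) (rule that)
  have "(\<lambda>z. \<Sum>j\<in>{..<r} <+> {..<r'}. (case j of Inl i \<Rightarrow> Ds i | Inr i \<Rightarrow> Ds' i) z) \<in> datum_cone S"
    using D(2) D'(2) by (intro cone_finite_sum) auto
  then show ?thesis by (simp add: D(1) D'(1) sum.Plus)
qed

lemma cone_scale:
  assumes "D \<in> datum_cone S" "0 \<le> c"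
  shows "(\<lambda>z. c * D z) \<in> datum_cone S"
proof -
  obtain r :: nat and Ds where D: "D = (\<lambda>z. \<Sum>i<r. Ds i z)" "\<And>i. i < r \<Longrightarrow> Ds i \<in> datums S"
    using assms(1) by (rule coneE) (rule that)
  have "(\<lambda>z. c * Ds i z) \<in> datums S" if i: "i < r" for i
  proof -
    obtain u d x where u: "Ds i = datum u x" "(d, x) \<in> S" "bounded_linear u" "\<And>v. supp_in d (u v)"
      using D(2)[OF i] by (rule datumsE) blast
    \<comment> \<open>A datum is quadratic in \<open>u\<close>, so scaling it by \<open>c\<close>
      means scaling \<open>u\<close> by the square root.\<close>
    have lin: "bounded_linear (\<lambda>v. sqrt c *\<^sub>R u v)"
      by (rule bounded_linear_compose[OF bounded_linear_scaleR_right u(3)])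
    have sq: "sqrt c * t * sqrt c = c * t" for t
    proof -
      have "sqrt c * t * sqrt c = (sqrt c)\<^sup>2 * t" by (simp add: power2_eq_square)
      then show ?thesis using assms(2) by simp
    qed
    have sc: "form x (sqrt c *\<^sub>R a) (sqrt c *\<^sub>R b) = c *\<^sub>R form x a b" for a b
    proof -
      have inner: "(\<Sum>\<^sub>\<infinity>j. coord (sqrt c *\<^sub>R b) j *\<^sub>R x i j) = sqrt c *\<^sub>R (\<Sum>\<^sub>\<infinity>j. coord b j *\<^sub>R x i j)" for i
        by (simp add: infsum_scaleR_right flip: scaleR_scaleR)
      have "form x (sqrt c *\<^sub>R a) (sqrt c *\<^sub>R b)
          = (\<Sum>\<^sub>\<infinity>i. c *\<^sub>R (coord a i *\<^sub>R (\<Sum>\<^sub>\<infinity>j. coord b j *\<^sub>R x i j)))"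
        unfolding form_def inner by (simp only: coord_scaleR scaleR_scaleR sq)
      also have "\<dots> = c *\<^sub>R form x a b" by (simp only: infsum_scaleR_right form_def)
      finally show ?thesis .
    qed
    have "(\<lambda>z. c * Ds i z) = datum (\<lambda>v. sqrt c *\<^sub>R u v) x"
    proof
      fix z show "c * Ds i z = datum (\<lambda>v. sqrt c *\<^sub>R u v) x z"
        using assms(2) by (cases z; cases "snd (snd z)") (auto simp: u(1) sc pr.scaleR_left)
    qed
    then show ?thesis using datumsI[OF u(2) lin] u(4) by (auto intro: supp_in_scaleR)
  qed
  then have "(\<lambda>z. \<Sum>i<r. c * Ds i z) \<in> datum_cone S" by (rule coneI)
  then show ?thesis by (simp add: D(1) sum_distrib_left)
qed

lemma cone_pull:
  assumes "D \<in> datum_cone S" and B: "bounded_linear B"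
  shows "(\<lambda>z. D (pull B z)) \<in> datum_cone S"
proof -
  obtain r :: nat and Ds where D: "D = (\<lambda>z. \<Sum>i<r. Ds i z)" "\<And>i. i < r \<Longrightarrow> Ds i \<in> datums S"
    using assms(1) by (rule coneE) (rule that)
  have "(\<lambda>z. Ds i (pull B z)) \<in> datums S" if i: "i < r" for i
  proof -
    obtain u d x where u: "Ds i = datum u x" "(d, x) \<in> S" "bounded_linear u" "\<And>v. supp_in d (u v)"
      using D(2)[OF i] by (rule datumsE) blast
    have "(\<lambda>z. Ds i (pull B z)) = datum (\<lambda>v. u (B v)) x"
      by (auto simp: u(1) datum_def pull_def fun_eq_iff)
    then show ?thesis using datumsI[OF u(2) bounded_linear_compose[OF u(3) B]] u(4) by auto
  qed
  then have "(\<lambda>z. \<Sum>i<r. Ds i (pull B z)) \<in> datum_cone S" by (rule coneI)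
  then show ?thesis by (simp add: D(1))
qed

lemma closure_cone_add: "D \<in> closure (datum_cone S) \<Longrightarrow> D' \<in> closure (datum_cone S) \<Longrightarrow> (\<lambda>z. D z + D' z) \<in> closure (datum_cone S)"
  by (erule (1) closure_fun_add) (rule cone_add)

lemma closure_cone_scale: "D \<in> closure (datum_cone S) \<Longrightarrow> 0 \<le> c \<Longrightarrow> (\<lambda>z. c * D z) \<in> closure (datum_cone S)"
  by (erule closure_fun_scale) (rule cone_scale)

lemma closure_cone_pull:
  "D \<in> closure (datum_cone S) \<Longrightarrow> bounded_linear B \<Longrightarrow> (\<lambda>z. D (pull B z)) \<in> closure (datum_cone S)"
  by (erule closure_fun_comp) (rule cone_pull)

lemma closure_cone_sum:
  "finite I \<Longrightarrow> (\<And>i. i \<in> I \<Longrightarrow> D i \<in> closure (datum_cone S)) \<Longrightarrow> (\<lambda>z. \<Sum>i\<in>I. D i z) \<in> closure (datum_cone S)"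
proof (induction I rule: finite_induct)
  case empty
  show ?case using cone_zero[of S] closure_subset by auto
next
  case (insert i I)
  then show ?case by (simp add: closure_cone_add)
qed

lemma form_proj:
  assumes "x \<in> Mn mnE N"
  shows "form x (proj N v) (proj N w) = form x v w"
proof (rule bounded_bilinear_eq_on_basis[where B = "\<lambda>v w. form x (proj N v) (proj N w)" and B' = "form x"])
  interpret bx: bounded_bilinear "form x" by (rule bilinear_form_E[OF assms])
  show "bounded_bilinear (\<lambda>v w. form x (proj N v) (proj N w))"
    by (rule bx.comp[OF bounded_linear_proj bounded_linear_proj])
  show "form x (proj N (basis p)) (proj N (basis q)) = form x (basis p) (basis q)" for p q
    by (auto simp: proj_basis bx.zero_left bx.zero_right Mn_zero[OF assms])
qed (rule bilinear_form_E[OF assms])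

text \<open>The competitor for the closed nc convex hull of \<open>X\<close>. The operator
  \<open>proj n\<close> is the identity of level \<open>n\<close>, so the first component is
  normalized here; cutting with \<open>K\<close> brings in the compactness of the levels.\<close>

definition cone_hull :: "('k, 'e) graded \<Rightarrow> ('k, 'e) graded \<Rightarrow> ('k, 'e) graded" where
  "cone_hull K X = {(n, x). (n, x) \<in> K \<and> datum (proj n) x \<in> closure (datum_cone X)}"

text \<open>With \<open>B i\<close> the adjoint of the isometry, the datum of \<open>y\<close> is
  the pointwise limit over finite \<open>J\<close> of sums of the data of \<open>x i\<close> with
  \<open>B i\<close> substituted. The first components converge because the ranges of the isometries
  fill the level, the second because \<open>y\<close> is the weak* limit. The closed cone is stable
  under all these operations.\<close>

lemma cone_hull_direct_sums:
  fixes K X :: "('k, 'e) graded"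
  assumes K: "nc_convex mnE pr K"
  shows "closed_under_direct_sums mnE pr (cone_hull K X)"
  unfolding closed_under_direct_sums_def
proof (intro ballI allI impI)
  fix n and I :: "'k set" and d x \<alpha> and y :: "'k \<Rightarrow> 'k \<Rightarrow> 'e"
  assume n: "n \<in> cardinals" and *: "(\<forall>i\<in>I. (d i, x i) \<in> cone_hull K X \<and> \<alpha> i \<in> isometries n (d i)) \<and>
      (\<exists>C. \<forall>i\<in>I. Mn_norm mnE (d i) (x i) \<le> C) \<and>
      limitin (wstar_real n) (\<lambda>J p q. \<Sum>i\<in>J. lmul (d i) (\<alpha> i) (mtrans (\<alpha> i)) p q)
        (idmat n) (finite_subsets_at_top I) \<and>
      limitin (wstar mnE pr n) (\<lambda>J p q. \<Sum>i\<in>J. sandwich (d i) (\<alpha> i) (x i) (mtrans (\<alpha> i)) p q)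
        y (finite_subsets_at_top I)"
  have xK: "(d i, x i) \<in> K" and xD: "datum (proj (d i)) (x i) \<in> closure (datum_cone X)"
    and \<alpha>: "\<alpha> i \<in> isometries n (d i)" if "i \<in> I" for i
    using * that by (auto simp: cone_hull_def)
  have lim1: "limitin (wstar_real n) (\<lambda>J p q. \<Sum>i\<in>J. lmul (d i) (\<alpha> i) (mtrans (\<alpha> i)) p q)
        (idmat n) (finite_subsets_at_top I)"
    and lim2: "limitin (wstar mnE pr n) (\<lambda>J p q. \<Sum>i\<in>J. sandwich (d i) (\<alpha> i) (x i) (mtrans (\<alpha> i)) p q)
        y (finite_subsets_at_top I)"
    using * by auto
  have KM: "K \<subseteq> nc_matrices mnE" and Kds: "closed_under_direct_sums mnE pr K"
    using K by (auto simp: nc_convex_def)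
  have yK: "(n, y) \<in> K"
    using Kds[unfolded closed_under_direct_sums_def, rule_format, OF n, of I d x \<alpha> y] * xK by blast
  have xM: "x i \<in> Mn mnE (d i)" if "i \<in> I" for i
    using xK[OF that] KM by (auto simp: nc_matrices_def)
  have yM: "y \<in> Mn mnE n" using yK KM by (auto simp: nc_matrices_def)
  have "\<exists>T. bounded_linear T \<and> (\<forall>v. T (proj (d i) v) = T v) \<and> \<alpha> i = mat (d i) T" if "i \<in> I" for i
    by (rule isometry_operator[OF \<alpha>[OF that]]) blast
  then obtain T where T: "\<And>i. i \<in> I \<Longrightarrow> bounded_linear (T i)" "\<And>i v. i \<in> I \<Longrightarrow> T i (proj (d i) v) = T i v"
    "\<And>i. i \<in> I \<Longrightarrow> \<alpha> i = mat (d i) (T i)" by metis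
  define B where "B i = adj (T i)" for i
  have B: "bounded_linear (B i)" if "i \<in> I" for i
    unfolding B_def by (rule bounded_linear_adj[OF T(1)[OF that]])
  have projB: "proj (d i) (B i v) = B i v" if i: "i \<in> I" for i v
  proof -
    have "inner u (proj (d i) (B i v)) = inner u (B i v)" for u
      by (simp only: B_def inner_proj[symmetric] adj[OF T(1)[OF i], symmetric] T(2)[OF i])
    then show ?thesis using vector_eq_ldot by blast
  qed
  have \<alpha>_eq: "\<alpha> i = (\<lambda>p j. coord (B i (basis p)) j)" if i: "i \<in> I" for i
    unfolding T(3)[OF i] mat_columns[OF T(2)[OF i] T(1)[OF i]] B_def
    by (simp add: coord_adj T(1)[OF i])
  have tr_eq: "mtrans (\<alpha> i) = (\<lambda>j p. coord (B i (basis p)) j)" if i: "i \<in> I" for i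
    by (simp add: \<alpha>_eq[OF i] mtrans_def)
  define a where "a J p q = (\<Sum>i\<in>J. lmul (d i) (\<alpha> i) (mtrans (\<alpha> i)) p q)" for J p q
  define s where "s J p q = (\<Sum>i\<in>J. sandwich (d i) (\<alpha> i) (x i) (mtrans (\<alpha> i)) p q)" for J p q
  have form_a: "form (a J) v w = (\<Sum>i\<in>J. inner (B i v) (B i w))" if J: "J \<subseteq> I" for J v w
  proof -
    have lw: "lmul (d i) (\<alpha> i) (mtrans (\<alpha> i)) p q = inner (B i (basis p)) (B i (basis q))"
      if "i \<in> J" for i p q
    proof -
      have i: "i \<in> I" using that J by blast
      show ?thesis
        unfolding tr_eq[OF i] unfolding \<alpha>_eq[OF i] by (simp add: lmul_inner projB[OF i])
    qed
    then have eq: "a J = (\<lambda>p q. \<Sum>i\<in>J. inner (B i (basis p)) (B i (basis q)))"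
      unfolding a_def by (intro ext sum.cong refl)
    have bil: "bounded_bilinear (\<lambda>v w. \<Sum>i\<in>J. inner (B i v) (B i w))"
      using J by (intro bounded_bilinear_sum bounded_bilinear.comp[OF bounded_bilinear_inner] B) auto
    show ?thesis unfolding eq by (rule form_of_bilinear[OF bil])
  qed
  have form_s: "form (s J) v w = (\<Sum>i\<in>J. form (x i) (B i v) (B i w))" if J: "J \<subseteq> I" for J v w
  proof -
    have sw: "sandwich (d i) (\<alpha> i) (x i) (mtrans (\<alpha> i)) p q = form (x i) (B i (basis p)) (B i (basis q))"
      if "i \<in> J" for i p q
    proof -
      have i: "i \<in> I" using that J by blast
      show ?thesis
        unfolding tr_eq[OF i] unfolding \<alpha>_eq[OF i] by (rule sandwich_form) (rule Mn_zero[OF xM[OF i]])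
    qed
    then have eq: "s J = (\<lambda>p q. \<Sum>i\<in>J. form (x i) (B i (basis p)) (B i (basis q)))"
      unfolding s_def by (intro ext sum.cong refl)
    have bil: "bounded_bilinear (\<lambda>v w. \<Sum>i\<in>J. form (x i) (B i v) (B i w))"
      using J by (intro bounded_bilinear_sum bounded_bilinear.comp[OF bilinear_form_E[OF xM]] B) auto
    show ?thesis unfolding eq by (rule form_of_bilinear[OF bil])
  qed
  have form_id: "form (idmat n) v w = inner (proj n v) (proj n w)" for v w :: "'k ell2"
  proof -
    have eq: "idmat n = (\<lambda>p q. inner (proj n (basis p)) (proj n (basis q :: 'k ell2)))"
      by (auto simp: idmat_def fun_eq_iff proj_basis)
    show ?thesis
      unfolding eq by (rule form_of_bilinear[OF bounded_bilinear.comp[OF bounded_bilinear_inner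
            bounded_linear_proj bounded_linear_proj]])
  qed
  have "datum (proj n) y \<in> closure (datum_cone X)"
  proof (rule closure_fun_limit)
    show "finite_subsets_at_top I \<noteq> bot" by simp
    show "eventually (\<lambda>J. (\<lambda>z. \<Sum>i\<in>J. datum (proj (d i)) (x i) (pull (B i) z)) \<in> closure (datum_cone X))
        (finite_subsets_at_top I)"
      by (intro eventually_finite_subsets_at_top_weakI closure_cone_sum closure_cone_pull xD B) auto
    fix z :: "'k ell2 \<times> 'k ell2 \<times> 'f option"
    obtain v w g where z: "z = (v, w, g)" by (cases z)
    show "((\<lambda>J. \<Sum>i\<in>J. datum (proj (d i)) (x i) (pull (B i) z)) \<longlongrightarrow> datum (proj n) y z) (finite_subsets_at_top I)"
    proof (cases g)
      case None
      have "((\<lambda>J. form (a J) v w * 1) \<longlongrightarrow> form (idmat n) v w * 1) (finite_subsets_at_top I)"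
        by (rule wstar_limitD[OF ruan_bound_real_mn predual_functional_form[OF ruan_bound_real_mn bounded_bilinear_mult]])
          (use lim1 in \<open>simp add: a_def[abs_def]\<close>)
      then have "((\<lambda>J. form (a J) v w) \<longlongrightarrow> datum (proj n) y z) (finite_subsets_at_top I)"
        by (simp add: z None form_id)
      then show ?thesis
      proof (rule Lim_transform_eventually, intro eventually_finite_subsets_at_top_weakI)
        fix J assume J: "finite J" "J \<subseteq> I"
        show "form (a J) v w = (\<Sum>i\<in>J. datum (proj (d i)) (x i) (pull (B i) z))"
          unfolding form_a[OF J(2)] by (intro sum.cong refl) (use J(2) projB in \<open>simp add: z None pull_def subset_iff\<close>)
      qed
    next
      case (Some f)
      have "((\<lambda>J. pr (form (s J) v w) f) \<longlongrightarrow> pr (form y v w) f) (finite_subsets_at_top I)"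
        by (rule wstar_limitD[OF ruan_E predual_form]) (use lim2 in \<open>simp add: s_def[abs_def]\<close>)
      then have "((\<lambda>J. pr (form (s J) v w) f) \<longlongrightarrow> datum (proj n) y z) (finite_subsets_at_top I)"
        by (simp add: z Some form_proj[OF yM])
      then show ?thesis
      proof (rule Lim_transform_eventually, intro eventually_finite_subsets_at_top_weakI)
        fix J assume J: "finite J" "J \<subseteq> I"
        show "pr (form (s J) v w) f = (\<Sum>i\<in>J. datum (proj (d i)) (x i) (pull (B i) z))"
          unfolding form_s[OF J(2)] pr.sum_left
          by (intro sum.cong refl) (use J(2) projB in \<open>simp add: z Some pull_def subset_iff\<close>)
      qed
    qed
  qed
  with yK show "(n, y) \<in> cone_hull K X" by (simp add: cone_hull_def)
qed

lemma compression_form: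
  fixes x :: "'k \<Rightarrow> 'k \<Rightarrow> 'e" and T :: "'k ell2 \<Rightarrow> 'k ell2"
  assumes x: "x \<in> Mn mnE n" and T: "bounded_linear T" "\<And>v. T (proj m v) = T v"
  shows "sandwich n (mtrans (mat m T)) x (mat m T) = (\<lambda>p q. form x (T (basis p)) (T (basis q)))"
proof -
  have eq: "mat m T = (\<lambda>j q. coord (T (basis q)) j)" by (rule mat_columns[OF T(2,1)])
  show ?thesis
    unfolding eq mtrans_def by (intro ext sandwich_form) (rule Mn_zero[OF x])
qed

text \<open>Substituting an isometry into the datum of \<open>x\<close> yields the datum of the
  compression: the first component remains an identity because the isometry preserves inner
  products.\<close>

lemma cone_hull_compressions:
  fixes K X :: "('k, 'e) graded"
  assumes K: "nc_convex mnE pr K"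
  shows "closed_under_compressions (cone_hull K X)"
  unfolding closed_under_compressions_def
proof (intro ballI allI impI)
  fix n m :: "'k set" and x \<beta> assume nm: "n \<in> cardinals" "m \<in> cardinals" and *: "(n, x) \<in> cone_hull K X \<and> \<beta> \<in> isometries n m"
  have KM: "K \<subseteq> nc_matrices mnE" and Kc: "closed_under_compressions K"
    using K by (auto simp: nc_convex_def)
  have xK: "(n, x) \<in> K" and xD: "datum (proj n) x \<in> closure (datum_cone X)" using * by (auto simp: cone_hull_def)
  have xM: "x \<in> Mn mnE n" using xK KM by (auto simp: nc_matrices_def)
  obtain T where T: "bounded_linear T" "\<And>v. supp_in n (T v)" "\<And>v. T (proj m v) = T v" "\<beta> = mat m T"
    "\<And>v w. inner (T v) (T w) = inner (proj m v) (proj m w)"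
    by (rule isometry_operator[of \<beta> n m]) (use * in auto)
  define y where "y = sandwich n (mtrans \<beta>) x \<beta>"
  have yK: "(m, y) \<in> K"
    using Kc[unfolded closed_under_compressions_def, rule_format, OF nm, of x \<beta>] * xK by (simp add: y_def)
  then have yM: "y \<in> Mn mnE m" using KM by (auto simp: nc_matrices_def)
  have form_y: "form y v w = form x (T v) (T w)" for v w
    unfolding y_def T(4) compression_form[OF xM T(1,3)]
    by (rule form_of_bilinear[OF bounded_bilinear.comp[OF bilinear_form_E[OF xM] T(1) T(1)]])
  have "datum (proj m) y = (\<lambda>z. datum (proj n) x (pull T z))"
  proof
    fix z show "datum (proj m) y z = datum (proj n) x (pull T z)"
      by (cases z; cases "snd (snd z)") (auto simp: pull_def proj_id T form_y)
  qed
  then have "datum (proj m) y \<in> closure (datum_cone X)" using closure_cone_pull[OF xD T(1)] by simp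
  with yK show "(m, sandwich n (mtrans \<beta>) x \<beta>) \<in> cone_hull K X" by (simp add: cone_hull_def y_def)
qed

text \<open>Minimality of the hull, tested against \<open>cone_hull\<close>. Its levels are closed
  because those of \<open>K\<close> are weak* compact and \<open>datum (proj n)\<close> is
  continuous into the product topology.\<close>

lemma hull_in_closure_cone:
  fixes K X :: "('k, 'e) graded"
  assumes K: "compact_nc_convex mnE pr K" and X: "X \<subseteq> K" and hull: "closed_nc_hull mnE pr X = K"
    and nx: "(n, x) \<in> K"
  shows "datum (proj n) x \<in> closure (datum_cone X)"
proof -
  have ncK: "nc_convex mnE pr K" and comp: "\<And>n. n \<in> cardinals \<Longrightarrow> compactin (wstar mnE pr n) (K `` {n})"
    using K by (auto simp: compact_nc_convex_def)
  have "closedin (wstar mnE pr n) (cone_hull K X `` {n})" if n: "n \<in> cardinals" for n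
  proof -
    have "continuous_map (wstar mnE pr n) euclideanreal (\<lambda>x. datum (proj n) x z)" for z
    proof (cases "snd (snd z)")
      case None
      then show ?thesis by (cases z) simp
    next
      case (Some f)
      then show ?thesis by (cases z) (simp add: continuous_map_predual[OF predual_form])
    qed
    then have "closedin (wstar mnE pr n) {x \<in> K `` {n}. datum (proj n) x \<in> closure (datum_cone X)}"
      by (intro closedin_compact_preimage comp n closed_closure)
    moreover have "{x \<in> K `` {n}. datum (proj n) x \<in> closure (datum_cone X)} = cone_hull K X `` {n}"
      by (auto simp: cone_hull_def)
    ultimately show ?thesis by simp
  qed
  moreover have "nc_convex mnE pr (cone_hull K X)"
    using ncK cone_hull_direct_sums[OF ncK] cone_hull_compressions[OF ncK]
    by (auto simp: nc_convex_def cone_hull_def)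
  ultimately have "closed_nc_convex mnE pr (cone_hull K X)" by (simp add: closed_nc_convex_def)
  moreover have "X \<subseteq> cone_hull K X"
  proof
    fix z assume z: "z \<in> X"
    obtain n x where "z = (n, x)" by (cases z)
    then show "z \<in> cone_hull K X"
      using z X datums_cone[OF datumsI[of n x X "proj n"]] closure_subset[of "datum_cone X"]
      by (auto simp: cone_hull_def bounded_linear_proj)
  qed
  ultimately have "K \<subseteq> cone_hull K X" using hull unfolding closed_nc_hull_def by blast
  with nx show ?thesis by (auto simp: cone_hull_def)
qed

end

section \<open>Realizing limit data in the convex set\<close>

text \<open>Gram-Schmidt with error control, one vector at a time. The tolerance \<delta> is chosen
  before the vectors, since these are found only after the required precision is known; staying in
  their span keeps the new vectors orthogonal to the spare ones added later.\<close>

lemma gram_perturb: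
  fixes P :: "'i set"
  assumes "finite P" "0 < \<epsilon>"
  shows "\<exists>\<delta>>0. \<forall>u :: 'i \<Rightarrow> 'b::real_inner.
    (\<forall>p\<in>P. \<forall>q\<in>P. \<bar>inner (u p) (u q) - (if p = q then 1 else 0)\<bar> < \<delta>) \<longrightarrow>
    (\<exists>t. (\<forall>p\<in>P. \<forall>q\<in>P. inner (t p) (t q) = (if p = q then 1 else 0)) \<and>
         (\<forall>p\<in>P. norm (t p - u p) < \<epsilon> \<and> t p \<in> span (u ` P)))"
  using assms
proof (induction P arbitrary: \<epsilon> rule: finite_induct)
  case empty
  show ?case by (intro exI[of _ 1]) auto
next
  case (insert a P)
  define m where "m = real (card P)"
  \<comment> \<open>The new vector moves by at most \<open>\<delta> + 2 * norm \<rho>\<close>, where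
    \<open>norm \<rho> \<le> 3 * m * \<epsilon>1\<close>, hence by at most
    \<open>\<epsilon>1 * (1 + 6 * m)\<close>. The minimum with 1 keeps \<open>s\<close> away from
    zero, so that it can be normalized.\<close>
  define \<epsilon>1 where "\<epsilon>1 = min \<epsilon> 1 / (2 * (1 + 6 * m))"
  have m0: "0 \<le> m" by (simp add: m_def)
  have e1: "\<epsilon>1 > 0" using insert.prems m0 by (simp add: \<epsilon>1_def)
  have e1b: "\<epsilon>1 * (1 + 6 * m) = min \<epsilon> 1 / 2"
    using m0 by (simp add: \<epsilon>1_def field_simps)
  have e1c: "\<epsilon>1 \<le> min \<epsilon> 1 / 2"
    unfolding e1b[symmetric] using e1 m0 by (simp add: mult_le_cancel_left1)
  obtain \<delta>1 where d1: "\<delta>1 > 0" "\<And>u :: 'i \<Rightarrow> 'b.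
    (\<forall>p\<in>P. \<forall>q\<in>P. \<bar>inner (u p) (u q) - (if p = q then 1 else 0)\<bar> < \<delta>1) \<Longrightarrow>
    (\<exists>t. (\<forall>p\<in>P. \<forall>q\<in>P. inner (t p) (t q) = (if p = q then 1 else 0)) \<and>
         (\<forall>p\<in>P. norm (t p - u p) < \<epsilon>1 \<and> t p \<in> span (u ` P)))"
    using insert.IH[OF e1] by blast
  define \<delta> where "\<delta> = min \<delta>1 \<epsilon>1"
  have d: "\<delta> > 0" "\<delta> \<le> \<delta>1" "\<delta> \<le> \<epsilon>1" using d1 e1 by (auto simp: \<delta>_def)
  show ?case
  proof (intro exI[of _ \<delta>] conjI d(1) allI impI)
    fix u :: "'i \<Rightarrow> 'b"
    assume u: "\<forall>p\<in>insert a P. \<forall>q\<in>insert a P. \<bar>inner (u p) (u q) - (if p = q then 1 else 0)\<bar> < \<delta>"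
    then have "\<forall>p\<in>P. \<forall>q\<in>P. \<bar>inner (u p) (u q) - (if p = q then 1 else 0)\<bar> < \<delta>1"
      using d(2) by force
    from d1(2)[OF this] obtain t where t: "\<And>p q. p \<in> P \<Longrightarrow> q \<in> P \<Longrightarrow> inner (t p) (t q) = (if p = q then 1 else 0)"
      "\<And>p. p \<in> P \<Longrightarrow> norm (t p - u p) < \<epsilon>1" "\<And>p. p \<in> P \<Longrightarrow> t p \<in> span (u ` P)" by blast
    have ua: "\<bar>(norm (u a))\<^sup>2 - 1\<bar> < \<delta>" using u by (auto simp: power2_norm_eq_inner)
    have "\<bar>norm (u a) - 1\<bar> \<le> \<bar>norm (u a) - 1\<bar> * (norm (u a) + 1)"
      by (simp add: mult_le_cancel_left1)
    also have "\<dots> = \<bar>(norm (u a))\<^sup>2 - 1\<bar>"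
    proof -
      have "(norm (u a))\<^sup>2 - 1 = (norm (u a) - 1) * (norm (u a) + 1)" by (simp add: power2_eq_square algebra_simps)
      then show ?thesis by (simp add: abs_mult)
    qed
    finally have na: "\<bar>norm (u a) - 1\<bar> < \<delta>" using ua by linarith
    have na2: "norm (u a) \<le> 2" using na d e1c by linarith
    \<comment> \<open>The component of the new vector along those already treated.\<close>
    define \<rho> where "\<rho> = (\<Sum>p\<in>P. inner (u a) (t p) *\<^sub>R t p)"
    have ip: "\<bar>inner (u a) (t p)\<bar> \<le> 3 * \<epsilon>1" if p: "p \<in> P" for p
    proof -
      have "a \<noteq> p" using p insert.hyps by blast
      then have "\<bar>inner (u a) (u p)\<bar> < \<delta>" using u p by force
      moreover have "\<bar>inner (u a) (t p - u p)\<bar> \<le> 2 * \<epsilon>1"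
        using Cauchy_Schwarz_ineq2[of "u a" "t p - u p"] na2 t(2)[OF p] e1
          mult_mono[of "norm (u a)" 2 "norm (t p - u p)" \<epsilon>1] by simp
      moreover have "inner (u a) (t p) = inner (u a) (u p) + inner (u a) (t p - u p)"
        by (simp add: inner_diff_right)
      ultimately show ?thesis using d(3) by linarith
    qed
    have "norm \<rho> \<le> (\<Sum>p\<in>P. 3 * \<epsilon>1)"
      unfolding \<rho>_def
    proof (rule sum_norm_le)
      fix p assume p: "p \<in> P"
      have "norm (t p) = 1" using t(1)[OF p p] by (simp add: norm_eq_sqrt_inner)
      then show "norm (inner (u a) (t p) *\<^sub>R t p) \<le> 3 * \<epsilon>1" using ip[OF p] by simp
    qed
    then have nr: "norm \<rho> \<le> 3 * m * \<epsilon>1" by (simp add: m_def)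
    define s where "s = u a - \<rho>"
    have ns: "\<bar>norm s - 1\<bar> \<le> \<delta> + norm \<rho>"
      using na norm_triangle_ineq3[of "u a - \<rho>" "u a"] unfolding s_def by simp
    have tot: "\<delta> + 2 * norm \<rho> \<le> min \<epsilon> 1 / 2"
      unfolding e1b[symmetric] using nr d(3) by (simp add: algebra_simps)
    have s0: "norm s > 0" using ns tot norm_ge_zero[of \<rho>] by linarith
    define ta where "ta = (1 / norm s) *\<^sub>R s"
    have st: "inner s (t q) = 0" if q: "q \<in> P" for q
    proof -
      have "inner \<rho> (t q) = (\<Sum>p\<in>P. if p = q then inner (u a) (t p) else 0)"
        unfolding \<rho>_def inner_sum_left using t(1) q by (intro sum.cong) auto
      also have "\<dots> = inner (u a) (t q)" using insert.hyps(1) q by simp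
      finally show ?thesis by (simp add: s_def inner_diff_left)
    qed
    have "norm (ta - s) = \<bar>1 - norm s\<bar>"
    proof -
      have "ta - s = (1 / norm s - 1) *\<^sub>R s" by (simp add: ta_def scaleR_diff_left)
      also have "norm \<dots> = \<bar>(1 / norm s - 1) * norm s\<bar>" using s0 by (simp add: abs_mult)
      also have "(1 / norm s - 1) * norm s = 1 - norm s" using s0 by (simp add: left_diff_distrib)
      finally show ?thesis .
    qed
    moreover have "norm (s - u a) = norm \<rho>" by (simp add: s_def)
    ultimately have "norm (ta - u a) \<le> \<delta> + 2 * norm \<rho>"
      using norm_triangle_ineq[of "ta - s" "s - u a"] ns by simp
    then have nta: "norm (ta - u a) < \<epsilon>" using tot insert.prems by linarith
    have sub: "span (u ` P) \<subseteq> span (u ` insert a P)" by (intro span_mono) auto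
    have "t p \<in> span (u ` insert a P)" if "p \<in> P" for p using t(3)[OF that] sub by blast
    then have "ta \<in> span (u ` insert a P)"
      unfolding ta_def s_def \<rho>_def
      by (intro span_scale span_diff span_sum) (auto intro: span_base)
    moreover have "norm (t p - u p) < \<epsilon>" if "p \<in> P" for p
      using t(2)[OF that] e1c insert.prems by linarith
    moreover have "inner ta ta = 1"
      using s0 by (simp add: ta_def power2_norm_eq_inner[symmetric] power2_eq_square)
    moreover have "inner ta (t q) = 0" "inner (t q) ta = 0" if "q \<in> P" for q
      using st[OF that] by (simp_all add: ta_def inner_commute)
    ultimately show "\<exists>t. (\<forall>p\<in>insert a P. \<forall>q\<in>insert a P. inner (t p) (t q) = (if p = q then 1 else 0)) \<and>
         (\<forall>p\<in>insert a P. norm (t p - u p) < \<epsilon> \<and> t p \<in> span (u ` insert a P))"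
      using t(1,3) nta sub insert.hyps(2) by (intro exI[of _ "t(a := ta)"]) auto
  qed
qed

lemma orthonormal_operator:
  fixes g :: "'k \<Rightarrow> 'k ell2"
  assumes g: "\<And>p q. p \<in> N \<Longrightarrow> q \<in> N \<Longrightarrow> inner (g p) (g q) = (if p = q then 1 else 0)"
  obtains V where "bounded_linear V" "\<And>v. V (proj N v) = V v" "\<And>p. p \<in> N \<Longrightarrow> V (basis p) = g p"
    "\<And>p. p \<notin> N \<Longrightarrow> V (basis p) = 0" "\<And>v. norm (V v) = norm (proj N v)"
proof -
  define h where "h p = (if p \<in> N then g p else 0)" for p
  have bound: "norm (\<Sum>p\<in>J. c p *\<^sub>R h p) \<le> 1 * sqrt (\<Sum>p\<in>J. (c p)\<^sup>2)" if J: "finite J" for J c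
  proof -
    have "(norm (\<Sum>p\<in>J. c p *\<^sub>R h p))\<^sup>2 = (\<Sum>p\<in>J. \<Sum>q\<in>J. c p * (c q * inner (h p) (h q)))"
      by (simp add: power2_norm_eq_inner inner_sum_left inner_sum_right sum_distrib_left inner_commute
          mult.left_commute)
    also have "\<dots> = (\<Sum>p\<in>J. \<Sum>q\<in>J. if p = q then (if p \<in> N then (c p)\<^sup>2 else 0) else 0)"
      by (intro sum.cong refl) (auto simp: h_def g power2_eq_square)
    also have "\<dots> = (\<Sum>p\<in>J. if p \<in> N then (c p)\<^sup>2 else 0)" using J by simp
    also have "\<dots> \<le> (\<Sum>p\<in>J. (c p)\<^sup>2)" by (intro sum_mono) auto
    finally show ?thesis by (simp add: real_le_rsqrt)
  qed
  define V where "V v = (\<Sum>\<^sub>\<infinity>p. coord v p *\<^sub>R h p)" for v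
  have lin: "bounded_linear V" unfolding V_def by (rule ell2_extension(2)[OF bound])
  have Vb: "V (basis p) = h p" for p unfolding V_def by (rule infsum_basis)
  have "V (proj N v) = V v" for v
    using bounded_linear_eq_on_basis[OF bounded_linear_compose[OF lin bounded_linear_proj] lin, of N v]
    by (auto simp: proj_basis Vb h_def linear_0[OF bounded_linear.linear[OF lin]])
  moreover have "inner (V v) (V w) = inner (proj N v) (proj N w)" for v w
  proof (rule bounded_bilinear_eq_on_basis[where B = "\<lambda>v w. inner (V v) (V w)"
        and B' = "\<lambda>v w. inner (proj N v) (proj N w)"])
    show "bounded_bilinear (\<lambda>v w. inner (V v) (V w))"
      by (rule bounded_bilinear.comp[OF bounded_bilinear_inner lin lin])
    show "bounded_bilinear (\<lambda>v w. inner (proj N v) (proj N w))"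
      by (rule bounded_bilinear.comp[OF bounded_bilinear_inner bounded_linear_proj bounded_linear_proj])
  qed (auto simp: Vb h_def g proj_basis)
  then have "norm (V v) = norm (proj N v)" for v by (simp add: norm_eq_sqrt_inner)
  ultimately show thesis using that lin Vb by (simp add: h_def)
qed

context dual_pair
begin

text \<open>A sum of data is a single datum of a direct sum. The sum runs over all \<kappa> indices,
  with the given \<open>x0\<close> in every block but \<open>r\<close> of them; these extra blocks
  provide the \<kappa> many orthonormal vectors \<open>b\<close> orthogonal to the range of
  \<open>U\<close>.\<close>

lemma direct_sum_finite:
  fixes K :: "('k, 'e) graded"
  assumes K: "compact_nc_convex mnE pr K" and inf: "infinite (UNIV :: 'k set)" and nx: "(n, x0) \<in> K"
    and Ds: "\<And>i. i < (r :: nat) \<Longrightarrow> Ds i \<in> datums K"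
  obtains y U b where "(UNIV, y) \<in> K" "\<And>v w. (\<Sum>i<r. Ds i (v, w, None)) = inner (U v) (U w)"
    "\<And>v w f. (\<Sum>i<r. Ds i (v, w, Some f)) = pr (form y (U v) (U w)) f"
    "\<And>p q :: 'k. inner (b p) (b q) = (if p = q then 1 else 0)" "\<And>p v. inner (U v) (b p) = 0"
proof -
  have K': "closed_under_direct_sums mnE pr K" "K \<subseteq> nc_matrices mnE"
    using K by (auto simp: compact_nc_convex_def nc_convex_def)
  obtain C where C: "\<And>d x. (d, x) \<in> K \<Longrightarrow> Mn_norm mnE d x \<le> C"
    by (rule compact_nc_convex_bounded[OF K inf]) blast
  have "\<exists>u d x. Ds i = datum u x \<and> (d, x) \<in> K \<and> bounded_linear u \<and> (\<forall>v. supp_in d (u v))" if "i < r" for i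
    using Ds[OF that] by (rule datumsE) blast
  then obtain u d x where udx: "\<And>i. i < r \<Longrightarrow> Ds i = datum (u i) (x i)" "\<And>i. i < r \<Longrightarrow> (d i, x i) \<in> K"
    "\<And>i v. i < r \<Longrightarrow> supp_in (d i) (u i v)" by metis
  obtain e :: "nat \<Rightarrow> 'k" where e: "inj e" using infinite_countable_subset[OF inf] by blast
  define d' where "d' k = (if k \<in> e ` {..<r} then d (inv e k) else n)" for k
  define x' where "x' k = (if k \<in> e ` {..<r} then x (inv e k) else x0)" for k
  have d'K: "(d' k, x' k) \<in> K" for k
    using udx(2) nx e by (auto simp: d'_def x'_def)
  obtain y T where y: "(UNIV, y) \<in> K" "\<And>i. bounded_linear (T i)"
    "\<And>i j v w. inner (T i v) (T j w) = (if i = j then inner (proj (d' i) v) (proj (d' i) w) else 0)"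
    "\<And>i j v w. form y (T i v) (T j w) = (if i = j then form (x' i) v w else 0)"
    by (rule direct_sum[where d = d' and x = x', OF K' inf UNIV_in_cardinals d'K C[OF d'K]]) blast
  have yM: "y \<in> Mn mnE UNIV" using y(1) K'(2) by (auto simp: nc_matrices_def)
  interpret by': bounded_bilinear "form y" by (rule bilinear_form_E[OF yM])
  have de: "d' (e i) = d i" "x' (e i) = x i" if "i < r" for i
    using that e by (auto simp: d'_def x'_def)
  define U where "U v = (\<Sum>i<r. T (e i) (u i v))" for v
  have e_eq: "e i = e j \<longleftrightarrow> i = j" for i j using e by (auto dest: injD)
  have "(\<Sum>i<r. Ds i (v, w, None)) = inner (U v) (U w)" for v w
  proof -
    have "inner (U v) (U w) = (\<Sum>i<r. \<Sum>j<r. if i = j then inner (proj (d' (e i)) (u i v)) (proj (d' (e i)) (u j w)) else 0)"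
      by (simp add: U_def inner_sum_left inner_sum_right y(3) e_eq sum.swap[of _ "{..<r}" "{..<r}"])
    also have "\<dots> = (\<Sum>i<r. inner (proj (d' (e i)) (u i v)) (proj (d' (e i)) (u i w)))"
      by simp
    also have "\<dots> = (\<Sum>i<r. Ds i (v, w, None))"
      by (intro sum.cong refl) (simp add: de udx(1,3) proj_id)
    finally show ?thesis by simp
  qed
  moreover have "(\<Sum>i<r. Ds i (v, w, Some f)) = pr (form y (U v) (U w)) f" for v w f
  proof -
    have "form y (U v) (U w) = (\<Sum>i<r. form y (T (e i) (u i v)) (U w))"
      by (simp only: U_def[of v] by'.sum_left)
    also have "\<dots> = (\<Sum>i<r. \<Sum>j<r. if i = j then form (x' (e i)) (u i v) (u j w) else 0)"
      by (simp only: U_def[of w] by'.sum_right y(4) e_eq)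
    also have "\<dots> = (\<Sum>i<r. form (x i) (u i v) (u i w))"
      by (simp add: de)
    finally show ?thesis by (simp add: pr.sum_left udx(1))
  qed
  moreover obtain b where "\<And>p q :: 'k. inner (b p) (b q) = (if p = q then 1 else 0 :: real)"
    "\<And>p v. inner (U v) (b p) = 0"
  proof -
    \<comment> \<open>A shift along \<open>e\<close>, as in Hilbert's hotel: it embeds the whole
      index type into the complement of the first \<open>r\<close> values of
      \<open>e\<close>.\<close>
    define h where "h k = (if k \<in> range e then e (inv e k + r) else k)" for k
    have h: "inj h" "range h \<subseteq> UNIV - e ` {..<r}"
    proof -
      have h1: "h (e i) = e (i + r)" for i using e by (simp add: h_def)
      have h2: "h k = k" if "k \<notin> range e" for k using that by (simp add: h_def)
      show "inj h"
      proof (rule injI)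
        fix k l assume kl: "h k = h l"
        show "k = l"
        proof (cases "k \<in> range e"; cases "l \<in> range e")
          assume "k \<in> range e" "l \<in> range e"
          then obtain i j where "k = e i" "l = e j" by blast
          then show ?thesis using kl by (simp add: h1 e_eq)
        next
          assume k: "k \<in> range e" "l \<notin> range e"
          then obtain i where "k = e i" by blast
          then have "l = e (i + r)" using kl by (simp add: h1 h2[OF k(2)])
          then show ?thesis using k(2) by blast
        next
          assume k: "k \<notin> range e" "l \<in> range e"
          then obtain i where "l = e i" by blast
          then have "k = e (i + r)" using kl by (simp add: h1 h2[OF k(1)])
          then show ?thesis using k(1) by blast
        qed (use kl h2 in auto)
      qed
      show "range h \<subseteq> UNIV - e ` {..<r}"
      proof safe
        fix k i assume i: "h k = e i" "i < r"
        show False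
        proof (cases "k \<in> range e")
          case True
          then obtain j where "k = e j" by blast
          then show False using i by (simp add: h1 e_eq)
        next
          case False
          then show False using i h2 by auto
        qed
      qed simp
    qed
    have "n \<in> cardinals" using nx K'(2) by (auto simp: nc_matrices_def)
    then obtain p0 where p0: "p0 \<in> n" by (auto simp: cardinals_def)
    have dh: "d' (h p) = n" for p using h(2) by (auto simp: d'_def)
    have he: "e i \<noteq> h p" if "i < r" for i p using h(2) that by blast
    show thesis
    proof (rule that[of "\<lambda>p. T (h p) (basis p0)"])
      show "inner (T (h p) (basis p0)) (T (h q) (basis p0)) = (if p = q then 1 else 0)" for p q
        using p0 inj_eq[OF h(1), of p q] by (simp add: y(3) dh proj_basis)
      show "inner (U v) (T (h p) (basis p0)) = 0" for p v
        using he by (simp add: U_def inner_sum_left y(3))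
    qed
  qed
  ultimately show thesis using y(1) by (intro that[of y U b])
qed

text \<open>Weak* compactness of the level reduces the claim to finitely many entries. There
  \<open>D\<close> is near a finite sum, thus near the datum of one point \<open>y\<close> of the
  top level. The vectors \<open>U (a p)\<close> that occur are nearly orthonormal; they are
  corrected, completed to an isometry from level \<open>n\<close>, and \<open>y\<close> is
  compressed by it.\<close>

lemma approx_point:
  fixes K :: "('k, 'e) graded" and a :: "'k \<Rightarrow> 'k ell2"
  assumes K: "compact_nc_convex mnE pr K" and inf: "infinite (UNIV :: 'k set)" and nx: "(n, x0) \<in> K"
    and D: "D \<in> closure (datum_cone K)"
    and gram: "\<And>p q. p \<in> n \<Longrightarrow> q \<in> n \<Longrightarrow> D (a p, a q, None) = (if p = q then 1 else 0)"
  obtains w where "(n, w) \<in> K" "\<And>p q f. p \<in> n \<Longrightarrow> q \<in> n \<Longrightarrow> pr (w p q) f = D (a p, a q, Some f)"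
proof -
  have KM: "K \<subseteq> nc_matrices mnE" and Kc: "closed_under_compressions K"
    and comp: "\<And>n. n \<in> cardinals \<Longrightarrow> compactin (wstar mnE pr n) (K `` {n})"
    using K by (auto simp: compact_nc_convex_def nc_convex_def)
  have n: "n \<in> cardinals" using nx KM by (auto simp: nc_matrices_def)
  obtain C where C: "0 \<le> C" "\<And>d x. (d, x) \<in> K \<Longrightarrow> Mn_norm mnE d x \<le> C"
    by (rule compact_nc_convex_bounded[OF K inf]) blast
  obtain L where L: "L > 0" "\<And>e f. norm (pr e f) \<le> norm e * norm f * L"
    using pr.pos_bounded by blast
  define W where "W = (\<lambda>(p, q, f). if p \<in> n \<and> q \<in> n then D (a p, a q, Some f) else 0)"
  have "W \<in> closure (entries ` (K `` {n}))"
    unfolding closure_fun_iff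
  proof (intro allI impI)
    fix Q :: "('k \<times> 'k \<times> 'f) set" and \<epsilon> :: real
    assume Q: "finite Q" and \<epsilon>: "\<epsilon> > 0"
    define P where "P = (fst ` Q \<union> (fst \<circ> snd) ` Q) \<inter> n"
    have P: "finite P" "P \<subseteq> n" using Q by (auto simp: P_def)
    define \<Phi> where "\<Phi> = 1 + (\<Sum>z\<in>Q. norm (snd (snd z)))"
    have \<Phi>0: "\<Phi> > 0" by (simp add: \<Phi>_def add_pos_nonneg sum_nonneg)
    have \<Phi>: "norm f \<le> \<Phi>" if "(p, q, f) \<in> Q" for p q f
      using member_le_sum[of "(p, q, f)" Q "\<lambda>z. norm (snd (snd z))"] that Q by (simp add: \<Phi>_def)
    \<comment> \<open>Moving the vectors by \<open>\<epsilon>'\<close> changes the relevant entries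
      by at most \<open>3 * (C + 1) * \<epsilon>' * \<Phi> * L\<close>, which is less than
      \<open>\<epsilon> / 2\<close>; the other half goes to the approximation of \<open>D\<close> by
      a finite sum.\<close>
    define \<epsilon>' where "\<epsilon>' = min 1 (\<epsilon> / (8 * ((C + 1) * \<Phi> * L)))"
    have CL: "(C + 1) * \<Phi> * L > 0" using C(1) \<Phi>0 L(1) by simp
    have e': "\<epsilon>' > 0" "\<epsilon>' \<le> 1" using \<epsilon> CL by (auto simp: \<epsilon>'_def)
    have e'': "\<epsilon>' * ((C + 1) * \<Phi> * L) \<le> \<epsilon> / 8"
    proof -
      have "\<epsilon>' * ((C + 1) * \<Phi> * L) \<le> \<epsilon> / (8 * ((C + 1) * \<Phi> * L)) * ((C + 1) * \<Phi> * L)"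
        using CL by (intro mult_right_mono) (auto simp: \<epsilon>'_def)
      moreover have "\<epsilon> / (8 * X) * X = \<epsilon> / 8" if "X > 0" for X using that by simp
      ultimately show ?thesis using CL by metis
    qed
    obtain \<delta> where \<delta>: "\<delta> > 0" "\<And>u :: 'k \<Rightarrow> 'k ell2.
      (\<forall>p\<in>P. \<forall>q\<in>P. \<bar>inner (u p) (u q) - (if p = q then 1 else 0)\<bar> < \<delta>) \<Longrightarrow>
      (\<exists>t. (\<forall>p\<in>P. \<forall>q\<in>P. inner (t p) (t q) = (if p = q then 1 else 0)) \<and>
         (\<forall>p\<in>P. norm (t p - u p) < \<epsilon>' \<and> t p \<in> span (u ` P)))"
      using gram_perturb[OF P(1) e'(1), where 'b="'k ell2"] by blast
    define \<delta>' where "\<delta>' = min \<delta> (\<epsilon> / 2)"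
    have \<delta>': "\<delta>' > 0" "\<delta>' \<le> \<delta>" "\<delta>' \<le> \<epsilon> / 2" using \<delta>(1) \<epsilon> by (auto simp: \<delta>'_def)
    define Z where "Z = (\<lambda>(p, q). (a p, a q, None)) ` (P \<times> P) \<union> (\<lambda>(p, q, f). (a p, a q, Some f)) ` Q"
    have "finite Z" using P(1) Q by (simp add: Z_def)
    then obtain s where s: "s \<in> datum_cone K" "\<forall>z\<in>Z. \<bar>s z - D z\<bar> < \<delta>'"
      using D \<delta>'(1) unfolding closure_fun_iff by blast
    obtain r :: nat and Ds where Ds: "s = (\<lambda>z. \<Sum>i<r. Ds i z)" "\<And>i. i < r \<Longrightarrow> Ds i \<in> datums K"
      using s(1) by (rule coneE) (rule that)
    obtain y U b where y: "(UNIV, y) \<in> K" "\<And>v w. (\<Sum>i<r. Ds i (v, w, None)) = inner (U v) (U w)"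
      "\<And>v w f. (\<Sum>i<r. Ds i (v, w, Some f)) = pr (form y (U v) (U w)) f"
      "\<And>p q :: 'k. inner (b p) (b q) = (if p = q then 1 else 0)" "\<And>p v. inner (U v) (b p) = 0"
      by (rule direct_sum_finite[OF K inf nx Ds(2)]) blast+
    define u where "u p = U (a p)" for p
    have gu: "\<forall>p\<in>P. \<forall>q\<in>P. \<bar>inner (u p) (u q) - (if p = q then 1 else 0)\<bar> < \<delta>"
    proof (intro ballI)
      fix p q assume pq: "p \<in> P" "q \<in> P"
      then have "(a p, a q, None) \<in> Z" by (force simp: Z_def)
      then have "\<bar>inner (u p) (u q) - D (a p, a q, None)\<bar> < \<delta>'" using s(2) by (auto simp: Ds(1) y(2) u_def)
      moreover have "D (a p, a q, None) = (if p = q then 1 else 0)"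
        using gram pq P(2) by blast
      ultimately have "\<bar>inner (u p) (u q) - (if p = q then 1 else 0)\<bar> < \<delta>'" by (simp only:)
      then show "\<bar>inner (u p) (u q) - (if p = q then 1 else 0)\<bar> < \<delta>"
        using \<delta>'(2) by (rule order.strict_trans2)
    qed
    obtain t where t: "\<And>p q. p \<in> P \<Longrightarrow> q \<in> P \<Longrightarrow> inner (t p) (t q) = (if p = q then 1 else 0)"
      "\<And>p. p \<in> P \<Longrightarrow> norm (t p - u p) < \<epsilon>'" "\<And>p. p \<in> P \<Longrightarrow> t p \<in> span (u ` P)"
      using \<delta>(2)[OF gu] by blast
    have tb: "inner (t p) (b q) = 0" if "p \<in> P" for p q
    proof -
      have "span (u ` P) \<subseteq> {v. inner v (b q) = 0}"
        by (rule span_minimal) (auto simp: u_def y(5) subspace_def inner_add_left)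
      then show ?thesis using t(3)[OF that] by blast
    qed
    \<comment> \<open>Only the values on \<open>P\<close> affect the entries in \<open>Q\<close>;
      elsewhere any orthonormal completion inside the top level will do.\<close>
    define g where "g p = (if p \<in> P then t p else b p)" for p
    have g: "inner (g p) (g q) = (if p = q then 1 else 0)" for p q
      using t(1) tb y(4) by (auto simp: g_def inner_commute)
    obtain V where V: "bounded_linear V" "\<And>v. V (proj n v) = V v" "\<And>p. p \<in> n \<Longrightarrow> V (basis p) = g p"
      "\<And>p. p \<notin> n \<Longrightarrow> V (basis p) = 0" "\<And>v. norm (V v) = norm (proj n v)"
      by (rule orthonormal_operator[of n g]) (use g in auto)
    have iso: "mat n V \<in> isometries UNIV n"
      by (rule mat_isometry[OF V(1)]) (auto simp: supp_in_def[of UNIV] V(5) proj_id)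
    have yM: "y \<in> Mn mnE UNIV" using y(1) KM by (auto simp: nc_matrices_def)
    define w where "w = sandwich UNIV (mtrans (mat n V)) y (mat n V)"
    have w: "(n, w) \<in> K"
      using Kc[unfolded closed_under_compressions_def, rule_format, OF UNIV_in_cardinals n] y(1) iso
      by (simp add: w_def)
    have wM: "w \<in> Mn mnE n" using w KM by (auto simp: nc_matrices_def)
    have w_eq: "w p q = form y (V (basis p)) (V (basis q))" for p q
      unfolding w_def compression_form[OF yM V(1,2)] by simp
    interpret by': bounded_bilinear "form y" by (rule bilinear_form_E[OF yM])
    have yle: "norm (form y v v') \<le> C * (norm v * norm v')" for v v'
    proof -
      have "norm (form y v v') \<le> Mn_norm mnE UNIV y * norm v * norm v'" by (rule norm_form_le[OF bounded_form_E[OF yM]])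
      also have "\<dots> \<le> C * norm v * norm v'" by (intro mult_right_mono C(2) y(1)) auto
      finally show ?thesis by simp
    qed
    have "\<bar>entries w z - W z\<bar> < \<epsilon>" if z: "z \<in> Q" for z
    proof -
      obtain p q f where zz: "z = (p, q, f)" by (cases z)
      show ?thesis
      proof (cases "p \<in> n \<and> q \<in> n")
        case False
        then have "w p q = 0" using Mn_zero[OF wM] by blast
        then show ?thesis using False \<epsilon> by (auto simp: zz entries_def W_def pr.zero_left)
      next
        case True
        then have pq: "p \<in> P" "q \<in> P" using z by (force simp: P_def zz)+
        have w1: "w p q = form y (t p) (t q)" using True pq by (simp add: w_eq V(3) g_def)
        have "(a p, a q, Some f) \<in> Z" using z by (force simp: Z_def zz)
        then have d1: "\<bar>pr (form y (u p) (u q)) f - D (a p, a q, Some f)\<bar> < \<epsilon> / 2"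
          using s(2) \<delta>'(3) by (fastforce simp: Ds(1) y(3) u_def)
        have nt: "norm (t p) = 1" if "p \<in> P" for p using t(1)[OF that that] by (simp add: norm_eq_sqrt_inner)
        have nu: "norm (u p) \<le> 2"
          using norm_triangle_ineq3[of "t p" "u p"] t(2)[OF pq(1)] nt[OF pq(1)] e'(2) by linarith
        have "norm (form y (t p) (t q) - form y (u p) (u q)) \<le> C * (\<epsilon>' * 1) + C * (2 * \<epsilon>')"
        proof -
          have "form y (t p) (t q) - form y (u p) (u q) = form y (t p - u p) (t q) + form y (u p) (t q - u q)"
            by (simp add: by'.diff_left by'.diff_right)
          then have "norm (form y (t p) (t q) - form y (u p) (u q))
              \<le> norm (form y (t p - u p) (t q)) + norm (form y (u p) (t q - u q))"
            by (metis norm_triangle_ineq)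
          also have "\<dots> \<le> C * (norm (t p - u p) * norm (t q)) + C * (norm (u p) * norm (t q - u q))"
            by (intro add_mono yle)
          also have "\<dots> \<le> C * (\<epsilon>' * 1) + C * (2 * \<epsilon>')"
            using t(2)[OF pq(1)] t(2)[OF pq(2)] nt[OF pq(2)] nu C(1) e'(1)
            by (intro add_mono mult_left_mono mult_mono) auto
          finally show ?thesis .
        qed
        then have le: "norm (form y (t p) (t q) - form y (u p) (u q)) \<le> 3 * ((C + 1) * \<epsilon>')"
          using e'(1) by (simp add: algebra_simps)
        have "\<bar>pr (form y (t p) (t q)) f - pr (form y (u p) (u q)) f\<bar>
            \<le> norm (form y (t p) (t q) - form y (u p) (u q)) * norm f * L"
          using L(2)[of "form y (t p) (t q) - form y (u p) (u q)" f] by (simp add: pr.diff_left)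
        also have "\<dots> \<le> 3 * ((C + 1) * \<epsilon>') * \<Phi> * L"
          using \<Phi>[of p q f] z zz L(1) C(1) e'(1) by (intro mult_right_mono mult_mono le) auto
        also have "\<dots> = 3 * (\<epsilon>' * ((C + 1) * \<Phi> * L))" by simp
        also have "\<dots> < \<epsilon> / 2" using e'' \<epsilon> by linarith
        finally have "\<bar>pr (w p q) f - pr (form y (u p) (u q)) f\<bar> < \<epsilon> / 2" unfolding w1 .
        then have "\<bar>pr (w p q) f - D (a p, a q, Some f)\<bar> < \<epsilon>" using d1 by linarith
        then show ?thesis using True by (simp add: zz entries_def W_def)
      qed
    qed
    then show "\<exists>s\<in>entries ` (K `` {n}). \<forall>q\<in>Q. \<bar>s q - W q\<bar> < \<epsilon>" using w by blast
  qed
  then have "W \<in> entries ` (K `` {n})"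
    using compactin_closed_entries[OF comp[OF n]] by simp
  then obtain w where w: "(n, w) \<in> K" "W = entries w" by blast
  have "pr (w p q) f = D (a p, a q, Some f)" if "p \<in> n" "q \<in> n" for p q f
    using fun_cong[OF w(2), of "(p, q, f)"] that by (simp add: W_def entries_def)
  with w(1) show thesis using that by blast
qed

end

section \<open>Purity of nc extreme points\<close>

context dual_pair
begin

section \<open>Limits of data as dominated bilinear forms\<close>

lemma datum_cone_bilinear:
  assumes "D \<in> datum_cone K" and K: "K \<subseteq> nc_matrices mnE"
  shows "D (v + v', w, g) = D (v, w, g) + D (v', w, g)" "D (v, w + w', g) = D (v, w, g) + D (v, w', g)"
    "D (t *\<^sub>R v, w, g) = t * D (v, w, g)" "D (v, t *\<^sub>R w, g) = t * D (v, w, g)"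
    "D (v, w, None) = D (w, v, None)" "0 \<le> D (v, v, None)"
proof -
  obtain r :: nat and Ds where D: "D = (\<lambda>z. \<Sum>i<r. Ds i z)" "\<And>i. i < r \<Longrightarrow> Ds i \<in> datums K"
    using assms(1) by (rule coneE) (rule that)
  have *: "Ds i (v + v', w, g) = Ds i (v, w, g) + Ds i (v', w, g)"
    "Ds i (v, w + w', g) = Ds i (v, w, g) + Ds i (v, w', g)"
    "Ds i (t *\<^sub>R v, w, g) = t * Ds i (v, w, g)" "Ds i (v, t *\<^sub>R w, g) = t * Ds i (v, w, g)"
    "Ds i (v, w, None) = Ds i (w, v, None)" "0 \<le> Ds i (v, v, None)" if i: "i < r" for i
  proof -
    obtain u d x where u: "Ds i = datum u x" "(d, x) \<in> K" "bounded_linear u"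
      using D(2)[OF i] by (rule datumsE) blast
    interpret u: bounded_linear u by fact
    have "x \<in> Mn mnE d" using u(2) K by (auto simp: nc_matrices_def)
    then interpret bx: bounded_bilinear "form x" by (rule bilinear_form_E)
    show "Ds i (v + v', w, g) = Ds i (v, w, g) + Ds i (v', w, g)"
      "Ds i (v, w + w', g) = Ds i (v, w, g) + Ds i (v, w', g)"
      "Ds i (t *\<^sub>R v, w, g) = t * Ds i (v, w, g)" "Ds i (v, t *\<^sub>R w, g) = t * Ds i (v, w, g)"
      "Ds i (v, w, None) = Ds i (w, v, None)" "0 \<le> Ds i (v, v, None)"
      by (cases g; simp add: u(1) u.add u.scaleR inner_add_left inner_add_right bx.add_left bx.add_right
          bx.scaleR_left bx.scaleR_right pr.add_left pr.scaleR_left inner_commute)+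
  qed
  show "D (v + v', w, g) = D (v, w, g) + D (v', w, g)" "D (v, w + w', g) = D (v, w, g) + D (v, w', g)"
    by (simp_all add: D(1) * flip: sum.distrib)
  show "D (t *\<^sub>R v, w, g) = t * D (v, w, g)" "D (v, t *\<^sub>R w, g) = t * D (v, w, g)"
    by (simp_all add: D(1) * sum_distrib_left)
  show "D (v, w, None) = D (w, v, None)"
    unfolding D(1) by (intro sum.cong refl) (simp add: *(5))
  show "0 \<le> D (v, v, None)"
    unfolding D(1) by (intro sum_nonneg) (simp add: *(6))
qed

text \<open>Cauchy-Schwarz twice, inside each summand and over the summands. Every component is
  controlled by the first one, so limits remain bounded and vanish wherever the first component
  does.\<close>

lemma datum_cone_bound:
  assumes "D \<in> datum_cone K" and K: "K \<subseteq> nc_matrices mnE"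
    and C: "\<And>d x. (d, x) \<in> K \<Longrightarrow> Mn_norm mnE d x \<le> C"
    and L: "\<And>e f. norm (pr e f) \<le> norm e * norm f * L" "0 \<le> L"
  shows "\<bar>D (v, w, g)\<bar> \<le> (case g of None \<Rightarrow> 1 | Some f \<Rightarrow> C * norm f * L) * sqrt (D (v, v, None)) * sqrt (D (w, w, None))"
proof -
  let ?M = "case g of None \<Rightarrow> 1 | Some f \<Rightarrow> C * norm f * L"
  obtain r :: nat and Ds where D: "D = (\<lambda>z. \<Sum>i<r. Ds i z)" "\<And>i. i < r \<Longrightarrow> Ds i \<in> datums K"
    using assms(1) by (rule coneE) (rule that)
  have "\<exists>u d x. Ds i = datum u x \<and> (d, x) \<in> K" if "i < r" for i
    using D(2)[OF that] by (rule datumsE) blast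
  then obtain u d x where u: "\<And>i. i < r \<Longrightarrow> Ds i = datum (u i) (x i)" "\<And>i. i < r \<Longrightarrow> (d i, x i) \<in> K" by metis
  have le: "\<bar>Ds i (v, w, g)\<bar> \<le> ?M * (norm (u i v) * norm (u i w))" if i: "i < r" for i
  proof (cases g)
    case None
    then show ?thesis using i Cauchy_Schwarz_ineq2 by (simp add: u(1))
  next
    case (Some f)
    have xM: "x i \<in> Mn mnE (d i)" using u(2)[OF i] K by (auto simp: nc_matrices_def)
    have "\<bar>Ds i (v, w, g)\<bar> \<le> norm (form (x i) (u i v) (u i w)) * norm f * L"
      using L(1)[of "form (x i) (u i v) (u i w)" f] by (simp add: u(1)[OF i] Some)
    also have "\<dots> \<le> (C * norm (u i v) * norm (u i w)) * norm f * L"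
    proof (intro mult_right_mono L(2) norm_ge_zero)
      have "norm (form (x i) (u i v) (u i w)) \<le> Mn_norm mnE (d i) (x i) * norm (u i v) * norm (u i w)"
        by (rule norm_form_le[OF bounded_form_E[OF xM]])
      also have "\<dots> \<le> C * norm (u i v) * norm (u i w)"
        by (intro mult_right_mono C u(2) i norm_ge_zero)
      finally show "norm (form (x i) (u i v) (u i w)) \<le> C * norm (u i v) * norm (u i w)" .
    qed
    finally show ?thesis by (simp add: Some mult_ac)
  qed
  have M0: "0 \<le> ?M" if "0 < r"
  proof (cases g)
    case (Some f)
    have "0 \<le> Mn_norm mnE (d 0) (x 0)"
      using u(2)[OF that] K by (intro Mn_norm_nonneg[OF ruan_E]) (auto simp: nc_matrices_def)
    then have "0 \<le> C" using C[OF u(2)[OF that]] by linarith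
    then show ?thesis using L(2) Some by simp
  qed simp
  have sq: "(\<Sum>i<r. Ds i (v, v, None)) = (\<Sum>i<r. (norm (u i v))\<^sup>2)" for v
    by (intro sum.cong refl) (simp add: u(1) power2_norm_eq_inner)
  have "\<bar>D (v, w, g)\<bar> \<le> (\<Sum>i<r. ?M * (norm (u i v) * norm (u i w)))"
    unfolding D(1) by (rule order_trans[OF sum_abs]) (intro sum_mono, simp add: le)
  also have "\<dots> = ?M * (\<Sum>i<r. norm (u i v) * norm (u i w))" by (simp add: sum_distrib_left)
  also have "\<dots> \<le> ?M * (sqrt (\<Sum>i<r. (norm (u i v))\<^sup>2) * sqrt (\<Sum>i<r. (norm (u i w))\<^sup>2))"
  proof (cases "0 < r")
    case True
    then show ?thesis
      using L2_set_mult_ineq[of "\<lambda>i. norm (u i v)" "\<lambda>i. norm (u i w)" "{..<r}"] M0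
      by (intro mult_left_mono) (auto simp: L2_set_def)
  qed simp
  finally show ?thesis by (simp add: D(1) sq mult.assoc)
qed

text \<open>Each of these relations involves finitely many coordinates, so it cuts out a closed set
  of functions.\<close>

lemma closure_cone_bilinear:
  assumes D: "D \<in> closure (datum_cone K)" and K: "K \<subseteq> nc_matrices mnE"
  shows "D (v + v', w, g) = D (v, w, g) + D (v', w, g)" "D (v, w + w', g) = D (v, w, g) + D (v, w', g)"
    "D (t *\<^sub>R v, w, g) = t * D (v, w, g)" "D (v, t *\<^sub>R w, g) = t * D (v, w, g)"
    "D (v, w, None) = D (w, v, None)" "0 \<le> D (v, v, None)"
proof -
  have sub: "D \<in> A" if "closed A" "datum_cone K \<subseteq> A" for A
    using closure_minimal[OF that(2,1)] D by blast
  note cont = continuous_intros continuous_on_product_coordinates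
  have "D \<in> {D. D (v + v', w, g) = D (v, w, g) + D (v', w, g)}"
    by (rule sub) (auto intro!: closed_Collect_eq cont simp: datum_cone_bilinear(1)[OF _ K])
  then show "D (v + v', w, g) = D (v, w, g) + D (v', w, g)" by simp
  have "D \<in> {D. D (v, w + w', g) = D (v, w, g) + D (v, w', g)}"
    by (rule sub) (auto intro!: closed_Collect_eq cont simp: datum_cone_bilinear(2)[OF _ K])
  then show "D (v, w + w', g) = D (v, w, g) + D (v, w', g)" by simp
  have "D \<in> {D. D (t *\<^sub>R v, w, g) = t * D (v, w, g)}"
    by (rule sub) (auto intro!: closed_Collect_eq cont simp: datum_cone_bilinear(3)[OF _ K])
  then show "D (t *\<^sub>R v, w, g) = t * D (v, w, g)" by simp
  have "D \<in> {D. D (v, t *\<^sub>R w, g) = t * D (v, w, g)}"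
    by (rule sub) (auto intro!: closed_Collect_eq cont simp: datum_cone_bilinear(4)[OF _ K])
  then show "D (v, t *\<^sub>R w, g) = t * D (v, w, g)" by simp
  have "D \<in> {D. D (v, w, None) = D (w, v, None)}"
    by (rule sub) (auto intro!: closed_Collect_eq cont intro: datum_cone_bilinear(5)[OF _ K])
  then show "D (v, w, None) = D (w, v, None)" by simp
  have "D \<in> {D. 0 \<le> D (v, v, None)}"
    by (rule sub) (auto intro!: closed_Collect_le cont simp: datum_cone_bilinear(6)[OF _ K])
  then show "0 \<le> D (v, v, None)" by simp
qed

lemma closure_cone_bound:
  assumes D: "D \<in> closure (datum_cone K)" and K: "K \<subseteq> nc_matrices mnE"
    and C: "\<And>d x. (d, x) \<in> K \<Longrightarrow> Mn_norm mnE d x \<le> C"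
    and L: "\<And>e f. norm (pr e f) \<le> norm e * norm f * L" "0 \<le> L"
  shows "\<bar>D (v, w, g)\<bar> \<le> (case g of None \<Rightarrow> 1 | Some f \<Rightarrow> C * norm f * L) * sqrt (D (v, v, None)) * sqrt (D (w, w, None))"
    (is "_ \<le> ?M * _ * _")
proof -
  have "closed {D. \<bar>D (v, w, g)\<bar> \<le> ?M * sqrt (D (v, v, None)) * sqrt (D (w, w, None))}"
    by (intro closed_Collect_le continuous_intros continuous_on_product_coordinates)
  moreover have "datum_cone K \<subseteq> {D. \<bar>D (v, w, g)\<bar> \<le> ?M * sqrt (D (v, v, None)) * sqrt (D (w, w, None))}"
    using datum_cone_bound[OF _ K C L] by blast
  ultimately show ?thesis using closure_minimal D by blast
qed

text \<open>\<open>1 + S\<close> is a square root of \<open>1 + B\<close>, where \<open>B\<close> is the operator of the form \<open>b\<close>: the fixed point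
  of the contraction \<open>S \<mapsto> (B - S\<^sup>2)/2\<close>.\<close>

lemma operator_square_root:
  fixes b :: "'k ell2 \<Rightarrow> 'k ell2 \<Rightarrow> real"
  assumes b: "bounded_bilinear b" "\<And>v w. b v w = b w v" "\<And>v w. \<bar>b v w\<bar> \<le> 1/4 * norm v * norm w"
    "\<And>v w. b (proj n v) w = b v w"
  obtains S where "bounded_linear S" "\<And>v. norm (S v) \<le> 1/2 * norm v" "\<And>v. proj n (S v) = S v"
    "\<And>v. S (proj n v) = S v" "\<And>v w. inner (S v) w = inner v (S w)"
    "\<And>v w. 2 * inner (S v) w + inner (S v) (S w) = b v w"
proof -
  interpret b: bounded_bilinear b by fact
  have "\<exists>u. \<forall>w. b v w = inner u w" for v by (rule ell2_riesz[OF b.bounded_linear_right])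
  then obtain Bf where Bf: "\<And>v w. b v w = inner (Bf v) w" by metis
  have eqI: "u = u'" if "\<And>w. inner u w = inner u' w" for u u' :: "'k ell2"
    using that vector_eq_rdot by blast
  have Bn: "norm (Bf v) \<le> 1/4 * norm v" for v
  proof (cases "Bf v = 0")
    case False
    have "norm (Bf v) * norm (Bf v) = b v (Bf v)" by (simp add: Bf norm_eq_sqrt_inner)
    also have "\<dots> \<le> 1/4 * norm v * norm (Bf v)" using b(3)[of v "Bf v"] by linarith
    finally show ?thesis using False by simp
  qed simp
  have Blin: "bounded_linear Bf"
    by (rule bounded_linear_intro[where K="1/4"])
      (use Bn in \<open>auto intro!: eqI simp: Bf[symmetric] inner_add_left b.add_left b.scaleR_left mult.commute\<close>)
  define B where "B = Blinfun Bf"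
  have B: "blinfun_apply B = Bf" unfolding B_def by (rule bounded_linear_Blinfun_apply[OF Blin])
  have Bnorm: "norm B \<le> 1/4" by (rule norm_blinfun_bound) (use Bn in \<open>simp_all add: B\<close>)
  have Bproj: "Bf (proj n v) = Bf v" for v by (rule eqI) (simp add: Bf[symmetric] b(4))
  have projB: "proj n (Bf v) = Bf v" for v
    by (rule eqI) (metis Bf b(2,4) inner_proj inner_commute)
  \<comment> \<open>Self-adjointness and compatibility with \<open>proj n\<close> are put into the
    complete set itself, so the fixed point inherits them.\<close>
  define \<S> where "\<S> = {S :: 'k ell2 \<Rightarrow>\<^sub>L 'k ell2. norm S \<le> 1/2 \<and> (\<forall>v w. inner (blinfun_apply S v) w = inner v (blinfun_apply S w)) \<and>
      (\<forall>v. blinfun_apply S (proj n v) = blinfun_apply S v) \<and> (\<forall>v. proj n (blinfun_apply S v) = blinfun_apply S v)}"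
  define F where "F S = (1/2) *\<^sub>R (B - (S o\<^sub>L S))" for S
  have "\<exists>!S\<in>\<S>. F S = S"
  proof (rule Banach_fix)
    have ap: "continuous_on UNIV (\<lambda>S :: 'k ell2 \<Rightarrow>\<^sub>L 'k ell2. (blinfun_apply S v))" for v
      by (rule linear_continuous_on[OF blinfun.bounded_linear_left])
    have pr_ap: "continuous_on UNIV (\<lambda>S :: 'k ell2 \<Rightarrow>\<^sub>L 'k ell2. proj n (blinfun_apply S v))" for v
      by (rule linear_continuous_on[OF bounded_linear_compose[OF bounded_linear_proj blinfun.bounded_linear_left]])
    have "closed \<S>"
      unfolding \<S>_def
      by (intro closed_Collect_conj closed_Collect_all closed_Collect_le closed_Collect_eq continuous_intros ap pr_ap)
    then show "complete \<S>" by (simp add: complete_eq_closed)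
    have "0 \<in> \<S>" using linear_0[OF bounded_linear.linear[OF bounded_linear_proj]] by (auto simp: \<S>_def)
    then show "\<S> \<noteq> {}" by blast
    show "F ` \<S> \<subseteq> \<S>"
    proof safe
      fix S assume S: "S \<in> \<S>"
      have nS: "norm S \<le> 1/2" using S by (simp add: \<S>_def)
      have "norm (S o\<^sub>L S) \<le> 1/2 * (1/2)"
        by (rule order_trans[OF norm_blinfun_compose mult_mono[OF nS nS]]) auto
      then have "norm (B - (S o\<^sub>L S)) \<le> 1/4 + 1/4"
        using norm_triangle_ineq4[of B "(S o\<^sub>L S)"] Bnorm by linarith
      then have 1: "norm (F S) \<le> 1/2" by (simp add: F_def)
      have Fv: "(blinfun_apply (F S) v) = (1/2) *\<^sub>R (Bf v - (blinfun_apply S (blinfun_apply S v)))" for v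
        by (simp add: F_def B blinfun.diff_left blinfun.scaleR_left)
      have 2: "inner ((blinfun_apply (F S) v)) w = inner v ((blinfun_apply (F S) w))" for v w
      proof -
        have "inner (Bf v) w = inner v (Bf w)" by (metis Bf b(2) inner_commute)
        moreover have "inner (blinfun_apply S (blinfun_apply S v)) w = inner v (blinfun_apply S (blinfun_apply S w))" using S by (simp add: \<S>_def)
        ultimately show ?thesis by (simp add: Fv inner_diff_left inner_diff_right)
      qed
      have 3: "blinfun_apply (F S) (proj n v) = (blinfun_apply (F S) v)" for v using S by (simp add: Fv Bproj \<S>_def)
      have 4: "proj n ((blinfun_apply (F S) v)) = (blinfun_apply (F S) v)" for v
      proof -
        have l: "linear (proj n)" by (rule bounded_linear.linear[OF bounded_linear_proj])
        show ?thesis using S by (simp add: Fv linear_cmul[OF l] linear_diff[OF l] projB \<S>_def)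
      qed
      show "F S \<in> \<S>" using 1 2 3 4 by (simp add: \<S>_def)
    qed
    \<comment> \<open>The difference of the squares is \<open>S (S - R) + (S - R) R\<close>. The
      norms of \<open>S\<close> and \<open>R\<close>, at most 1/2 each, add up to at most 1, and the
      factor 1/2 of \<open>F\<close> makes the map a contraction.\<close>
    show "dist (F S) (F R) \<le> 1/2 * dist S R" if "S \<in> \<S>" "R \<in> \<S>" for S R
    proof -
      have eq: "F S - F R = (- (1/2)) *\<^sub>R ((S o\<^sub>L (S - R)) + ((S - R) o\<^sub>L R))"
        by (rule blinfun_eqI)
          (simp add: F_def blinfun.diff_left blinfun.diff_right blinfun.add_left blinfun.scaleR_left
            blinfun.minus_left scaleR_diff_right algebra_simps)
      have nS: "norm S \<le> 1/2" and nR: "norm R \<le> 1/2" using that by (auto simp: \<S>_def)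
      have "norm (S o\<^sub>L (S - R)) \<le> 1/2 * norm (S - R)"
        by (rule order_trans[OF norm_blinfun_compose mult_right_mono[OF nS norm_ge_zero]])
      moreover have "norm ((S - R) o\<^sub>L R) \<le> norm (S - R) * (1/2)"
        by (rule order_trans[OF norm_blinfun_compose mult_left_mono[OF nR norm_ge_zero]])
      ultimately have "norm ((S o\<^sub>L (S - R)) + ((S - R) o\<^sub>L R)) \<le> norm (S - R)"
        using norm_triangle_ineq[of "(S o\<^sub>L (S - R))" "((S - R) o\<^sub>L R)"] by simp
      then show ?thesis by (simp add: dist_norm eq)
    qed
  qed auto
  then obtain S where S: "S \<in> \<S>" "F S = S" by blast
  have SB: "2 *\<^sub>R (blinfun_apply S v) = Bf v - (blinfun_apply S (blinfun_apply S v))" for v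
  proof -
    have "(blinfun_apply S v) = (1/2) *\<^sub>R (Bf v - (blinfun_apply S (blinfun_apply S v)))"
      using arg_cong[OF S(2), of "\<lambda>T. blinfun_apply T v"]
      by (simp add: F_def B blinfun.diff_left blinfun.scaleR_left)
    then have "2 *\<^sub>R blinfun_apply S v = 2 *\<^sub>R ((1/2) *\<^sub>R (Bf v - blinfun_apply S (blinfun_apply S v)))"
      by (rule arg_cong)
    then show ?thesis by simp
  qed
  have sym: "inner (blinfun_apply S v) w = inner v (blinfun_apply S w)" for v w using S(1) by (simp add: \<S>_def)
  show thesis
  proof (rule that[of "blinfun_apply S"])
    show "bounded_linear (blinfun_apply S)" by (rule blinfun.bounded_linear_right)
    show "norm (blinfun_apply S v) \<le> 1/2 * norm v" for v
    proof -
      have "norm (blinfun_apply S v) \<le> norm S * norm v" by (rule norm_blinfun)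
      also have "\<dots> \<le> 1/2 * norm v" using S(1) by (intro mult_right_mono) (auto simp: \<S>_def)
      finally show ?thesis .
    qed
    show "2 * inner (blinfun_apply S v) w + inner (blinfun_apply S v) (blinfun_apply S w) = b v w" for v w
    proof -
      have "2 * inner (blinfun_apply S v) w = inner (2 *\<^sub>R (blinfun_apply S v)) w" by simp
      also have "\<dots> = b v w - inner (blinfun_apply S (blinfun_apply S v)) w" unfolding SB by (simp add: inner_diff_left Bf)
      finally show ?thesis by (simp add: sym)
    qed
  qed (use S(1) in \<open>auto simp: \<S>_def\<close>)
qed

text \<open>With \<open>A\<close> a square root of the first component and \<open>G\<close> its
  inverse on level \<open>n\<close>, the point sought must be \<open>G\<^sup>T E G\<close>. On the
  vectors \<open>G (basis p)\<close> the first component of \<open>E\<close> is the identity matrix,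
  which is what \<open>approx_point\<close> needs. The hypothesis \<open>near\<close> makes the
  square root exist and be invertible.\<close>

lemma realize:
  fixes K :: "('k, 'e) graded"
  assumes K: "compact_nc_convex mnE pr K" and inf: "infinite (UNIV :: 'k set)" and nx: "(n, x0) \<in> K"
    and E: "E \<in> closure (datum_cone K)" and bil: "\<And>g. bounded_bilinear (\<lambda>v w. E (v, w, g))"
    and sym: "\<And>v w. E (v, w, None) = E (w, v, None)"
    and near: "\<And>v w. \<bar>E (v, w, None) - inner (proj n v) (proj n w)\<bar> \<le> 1/4 * norm v * norm w"
    and Eproj: "\<And>v w g. E (proj n v, proj n w, g) = E (v, w, g)"
  obtains w A where "(n, w) \<in> K" "bounded_linear A" "\<And>v. supp_in n (A v)" "\<And>v. A (proj n v) = A v"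
    "\<And>v v'. inner (A v) (A v') = E (v, v', None)" "\<And>v v' f. pr (form w (A v) (A v')) f = E (v, v', Some f)"
proof -
  have KM: "K \<subseteq> nc_matrices mnE" using K by (auto simp: compact_nc_convex_def nc_convex_def)
  define b where "b v w = E (v, w, None) - inner (proj n v) (proj n w)" for v w
  have ip: "bounded_bilinear (\<lambda>v w. inner (proj n v) (proj n w))"
    by (rule bounded_bilinear.comp[OF bounded_bilinear_inner bounded_linear_proj bounded_linear_proj])
  have b_bil: "bounded_bilinear b"
  proof -
    have "bounded_bilinear (\<lambda>v w. - inner (proj n v) (proj n w))"
      using bounded_bilinear.comp[OF bounded_bilinear_inner bounded_linear_minus[OF bounded_linear_proj] bounded_linear_proj]
      by simp
    from bounded_bilinear_add[OF bil[of None] this] show ?thesis by (simp add: b_def[abs_def])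
  qed
  have E1: "E (proj n v, w, g) = E (v, w, g)" for v w g
    by (metis Eproj proj_proj)
  obtain S where S: "bounded_linear S" "\<And>v. norm (S v) \<le> 1/2 * norm v" "\<And>v. proj n (S v) = S v"
    "\<And>v. S (proj n v) = S v" "\<And>v w. inner (S v) w = inner v (S w)"
    "\<And>v w. 2 * inner (S v) w + inner (S v) (S w) = b v w"
  proof (rule operator_square_root[of b n])
    show "b v w = b w v" for v w using sym[of v w] by (simp add: b_def inner_commute)
    show "\<bar>b v w\<bar> \<le> 1/4 * norm v * norm w" for v w using near by (simp add: b_def)
    show "b (proj n v) w = b v w" for v w by (simp add: b_def E1)
  qed (use b_bil in auto)
  interpret S: bounded_linear S by fact
  interpret P: bounded_linear "proj n" by (rule bounded_linear_proj)
  \<comment> \<open>This is \<open>1 + S\<close> on level \<open>n\<close> and zero on its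
    complement.\<close>
  define A where "A v = proj n v + S v" for v
  have A_lin: "bounded_linear A"
    unfolding A_def by (rule bounded_linear_add[OF bounded_linear_proj S(1)])
  have A_supp: "supp_in n (A v)" for v
  proof -
    have "proj n (A v) = A v" by (simp add: A_def P.add S(3))
    then show ?thesis by (metis supp_in_proj)
  qed
  have A_proj: "A (proj n v) = A v" for v by (simp add: A_def S(4))
  have A_inner: "inner (A v) (A v') = E (v, v', None)" for v v'
  proof -
    have "inner (proj n v) (S v') = inner (S v) v'" by (metis S(3,5) inner_proj)
    moreover have "inner (S v) (proj n v') = inner (S v) v'" by (metis S(3) inner_proj)
    ultimately have "inner (A v) (A v') = inner (proj n v) (proj n v') + b v v'"
      by (simp add: A_def inner_add_left inner_add_right S(6)[symmetric])
    then show ?thesis by (simp add: b_def)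
  qed
  have inj: "u = 0" if "u + S u = 0" for u
  proof -
    have "norm u = norm (S u)" using that by (metis add.commute add_eq_0_iff norm_minus_cancel)
    then have "norm u \<le> 1/2 * norm u" using S(2)[of u] by simp
    then show ?thesis by simp
  qed
  define BS where "BS = Blinfun S"
  have BS: "blinfun_apply BS = S" unfolding BS_def by (rule bounded_linear_Blinfun_apply[OF S(1)])
  have BSn: "norm BS \<le> 1/2" by (rule norm_blinfun_bound) (use S(2) in \<open>simp_all add: BS\<close>)
  \<comment> \<open>The inverse of \<open>1 + S\<close> as the fixed point of
    \<open>G \<mapsto> 1 - S G\<close>, a contraction because \<open>S\<close> has norm at most
    1/2.\<close>
  have "\<exists>!G. id_blinfun - (BS o\<^sub>L G) = G"
  proof (rule banach_fix_type[of "1/2"])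
    show "\<forall>G H. dist (id_blinfun - (BS o\<^sub>L G)) (id_blinfun - (BS o\<^sub>L H)) \<le> 1/2 * dist G H"
    proof (intro allI)
      fix G H :: "'k ell2 \<Rightarrow>\<^sub>L 'k ell2"
      have "(BS o\<^sub>L H) - (BS o\<^sub>L G) = (BS o\<^sub>L (H - G))"
        by (rule blinfun_eqI) (simp add: blinfun.diff_left blinfun.diff_right)
      moreover have "(id_blinfun - (BS o\<^sub>L G)) - (id_blinfun - (BS o\<^sub>L H)) = (BS o\<^sub>L H) - (BS o\<^sub>L G)"
        by simp
      moreover have "norm (BS o\<^sub>L (H - G)) \<le> 1/2 * norm (H - G)"
        by (rule order_trans[OF norm_blinfun_compose mult_right_mono[OF BSn]]) simp
      ultimately show "dist (id_blinfun - (BS o\<^sub>L G)) (id_blinfun - (BS o\<^sub>L H)) \<le> 1/2 * dist G H"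
        by (simp add: dist_norm norm_minus_commute[of G H])
    qed
  qed auto
  then obtain G' where G': "id_blinfun - (BS o\<^sub>L G') = G'" by blast
  define G where "G = blinfun_apply G'"
  have G_lin: "bounded_linear G" unfolding G_def by (rule blinfun.bounded_linear_right)
  interpret G: bounded_linear G by fact
  have GS: "G v + S (G v) = v" for v
    using arg_cong[OF G', of "\<lambda>T. blinfun_apply T v"] by (simp add: blinfun.diff_left BS G_def algebra_simps)
  have uniq: "u = G v" if "u + S u = v" for u v
  proof -
    have "(u - G v) + S (u - G v) = 0" using that GS[of v] by (simp add: S.diff algebra_simps)
    from inj[OF this] show ?thesis by simp
  qed
  have GP: "proj n (G v) = G (proj n v)" for v
  proof (rule uniq)
    have "proj n (G v) + S (proj n (G v)) = proj n (G v + S (G v))" by (simp add: P.add S(3,4))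
    then show "proj n (G v) + S (proj n (G v)) = proj n v" by (simp add: GS)
  qed
  have GA: "G (A v) = proj n v" for v
    by (rule uniq[symmetric]) (simp add: A_def S(4))
  have AG: "A (G v) = v" if "proj n v = v" for v
  proof -
    have "proj n (G v) = G v" by (simp add: GP that)
    then show ?thesis by (simp add: A_def GS)
  qed
  have gram: "E (G (basis p), G (basis q), None) = (if p = q then 1 else 0)" if "p \<in> n" "q \<in> n" for p q
    using that by (simp add: A_inner[symmetric] AG proj_basis)
  obtain w where w: "(n, w) \<in> K" "\<And>p q f. p \<in> n \<Longrightarrow> q \<in> n \<Longrightarrow> pr (w p q) f = E (G (basis p), G (basis q), Some f)"
    by (rule approx_point[where a = "\<lambda>p. G (basis p)", OF K inf nx E gram]) blast+
  have wM: "w \<in> Mn mnE n" using w(1) KM by (auto simp: nc_matrices_def)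
  have form_w: "pr (form w v v') f = E (G (proj n v), G (proj n v'), Some f)" for v v' f
  proof (rule bounded_bilinear_eq_on_basis[where B = "\<lambda>v v'. pr (form w v v') f"
        and B' = "\<lambda>v v'. E (G (proj n v), G (proj n v'), Some f)"])
    have GPl: "bounded_linear (\<lambda>v. G (proj n v))" by (rule bounded_linear_compose[OF G_lin bounded_linear_proj])
    interpret Ef: bounded_bilinear "\<lambda>v w. E (v, w, Some f)" by (rule bil)
    show "bounded_bilinear (\<lambda>v v'. E (G (proj n v), G (proj n v'), Some f))"
      by (rule Ef.comp[OF GPl GPl])
    interpret bw: bounded_bilinear "form w" by (rule bilinear_form_E[OF wM])
    obtain L where L: "\<And>e f. norm (pr e f) \<le> norm e * norm f * L" "0 \<le> L"
      using pr.nonneg_bounded by blast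
    obtain M where M: "\<And>v v'. norm (form w v v') \<le> norm v * norm v' * M" using bw.bounded by blast
    show "bounded_bilinear (\<lambda>v v'. pr (form w v v') f)"
    proof (rule bounded_bilinear.intro)
      have "norm (pr (form w v v') f) \<le> norm v * norm v' * (M * norm f * L)" for v v'
      proof -
        have "norm (pr (form w v v') f) \<le> norm (form w v v') * norm f * L" by (rule L)
        also have "\<dots> \<le> (norm v * norm v' * M) * norm f * L"
          by (intro mult_right_mono M L norm_ge_zero)
        finally show ?thesis by (simp add: mult_ac)
      qed
      then show "\<exists>K. \<forall>a b. norm (pr (form w a b) f) \<le> norm a * norm b * K" by blast
    qed (simp_all add: bw.add_left bw.add_right bw.scaleR_left bw.scaleR_right pr.add_left pr.scaleR_left)
    fix p q
    show "pr (form w (basis p) (basis q)) f = E (G (proj n (basis p)), G (proj n (basis q)), Some f)"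
      by (cases "p \<in> n \<and> q \<in> n")
        (auto simp: proj_basis w(2) G.zero Ef.zero_left Ef.zero_right Mn_zero[OF wM] pr.zero_left)
  qed
  have "pr (form w (A v) (A v')) f = E (v, v', Some f)" for v v' f
  proof -
    have "proj n (A u) = A u" for u by (rule proj_id[OF A_supp])
    then show ?thesis by (simp add: form_w GA Eproj)
  qed
  then show thesis using that w(1) A_lin A_supp A_proj A_inner by blast
qed

text \<open>With \<open>s\<close> small, \<open>(1 - s)/2 (1, x) + s D\<^sub>i\<close> is so close to \<open>(1, x)/2\<close> in its first component that it
  is \<open>(\<alpha>\<^sub>i\<^sup>T\<alpha>\<^sub>i, \<alpha>\<^sub>i\<^sup>Tw\<^sub>i\<alpha>\<^sub>i)\<close> for an invertible \<open>\<alpha>\<^sub>i\<close> and a point \<open>w\<^sub>i \<in> K\<^sub>n\<close>.  Extremality applies to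
  the two-term nc convex combination \<open>x = \<Sum>\<^sub>i \<alpha>\<^sub>i\<^sup>Tw\<^sub>i\<alpha>\<^sub>i\<close>.\<close>

lemma extreme_split:
  fixes K :: "('k, 'e) graded"
  assumes K: "compact_nc_convex mnE pr K" and inf: "infinite (UNIV :: 'k set)" and extr: "nc_extreme K n x"
    and D1: "D1 \<in> closure (datum_cone K)" and D2: "D2 \<in> closure (datum_cone K)"
    and sum: "\<And>z. D1 z + D2 z = datum (proj n) x z"
  obtains c where "\<And>p q g. p \<in> n \<Longrightarrow> q \<in> n \<Longrightarrow> D1 (basis p, basis q, g) = c * datum (proj n) x (basis p, basis q, g)"
proof -
  have KM: "K \<subseteq> nc_matrices mnE" using K by (auto simp: compact_nc_convex_def nc_convex_def)
  have nx: "(n, x) \<in> K" using extr by (simp add: nc_extreme_def)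
  have n: "n \<in> cardinals" and xM: "x \<in> Mn mnE n" using nx KM by (auto simp: nc_matrices_def)
  obtain p0 where p0: "p0 \<in> n" using n by (auto simp: cardinals_def)
  obtain C where C: "0 \<le> C" "\<And>d x. (d, x) \<in> K \<Longrightarrow> Mn_norm mnE d x \<le> C"
    by (rule compact_nc_convex_bounded[OF K inf]) blast
  obtain L where L: "\<And>e f. norm (pr e f) \<le> norm e * norm f * L" "0 \<le> L"
    using pr.nonneg_bounded by blast
  let ?xd = "datum (proj n) x"
  have xd: "?xd \<in> closure (datum_cone K)"
    using datums_cone[OF datumsI[OF nx bounded_linear_proj supp_in_proj]] closure_subset[of "datum_cone K"] by blast
  define M where "M g = (case g of None \<Rightarrow> 1 | Some f \<Rightarrow> C * norm f * L)" for g :: "'f option"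
  have M0: "0 \<le> M g" for g using C(1) L(2) by (cases g) (simp_all add: M_def)
  \<comment> \<open>The mixed datum differs from the projection by \<open>s\<close> times the
    identity part plus \<open>2 * s\<close> times \<open>D\<close>. Together this is at most
    \<open>3 * s\<close> times the norms, and 1/12 makes it the 1/4 required by
    \<open>realize\<close>.\<close>
  define s where "s = (1/12 :: real)"
  have part: "\<exists>w A. (n, w) \<in> K \<and> bounded_linear A \<and> (\<forall>v. supp_in n (A v)) \<and> (\<forall>v. A (proj n v) = A v) \<and>
      (\<forall>v v'. inner (A v) (A v') = (1 - s) * ?xd (v, v', None) + 2 * s * D (v, v', None)) \<and>
      (\<forall>v v' f. pr (form w (A v) (A v')) f = (1 - s) * ?xd (v, v', Some f) + 2 * s * D (v, v', Some f))"
    if D: "D \<in> closure (datum_cone K)" and dom: "\<And>v. D (v, v, None) \<le> ?xd (v, v, None)" for D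
  proof -
    note Db = closure_cone_bilinear[OF D KM] and xb = closure_cone_bilinear[OF xd KM]
    \<comment> \<open>Domination by the identity in the first component bounds all components and
      confines them to level \<open>n\<close>.\<close>
    have bd: "\<bar>D' (v, w, g)\<bar> \<le> M g * norm (proj n v) * norm (proj n w)"
      if "D' \<in> closure (datum_cone K)" "\<And>v. D' (v, v, None) \<le> ?xd (v, v, None)" for D' v w g
    proof -
      have sq: "sqrt (D' (v, v, None)) \<le> norm (proj n v)" for v
        using that(2)[of v] real_sqrt_le_mono[of "D' (v, v, None)" "inner (proj n v) (proj n v)"]
        by (simp add: norm_eq_sqrt_inner)
      have "\<bar>D' (v, w, g)\<bar> \<le> M g * sqrt (D' (v, v, None)) * sqrt (D' (w, w, None))"
        unfolding M_def by (rule closure_cone_bound[OF that(1) KM C(2) L])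
      also have "\<dots> \<le> M g * norm (proj n v) * norm (proj n w)"
        by (intro mult_mono sq M0 mult_nonneg_nonneg) (auto simp: closure_cone_bilinear(6)[OF that(1) KM])
      finally show ?thesis .
    qed
    have bil: "bounded_bilinear (\<lambda>v w. D' (v, w, g))"
      if "D' \<in> closure (datum_cone K)" "\<And>v. D' (v, v, None) \<le> ?xd (v, v, None)" for D' g
    proof (rule bounded_bilinear.intro)
      have "norm (D' (v, w, g)) \<le> norm v * norm w * M g" for v w
      proof -
        have "norm (D' (v, w, g)) \<le> M g * norm (proj n v) * norm (proj n w)" using bd[OF that] by simp
        also have "\<dots> \<le> M g * norm v * norm w" by (intro mult_mono norm_proj_le M0 mult_nonneg_nonneg) auto
        finally show ?thesis by (simp add: mult_ac)
      qed
      then show "\<exists>K. \<forall>a b. norm (D' (a, b, g)) \<le> norm a * norm b * K" by blast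
    qed (simp_all add: closure_cone_bilinear(1-4)[OF that(1) KM])
    have dproj: "D' (proj n v, proj n w, g) = D' (v, w, g)"
      if "D' \<in> closure (datum_cone K)" "\<And>v. D' (v, v, None) \<le> ?xd (v, v, None)" for D' v w g
    proof -
      have v0: "D' (v - proj n v, w, g) = 0" for v w
      proof -
        have "proj n (v - proj n v) = 0" by (intro ell2_eqI) simp
        then show ?thesis using bd[OF that, of "v - proj n v" w g] by simp
      qed
      have w0: "D' (v, w - proj n w, g) = 0" for v w
      proof -
        have "proj n (w - proj n w) = 0" by (intro ell2_eqI) simp
        then show ?thesis using bd[OF that, of v "w - proj n w" g] by simp
      qed
      have "D' (v, w, g) = D' (proj n v, w, g)"
        using closure_cone_bilinear(1)[OF that(1) KM, of "proj n v" "v - proj n v" w g] v0 by simp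
      also have "\<dots> = D' (proj n v, proj n w, g)"
        using closure_cone_bilinear(2)[OF that(1) KM, of "proj n v" "proj n w" "w - proj n w" g] w0 by simp
      finally show ?thesis by simp
    qed
    define E where "E z = (1 - s) * ?xd z + 2 * s * D z" for z
    have Ecl: "E \<in> closure (datum_cone K)"
      unfolding E_def[abs_def] s_def by (intro closure_cone_add closure_cone_scale xd D) auto
    have scale: "bounded_bilinear (\<lambda>v w. t * B v w)" if "bounded_bilinear B"
      for B :: "'k ell2 \<Rightarrow> 'k ell2 \<Rightarrow> real" and t :: real
    proof -
      interpret B: bounded_bilinear B by fact
      obtain k where k: "\<And>a b. norm (B a b) \<le> norm a * norm b * k" using B.bounded by blast
      show ?thesis
      proof (rule bounded_bilinear.intro)
        have "norm (t * B a b) \<le> norm a * norm b * (\<bar>t\<bar> * k)" for a b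
          using mult_left_mono[OF k[of a b], of "\<bar>t\<bar>"] by (simp add: abs_mult mult_ac)
        then show "\<exists>K. \<forall>a b. norm (t * B a b) \<le> norm a * norm b * K" by blast
      qed (simp_all add: B.add_left B.add_right B.scaleR_left B.scaleR_right distrib_left)
    qed
    have Ebil: "bounded_bilinear (\<lambda>v w. E (v, w, g))" for g
      unfolding E_def by (intro bounded_bilinear_add scale bil xd D dom order_refl)
    have near: "\<bar>E (v, w, None) - inner (proj n v) (proj n w)\<bar> \<le> 1/4 * norm v * norm w" for v w
    proof -
      have "\<bar>D (v, w, None)\<bar> \<le> norm (proj n v) * norm (proj n w)"
        using bd[OF D dom, of v w None] by (simp add: M_def)
      moreover have "\<bar>inner (proj n v) (proj n w)\<bar> \<le> norm (proj n v) * norm (proj n w)"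
        by (rule Cauchy_Schwarz_ineq2)
      moreover have "norm (proj n v) * norm (proj n w) \<le> norm v * norm w"
        by (intro mult_mono norm_proj_le) auto
      ultimately have "\<bar>D (v, w, None)\<bar> \<le> norm v * norm w" "\<bar>inner (proj n v) (proj n w)\<bar> \<le> norm v * norm w"
        by linarith+
      then have "\<bar>E (v, w, None) - inner (proj n v) (proj n w)\<bar> \<le> 1/4 * (norm v * norm w)"
      proof -
        have "\<bar>(1 - 1 / 12) * y + 2 * (1 / 12) * x - y\<bar> \<le> 1 / 4 * m" if "\<bar>x\<bar> \<le> m" "\<bar>y\<bar> \<le> m" for x y m :: real
          using that unfolding abs_le_iff by simp
        then show ?thesis
          using \<open>\<bar>D (v, w, None)\<bar> \<le> norm v * norm w\<close> \<open>\<bar>inner (proj n v) (proj n w)\<bar> \<le> norm v * norm w\<close>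
          unfolding E_def s_def datum_simps by blast
      qed
      then show ?thesis by simp
    qed
    have Eproj: "E (proj n v, proj n w, g) = E (v, w, g)" for v w g
      unfolding E_def dproj[OF D dom] dproj[OF xd order_refl] ..
    have Esym: "E (v, w, None) = E (w, v, None)" for v w
      unfolding E_def using Db(5)[of v w] xb(5)[of v w] by simp
    obtain w A where "(n, w) \<in> K" "bounded_linear A" "\<And>v. supp_in n (A v)" "\<And>v. A (proj n v) = A v"
      "\<And>v v'. inner (A v) (A v') = E (v, v', None)" "\<And>v v' f. pr (form w (A v) (A v')) f = E (v, v', Some f)"
      by (rule realize[OF K inf nx Ecl Ebil Esym near Eproj]) blast
    then show ?thesis unfolding E_def by blast
  qed
  have nonneg: "0 \<le> D1 (v, v, None)" "0 \<le> D2 (v, v, None)" for v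
    using closure_cone_bilinear(6)[OF D1 KM] closure_cone_bilinear(6)[OF D2 KM] by auto
  have dom1: "D1 (v, v, None) \<le> ?xd (v, v, None)" and dom2: "D2 (v, v, None) \<le> ?xd (v, v, None)" for v
    using nonneg[of v] sum[of "(v, v, None)"] by linarith+
  obtain w1 A1 where A1: "(n, w1) \<in> K" "bounded_linear A1" "\<And>v. supp_in n (A1 v)" "\<And>v. A1 (proj n v) = A1 v"
    "\<And>v v'. inner (A1 v) (A1 v') = (1 - s) * ?xd (v, v', None) + 2 * s * D1 (v, v', None)"
    "\<And>v v' f. pr (form w1 (A1 v) (A1 v')) f = (1 - s) * ?xd (v, v', Some f) + 2 * s * D1 (v, v', Some f)"
    using part[OF D1 dom1] by blast
  obtain w2 A2 where A2: "(n, w2) \<in> K" "bounded_linear A2" "\<And>v. supp_in n (A2 v)" "\<And>v. A2 (proj n v) = A2 v"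
    "\<And>v v'. inner (A2 v) (A2 v') = (1 - s) * ?xd (v, v', None) + 2 * s * D2 (v, v', None)"
    "\<And>v v' f. pr (form w2 (A2 v) (A2 v')) f = (1 - s) * ?xd (v, v', Some f) + 2 * s * D2 (v, v', Some f)"
    using part[OF D2 dom2] by blast
  \<comment> \<open>Each mixed datum enters with weight one half, so the two add up to
    \<open>(1 - s) * ?xd + s * (D1 + D2)\<close>, which is \<open>?xd\<close>.\<close>
  define h where "h = sqrt (1/2 :: real)"
  have hh: "h * h = 1/2" by (simp add: h_def)
  define T where "T i v = h *\<^sub>R (if i = 0 then A1 v else A2 v)" for i :: nat and v
  have T_lin: "bounded_linear (T i)" for i
    unfolding T_def by (cases "i = 0")
      (simp_all add: bounded_linear_compose[OF bounded_linear_scaleR_right A1(2)]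
        bounded_linear_compose[OF bounded_linear_scaleR_right A2(2)])
  have T_supp: "supp_in n (T i v)" for i v using A1(3) A2(3) by (simp add: T_def supp_in_scaleR)
  have T_proj: "T i (proj n v) = T i v" for i v by (simp add: T_def A1(4) A2(4))
  define y where "y i = (if i = 0 then w1 else w2)" for i :: nat
  define \<alpha> where "\<alpha> i = mat n (T i)" for i
  have \<alpha>_cols: "\<alpha> i = (\<lambda>j q. coord (T i (basis q)) j)" for i
    unfolding \<alpha>_def by (rule mat_columns[OF T_proj T_lin])
  have yK: "(n, y i) \<in> K" for i using A1(1) A2(1) by (simp add: y_def)
  have yM: "y i \<in> Mn mnE n" for i using yK[of i] KM by (auto simp: nc_matrices_def)
  have T_inner: "inner (T 0 v) (T 0 v') = 1/2 * ((1 - s) * ?xd (v, v', None) + 2 * s * D1 (v, v', None))"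
    "inner (T 1 v) (T 1 v') = 1/2 * ((1 - s) * ?xd (v, v', None) + 2 * s * D2 (v, v', None))" for v v'
    by (simp_all only: T_def inner_scaleR_left inner_scaleR_right mult.assoc[symmetric] hh A1(5) A2(5) if_True
        one_neq_zero if_False simp_thms)
  have T_form: "pr (form (y 0) (T 0 v) (T 0 v')) f = 1/2 * ((1 - s) * ?xd (v, v', Some f) + 2 * s * D1 (v, v', Some f))"
    "pr (form (y 1) (T 1 v) (T 1 v')) f = 1/2 * ((1 - s) * ?xd (v, v', Some f) + 2 * s * D2 (v, v', Some f))" for v v' f
  proof -
    interpret b1: bounded_bilinear "form w1" using yM[of 0] by (simp add: y_def bilinear_form_E)
    interpret b2: bounded_bilinear "form w2" using yM[of 1] by (simp add: y_def bilinear_form_E)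
    show "pr (form (y 0) (T 0 v) (T 0 v')) f = 1/2 * ((1 - s) * ?xd (v, v', Some f) + 2 * s * D1 (v, v', Some f))"
      by (simp only: T_def y_def b1.scaleR_left b1.scaleR_right scaleR_scaleR hh pr.scaleR_left real_scaleR_def A1(6)
          if_True simp_thms)
    show "pr (form (y 1) (T 1 v) (T 1 v')) f = 1/2 * ((1 - s) * ?xd (v, v', Some f) + 2 * s * D2 (v, v', Some f))"
      by (simp only: T_def y_def b2.scaleR_left b2.scaleR_right scaleR_scaleR hh pr.scaleR_left real_scaleR_def A2(6)
          one_neq_zero if_False simp_thms)
  qed
  have half: "1/2 * ((1 - s) * ?xd z + 2 * s * D1 z) + 1/2 * ((1 - s) * ?xd z + 2 * s * D2 z) = ?xd z" for z
  proof -
    have "1/2 * ((1 - s) * (a + b) + 2 * s * a) + 1/2 * ((1 - s) * (a + b) + 2 * s * b) = a + b" for a b :: real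
      by (simp add: field_simps)
    then show ?thesis unfolding sum[of z, symmetric] .
  qed
  have lm: "lmul n (mtrans (\<alpha> i)) (\<alpha> i) p q = inner (T i (basis p)) (T i (basis q))" for i p q
    unfolding \<alpha>_cols mtrans_def by (simp add: lmul_inner proj_id T_supp)
  have sw: "sandwich n (mtrans (\<alpha> i)) (y i) (\<alpha> i) = (\<lambda>p q. form (y i) (T i (basis p)) (T i (basis q)))" for i
    unfolding \<alpha>_def by (rule compression_form[OF yM T_lin T_proj])
  have two: "(\<Sum>i<2. g i) = g 0 + g 1" for g :: "nat \<Rightarrow> 'z::comm_monoid_add"
    by (simp add: numeral_2_eq_2)
  have gram: "(\<lambda>p q. \<Sum>i<2. lmul n (mtrans (\<alpha> i)) (\<alpha> i) p q) = idmat n"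
  proof (intro ext)
    fix p q
    have "(\<Sum>i<2. lmul n (mtrans (\<alpha> i)) (\<alpha> i) p q) = ?xd (basis p, basis q, None)"
      unfolding lm two T_inner by (rule half)
    then show "(\<Sum>i<2. lmul n (mtrans (\<alpha> i)) (\<alpha> i) p q) = idmat n p q"
      by (auto simp: proj_basis idmat_def)
  qed
  have comb: "(\<lambda>p q. \<Sum>i<2. sandwich n (mtrans (\<alpha> i)) (y i) (\<alpha> i) p q) = x"
  proof (intro ext pr_eqI)
    fix p q f
    have "pr (\<Sum>i<2. sandwich n (mtrans (\<alpha> i)) (y i) (\<alpha> i) p q) f = ?xd (basis p, basis q, Some f)"
      unfolding sw two pr.add_left T_form by (rule half)
    also have "\<dots> = pr (x p q) f" by (simp add: form_proj[OF xM])
    finally show "pr (\<Sum>i<2. sandwich n (mtrans (\<alpha> i)) (y i) (\<alpha> i) p q) f = pr (x p q) f" .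
  qed
  \<comment> \<open>The share \<open>(1 - s) / 2\<close> of the identity and the nonnegativity of
    \<open>D1\<close> and \<open>D2\<close> give \<open>basis p0\<close> a nonzero image.\<close>
  have nz: "\<alpha> i \<noteq> (\<lambda>p q. 0)" if "i < 2" for i
  proof
    assume "\<alpha> i = (\<lambda>p q. 0)"
    then have "coord (T i (basis p0)) j = 0" for j unfolding \<alpha>_cols by (metis (no_types))
    then have "T i (basis p0) = 0" by (intro ell2_eqI) simp
    then have "inner (T i (basis p0)) (T i (basis p0)) = 0" by simp
    moreover have "i = 0 \<or> i = 1" using that by auto
    moreover have "0 < inner (T 0 (basis p0)) (T 0 (basis p0))" "0 < inner (T 1 (basis p0)) (T 1 (basis p0))"
      unfolding T_inner using nonneg[of "basis p0"] p0 by (simp_all add: proj_basis s_def add_pos_nonneg)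
    ultimately show False by auto
  qed
  have "\<exists>c \<beta>. c > 0 \<and> \<beta> \<in> isometries n n \<and> \<alpha> 0 = (\<lambda>p q. c * \<beta> p q) \<and> sandwich n (mtrans \<beta>) (y 0) \<beta> = x"
    using extr[unfolded nc_extreme_def, THEN conjunct2, rule_format, of 2 "\<lambda>_. n" y \<alpha> 0] yK nz gram comb
      mat_bounded_mats[OF T_lin T_supp] unfolding \<alpha>_def by auto
  then obtain c \<beta> where c: "c > 0" "\<beta> \<in> isometries n n" "\<alpha> 0 = (\<lambda>p q. c * \<beta> p q)"
    "sandwich n (mtrans \<beta>) (y 0) \<beta> = x" by blast
  obtain V where V: "bounded_linear V" "\<And>v. V (proj n v) = V v" "\<beta> = mat n V"
    "\<And>v w. inner (V v) (V w) = inner (proj n v) (proj n w)"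
    by (rule isometry_operator[OF c(2)]) blast
  have \<beta>_cols: "\<beta> = (\<lambda>j q. coord (V (basis q)) j)" unfolding V(3) by (rule mat_columns[OF V(2,1)])
  have TV: "T 0 (basis q) = c *\<^sub>R V (basis q)" for q
    using c(3) unfolding \<alpha>_cols \<beta>_cols by (intro ell2_eqI) (simp, metis)
  have xV: "x p q = form (y 0) (V (basis p)) (V (basis q))" for p q
    using c(4) unfolding V(3) compression_form[OF yM V(1,2)] by (metis (no_types))
  \<comment> \<open>By extremality the first operator is \<open>c\<close> times an isometry that
    compresses \<open>y 0\<close> to \<open>x\<close>, so both components of its datum are
    \<open>c\<^sup>2\<close> times those of \<open>(1, x)\<close>. Solving the linear relation for
    \<open>D1\<close> then gives the constant.\<close>
  have key: "1/2 * ((1 - s) * ?xd (basis p, basis q, g) + 2 * s * D1 (basis p, basis q, g)) = c\<^sup>2 * ?xd (basis p, basis q, g)"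
    for p q g
  proof (cases g)
    case None
    then show ?thesis
      using T_inner(1)[of "basis p" "basis q"] by (simp add: TV V(4) power2_eq_square)
  next
    case (Some f)
    interpret b1: bounded_bilinear "form (y 0)" by (rule bilinear_form_E[OF yM])
    show ?thesis
      using T_form(1)[of "basis p" "basis q" f]
      by (simp add: Some TV b1.scaleR_left b1.scaleR_right pr.scaleR_left form_proj[OF xM] power2_eq_square flip: xV)
  qed
  have "D1 (basis p, basis q, g) = ((2 * c\<^sup>2 - (1 - s)) / (2 * s)) * ?xd (basis p, basis q, g)" for p q g
    using key[of p q g] by (simp add: s_def field_simps)
  then show thesis using that by blast
qed

end

section \<open>Milman's argument\<close>

text \<open>If every colour class carried less than the average, the classes together would carry
  less than the total.\<close>

lemma pigeonhole_sum:
  fixes m :: "'i \<Rightarrow> real"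
  assumes I: "finite I" and Col: "finite Col" "\<And>i. i \<in> I \<Longrightarrow> col i \<in> Col" and pos: "0 < (\<Sum>i\<in>I. m i)"
  obtains c where "c \<in> Col" "(\<Sum>i\<in>I. m i) / real (card Col) \<le> (\<Sum>i\<in>{i \<in> I. col i = c}. m i)"
proof (rule ccontr)
  assume no: "\<not> thesis"
  have ne: "Col \<noteq> {}" using Col(2) pos by (metis empty_iff less_irrefl sum.neutral)
  have "(\<Sum>i\<in>I. m i) = (\<Sum>c\<in>Col. \<Sum>i\<in>{i \<in> I. col i = c}. m i)"
  proof -
    have "col ` I \<subseteq> Col" using Col(2) by blast
    from sum.group[OF I Col(1) this, of m] show ?thesis by simp
  qed
  also have "\<dots> < (\<Sum>c\<in>Col. (\<Sum>i\<in>I. m i) / real (card Col))"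
    using no that by (intro sum_strict_mono Col ne) (meson not_le)
  also have "\<dots> = (\<Sum>i\<in>I. m i)" using ne Col(1) by simp
  finally show False by simp
qed

section \<open>Cluster values along an approximating family\<close>

lemma compact_box: "compact {h :: 'z \<Rightarrow> real. \<forall>z. h z \<in> {- b z..b z}}"
proof -
  have "compactin (product_topology (\<lambda>_. euclideanreal) UNIV) (\<Pi>\<^sub>E z\<in>UNIV. {- b z..b z})"
    by (simp add: compactin_PiE)
  moreover have "(\<Pi>\<^sub>E z\<in>UNIV. {- b z..b z}) = {h. \<forall>z. h z \<in> {- b z..b z}}" by (auto simp: PiE_iff)
  ultimately show ?thesis by (simp add: euclidean_product_topology)
qed

text \<open>The function \<open>s\<close> is arbitrary, so \<open>s h\<close> need not converge as
  \<open>h\<close> tends to \<open>D\<close>; compactness of a box supplies a cluster value along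
  the same approach. The bound at \<open>z\<close> holds only for \<open>h\<close> near
  \<open>D\<close>, in a sense that depends on \<open>z\<close>, so the values are clamped to the
  box first. Close to \<open>D\<close> the clamp is inactive on any given finite set of
  coordinates.\<close>

lemma cluster_point:
  fixes D :: "'z \<Rightarrow> real" and s :: "('z \<Rightarrow> real) \<Rightarrow> 'z \<Rightarrow> real"
  assumes D: "D \<in> closure S"
    and b: "\<And>z. \<exists>Q \<epsilon>. finite Q \<and> \<epsilon> > 0 \<and> (\<forall>h\<in>S. (\<forall>q\<in>Q. \<bar>h q - D q\<bar> < \<epsilon>) \<longrightarrow> \<bar>s h z\<bar> \<le> b z)"
  obtains L where "\<And>Q \<epsilon>. finite Q \<Longrightarrow> \<epsilon> > 0 \<Longrightarrow> \<exists>h\<in>S. \<forall>q\<in>Q. \<bar>h q - D q\<bar> < \<epsilon> \<and> \<bar>s h q - L q\<bar> < \<epsilon>"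
proof -
  define F where "F = inf (nhds D) (principal S)"
  define c where "c h z = max (- b z) (min (b z) (s h z))" for h z
  have near: "eventually (\<lambda>h. \<forall>q\<in>Q. \<bar>h q - D q\<bar> < \<epsilon>) (nhds D)" if "finite Q" "\<epsilon> > 0" for Q and \<epsilon> :: real
  proof -
    have "open {g :: 'z \<Rightarrow> real. \<bar>g q - D q\<bar> < \<epsilon>}" for q
      by (intro open_Collect_less continuous_intros continuous_on_product_coordinates)
    then have "open (\<Inter>q\<in>Q. {g :: 'z \<Rightarrow> real. \<bar>g q - D q\<bar> < \<epsilon>})"
      using that(1) by (intro open_INT) auto
    then show ?thesis
      unfolding eventually_nhds by (intro exI[of _ "\<Inter>q\<in>Q. {g. \<bar>g q - D q\<bar> < \<epsilon>}"]) (use that(2) in auto)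
  qed
  have F: "F \<noteq> bot"
  proof
    assume "F = bot"
    then have "eventually (\<lambda>_. False) F" by simp
    then have "eventually (\<lambda>h. h \<notin> S) (nhds D)"
      unfolding F_def eventually_inf_principal by simp
    then obtain U where "open U" "D \<in> U" "\<forall>h\<in>U. h \<notin> S" unfolding eventually_nhds by blast
    then show False using D unfolding closure_iff_nhds_not_empty by (metis IntE equals0I order_refl)
  qed
  have b0: "0 \<le> b z" for z
  proof -
    obtain Q \<epsilon> where Q: "finite Q" "\<epsilon> > 0" "\<And>h. h \<in> S \<Longrightarrow> (\<forall>q\<in>Q. \<bar>h q - D q\<bar> < \<epsilon>) \<Longrightarrow> \<bar>s h z\<bar> \<le> b z"
      using b[of z] by blast
    obtain h where "h \<in> S" "\<forall>q\<in>Q. \<bar>h q - D q\<bar> < \<epsilon>"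
      using D Q(1,2) unfolding closure_fun_iff by blast
    then have "\<bar>s h z\<bar> \<le> b z" by (rule Q(3))
    then show ?thesis by linarith
  qed
  have "filtermap c F \<noteq> bot" using F by (simp add: filtermap_bot_iff)
  moreover have "eventually (\<lambda>h. h \<in> {h. \<forall>z. h z \<in> {- b z..b z}}) (filtermap c F)"
  proof -
    have "c h z \<in> {- b z..b z}" for h z using b0[of z] by (auto simp: c_def)
    then show ?thesis by (simp add: eventually_filtermap)
  qed
  ultimately obtain L where L: "inf (nhds L) (filtermap c F) \<noteq> bot"
    using compact_box[of b] unfolding compact_filter by (metis (no_types, lifting))
  show thesis
  proof (rule that[of L])
    fix Q :: "'z set" and \<epsilon> :: real assume Q: "finite Q" "\<epsilon> > 0"
    obtain R e where R: "\<And>z. finite (R z)" "\<And>z. e z > 0"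
      "\<And>z h. h \<in> S \<Longrightarrow> (\<forall>q\<in>R z. \<bar>h q - D q\<bar> < e z) \<Longrightarrow> \<bar>s h z\<bar> \<le> b z"
      using b by metis
    have ev_clamp: "eventually (\<lambda>h. \<forall>q\<in>Q. \<forall>q'\<in>R q. \<bar>h q' - D q'\<bar> < e q) (nhds D)"
      using Q(1) by (intro eventually_ball_finite ballI near R)
    have "eventually (\<lambda>h. (\<forall>q\<in>Q. \<bar>h q - D q\<bar> < \<epsilon>) \<and> h \<in> S \<and> (\<forall>q\<in>Q. c h q = s h q)) F"
      unfolding F_def eventually_inf_principal using near[OF Q] ev_clamp
    proof eventually_elim
      case (elim h)
      have "c h q = s h q" if "q \<in> Q" "h \<in> S" for q
        using R(3)[of h q] that elim(2) by (auto simp: c_def)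
      then show ?case using elim(1) by blast
    qed
    then have "eventually (\<lambda>g. \<exists>h. g = c h \<and> (\<forall>q\<in>Q. \<bar>h q - D q\<bar> < \<epsilon>) \<and> h \<in> S \<and> (\<forall>q\<in>Q. c h q = s h q)) (filtermap c F)"
      unfolding eventually_filtermap by eventually_elim blast
    moreover have "eventually (\<lambda>g. \<forall>q\<in>Q. \<bar>g q - L q\<bar> < \<epsilon>) (nhds L)"
    proof -
      have "open {g :: 'z \<Rightarrow> real. \<bar>g q - L q\<bar> < \<epsilon>}" for q
        by (intro open_Collect_less continuous_intros continuous_on_product_coordinates)
      then have "open (\<Inter>q\<in>Q. {g :: 'z \<Rightarrow> real. \<bar>g q - L q\<bar> < \<epsilon>})"
        using Q(1) by (intro open_INT) auto
      then show ?thesis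
        unfolding eventually_nhds by (intro exI[of _ "\<Inter>q\<in>Q. {g. \<bar>g q - L q\<bar> < \<epsilon>}"]) (use Q(2) in auto)
    qed
    ultimately have "eventually (\<lambda>g. (\<forall>q\<in>Q. \<bar>g q - L q\<bar> < \<epsilon>) \<and>
        (\<exists>h. g = c h \<and> (\<forall>q\<in>Q. \<bar>h q - D q\<bar> < \<epsilon>) \<and> h \<in> S \<and> (\<forall>q\<in>Q. c h q = s h q))) (inf (nhds L) (filtermap c F))"
      unfolding eventually_inf by blast
    then obtain g h where g: "\<forall>q\<in>Q. \<bar>g q - L q\<bar> < \<epsilon>" "g = c h" "\<forall>q\<in>Q. \<bar>h q - D q\<bar> < \<epsilon>" "h \<in> S"
      "\<forall>q\<in>Q. c h q = s h q"
      using eventually_happens'[OF L] by blast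
    have "\<bar>h q - D q\<bar> < \<epsilon> \<and> \<bar>s h q - L q\<bar> < \<epsilon>" if "q \<in> Q" for q
    proof -
      have "c h q = s h q" "\<bar>c h q - L q\<bar> < \<epsilon>" "\<bar>h q - D q\<bar> < \<epsilon>" using g that by auto
      then show ?thesis by simp
    qed
    then show "\<exists>h\<in>S. \<forall>q\<in>Q. \<bar>h q - D q\<bar> < \<epsilon> \<and> \<bar>s h q - L q\<bar> < \<epsilon>" using g(4) by blast
  qed
qed

context dual_pair
begin

text \<open>The trace of the first component over \<open>P\<close>: additive, nonnegative on the
  cone, and finite even where the full trace is not.\<close>

definition mass :: "'k set \<Rightarrow> ('k ell2 \<times> 'k ell2 \<times> 'f option \<Rightarrow> real) \<Rightarrow> real" where
  "mass P D = (\<Sum>p\<in>P. D (basis p, basis p, None))"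

text \<open>\<open>R\<close> bounds the number of colours, \<open>D1\<close> the part of \<open>D\<close> of the heaviest colour, and \<open>D'\<close> one of its
  summands.\<close>

lemma colour_split:
  fixes K X :: "('k, 'e) graded"
  assumes X: "X \<subseteq> nc_matrices mnE" and P: "finite P" and G: "finite G" and \<eta>: "0 < \<eta>"
    and M: "\<And>D p q g. D \<in> datums X \<Longrightarrow> g \<in> G \<Longrightarrow> \<bar>D (basis p, basis q, g)\<bar>
      \<le> M * sqrt (D (basis p, basis p, None)) * sqrt (D (basis q, basis q, None))" "0 \<le> M"
  shows "\<exists>R>0. \<forall>D\<in>datum_cone X. 0 < mass P D \<longrightarrow> (\<exists>D1 D2 D'. D1 \<in> datum_cone X \<and> D2 \<in> datum_cone X \<and>
      D' \<in> datums X \<and> D = (\<lambda>z. D1 z + D2 z) \<and> mass P D / R \<le> mass P D1 \<and> 0 < mass P D' \<and>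
      (\<forall>p\<in>P. \<forall>q\<in>P. \<forall>g\<in>G. \<bar>D1 (basis p, basis q, g) - mass P D1 * (D' (basis p, basis q, g) / mass P D')\<bar> \<le> \<eta> * mass P D1))"
proof -
  define I where "I = P \<times> P \<times> G"
  define val where "val D j = (case j of (p, q, g) \<Rightarrow> D (basis p, basis q, g))"
    for D :: "'k ell2 \<times> 'k ell2 \<times> 'f option \<Rightarrow> real" and j
  \<comment> \<open>Values divided by the mass are at most \<open>M\<close> in absolute value, so
    their floors in units of \<eta> lie between \<open>- N\<close> and \<open>N\<close>. The colour
    set thus does not depend on the sum to be split.\<close>
  define N where "N = \<lceil>M / \<eta>\<rceil> + 1"
  define Col where "Col = PiE I (\<lambda>_. {- N..N})"
  define col where "col D = (\<lambda>j\<in>I. \<lfloor>val D j / mass P D / \<eta>\<rfloor>)" for D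
  have I: "finite I" using P G by (simp add: I_def)
  have Col: "finite Col" unfolding Col_def by (intro finite_PiE I) simp
  have d0: "0 \<le> D (v, v, None)" if "D \<in> datums X" for D v
    using datum_cone_bilinear(6)[OF datums_cone[OF that] X] .
  have m0: "0 \<le> mass P D" if "D \<in> datums X" for D
    unfolding mass_def by (intro sum_nonneg d0 that)
  have val_le: "\<bar>val D j\<bar> \<le> M * mass P D" if D: "D \<in> datums X" and j: "j \<in> I" for D j
  proof -
    obtain p q g where jj: "j = (p, q, g)" "p \<in> P" "q \<in> P" "g \<in> G" using j by (auto simp: I_def)
    have dm: "D (basis r, basis r, None) \<le> mass P D" if "r \<in> P" for r
      unfolding mass_def using member_le_sum[of r P "\<lambda>r. D (basis r, basis r, None)"] that P d0[OF D] by simp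
    have "\<bar>val D j\<bar> \<le> M * sqrt (D (basis p, basis p, None)) * sqrt (D (basis q, basis q, None))"
      unfolding val_def jj using M(1)[OF D jj(4)] by simp
    also have "\<dots> \<le> M * sqrt (mass P D) * sqrt (mass P D)"
      using dm jj d0[OF D] m0[OF D] M(2) by (intro mult_mono real_sqrt_le_mono mult_nonneg_nonneg) auto
    also have "\<dots> = M * mass P D" using m0[OF D] by simp
    finally show ?thesis .
  qed
  have colC: "col D \<in> Col" if D: "D \<in> datums X" "0 < mass P D" for D
  proof -
    have "\<lfloor>val D j / mass P D / \<eta>\<rfloor> \<in> {- N..N}" if j: "j \<in> I" for j
    proof -
      have *: "\<bar>val D j / mass P D / \<eta>\<bar> \<le> M / \<eta>"
        using val_le[OF D(1) j] D(2) \<eta> by (simp add: abs_divide divide_right_mono pos_divide_le_eq)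
      have "- (M / \<eta>) \<le> val D j / mass P D / \<eta>" "val D j / mass P D / \<eta> \<le> M / \<eta>"
        using abs_le_D1[OF *] abs_le_D2[OF *] by linarith+
      then show ?thesis unfolding N_def by (simp add: le_floor_iff floor_le_iff) linarith
    qed
    then show ?thesis by (auto simp: Col_def col_def)
  qed
  \<comment> \<open>The \<open>+ 1\<close> makes \<open>R\<close> positive outright and only weakens
    the share that is claimed.\<close>
  define R where "R = real (card Col) + 1"
  show ?thesis
  proof (intro exI[of _ R] conjI ballI impI)
    show "0 < R" by (simp add: R_def)
    fix D assume D: "D \<in> datum_cone X" "0 < mass P D"
    obtain r :: nat and Ds where Ds: "D = (\<lambda>z. \<Sum>i<r. Ds i z)" "\<And>i. i < r \<Longrightarrow> Ds i \<in> datums X"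
      using D(1) by (rule coneE) (rule that)
    have mass_sum: "mass P (\<lambda>z. \<Sum>i\<in>J. Ds i z) = (\<Sum>i\<in>J. mass P (Ds i))" for J
      unfolding mass_def by (rule sum.swap)
    \<comment> \<open>Summands of mass zero cannot be normalized; they receive no colour and end up
      in \<open>D2\<close>.\<close>
    define J where "J = {i \<in> {..<r}. 0 < mass P (Ds i)}"
    have massD: "mass P D = (\<Sum>i\<in>J. mass P (Ds i))"
    proof -
      have "mass P D = (\<Sum>i<r. mass P (Ds i))" unfolding Ds(1) by (rule mass_sum)
      also have "\<dots> = (\<Sum>i\<in>J. mass P (Ds i))"
        using m0[OF Ds(2)] unfolding J_def by (intro sum.mono_neutral_right) (auto simp: less_le)
      finally show ?thesis .
    qed
    have J: "finite J" by (simp add: J_def)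
    obtain k where k: "k \<in> Col" "(\<Sum>i\<in>J. mass P (Ds i)) / real (card Col) \<le> (\<Sum>i\<in>{i \<in> J. col (Ds i) = k}. mass P (Ds i))"
    proof (rule pigeonhole_sum[OF J Col])
      show "col (Ds i) \<in> Col" if "i \<in> J" for i using that Ds(2) by (intro colC) (auto simp: J_def)
      show "0 < (\<Sum>i\<in>J. mass P (Ds i))" using D(2) massD by simp
    qed
    define J1 where "J1 = {i \<in> J. col (Ds i) = k}"
    define D1 where "D1 z = (\<Sum>i\<in>J1. Ds i z)" for z
    define D2 where "D2 z = (\<Sum>i\<in>{..<r} - J1. Ds i z)" for z
    have J1: "finite J1" "J1 \<subseteq> {..<r}" by (auto simp: J1_def J_def)
    have D1C: "D1 \<in> datum_cone X" unfolding D1_def[abs_def] using J1 Ds(2) by (intro cone_finite_sum) auto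
    have D2C: "D2 \<in> datum_cone X" unfolding D2_def[abs_def] using Ds(2) by (intro cone_finite_sum) auto
    have D12: "D = (\<lambda>z. D1 z + D2 z)"
      unfolding Ds(1) D1_def D2_def using J1 by (intro ext) (metis add.commute finite_lessThan sum.subset_diff)
    have mD1: "mass P D1 = (\<Sum>i\<in>J1. mass P (Ds i))" unfolding D1_def[abs_def] by (rule mass_sum)
    have cardC: "0 < real (card Col)" using k(1) Col by (auto simp: card_gt_0_iff)
    have mD1': "mass P D / R \<le> mass P D1"
    proof -
      have "mass P D / R \<le> mass P D / real (card Col)"
        using D(2) cardC by (intro divide_left_mono) (auto simp: R_def)
      then show ?thesis using k(2) unfolding massD[symmetric] mD1 J1_def by linarith
    qed
    then have "0 < mass P D1" using D(2) cardC by (smt (verit) R_def divide_pos_pos)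
    then obtain i0 where i0: "i0 \<in> J1" unfolding mD1 by (metis ex_in_conv less_irrefl sum.empty)
    define D' where "D' = Ds i0"
    have D': "D' \<in> datums X" "0 < mass P D'" "col D' = k"
      using i0 Ds(2) by (auto simp: D'_def J1_def J_def)
    \<comment> \<open>Equal floors mean that the normalized values differ by at most \<eta>;
      multiplying by the mass makes the estimate additive over the colour class.\<close>
    have close: "\<bar>val (Ds i) j - mass P (Ds i) * (val D' j / mass P D')\<bar> \<le> \<eta> * mass P (Ds i)"
      if i: "i \<in> J1" and j: "j \<in> I" for i j
    proof -
      have mi: "0 < mass P (Ds i)" using i by (auto simp: J1_def J_def)
      have "\<lfloor>val (Ds i) j / mass P (Ds i) / \<eta>\<rfloor> = \<lfloor>val D' j / mass P D' / \<eta>\<rfloor>"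
      proof -
        have "col (Ds i) j = col D' j" using i D'(3) by (simp add: J1_def)
        then show ?thesis using j unfolding col_def restrict_apply by simp
      qed
      then have "\<bar>val (Ds i) j / mass P (Ds i) / \<eta> - val D' j / mass P D' / \<eta>\<bar> \<le> 1" by linarith
      then have "\<bar>(val (Ds i) j / mass P (Ds i) - val D' j / mass P D') / \<eta>\<bar> \<le> 1"
        by (simp add: diff_divide_distrib)
      then have "\<bar>val (Ds i) j / mass P (Ds i) - val D' j / mass P D'\<bar> \<le> \<eta>"
        using \<eta> by (simp add: abs_divide)
      then have "mass P (Ds i) * \<bar>val (Ds i) j / mass P (Ds i) - val D' j / mass P D'\<bar> \<le> mass P (Ds i) * \<eta>"
        using mi by (intro mult_left_mono) auto
      moreover have "mass P (Ds i) * \<bar>val (Ds i) j / mass P (Ds i) - val D' j / mass P D'\<bar>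
          = \<bar>val (Ds i) j - mass P (Ds i) * (val D' j / mass P D')\<bar>"
      proof -
        have "mass P (Ds i) * \<bar>val (Ds i) j / mass P (Ds i) - val D' j / mass P D'\<bar>
            = \<bar>mass P (Ds i) * (val (Ds i) j / mass P (Ds i) - val D' j / mass P D')\<bar>"
          using mi by (simp add: abs_mult)
        also have "mass P (Ds i) * (val (Ds i) j / mass P (Ds i) - val D' j / mass P D')
            = val (Ds i) j - mass P (Ds i) * (val D' j / mass P D')"
          using mi by (simp add: right_diff_distrib)
        finally show ?thesis .
      qed
      ultimately show ?thesis by (simp add: mult.commute)
    qed
    have "\<bar>D1 (basis p, basis q, g) - mass P D1 * (D' (basis p, basis q, g) / mass P D')\<bar> \<le> \<eta> * mass P D1"
      if "p \<in> P" "q \<in> P" "g \<in> G" for p q g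
    proof -
      let ?j = "(p, q, g)"
      have j: "?j \<in> I" using that by (simp add: I_def)
      have "D1 (basis p, basis q, g) - mass P D1 * (D' (basis p, basis q, g) / mass P D')
          = (\<Sum>i\<in>J1. val (Ds i) ?j - mass P (Ds i) * (val D' ?j / mass P D'))"
        by (simp add: D1_def mD1 val_def sum_subtractf sum_distrib_right sum_divide_distrib)
      also have "\<bar>\<dots>\<bar> \<le> (\<Sum>i\<in>J1. \<eta> * mass P (Ds i))"
        by (rule order_trans[OF sum_abs]) (intro sum_mono close j)
      also have "\<dots> = \<eta> * mass P D1" by (simp add: mD1 sum_distrib_left)
      finally show ?thesis .
    qed
    then show "\<exists>D1 D2 D'. D1 \<in> datum_cone X \<and> D2 \<in> datum_cone X \<and>
      D' \<in> datums X \<and> D = (\<lambda>z. D1 z + D2 z) \<and> mass P D / R \<le> mass P D1 \<and> 0 < mass P D' \<and>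
      (\<forall>p\<in>P. \<forall>q\<in>P. \<forall>g\<in>G. \<bar>D1 (basis p, basis q, g) - mass P D1 * (D' (basis p, basis q, g) / mass P D')\<bar> \<le> \<eta> * mass P D1)"
      using D1C D2C D' D12 mD1' by blast
  qed
qed

lemma datum_cone_mono: "X \<subseteq> K \<Longrightarrow> datum_cone X \<subseteq> datum_cone K"
  unfolding datum_cone_def datums_def by blast

text \<open>The colour bound \<open>R\<close> is fixed before the sums approach
  \<open>(1, x)\<close>, so the heavy part keeps a mass that does not tend to zero. It tends to a
  positive multiple of \<open>(1, x)\<close> on the entries at hand while staying within \<eta>
  times its mass of a multiple of one summand; dividing by the multiple gives the
  approximation.\<close>

lemma extreme_approx:
  fixes K X :: "('k, 'e) graded"
  assumes K: "compact_nc_convex mnE pr K" and inf: "infinite (UNIV :: 'k set)" and extr: "nc_extreme K n x"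
    and X: "X \<subseteq> K" and hull: "closed_nc_hull mnE pr X = K"
    and P: "finite P" "P \<subseteq> n" "P \<noteq> {}" and G: "finite G" and \<epsilon>: "0 < \<epsilon>"
  obtains d x' u where "(d, x') \<in> X" "bounded_linear u" "\<And>v. supp_in d (u v)"
    "\<And>p q. p \<in> P \<Longrightarrow> q \<in> P \<Longrightarrow> \<bar>inner (u (basis p)) (u (basis q)) - (if p = q then 1 else 0)\<bar> < \<epsilon>"
    "\<And>p q f. p \<in> P \<Longrightarrow> q \<in> P \<Longrightarrow> f \<in> G \<Longrightarrow> \<bar>pr (form x' (u (basis p)) (u (basis q))) f - pr (x p q) f\<bar> < \<epsilon>"
proof -
  have KM: "K \<subseteq> nc_matrices mnE" using K by (auto simp: compact_nc_convex_def nc_convex_def)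
  then have XM: "X \<subseteq> nc_matrices mnE" using X by blast
  have nx: "(n, x) \<in> K" using extr by (simp add: nc_extreme_def)
  have xM: "x \<in> Mn mnE n" using nx KM by (auto simp: nc_matrices_def)
  let ?xd = "datum (proj n) x"
  have xd: "?xd \<in> closure (datum_cone X)" by (rule hull_in_closure_cone[OF K X hull nx])
  obtain C where C: "0 \<le> C" "\<And>d x. (d, x) \<in> K \<Longrightarrow> Mn_norm mnE d x \<le> C"
    by (rule compact_nc_convex_bounded[OF K inf]) blast
  obtain L where L: "\<And>e f. norm (pr e f) \<le> norm e * norm f * L" "0 \<le> L"
    using pr.nonneg_bounded by blast
  define M where "M g = (case g of None \<Rightarrow> 1 | Some f \<Rightarrow> C * norm f * L)" for g :: "'f option"
  have M0: "0 \<le> M g" for g using C(1) L(2) by (cases g) (simp_all add: M_def)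
  have bound: "\<bar>D (v, w, g)\<bar> \<le> M g * sqrt (D (v, v, None)) * sqrt (D (w, w, None))" if "D \<in> datum_cone X" for D v w g
    unfolding M_def using that datum_cone_mono[OF X] by (intro datum_cone_bound[OF _ KM C(2) L]) auto
  define G' where "G' = insert None (Some ` G)"
  have G': "finite G'" using G by (simp add: G'_def)
  define Mb where "Mb = (\<Sum>g\<in>G'. M g)"
  have Mb: "M g \<le> Mb" if "g \<in> G'" for g
    unfolding Mb_def using member_le_sum[of g G' M] that G' M0 by simp
  have Mb0: "0 \<le> Mb" unfolding Mb_def by (intro sum_nonneg M0)
  have Xd0: "0 \<le> D (v, v, None)" if "D \<in> datum_cone X" for D v
    using datum_cone_bilinear(6)[OF that XM] .
  have mass0: "0 \<le> mass P D" if "D \<in> datum_cone X" for D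
    unfolding mass_def by (intro sum_nonneg Xd0 that)
  define k where "k = real (card P)"
  have k: "k \<ge> 1" using P by (simp add: k_def Suc_le_eq card_gt_0_iff)
  have mass_xd: "mass P ?xd = k"
    using P(2) by (simp add: mass_def proj_basis k_def subset_iff)
  \<comment> \<open>The heavy part has mass about \<open>c * k\<close>, so the colour error is about
    \<open>c * \<epsilon> / 4\<close>.\<close>
  define \<eta> where "\<eta> = \<epsilon> / (4 * k)"
  have \<eta>: "0 < \<eta>" "\<eta> * k = \<epsilon> / 4" using \<epsilon> k by (auto simp: \<eta>_def)
  have bd: "\<bar>D (basis p, basis q, g)\<bar> \<le> Mb * sqrt (D (basis p, basis p, None)) * sqrt (D (basis q, basis q, None))"
    if D: "D \<in> datums X" and g: "g \<in> G'" for D p q g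
  proof -
    have DC: "D \<in> datum_cone X" by (rule datums_cone[OF D])
    have "\<bar>D (basis p, basis q, g)\<bar> \<le> M g * sqrt (D (basis p, basis p, None)) * sqrt (D (basis q, basis q, None))"
      by (rule bound[OF DC])
    also have "\<dots> \<le> Mb * sqrt (D (basis p, basis p, None)) * sqrt (D (basis q, basis q, None))"
      using Xd0[OF DC] by (intro mult_right_mono Mb g) auto
    finally show ?thesis .
  qed
  \<comment> \<open>The split is packaged as one triple so that it can be chosen as a function of
    the sum, as \<open>cluster_point\<close> requires.\<close>
  define good where "good R D t \<longleftrightarrow> fst t \<in> datum_cone X \<and> fst (snd t) \<in> datum_cone X \<and> snd (snd t) \<in> datums X \<and>
      D = (\<lambda>z. fst t z + fst (snd t) z) \<and> mass P D / R \<le> mass P (fst t) \<and> 0 < mass P (snd (snd t)) \<and>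
      (\<forall>p\<in>P. \<forall>q\<in>P. \<forall>g\<in>G'. \<bar>fst t (basis p, basis q, g)
        - mass P (fst t) * (snd (snd t) (basis p, basis q, g) / mass P (snd (snd t)))\<bar> \<le> \<eta> * mass P (fst t))"
    for R :: real and D t
  define S where "S = {D \<in> datum_cone X. 0 < mass P D}"
  have "\<exists>R>0. \<forall>D\<in>S. \<exists>t. good R D t"
  proof -
    have "\<exists>R>0. \<forall>D\<in>datum_cone X. 0 < mass P D \<longrightarrow> (\<exists>D1 D2 D'. good R D (D1, D2, D'))"
      unfolding good_def fst_conv snd_conv by (rule colour_split[OF XM P(1) G' \<eta>(1) bd Mb0])
    then show ?thesis unfolding S_def by blast
  qed
  then obtain R t where R: "R > 0" and t: "\<forall>D\<in>S. good R D (t D)" by (metis (no_types))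
  define s1 s2 s' where "s1 D = fst (t D)" and "s2 D = fst (snd (t D))" and "s' D = snd (snd (t D))" for D
  have s: "s1 D \<in> datum_cone X \<and> s2 D \<in> datum_cone X \<and> s' D \<in> datums X \<and>
      D = (\<lambda>z. s1 D z + s2 D z) \<and> mass P D / R \<le> mass P (s1 D) \<and> 0 < mass P (s' D) \<and>
      (\<forall>p\<in>P. \<forall>q\<in>P. \<forall>g\<in>G'. \<bar>s1 D (basis p, basis q, g) - mass P (s1 D) * (s' D (basis p, basis q, g) / mass P (s' D))\<bar>
        \<le> \<eta> * mass P (s1 D))" if "D \<in> S" for D
    using t that unfolding good_def s1_def s2_def s'_def by blast
  define diag where "diag = (\<lambda>p. (basis p, basis p, None :: 'f option)) ` P"
  have diag: "finite diag" using P(1) by (simp add: diag_def)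
  have mass_near: "\<bar>mass P D - mass P D0\<bar> \<le> k * e"
    if near: "\<forall>z\<in>diag. \<bar>D z - D0 z\<bar> < e" for D D0 e
  proof -
    have "\<bar>mass P D - mass P D0\<bar> \<le> (\<Sum>p\<in>P. \<bar>D (basis p, basis p, None) - D0 (basis p, basis p, None)\<bar>)"
      unfolding mass_def sum_subtractf[symmetric] by (rule sum_abs)
    also have "\<dots> \<le> (\<Sum>p\<in>P. e)" using near by (intro sum_mono less_imp_le) (auto simp: diag_def)
    finally show ?thesis by (simp add: k_def)
  qed
  \<comment> \<open>Sums near \<open>(1, x)\<close> on the diagonal have mass near \<open>k\<close>,
    which is at least 1, so requiring positive mass loses nothing.\<close>
  have xdS: "?xd \<in> closure S"
    unfolding closure_fun_iff
  proof (intro allI impI)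
    fix Q :: "('k ell2 \<times> 'k ell2 \<times> 'f option) set" and e :: real assume Q: "finite Q" "e > 0"
    obtain D where D: "D \<in> datum_cone X" "\<forall>q\<in>Q \<union> diag. \<bar>D q - ?xd q\<bar> < min e (1/2)"
      using xd Q diag unfolding closure_fun_iff by (metis finite_UnI half_gt_zero min_less_iff_conj zero_less_one)
    have "\<bar>mass P D - mass P ?xd\<bar> \<le> k * (1/2)"
      by (rule mass_near) (use D(2) in \<open>simp add: ball_Un\<close>)
    then have "0 < mass P D" using k unfolding mass_xd by linarith
    then show "\<exists>s\<in>S. \<forall>q\<in>Q. \<bar>s q - ?xd q\<bar> < e" using D by (intro bexI[of _ D]) (auto simp: S_def)
  qed
  \<comment> \<open>In the first component the heavy part lies below \<open>h\<close>, and
    \<open>h\<close> is within 1 of the projection at the two diagonal entries; the square root of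
    \<open>(norm v)\<^sup>2 + 1\<close> is at most \<open>norm v + 1\<close>.\<close>
  define b where "b z = (case z of (v, w, g) \<Rightarrow> M g * (norm v + 1) * (norm w + 1))" for z :: "'k ell2 \<times> 'k ell2 \<times> 'f option"
  obtain D1 where D1: "\<And>Q e. finite Q \<Longrightarrow> e > 0 \<Longrightarrow> \<exists>h\<in>S. \<forall>q\<in>Q. \<bar>h q - ?xd q\<bar> < e \<and> \<bar>s1 h q - D1 q\<bar> < e"
  proof (rule cluster_point[OF xdS, of s1 b])
    fix z :: "'k ell2 \<times> 'k ell2 \<times> 'f option"
    obtain v w g where z: "z = (v, w, g)" by (cases z)
    have "\<bar>s1 h z\<bar> \<le> b z" if h: "h \<in> S" and near: "\<forall>q\<in>{(v, v, None), (w, w, None)}. \<bar>h q - ?xd q\<bar> < 1" for h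
    proof -
      have sh: "s1 h \<in> datum_cone X" "s2 h \<in> datum_cone X" "h = (\<lambda>z. s1 h z + s2 h z)" using s[OF h] by auto
      have sq: "sqrt (s1 h (u, u, None)) \<le> norm u + 1" if "\<bar>h (u, u, None) - ?xd (u, u, None)\<bar> < 1" for u
      proof (rule real_le_lsqrt)
        have "s1 h (u, u, None) \<le> h (u, u, None)"
          using Xd0[OF sh(2), of u] fun_cong[OF sh(3), of "(u, u, None)"] by linarith
        also have "\<dots> \<le> (norm (proj n u))\<^sup>2 + 1"
          using that by (simp add: power2_norm_eq_inner)
        also have "\<dots> \<le> (norm u)\<^sup>2 + 1" using power_mono[OF norm_proj_le[of n u], of 2] by simp
        also have "\<dots> \<le> (norm u + 1)\<^sup>2" by (simp add: power2_sum)
        finally show "s1 h (u, u, None) \<le> (norm u + 1)\<^sup>2" .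
      qed (simp_all add: Xd0[OF sh(1)])
      have "\<bar>s1 h z\<bar> \<le> M g * sqrt (s1 h (v, v, None)) * sqrt (s1 h (w, w, None))"
        unfolding z by (rule bound[OF sh(1)])
      also have "\<dots> \<le> M g * (norm v + 1) * (norm w + 1)"
        using near by (intro mult_mono sq M0 mult_nonneg_nonneg) (auto simp: Xd0[OF sh(1)])
      finally show ?thesis by (simp add: b_def z)
    qed
    then show "\<exists>Q \<epsilon>. finite Q \<and> \<epsilon> > 0 \<and> (\<forall>h\<in>S. (\<forall>q\<in>Q. \<bar>h q - ?xd q\<bar> < \<epsilon>) \<longrightarrow> \<bar>s1 h z\<bar> \<le> b z)"
      by (intro exI[of _ "{(v, v, None), (w, w, None)}"] exI[of _ 1]) auto
  qed blast
  \<comment> \<open>The remainder needs no cluster argument of its own: it is the difference of two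
    functions that are both approximated by the same \<open>h\<close>.\<close>
  define D2 where "D2 z = ?xd z - D1 z" for z
  have "D1 \<in> closure (datum_cone K)"
    unfolding closure_fun_iff
  proof (intro allI impI)
    fix Q :: "('k ell2 \<times> 'k ell2 \<times> 'f option) set" and e :: real assume Q: "finite Q" "e > 0"
    obtain h where "h \<in> S" "\<forall>q\<in>Q. \<bar>h q - ?xd q\<bar> < e \<and> \<bar>s1 h q - D1 q\<bar> < e" using D1[OF Q] by blast
    then show "\<exists>s\<in>datum_cone K. \<forall>q\<in>Q. \<bar>s q - D1 q\<bar> < e"
      using s datum_cone_mono[OF X] by (intro bexI[of _ "s1 h"]) auto
  qed
  moreover have "D2 \<in> closure (datum_cone K)"
    unfolding closure_fun_iff
  proof (intro allI impI)
    fix Q :: "('k ell2 \<times> 'k ell2 \<times> 'f option) set" and e :: real assume Q: "finite Q" "e > 0"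
    then have "e / 2 > 0" by simp
    then obtain h where h: "h \<in> S" "\<forall>q\<in>Q. \<bar>h q - ?xd q\<bar> < e / 2 \<and> \<bar>s1 h q - D1 q\<bar> < e / 2" using D1[OF Q(1)] by blast
    have sh: "h = (\<lambda>z. s1 h z + s2 h z)" "s2 h \<in> datum_cone X" using s[OF h(1)] by auto
    have "\<bar>s2 h q - D2 q\<bar> < e" if "q \<in> Q" for q
    proof -
      have "\<bar>h q - ?xd q\<bar> < e / 2" "\<bar>s1 h q - D1 q\<bar> < e / 2" using h(2) that by auto
      then show ?thesis using fun_cong[OF sh(1), of q] unfolding D2_def by linarith
    qed
    then show "\<exists>s\<in>datum_cone K. \<forall>q\<in>Q. \<bar>s q - D2 q\<bar> < e"
      using sh(2) datum_cone_mono[OF X] by (intro bexI[of _ "s2 h"]) auto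
  qed
  moreover have "D1 z + D2 z = ?xd z" for z by (simp add: D2_def)
  ultimately obtain c where c: "\<And>p q g. p \<in> n \<Longrightarrow> q \<in> n \<Longrightarrow> D1 (basis p, basis q, g) = c * ?xd (basis p, basis q, g)"
    by (rule extreme_split[OF K inf extr]) blast
  have mD1: "mass P D1 = c * k"
  proof -
    have "mass P D1 = (\<Sum>p\<in>P. c * ?xd (basis p, basis p, None))"
      unfolding mass_def using P(2) by (intro sum.cong refl c) auto
    then show ?thesis using mass_xd by (simp add: mass_def sum_distrib_left[symmetric])
  qed
  have c0: "c > 0"
  proof -
    \<comment> \<open>The bound 1/2 keeps the mass of \<open>h\<close> at least
      \<open>k / 2\<close>, so its heavy part has mass at least \<open>k / (2 * R)\<close>; the
      error \<open>k / (4 * R)\<close> in passing to \<open>D1\<close> leaves half of that.\<close>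
    define e where "e = min (1/2) (1 / (4 * R))"
    have e: "e > 0" using R by (simp add: e_def)
    obtain h where h: "h \<in> S" "\<forall>q\<in>diag. \<bar>h q - ?xd q\<bar> < e \<and> \<bar>s1 h q - D1 q\<bar> < e" using D1[OF diag e] by blast
    have 1: "\<bar>mass P h - k\<bar> \<le> k * e"
      using mass_near[of h ?xd e] h(2) unfolding mass_xd by blast
    have 2: "\<bar>mass P (s1 h) - c * k\<bar> \<le> k * e"
      unfolding mD1[symmetric] by (rule mass_near) (use h(2) in blast)
    have 3: "mass P h / R \<le> mass P (s1 h)" using s[OF h(1)] by blast
    have "k * e \<le> k * (1/2)" using k by (intro mult_left_mono) (auto simp: e_def)
    then have "k / 2 \<le> mass P h" using 1 by linarith
    then have "k / 2 / R \<le> mass P h / R" using R by (intro divide_right_mono) auto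
    moreover have "k * e \<le> k * (1 / (4 * R))" using k by (intro mult_left_mono) (auto simp: e_def)
    moreover have "k / 2 / R = 2 * (k * (1 / (4 * R)))" "0 < k * (1 / (4 * R))" using k R by auto
    ultimately have "0 < c * k" using 2 3 by linarith
    then show ?thesis using k by (simp add: zero_less_mult_iff)
  qed
  \<comment> \<open>Collects the errors proportional to \<open>e1\<close>: \<open>k * Mb\<close>
    from replacing the mass \<mu> by \<open>c * k\<close>, 1 from replacing the heavy part by
    \<open>D1\<close>, and \<open>\<eta> * k\<close> from \<mu> in the colour estimate.\<close>
  define B where "B = k * Mb + 1 + \<eta> * k"
  have B: "B > 0" using k Mb0 \<eta>(1) by (simp add: B_def add_pos_pos add_nonneg_pos)
  define e1 where "e1 = c * \<epsilon> / (4 * B)"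
  have e1: "e1 > 0" "e1 * B = c * \<epsilon> / 4" using c0 \<epsilon> B by (auto simp: e1_def)
  define Q where "Q = diag \<union> (\<lambda>(p, q, g). (basis p, basis q, g)) ` (P \<times> P \<times> G')"
  have Q: "finite Q" using diag P(1) G' by (simp add: Q_def)
  obtain h where h: "h \<in> S" "\<forall>q\<in>Q. \<bar>h q - ?xd q\<bar> < e1 \<and> \<bar>s1 h q - D1 q\<bar> < e1" using D1[OF Q e1(1)] by blast
  define \<mu> where "\<mu> = mass P (s1 h)"
  define D' where "D' = s' h"
  have sh: "s1 h \<in> datum_cone X" "D' \<in> datums X" "0 < mass P D'"
    "\<And>p q g. p \<in> P \<Longrightarrow> q \<in> P \<Longrightarrow> g \<in> G' \<Longrightarrow>
      \<bar>s1 h (basis p, basis q, g) - \<mu> * (D' (basis p, basis q, g) / mass P D')\<bar> \<le> \<eta> * \<mu>"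
    using s[OF h(1)] unfolding \<mu>_def D'_def by auto
  have \<mu>: "\<bar>\<mu> - c * k\<bar> \<le> k * e1"
    unfolding \<mu>_def mD1[symmetric] by (rule mass_near) (use h(2) in \<open>simp add: Q_def ball_Un\<close>)
  have key: "\<bar>k / mass P D' * D' (basis p, basis q, g) - ?xd (basis p, basis q, g)\<bar> < \<epsilon>"
    if pq: "p \<in> P" "q \<in> P" and g: "g \<in> G'" for p q g
  proof -
    define t where "t = D' (basis p, basis q, g) / mass P D'"
    have D'C: "D' \<in> datum_cone X" by (rule datums_cone[OF sh(2)])
    have "\<bar>t\<bar> \<le> Mb"
    proof -
      have dm: "D' (basis r, basis r, None) \<le> mass P D'" if "r \<in> P" for r
        unfolding mass_def using member_le_sum[of r P "\<lambda>r. D' (basis r, basis r, None)"] that P(1) Xd0[OF D'C] by simp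
      have "\<bar>D' (basis p, basis q, g)\<bar> \<le> Mb * sqrt (D' (basis p, basis p, None)) * sqrt (D' (basis q, basis q, None))"
        by (rule bd[OF sh(2) g])
      also have "\<dots> \<le> Mb * sqrt (mass P D') * sqrt (mass P D')"
        using dm pq Xd0[OF D'C] sh(3) Mb0 by (intro mult_mono real_sqrt_le_mono mult_nonneg_nonneg) auto
      also have "\<dots> = Mb * mass P D'" using sh(3) by simp
      finally show ?thesis using sh(3) by (simp add: t_def abs_divide pos_divide_le_eq)
    qed
    let ?y = "?xd (basis p, basis q, g)" and ?s = "s1 h (basis p, basis q, g)"
    have z: "(basis p, basis q, g) \<in> Q" using pq g by (force simp: Q_def)
    have 1: "\<bar>?s - c * ?y\<bar> < e1" using h(2) z c[of p q g] pq P(2) by (metis subsetD)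
    have 2: "\<bar>?s - \<mu> * t\<bar> \<le> \<eta> * \<mu>" using sh(4)[OF pq g] by (simp add: t_def)
    have 3: "\<bar>(\<mu> - c * k) * t\<bar> \<le> (k * e1) * Mb"
      unfolding abs_mult by (intro mult_mono \<mu> \<open>\<bar>t\<bar> \<le> Mb\<close>) (use k e1 in auto)
    have 4: "\<eta> * \<mu> \<le> \<eta> * (c * k + k * e1)" using \<mu> \<eta>(1) by (intro mult_left_mono) linarith+
    have "\<bar>c * (k * t) - c * ?y\<bar> \<le> \<bar>(\<mu> - c * k) * t\<bar> + \<bar>?s - \<mu> * t\<bar> + \<bar>?s - c * ?y\<bar>"
    proof -
      have "c * (k * t) - c * ?y = - ((\<mu> - c * k) * t) - (?s - \<mu> * t) + (?s - c * ?y)" by (simp add: algebra_simps)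
      then show ?thesis by linarith
    qed
    also have "\<dots> < (k * e1) * Mb + \<eta> * (c * k + k * e1) + e1" using 1 2 3 4 by linarith
    also have "\<dots> = e1 * B + c * (\<eta> * k)" by (simp add: B_def algebra_simps)
    also have "\<dots> = c * (\<epsilon> / 2)" by (simp add: e1(2) \<eta>(2))
    also have "\<dots> < c * \<epsilon>" using c0 \<epsilon> by simp
    finally have "c * \<bar>k * t - ?y\<bar> < c * \<epsilon>"
      using c0 unfolding right_diff_distrib[symmetric] abs_mult by (simp only: abs_of_pos)
    then show ?thesis using c0 by (simp add: t_def)
  qed
  obtain u d x' where u: "D' = datum u x'" "(d, x') \<in> X" "bounded_linear u" "\<And>v. supp_in d (u v)"
    using sh(2) by (rule datumsE) blast
  have "x' \<in> Mn mnE d" using u(2) XM by (auto simp: nc_matrices_def)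
  then interpret bx: bounded_bilinear "form x'" by (rule bilinear_form_E)
  \<comment> \<open>Rescales the chosen summand to mass \<open>k\<close>, the mass of
    \<open>(1, x)\<close>.\<close>
  define \<tau> where "\<tau> = sqrt (k / mass P D')"
  have \<tau>: "\<tau> * \<tau> = k / mass P D'" using k sh(3) by (simp add: \<tau>_def)
  show thesis
  proof (rule that[of d x' "\<lambda>v. \<tau> *\<^sub>R u v"])
    show "bounded_linear (\<lambda>v. \<tau> *\<^sub>R u v)" by (rule bounded_linear_compose[OF bounded_linear_scaleR_right u(3)])
    show "\<bar>inner (\<tau> *\<^sub>R u (basis p)) (\<tau> *\<^sub>R u (basis q)) - (if p = q then 1 else 0)\<bar> < \<epsilon>"
      if pq: "p \<in> P" "q \<in> P" for p q
    proof -
      have "inner (\<tau> *\<^sub>R u (basis p)) (\<tau> *\<^sub>R u (basis q)) = k / mass P D' * D' (basis p, basis q, None)"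
        unfolding \<tau>[symmetric] by (simp add: u(1) mult.assoc)
      moreover have "?xd (basis p, basis q, None) = (if p = q then 1 else 0)"
        using pq P(2) by (simp add: proj_basis subset_iff)
      ultimately show ?thesis using key[OF pq, of None] by (simp add: G'_def)
    qed
    show "\<bar>pr (form x' (\<tau> *\<^sub>R u (basis p)) (\<tau> *\<^sub>R u (basis q))) f - pr (x p q) f\<bar> < \<epsilon>"
      if pq: "p \<in> P" "q \<in> P" and f: "f \<in> G" for p q f
    proof -
      have "pr (form x' (\<tau> *\<^sub>R u (basis p)) (\<tau> *\<^sub>R u (basis q))) f = k / mass P D' * D' (basis p, basis q, Some f)"
        unfolding \<tau>[symmetric] by (simp add: u(1) bx.scaleR_left bx.scaleR_right pr.scaleR_left mult.assoc)
      moreover have "?xd (basis p, basis q, Some f) = pr (x p q) f" by (simp add: form_proj[OF xM])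
      ultimately show ?thesis using key[OF pq, of "Some f"] f by (simp add: G'_def)
    qed
    show "(d, x') \<in> X" by (rule u(2))
    show "supp_in d (\<tau> *\<^sub>R u v)" for v by (intro supp_in_scaleR u(4))
  qed
qed

text \<open>The approximations are indexed by the finite subsets of \<open>Ix\<close>, which
  prescribe the basis vectors, the predual elements and the precision. Each is made a contraction by
  truncation and rescaling. The net is then norm bounded, so entrywise convergence is weak*
  convergence and the definition of an nc closed set applies.\<close>

lemma nc_extreme_in_closed:
  fixes K X :: "('k, 'e) graded"
  assumes K: "compact_nc_convex mnE pr K" and inf: "infinite (UNIV :: 'k set)" and extr: "nc_extreme K n x"
    and X: "nc_closed_in mnE pr K X" and hull: "closed_nc_hull mnE pr X = K"
  shows "(n, x) \<in> X"
proof -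
  have KM: "K \<subseteq> nc_matrices mnE" using K by (auto simp: compact_nc_convex_def nc_convex_def)
  have XK: "X \<subseteq> K" using X by (simp add: nc_closed_in_def)
  have nx: "(n, x) \<in> K" using extr by (simp add: nc_extreme_def)
  have n: "n \<in> cardinals" and xM: "x \<in> Mn mnE n" using nx KM by (auto simp: nc_matrices_def)
  obtain p0 where p0: "p0 \<in> n" using n by (auto simp: cardinals_def)
  obtain C where C: "0 \<le> C" "\<And>d x. (d, x) \<in> K \<Longrightarrow> Mn_norm mnE d x \<le> C"
    by (rule compact_nc_convex_bounded[OF K inf]) blast
  \<comment> \<open>The natural number is a mere counter: it lets \<Lambda> grow, and hence
    \<open>\<delta> \<Lambda>\<close> tend to zero, even when there are only finitely many pairs of
    a basis index and a predual element.\<close>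
  define Ix where "Ix = n \<times> (UNIV :: 'f set) \<times> (UNIV :: nat set)"
  define P where "P \<Lambda> = insert p0 (fst ` \<Lambda>)" for \<Lambda> :: "('k \<times> 'f \<times> nat) set"
  define G where "G \<Lambda> = (fst \<circ> snd) ` \<Lambda>" for \<Lambda> :: "('k \<times> 'f \<times> nat) set"
  define \<delta> where "\<delta> \<Lambda> = 1 / (1 + real (card \<Lambda>))" for \<Lambda> :: "('k \<times> 'f \<times> nat) set"
  \<comment> \<open>An error \<epsilon> in each entry of the Gram matrix over
    \<open>P \<Lambda>\<close> changes its quadratic form by at most \<epsilon> times the number of
    vectors, that is by \<delta>.\<close>
  define \<epsilon> where "\<epsilon> \<Lambda> = \<delta> \<Lambda> / real (card (P \<Lambda>))" for \<Lambda>
  have \<delta>: "0 < \<delta> \<Lambda>" for \<Lambda> by (simp add: \<delta>_def)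
  have cardP: "1 \<le> real (card (P \<Lambda>))" if "finite \<Lambda>" for \<Lambda>
    using that by (simp add: P_def Suc_le_eq card_gt_0_iff)
  have \<epsilon>: "0 < \<epsilon> \<Lambda>" "\<epsilon> \<Lambda> \<le> \<delta> \<Lambda>" "\<epsilon> \<Lambda> * real (card (P \<Lambda>)) = \<delta> \<Lambda>" if "finite \<Lambda>" for \<Lambda>
    using cardP[OF that] \<delta>[of \<Lambda>] by (auto simp: \<epsilon>_def divide_le_eq mult_le_cancel_left1)
  define good where "good \<Lambda> t \<longleftrightarrow> (fst t, fst (snd t)) \<in> X \<and> bounded_linear (snd (snd t)) \<and>
      (\<forall>v. supp_in (fst t) (snd (snd t) v)) \<and>
      (\<forall>p\<in>P \<Lambda>. \<forall>q\<in>P \<Lambda>. \<bar>inner (snd (snd t) (basis p)) (snd (snd t) (basis q)) - (if p = q then 1 else 0)\<bar> < \<epsilon> \<Lambda>) \<and>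
      (\<forall>p\<in>P \<Lambda>. \<forall>q\<in>P \<Lambda>. \<forall>f\<in>G \<Lambda>.
        \<bar>pr (form (fst (snd t)) (snd (snd t) (basis p)) (snd (snd t) (basis q))) f - pr (x p q) f\<bar> < \<epsilon> \<Lambda>)"
    for \<Lambda> and t :: "'k set \<times> ('k \<Rightarrow> 'k \<Rightarrow> 'e) \<times> ('k ell2 \<Rightarrow> 'k ell2)"
  have "\<exists>t. good \<Lambda> t" if \<Lambda>: "finite \<Lambda>" "\<Lambda> \<subseteq> Ix" for \<Lambda>
  proof -
    have P: "finite (P \<Lambda>)" "P \<Lambda> \<subseteq> n" "P \<Lambda> \<noteq> {}" and G: "finite (G \<Lambda>)"
      using \<Lambda> p0 by (auto simp: P_def G_def Ix_def)
    show ?thesis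
    proof (rule extreme_approx[OF K inf extr XK hull P G \<epsilon>(1)[OF \<Lambda>(1)]])
      fix d x' u
      assume t: "(d, x') \<in> X" "bounded_linear u" "\<And>v. supp_in d (u v)"
        "\<And>p q. p \<in> P \<Lambda> \<Longrightarrow> q \<in> P \<Lambda> \<Longrightarrow> \<bar>inner (u (basis p)) (u (basis q)) - (if p = q then 1 else 0)\<bar> < \<epsilon> \<Lambda>"
        "\<And>p q f. p \<in> P \<Lambda> \<Longrightarrow> q \<in> P \<Lambda> \<Longrightarrow> f \<in> G \<Lambda> \<Longrightarrow> \<bar>pr (form x' (u (basis p)) (u (basis q))) f - pr (x p q) f\<bar> < \<epsilon> \<Lambda>"
      have "good \<Lambda> (d, x', u)"
        unfolding good_def fst_conv snd_conv by (intro conjI ballI allI) (rule t; assumption)+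
      then show ?thesis ..
    qed
  qed
  then have good: "good \<Lambda> (SOME t. good \<Lambda> t)" if "finite \<Lambda>" "\<Lambda> \<subseteq> Ix" for \<Lambda>
    using that by (intro someI_ex[of "good \<Lambda>"])
  define d x' u where "d \<Lambda> = fst (SOME t. good \<Lambda> t)" and "x' \<Lambda> = fst (snd (SOME t. good \<Lambda> t))"
    and "u \<Lambda> = snd (snd (SOME t. good \<Lambda> t))" for \<Lambda>
  have good': "good \<Lambda> (d \<Lambda>, x' \<Lambda>, u \<Lambda>)" if "finite \<Lambda>" "\<Lambda> \<subseteq> Ix" for \<Lambda>
    unfolding d_def x'_def u_def prod.collapse by (rule good[OF that])
  have u: "\<And>\<Lambda>. finite \<Lambda> \<Longrightarrow> \<Lambda> \<subseteq> Ix \<Longrightarrow> (d \<Lambda>, x' \<Lambda>) \<in> X"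
    "\<And>\<Lambda>. finite \<Lambda> \<Longrightarrow> \<Lambda> \<subseteq> Ix \<Longrightarrow> bounded_linear (u \<Lambda>)"
    "\<And>\<Lambda> v. finite \<Lambda> \<Longrightarrow> \<Lambda> \<subseteq> Ix \<Longrightarrow> supp_in (d \<Lambda>) (u \<Lambda> v)"
    "\<And>\<Lambda> p q. finite \<Lambda> \<Longrightarrow> \<Lambda> \<subseteq> Ix \<Longrightarrow> p \<in> P \<Lambda> \<Longrightarrow> q \<in> P \<Lambda> \<Longrightarrow>
      \<bar>inner (u \<Lambda> (basis p)) (u \<Lambda> (basis q)) - (if p = q then 1 else 0)\<bar> < \<epsilon> \<Lambda>"
    "\<And>\<Lambda> p q f. finite \<Lambda> \<Longrightarrow> \<Lambda> \<subseteq> Ix \<Longrightarrow> p \<in> P \<Lambda> \<Longrightarrow> q \<in> P \<Lambda> \<Longrightarrow> f \<in> G \<Lambda> \<Longrightarrow>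
      \<bar>pr (form (x' \<Lambda>) (u \<Lambda> (basis p)) (u \<Lambda> (basis q))) f - pr (x p q) f\<bar> < \<epsilon> \<Lambda>"
    by (drule (1) good', unfold good_def fst_conv snd_conv, blast)+
  \<comment> \<open>The quadratic form of the Gram matrix is at most \<open>1 + \<delta>\<close>, so
    this factor produces a contraction.\<close>
  define \<tau> where "\<tau> \<Lambda> = 1 / sqrt (1 + \<delta> \<Lambda>)" for \<Lambda>
  have \<tau>: "\<tau> \<Lambda> * \<tau> \<Lambda> = 1 / (1 + \<delta> \<Lambda>)" for \<Lambda>
    using \<delta>[of \<Lambda>] by (simp add: \<tau>_def)
  \<comment> \<open>Nothing is known about \<open>u \<Lambda>\<close> on basis vectors outside
    \<open>P \<Lambda>\<close>, so these are projected away.\<close>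
  define U where "U \<Lambda> v = \<tau> \<Lambda> *\<^sub>R u \<Lambda> (proj (P \<Lambda>) v)" for \<Lambda> v
  have U_lin: "bounded_linear (U \<Lambda>)" if "finite \<Lambda>" "\<Lambda> \<subseteq> Ix" for \<Lambda>
    unfolding U_def by (intro bounded_linear_compose[OF bounded_linear_scaleR_right]
        bounded_linear_compose[OF u(2)[OF that] bounded_linear_proj])
  have U_supp: "supp_in (d \<Lambda>) (U \<Lambda> v)" if "finite \<Lambda>" "\<Lambda> \<subseteq> Ix" for \<Lambda> v
    unfolding U_def by (intro supp_in_scaleR u(3) that)
  have U_norm: "norm (U \<Lambda> v) \<le> norm v" if \<Lambda>: "finite \<Lambda>" "\<Lambda> \<subseteq> Ix" for \<Lambda> v
  proof -
    interpret u: bounded_linear "u \<Lambda>" by (rule u(2)[OF \<Lambda>])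
    have fP: "finite (P \<Lambda>)" using \<Lambda> by (simp add: P_def)
    let ?c = "coord v"
    have projP: "proj (P \<Lambda>) v = (\<Sum>p\<in>P \<Lambda>. ?c p *\<^sub>R basis p)"
      using fP by (intro ell2_eqI) (simp add: coord_sum if_distrib cong: if_cong)
    let ?g = "\<lambda>p q. inner (u \<Lambda> (basis p)) (u \<Lambda> (basis q))"
    have "(norm (u \<Lambda> (proj (P \<Lambda>) v)))\<^sup>2 = (\<Sum>p\<in>P \<Lambda>. \<Sum>q\<in>P \<Lambda>. ?c p * ?c q * ?g p q)"
      unfolding projP by (simp add: u.sum u.scaleR power2_norm_eq_inner inner_sum_left inner_sum_right
          sum_distrib_left inner_commute mult_ac)
    also have "\<dots> = (\<Sum>p\<in>P \<Lambda>. \<Sum>q\<in>P \<Lambda>. if p = q then (?c p)\<^sup>2 else 0)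
        + (\<Sum>p\<in>P \<Lambda>. \<Sum>q\<in>P \<Lambda>. ?c p * ?c q * (?g p q - (if p = q then 1 else 0)))"
      unfolding sum.distrib[symmetric]
      by (intro sum.cong refl) (simp add: right_diff_distrib power2_eq_square)
    also have "\<dots> \<le> (norm v)\<^sup>2 + \<delta> \<Lambda> * (norm v)\<^sup>2"
    proof (rule add_mono)
      have sq: "(\<Sum>p\<in>P \<Lambda>. (?c p)\<^sup>2) \<le> (norm v)\<^sup>2" by (rule sum_coord_square_le[OF fP])
      then show "(\<Sum>p\<in>P \<Lambda>. \<Sum>q\<in>P \<Lambda>. if p = q then (?c p)\<^sup>2 else 0) \<le> (norm v)\<^sup>2"
        using fP by simp
      have "(\<Sum>p\<in>P \<Lambda>. \<Sum>q\<in>P \<Lambda>. ?c p * ?c q * (?g p q - (if p = q then 1 else 0)))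
          \<le> (\<Sum>p\<in>P \<Lambda>. \<Sum>q\<in>P \<Lambda>. \<bar>?c p\<bar> * \<bar>?c q\<bar> * \<epsilon> \<Lambda>)"
      proof (intro sum_mono)
        fix p q assume "p \<in> P \<Lambda>" "q \<in> P \<Lambda>"
        then have "\<bar>?g p q - (if p = q then 1 else 0)\<bar> \<le> \<epsilon> \<Lambda>" using u(4)[OF \<Lambda>] less_imp_le by blast
        then have "\<bar>?c p * ?c q * (?g p q - (if p = q then 1 else 0))\<bar> \<le> \<bar>?c p\<bar> * \<bar>?c q\<bar> * \<epsilon> \<Lambda>"
          unfolding abs_mult by (intro mult_left_mono) auto
        then show "?c p * ?c q * (?g p q - (if p = q then 1 else 0)) \<le> \<bar>?c p\<bar> * \<bar>?c q\<bar> * \<epsilon> \<Lambda>" by linarith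
      qed
      also have "\<dots> = \<epsilon> \<Lambda> * (\<Sum>p\<in>P \<Lambda>. \<bar>?c p\<bar>)\<^sup>2"
        by (simp add: power2_eq_square sum_product sum_distrib_left mult_ac)
      also have "\<dots> \<le> \<epsilon> \<Lambda> * (real (card (P \<Lambda>)) * (norm v)\<^sup>2)"
      proof (intro mult_left_mono)
        have "(\<Sum>p\<in>P \<Lambda>. \<bar>?c p\<bar> * \<bar>1\<bar>) \<le> L2_set ?c (P \<Lambda>) * L2_set (\<lambda>_. 1) (P \<Lambda>)"
          by (rule L2_set_mult_ineq)
        then have "(\<Sum>p\<in>P \<Lambda>. \<bar>?c p\<bar>) \<le> sqrt (\<Sum>p\<in>P \<Lambda>. (?c p)\<^sup>2) * sqrt (real (card (P \<Lambda>)))"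
          by (simp add: L2_set_def)
        then have "(\<Sum>p\<in>P \<Lambda>. \<bar>?c p\<bar>)\<^sup>2 \<le> (sqrt (\<Sum>p\<in>P \<Lambda>. (?c p)\<^sup>2) * sqrt (real (card (P \<Lambda>))))\<^sup>2"
          by (intro power_mono) (auto simp: sum_nonneg)
        also have "\<dots> = (\<Sum>p\<in>P \<Lambda>. (?c p)\<^sup>2) * real (card (P \<Lambda>))"
          by (simp add: power_mult_distrib sum_nonneg)
        also have "\<dots> \<le> (norm v)\<^sup>2 * real (card (P \<Lambda>))" by (intro mult_right_mono sq) simp
        finally show "(\<Sum>p\<in>P \<Lambda>. \<bar>?c p\<bar>)\<^sup>2 \<le> real (card (P \<Lambda>)) * (norm v)\<^sup>2" by (simp add: mult.commute)
      qed (use \<epsilon>(1)[OF \<Lambda>(1)] in simp)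
      also have "\<dots> = \<delta> \<Lambda> * (norm v)\<^sup>2" unfolding mult.assoc[symmetric] \<epsilon>(3)[OF \<Lambda>(1)] ..
      finally show "(\<Sum>p\<in>P \<Lambda>. \<Sum>q\<in>P \<Lambda>. ?c p * ?c q * (?g p q - (if p = q then 1 else 0))) \<le> \<delta> \<Lambda> * (norm v)\<^sup>2" .
    qed
    finally have le: "(norm (u \<Lambda> (proj (P \<Lambda>) v)))\<^sup>2 \<le> (1 + \<delta> \<Lambda>) * (norm v)\<^sup>2" by (simp add: distrib_right)
    have "(norm (U \<Lambda> v))\<^sup>2 = 1 / (1 + \<delta> \<Lambda>) * (norm (u \<Lambda> (proj (P \<Lambda>) v)))\<^sup>2"
      by (simp add: U_def power_mult_distrib power2_eq_square[of "\<tau> \<Lambda>"] \<tau>)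
    also have "\<dots> \<le> 1 / (1 + \<delta> \<Lambda>) * ((1 + \<delta> \<Lambda>) * (norm v)\<^sup>2)"
      using \<delta>[of \<Lambda>] by (intro mult_left_mono le) auto
    also have "\<dots> = (norm v)\<^sup>2" using \<delta>[of \<Lambda>] by simp
    finally show ?thesis by (simp add: power2_le_iff_abs_le)
  qed
  \<comment> \<open>The matrix of the adjoint of \<open>U \<Lambda>\<close>: nc closedness asks for
    operators from level \<open>d\<close> into level \<open>n\<close>, whereas
    \<open>U \<Lambda>\<close> goes the other way.\<close>
  define \<alpha> where "\<alpha> \<Lambda> = (\<lambda>p j. coord (U \<Lambda> (basis p)) j)" for \<Lambda>
  have U0: "U \<Lambda> (basis p) = 0" if "finite \<Lambda>" "\<Lambda> \<subseteq> Ix" "p \<notin> n" for \<Lambda> p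
  proof -
    have "P \<Lambda> \<subseteq> n" using that(2) p0 by (auto simp: P_def Ix_def)
    then have "proj (P \<Lambda>) (basis p) = 0" using that(3) by (auto simp: proj_basis)
    then show ?thesis using linear_0[OF bounded_linear.linear[OF u(2)[OF that(1,2)]]] by (simp add: U_def)
  qed
  have \<alpha>: "\<alpha> \<Lambda> \<in> contractions n (d \<Lambda>)" if \<Lambda>: "finite \<Lambda>" "\<Lambda> \<subseteq> Ix" for \<Lambda>
  proof -
    have adj_supp: "supp_in n (adj (U \<Lambda>) w)" for w
      using adj[OF U_lin[OF \<Lambda>], of _ w, symmetric] U0[OF \<Lambda>]
      unfolding supp_in_def inner_basis(2)[symmetric] by simp
    have eq: "mat (d \<Lambda>) (adj (U \<Lambda>)) = \<alpha> \<Lambda>"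
      using U_supp[OF \<Lambda>] by (auto simp: mat_def \<alpha>_def coord_adj[OF U_lin[OF \<Lambda>]] supp_in_def fun_eq_iff)
    have lin: "bounded_linear (adj (U \<Lambda>))" by (rule bounded_linear_adj[OF U_lin[OF \<Lambda>]])
    have "norm (adj (U \<Lambda>) w) \<le> 1 * norm w" for w
      by (rule adj_norm_le[OF U_lin[OF \<Lambda>]]) (use U_norm[OF \<Lambda>] in simp)
    from opnorm_mat_le[OF lin adj_supp this] have "opnorm n (d \<Lambda>) (mat (d \<Lambda>) (adj (U \<Lambda>))) \<le> 1" by simp
    with mat_bounded_mats[OF lin adj_supp, of "d \<Lambda>"] show ?thesis unfolding eq contractions_def by simp
  qed
  have tr: "mtrans (\<alpha> \<Lambda>) = (\<lambda>j p. coord (U \<Lambda> (basis p)) j)" for \<Lambda> by (simp add: \<alpha>_def mtrans_def)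
  have lm: "lmul (d \<Lambda>) (\<alpha> \<Lambda>) (mtrans (\<alpha> \<Lambda>)) = (\<lambda>p q. inner (U \<Lambda> (basis p)) (U \<Lambda> (basis q)))"
    if "finite \<Lambda>" "\<Lambda> \<subseteq> Ix" for \<Lambda>
    unfolding tr unfolding \<alpha>_def by (intro ext) (simp add: lmul_inner proj_id U_supp[OF that])
  have x'M: "x' \<Lambda> \<in> Mn mnE (d \<Lambda>)" and x'C: "Mn_norm mnE (d \<Lambda>) (x' \<Lambda>) \<le> C" if "finite \<Lambda>" "\<Lambda> \<subseteq> Ix" for \<Lambda>
    using u(1)[OF that] XK KM C(2) by (auto simp: nc_matrices_def)
  have sw: "sandwich (d \<Lambda>) (\<alpha> \<Lambda>) (x' \<Lambda>) (mtrans (\<alpha> \<Lambda>))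
      = (\<lambda>p q. form (x' \<Lambda>) (U \<Lambda> (basis p)) (U \<Lambda> (basis q)))"
    if "finite \<Lambda>" "\<Lambda> \<subseteq> Ix" for \<Lambda>
    unfolding tr unfolding \<alpha>_def by (intro ext sandwich_form) (rule Mn_zero[OF x'M[OF that]])
  \<comment> \<open>Serves both limits: in each, an entry equals \<open>a / (1 + \<delta>)\<close>
    with \<open>a\<close> within \<epsilon> of its target as soon as \<Lambda> mentions the two
    indices.\<close>
  have conv: "((\<lambda>\<Lambda>. h \<Lambda>) \<longlongrightarrow> b) (finite_subsets_at_top Ix)"
    if pq: "p \<in> n" "q \<in> n" and
      h: "\<And>\<Lambda>. finite \<Lambda> \<Longrightarrow> \<Lambda> \<subseteq> Ix \<Longrightarrow> (p, z, 0) \<in> \<Lambda> \<Longrightarrow> (q, z, 0) \<in> \<Lambda> \<Longrightarrow> \<exists>a. h \<Lambda> = 1 / (1 + \<delta> \<Lambda>) * a \<and> \<bar>a - b\<bar> < \<epsilon> \<Lambda>"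
    for h :: "_ \<Rightarrow> real" and b p q z
  proof (rule tendstoI)
    fix e :: real assume e: "e > 0"
    obtain N :: nat where N: "(1 + \<bar>b\<bar>) / e < real N" using reals_Archimedean2 by blast
    \<comment> \<open>The \<open>N\<close> distinct triples force every larger \<Lambda> to have at
      least \<open>N\<close> elements, which makes
      \<open>(1 + \<bar>b\<bar>) * \<delta> \<Lambda>\<close> smaller than \<open>e\<close>.\<close>
    define \<Lambda>0 where "\<Lambda>0 = {(p, z, 0), (q, z, 0)} \<union> (\<lambda>k. (p, z, k)) ` {..<N}"
    have "dist (h \<Lambda>) b < e" if \<Lambda>: "finite \<Lambda>" "\<Lambda>0 \<subseteq> \<Lambda>" "\<Lambda> \<subseteq> Ix" for \<Lambda>
    proof -
      have "card ((\<lambda>k. (p, z, k)) ` {..<N}) \<le> card \<Lambda>"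
        using \<Lambda> by (intro card_mono) (auto simp: \<Lambda>0_def)
      then have cN: "N \<le> card \<Lambda>" by (simp add: card_image inj_on_def)
      obtain a where a: "h \<Lambda> = 1 / (1 + \<delta> \<Lambda>) * a" "\<bar>a - b\<bar> < \<epsilon> \<Lambda>"
        using h[of \<Lambda>] \<Lambda> by (auto simp: \<Lambda>0_def)
      have d0: "0 < \<delta> \<Lambda>" by (rule \<delta>)
      have "h \<Lambda> - b = 1 / (1 + \<delta> \<Lambda>) * ((a - b) - \<delta> \<Lambda> * b)"
        unfolding a(1) using d0 by (simp add: field_simps)
      then have "\<bar>h \<Lambda> - b\<bar> = 1 / (1 + \<delta> \<Lambda>) * \<bar>(a - b) - \<delta> \<Lambda> * b\<bar>" using d0 by (simp add: abs_mult)
      also have "\<dots> \<le> 1 * \<bar>(a - b) - \<delta> \<Lambda> * b\<bar>" using d0 by (intro mult_right_mono) auto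
      also have "\<dots> \<le> \<bar>a - b\<bar> + \<delta> \<Lambda> * \<bar>b\<bar>" using d0 abs_triangle_ineq4[of "a - b" "\<delta> \<Lambda> * b"] by (simp add: abs_mult)
      also have "\<dots> \<le> \<delta> \<Lambda> * (1 + \<bar>b\<bar>)" using a(2) \<epsilon>(2)[OF \<Lambda>(1)] by (simp add: algebra_simps)
      also have "\<dots> < e"
      proof -
        have "1 + \<bar>b\<bar> < real N * e" using N e by (simp add: pos_divide_less_eq)
        also have "\<dots> \<le> (1 + real (card \<Lambda>)) * e" using cN e by (intro mult_right_mono) auto
        finally show ?thesis by (simp add: \<delta>_def pos_divide_less_eq mult.commute)
      qed
      finally show ?thesis by (simp add: dist_real_def)
    qed
    moreover have "finite \<Lambda>0" "\<Lambda>0 \<subseteq> Ix" using pq by (auto simp: \<Lambda>0_def Ix_def)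
    ultimately show "eventually (\<lambda>\<Lambda>. dist (h \<Lambda>) b < e) (finite_subsets_at_top Ix)"
      unfolding eventually_finite_subsets_at_top by blast
  qed
  have inP: "p \<in> P \<Lambda>" "f \<in> G \<Lambda>" if "(p, f, k) \<in> \<Lambda>" for p f k \<Lambda>
    using that by (force simp: P_def G_def)+
  have U_basis: "U \<Lambda> (basis p) = \<tau> \<Lambda> *\<^sub>R u \<Lambda> (basis p)" if "p \<in> P \<Lambda>" for \<Lambda> p
    using that by (simp add: U_def proj_basis)
  have lim1: "limitin (wstar_real n) (\<lambda>\<Lambda>. lmul (d \<Lambda>) (\<alpha> \<Lambda>) (mtrans (\<alpha> \<Lambda>))) (idmat n) (finite_subsets_at_top Ix)"
  proof (rule wstar_limitI[OF ruan_bound_real_mn, where C = 1])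
    have ip: "bounded_form 1 (\<lambda>p q. inner (V (basis p)) (V (basis q)))"
      if V: "bounded_linear V" "\<And>v. norm (V v) \<le> norm v" for V :: "'k ell2 \<Rightarrow> 'k ell2"
    proof (rule bounded_form_of_bilinear(1)[OF bounded_bilinear.comp[OF bounded_bilinear_inner V(1) V(1)]])
      fix v w
      have "norm (inner (V v) (V w)) \<le> norm (V v) * norm (V w)" by (simp add: Cauchy_Schwarz_ineq2)
      also have "\<dots> \<le> norm v * norm w" by (intro mult_mono V) auto
      finally show "norm (inner (V v) (V w)) \<le> 1 * norm v * norm w" by simp
    qed simp
    have id: "idmat n = (\<lambda>p q. inner (proj n (basis p)) (proj n (basis q :: 'k ell2)))"
      by (auto simp: idmat_def fun_eq_iff proj_basis)
    show "idmat n \<in> Mn real_mn n"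
      unfolding id by (rule Mn_realI[OF _ ip[OF bounded_linear_proj norm_proj_le]]) (auto simp: proj_basis)
    have "lmul (d \<Lambda>) (\<alpha> \<Lambda>) (mtrans (\<alpha> \<Lambda>)) \<in> Mn real_mn n \<and> Mn_norm real_mn n (lmul (d \<Lambda>) (\<alpha> \<Lambda>) (mtrans (\<alpha> \<Lambda>))) \<le> 1"
      if \<Lambda>: "finite \<Lambda>" "\<Lambda> \<subseteq> Ix" for \<Lambda>
    proof -
      have z: "inner (U \<Lambda> (basis p)) (U \<Lambda> (basis q)) = 0" if "p \<notin> n \<or> q \<notin> n" for p q
        using that U0[OF \<Lambda>] by auto
      show ?thesis
        unfolding lm[OF \<Lambda>]
        using Mn_realI[OF z ip[OF U_lin[OF \<Lambda>] U_norm[OF \<Lambda>]]] Mn_norm_real_le[OF z ip[OF U_lin[OF \<Lambda>] U_norm[OF \<Lambda>]]]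
        by simp
    qed
    then show "eventually (\<lambda>\<Lambda>. lmul (d \<Lambda>) (\<alpha> \<Lambda>) (mtrans (\<alpha> \<Lambda>)) \<in> Mn real_mn n \<and>
        Mn_norm real_mn n (lmul (d \<Lambda>) (\<alpha> \<Lambda>) (mtrans (\<alpha> \<Lambda>))) \<le> 1) (finite_subsets_at_top Ix)"
      by (rule eventually_finite_subsets_at_top_weakI)
    fix p q and t :: real assume pq: "p \<in> n" "q \<in> n"
    have "((\<lambda>\<Lambda>. lmul (d \<Lambda>) (\<alpha> \<Lambda>) (mtrans (\<alpha> \<Lambda>)) p q) \<longlongrightarrow> idmat n p q) (finite_subsets_at_top Ix)"
    proof (rule conv[of p q 0, OF pq])
      fix \<Lambda> assume \<Lambda>: "finite \<Lambda>" "\<Lambda> \<subseteq> Ix" "(p, 0, 0) \<in> \<Lambda>" "(q, 0, 0) \<in> \<Lambda>"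
      have P: "p \<in> P \<Lambda>" "q \<in> P \<Lambda>" using inP \<Lambda> by blast+
      show "\<exists>a. lmul (d \<Lambda>) (\<alpha> \<Lambda>) (mtrans (\<alpha> \<Lambda>)) p q = 1 / (1 + \<delta> \<Lambda>) * a \<and> \<bar>a - idmat n p q\<bar> < \<epsilon> \<Lambda>"
        using u(4)[OF \<Lambda>(1,2) P] pq
        by (intro exI[of _ "inner (u \<Lambda> (basis p)) (u \<Lambda> (basis q))"])
          (simp add: lm[OF \<Lambda>(1,2)] U_basis P idmat_def mult.assoc[symmetric] \<tau>)
    qed
    then show "((\<lambda>\<Lambda>. lmul (d \<Lambda>) (\<alpha> \<Lambda>) (mtrans (\<alpha> \<Lambda>)) p q * t) \<longlongrightarrow> idmat n p q * t) (finite_subsets_at_top Ix)"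
      by (rule tendsto_mult_right)
  qed
  have lim2: "limitin (wstar mnE pr n) (\<lambda>\<Lambda>. sandwich (d \<Lambda>) (\<alpha> \<Lambda>) (x' \<Lambda>) (mtrans (\<alpha> \<Lambda>))) x (finite_subsets_at_top Ix)"
  proof (rule wstar_limitI[OF ruan_E xM])
    have "sandwich (d \<Lambda>) (\<alpha> \<Lambda>) (x' \<Lambda>) (mtrans (\<alpha> \<Lambda>)) \<in> Mn mnE n \<and>
        Mn_norm mnE n (sandwich (d \<Lambda>) (\<alpha> \<Lambda>) (x' \<Lambda>) (mtrans (\<alpha> \<Lambda>))) \<le> C" if \<Lambda>: "finite \<Lambda>" "\<Lambda> \<subseteq> Ix" for \<Lambda>
    proof -
      let ?y = "\<lambda>p q. form (x' \<Lambda>) (U \<Lambda> (basis p)) (U \<Lambda> (basis q))"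
      interpret bx: bounded_bilinear "form (x' \<Lambda>)" by (rule bilinear_form_E[OF x'M[OF \<Lambda>]])
      note fc = form_compose[OF bounded_form_E[OF x'M[OF \<Lambda>]] U_lin[OF \<Lambda>] U_norm[OF \<Lambda>]]
      have z: "?y p q = 0" if "p \<notin> n \<or> q \<notin> n" for p q
        using that U0[OF \<Lambda>] by (auto simp: bx.zero_left bx.zero_right)
      have le: "sqrt (\<Sum>k<r. (norm (U \<Lambda> (v k)))\<^sup>2) \<le> sqrt (\<Sum>k<r. (norm (v k))\<^sup>2)" for v :: "nat \<Rightarrow> 'k ell2" and r :: nat
        by (intro real_sqrt_le_mono sum_mono power_mono U_norm[OF \<Lambda>]) auto
      have "cb_bound C ?y"
        unfolding cb_bound_def
      proof (intro conjI allI impI C(1))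
        fix r f and v w :: "nat \<Rightarrow> 'k ell2" assume f: "mnF r f \<le> 1"
        have "\<bar>\<Sum>k<r. \<Sum>l<r. pr (form ?y (v k) (w l)) (f k l)\<bar>
            = \<bar>\<Sum>k<r. \<Sum>l<r. pr (form (x' \<Lambda>) (U \<Lambda> (v k)) (U \<Lambda> (w l))) (f k l)\<bar>" by (simp only: fc(2))
        also have "\<dots> \<le> Mn_norm mnE (d \<Lambda>) (x' \<Lambda>) * sqrt (\<Sum>k<r. (norm (U \<Lambda> (v k)))\<^sup>2) * sqrt (\<Sum>k<r. (norm (U \<Lambda> (w k)))\<^sup>2)"
          by (rule cb_boundD[OF Mn_cb_bound[OF x'M[OF \<Lambda>]] f])
        also have "\<dots> \<le> C * sqrt (\<Sum>k<r. (norm (v k))\<^sup>2) * sqrt (\<Sum>k<r. (norm (w k))\<^sup>2)"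
          by (intro mult_mono x'C[OF \<Lambda>] le mult_nonneg_nonneg C(1)) (auto simp: sum_nonneg)
        finally show "\<bar>\<Sum>k<r. \<Sum>l<r. pr (form ?y (v k) (w l)) (f k l)\<bar>
            \<le> C * sqrt (\<Sum>k<r. (norm (v k))\<^sup>2) * sqrt (\<Sum>k<r. (norm (w k))\<^sup>2)" .
      qed
      with Mn_cbI[OF z fc(1)] show ?thesis unfolding sw[OF \<Lambda>] by simp
    qed
    then show "eventually (\<lambda>\<Lambda>. sandwich (d \<Lambda>) (\<alpha> \<Lambda>) (x' \<Lambda>) (mtrans (\<alpha> \<Lambda>)) \<in> Mn mnE n \<and>
        Mn_norm mnE n (sandwich (d \<Lambda>) (\<alpha> \<Lambda>) (x' \<Lambda>) (mtrans (\<alpha> \<Lambda>))) \<le> C) (finite_subsets_at_top Ix)"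
      by (rule eventually_finite_subsets_at_top_weakI)
    fix p q f assume pq: "p \<in> n" "q \<in> n"
    show "((\<lambda>\<Lambda>. pr (sandwich (d \<Lambda>) (\<alpha> \<Lambda>) (x' \<Lambda>) (mtrans (\<alpha> \<Lambda>)) p q) f) \<longlongrightarrow> pr (x p q) f) (finite_subsets_at_top Ix)"
    proof (rule conv[of p q f, OF pq])
      fix \<Lambda> assume \<Lambda>: "finite \<Lambda>" "\<Lambda> \<subseteq> Ix" "(p, f, 0) \<in> \<Lambda>" "(q, f, 0) \<in> \<Lambda>"
      have P: "p \<in> P \<Lambda>" "q \<in> P \<Lambda>" "f \<in> G \<Lambda>" using inP \<Lambda> by blast+
      interpret bx: bounded_bilinear "form (x' \<Lambda>)" by (rule bilinear_form_E[OF x'M[OF \<Lambda>(1,2)]])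
      show "\<exists>a. pr (sandwich (d \<Lambda>) (\<alpha> \<Lambda>) (x' \<Lambda>) (mtrans (\<alpha> \<Lambda>)) p q) f = 1 / (1 + \<delta> \<Lambda>) * a \<and> \<bar>a - pr (x p q) f\<bar> < \<epsilon> \<Lambda>"
        using u(5)[OF \<Lambda>(1,2) P]
        by (intro exI[of _ "pr (form (x' \<Lambda>) (u \<Lambda> (basis p)) (u \<Lambda> (basis q))) f"])
          (simp add: sw[OF \<Lambda>(1,2)] U_basis P bx.scaleR_left bx.scaleR_right pr.scaleR_left mult.assoc[symmetric] \<tau>)
    qed
  qed
  \<comment> \<open>The image of the net as a filter of triples, the form in which
    \<open>nc_closed_in\<close> speaks of nets.\<close>
  let ?F = "filtermap (\<lambda>\<Lambda>. (d \<Lambda>, x' \<Lambda>, \<alpha> \<Lambda>)) (finite_subsets_at_top Ix)"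
  have "?F \<noteq> bot" by (simp add: filtermap_bot_iff)
  moreover have "\<forall>\<^sub>F (d, x, \<alpha>) in ?F. (d, x) \<in> X \<and> \<alpha> \<in> contractions n d"
    unfolding eventually_filtermap prod.case
    by (rule eventually_finite_subsets_at_top_weakI) (simp add: u(1) \<alpha>)
  moreover have "limitin (wstar_real n) (\<lambda>(d, x, \<alpha>). lmul d \<alpha> (mtrans \<alpha>)) (idmat n) ?F"
    using lim1 unfolding limitin_def eventually_filtermap prod.case .
  moreover have "limitin (wstar mnE pr n) (\<lambda>(d, x, \<alpha>). sandwich d \<alpha> x (mtrans \<alpha>)) x ?F"
    using lim2 unfolding limitin_def eventually_filtermap prod.case .
  ultimately show ?thesis
    using X[unfolded nc_closed_in_def, THEN conjunct2, THEN conjunct2, rule_format, OF n, of ?F x] by blast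
qed

end

theorem theorem2p20:
  fixes mnE :: "'e::banach mat_norms" and mnF :: "'f::banach mat_norms"
    and pr :: "'e \<Rightarrow> 'f \<Rightarrow> real"
    and K X :: "('k, 'e) graded"
  assumes "real_dual_operator_space mnE mnF pr"
    and "infinite (UNIV :: 'k set)"
    and "|UNIV :: 'e set| \<le>o |UNIV :: 'k set|"
    and "compact_nc_convex mnE pr K"
    and "nc_closed_in mnE pr K X"
    and "closed_under_compressions X"
    and "closed_nc_hull mnE pr X = K"
  shows "\<forall>n x. nc_extreme K n x \<longrightarrow> (n, x) \<in> X"
proof -
  interpret dual_pair mnE mnF pr by unfold_locales fact
  show ?thesis using nc_extreme_in_closed[OF assms(4,2) _ assms(5,7)] by blast
qed

end
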